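(* Let $f(z) := \sum_{n=0}^{\infty} a_n \frac{\sqrt{\pi^n}}{\sqrt{n!}}\, z^n$, $z\in\mathbb{C}$, where the $a_n$ are i.i.d. standard complex Gaussian random variables, and let $\omega$ be the point process on $\mathbb{C}\simeq\mathbb{R}^2$ given by the zeros of the Gaussian random analytic function $f$. Then, almost surely, the autocorrelation measure $\gamma$ and the diffraction measure $\widehat\gamma$ of $\omega$ exist and are given by \[ \gamma = \delta_0 + \bigl(1-g(r)\bigr)\,\lambda^2 \qquad\text{and}\qquad \widehat\gamma = \delta_0 + \bigl(1-h(s)\bigr)\,\lambda^2 , \] where $r = r(x_1,x_2) := \sqrt{x_1^2+x_2^2}$, $s = s(t_1,t_2) := \sqrt{t_1^2+t_2^2}$, and \[ g(r) := \frac{e^{-\pi r^2}\bigl(-2+4\pi r^2-\pi^2 r^4\bigr) + e^{-2\pi r^2}\bigl(4-4\pi r^2-\pi^2 r^4\bigr) - 2e^{-3\pi r^2}}{\bigl(1-e^{-\pi r^2}\bigr)^3}, \] \[ h(s) := 1+\sum_{k=2}^{\infty}\frac{(-1)^{k+1}}{(k-2)!}\,\pi^k s^{2k}\,\zeta(k+1), \] with $\zeta$ the Riemann zeta function.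
   Context: Standard complex Gaussian means mean $0$, $\mathbb{E}|a_n|^2=1$, $\mathbb{E}a_n^2=0$ (density $\frac1\pi e^{-|z|^2}$ on $\mathbb{C}$). The series defines almost surely an entire function; its zero set is identified with the locally finite point measure $\omega=\sum_{z: f(z)=0}\delta_z$. $\lambda^d$ is Lebesgue measure on $\mathbb{R}^d$; for a locally integrable function $F$ on $\mathbb{R}^d$, $F\,\lambda^d$ (or $F(x)\,\lambda^d$) is the (signed) measure with density $F$ with respect to $\lambda^d$. For a locally finite measure $\omega$ on $\mathbb{R}^d$, let $\widetilde\omega(A):=\omega(-A)$ and let $B_n$ be the open ball of radius $n$ around $0$. The autocorrelation measure of $\omega$ is \[ \gamma := \lim_{n\to\infty}\frac{\omega|_{B_n}\ast\widetilde{\omega|_{B_n}}}{\lambda^d(B_n)}, \] provided the limit exists in the vague topology as a locally finite measure. The diffraction measure of $\omega$ is the Fourier transform $\widehat\gamma$ of $\gamma$, i.e. the unique translation-bounded measure with $\int f\,d\widehat\gamma=\int\widehat f\,d\gamma$ for all Schwartz functions $f$ on $\mathbb{R}^d$, where $\widehat f(y)=\int_{\mathbb{R}^d}f(x)e^{-2\pi i xy}\,dx$ ($xy$ the standard inner product). A measure $\mu$ is translation-bounded if $\sup_{x}\mu(x+B)<\infty$ for every bounded Borel set $B$. For a point process, these notions are applied to its realisations. *)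

theory Defs
  imports "HOL-Probability.Probability"
begin

section \<open>Autocorrelation of a locally finite measure\<close>

definition locally_finite_measure :: "'a::euclidean_space measure \<Rightarrow> bool" where
  "locally_finite_measure \<mu> \<longleftrightarrow>
     sets \<mu> = sets borel \<and> (\<forall>K. compact K \<longrightarrow> emeasure \<mu> K < \<infinity>)"

definition vague_limit :: "(nat \<Rightarrow> 'a::euclidean_space measure) \<Rightarrow> 'a measure \<Rightarrow> bool" where
  "vague_limit \<mu> \<nu> \<longleftrightarrow>
     (\<forall>\<phi>::'a \<Rightarrow> real. continuous_on UNIV \<phi> \<longrightarrow> (\<exists>K. compact K \<and> (\<forall>x. x \<notin> K \<longrightarrow> \<phi> x = 0)) \<longrightarrow>
        (\<lambda>n. \<integral>x. \<phi> x \<partial>\<mu> n) \<longlonglongrightarrow> (\<integral>x. \<phi> x \<partial>\<nu>))"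

text \<open>The library's \<^const>\<open>convolution\<close> is restricted to the class \<^class>\<open>ordered_euclidean_space\<close>,
  of which \<^typ>\<open>complex\<close> is not an instance; this is the same definition without the order.\<close>

definition measure_conv :: "'a::euclidean_space measure \<Rightarrow> 'a measure \<Rightarrow> 'a measure" where
  "measure_conv \<mu> \<nu> = distr (\<mu> \<Otimes>\<^sub>M \<nu>) borel (\<lambda>(x, y). x + y)"

definition reflected :: "'a::euclidean_space measure \<Rightarrow> 'a measure" where
  "reflected \<mu> = distr \<mu> borel uminus"

text \<open>The restriction to a set is again a measure on the whole space, so it is a density and not
  \<^const>\<open>restrict_space\<close>.\<close>

definition restricted_to :: "'a::euclidean_space measure \<Rightarrow> 'a set \<Rightarrow> 'a measure" where
  "restricted_to \<mu> S = density \<mu> (indicator S)"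

definition is_autocorrelation :: "'a::euclidean_space measure \<Rightarrow> 'a measure \<Rightarrow> bool" where
  "is_autocorrelation \<omega> \<gamma> \<longleftrightarrow>
     locally_finite_measure \<omega> \<and> locally_finite_measure \<gamma> \<and>
     vague_limit
       (\<lambda>n. let \<omega>\<^sub>n = restricted_to \<omega> (ball 0 (real n)) in
          scale_measure (1 / emeasure lborel (ball (0::'a) (real n)))
            (measure_conv \<omega>\<^sub>n (reflected \<omega>\<^sub>n)))
       \<gamma>"

section \<open>Diffraction measure\<close>

text \<open>Iterated directional derivatives. In \<open>schwartz\<close> the directions range over the standard basis,
  and (Frechet) differentiability of all iterated partial derivatives amounts to smoothness.\<close>

fun iterated_deriv :: "'a::euclidean_space list \<Rightarrow> ('a \<Rightarrow> complex) \<Rightarrow> 'a \<Rightarrow> complex" where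
  "iterated_deriv [] f = f"
| "iterated_deriv (b # bs) f = (\<lambda>x. frechet_derivative (iterated_deriv bs f) (at x) b)"

definition schwartz :: "('a::euclidean_space \<Rightarrow> complex) \<Rightarrow> bool" where
  "schwartz f \<longleftrightarrow>
     (\<forall>bs. set bs \<subseteq> Basis \<longrightarrow>
        (\<forall>x. iterated_deriv bs f differentiable (at x)) \<and>
        (\<forall>k::nat. bounded (range (\<lambda>x. norm x ^ k *\<^sub>R iterated_deriv bs f x))))"

definition fourier :: "('a::euclidean_space \<Rightarrow> complex) \<Rightarrow> 'a \<Rightarrow> complex" where
  "fourier f y = (\<integral>x. f x * exp (- 2 * of_real pi * \<i> * of_real (x \<bullet> y)) \<partial>lborel)"

definition translation_bounded :: "'a::euclidean_space measure \<Rightarrow> bool" where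
  "translation_bounded \<mu> \<longleftrightarrow>
     sets \<mu> = sets borel \<and>
     (\<forall>B\<in>sets borel. bounded B \<longrightarrow> (SUP x. emeasure \<mu> ((+) x ` B)) < \<infinity>)"

text \<open>Both sides of the defining identity are required to be genuine integrals, since the
  Bochner integral of a non-integrable function is 0 by convention.\<close>

definition satisfies_fourier_identity :: "'a::euclidean_space measure \<Rightarrow> 'a measure \<Rightarrow> bool" where
  "satisfies_fourier_identity \<gamma> \<mu> \<longleftrightarrow>
     (\<forall>f. schwartz f \<longrightarrow>
        integrable \<mu> f \<and> integrable \<gamma> (fourier f) \<and>
        (\<integral>x. f x \<partial>\<mu>) = (\<integral>x. fourier f x \<partial>\<gamma>))"

definition is_fourier_transform_of :: "'a::euclidean_space measure \<Rightarrow> 'a measure \<Rightarrow> bool" where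
  "is_fourier_transform_of \<mu> \<gamma> \<longleftrightarrow>
     translation_bounded \<mu> \<and> satisfies_fourier_identity \<gamma> \<mu> \<and>
     (\<forall>\<mu>'. translation_bounded \<mu>' \<and> satisfies_fourier_identity \<gamma> \<mu>' \<longrightarrow> \<mu>' = \<mu>)"

definition is_diffraction :: "'a::euclidean_space measure \<Rightarrow> 'a measure \<Rightarrow> bool" where
  "is_diffraction \<omega> \<mu> \<longleftrightarrow> (\<exists>\<gamma>. is_autocorrelation \<omega> \<gamma> \<and> is_fourier_transform_of \<mu> \<gamma>)"

text \<open>The identity \<open>\<mu> = \<delta>\<^sub>0 + F \<lambda>\<^sup>d\<close>, where \<open>F \<lambda>\<^sup>d\<close> is a signed measure. It is stated through the
  values on bounded Borel sets, where all terms are finite; using \<^const>\<open>density\<close> with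
  \<^const>\<open>ennreal\<close> instead would silently replace \<open>F\<close> by its positive part.\<close>

definition eq_dirac_plus_density :: "'a::euclidean_space measure \<Rightarrow> ('a \<Rightarrow> real) \<Rightarrow> bool" where
  "eq_dirac_plus_density \<mu> F \<longleftrightarrow>
     sets \<mu> = sets borel \<and>
     (\<forall>A\<in>sets borel. bounded A \<longrightarrow>
        set_integrable lborel A F \<and> emeasure \<mu> A < \<infinity> \<and>
        measure \<mu> A = measure (return borel 0) A + (LINT x:A|lborel. F x))"

section \<open>Zeros of the Gaussian random analytic function\<close>

definition standard_complex_gaussian :: "'w measure \<Rightarrow> ('w \<Rightarrow> complex) \<Rightarrow> bool" where
  "standard_complex_gaussian M X \<longleftrightarrow>
     distributed M lborel X (\<lambda>z. ennreal (exp (- (cmod z)\<^sup>2) / pi))"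

definition gaf :: "(nat \<Rightarrow> complex) \<Rightarrow> complex \<Rightarrow> complex" where
  "gaf a z = (\<Sum>n. a n * of_real (sqrt (pi ^ n) / sqrt (fact n)) * z ^ n)"

text \<open>The measure \<open>\<Sum>z\<in>Z. \<delta>\<^sub>z\<close> with \<open>Z\<close> the zero set of \<open>f\<close>.\<close>

definition zero_measure :: "(complex \<Rightarrow> complex) \<Rightarrow> complex measure" where
  "zero_measure f = distr (count_space {z. f z = 0}) borel (\<lambda>z. z)"

definition g :: "real \<Rightarrow> real" where
  "g r = (exp (- pi * r^2) * (- 2 + 4 * pi * r^2 - pi^2 * r^4)
          + exp (- 2 * pi * r^2) * (4 - 4 * pi * r^2 - pi^2 * r^4)
          - 2 * exp (- 3 * pi * r^2)) / (1 - exp (- pi * r^2))^3"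

text \<open>Riemann's zeta function by its Dirichlet series, hence only for \<open>s > 1\<close>; below it is
  evaluated at integers \<open>\<ge> 3\<close>.\<close>

definition riemann_zeta :: "real \<Rightarrow> real" where
  "riemann_zeta s = (\<Sum>n. 1 / real (Suc n) powr s)"

definition h :: "real \<Rightarrow> real" where
  "h s = 1 + (\<Sum>\<^sub>\<infinity>k\<in>{2..}. (- 1) ^ (k + 1) / fact (k - 2) * pi ^ k * s ^ (2 * k)
                          * riemann_zeta (real (k + 1)))"

end

theory Submission
 imports Defs "HOL-Complex_Analysis.Complex_Analysis" "HOL-Real_Asymp.Real_Asymp"
begin

text \<open>Let \<open>X t\<close> be the difference of the averages of \<open>ln |f|\<close> over two concentric circles around \<open>t\<close>.
By Jensen's formula \<open>X t\<close> is a sum of a tent function over the zeros near \<open>t\<close>, so averages of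
\<open>X t * X (t + c)\<close> over large balls are pair sums over the zeros, with the correlation of two tents as the
test function. Normalized values of \<open>f\<close> at distant points are almost independent, and they have
fourth logarithmic moments; hence these averages converge almost surely to their expectation along a
sparse sequence of radii (Chebyshev and Borel-Cantelli), and then along all radii since pair sums are
monotone. The expectation involves only the covariance of \<open>ln |U|\<close> and \<open>ln |V|\<close> for jointly Gaussian
\<open>U\<close> and \<open>V\<close>, a quarter of the dilogarithm of the squared correlation \<open>exp (- \<pi> r\<^sup>2)\<close>. Its bi-Laplacian
is a series of Gaussians whose partial sums are an approximate identity minus \<open>g\<close>, which yields \<open>\<gamma>\<close> on
tent correlations. Countably many of these approximate every continuous function of compact support.
On the Fourier side the same series of Gaussians is transformed term by term and sums to \<open>1 - h\<close>.\<close>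

section \<open>Lebesgue measure on the complex plane\<close>

text \<open>Up to the factor 2 pi the zeros are the distributional Laplacian of
  \<open>ln |f|\<close>, and a difference of two circle means is a smoothed form of it. Pair
  statistics of the zeros thus reduce to the covariance of two logarithms, which is explicit; the
  joint law of \<open>f\<close> and its derivative never enters. The obstacle is independence, since
  values of \<open>f\<close> at distinct points are always correlated. The squared moduli of the
  coefficients in the normalized value at \<open>z\<close> are Poisson weights of mean
  \<open>pi |z|^2\<close>, so they sit at indices within a few multiples of \<open>|z|\<close> of
  that mean. Two points with well separated moduli therefore use almost disjoint blocks of
  coefficients. This decouples by modulus and not by distance, but pairs with nearly equal moduli
  are a small fraction of all pairs in a large ball. The variance of an average of products involves
  four ring averages at once, each with logarithmic singularities; this fixes the order of the
  moments. The point mass of \<open>\<gamma>\<close> is the diagonal of the pair sum. Analytically,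
  each bi-Laplacian has integral 0; the series sums to \<open>- g\<close> off the origin, and the
  compensating mass one concentrates at 0.\<close>

lemmas power2 = power2_eq_square
lemmas integrable_plus = Bochner_Integration.integrable_add
lemmas integral_congr = Bochner_Integration.integral_cong
lemmas integral_plus = Bochner_Integration.integral_add
lemmas integral_of_sum = Bochner_Integration.integral_sum
lemmas cont_measurable = borel_measurable_continuous_onI
lemmas alg_simps = algebra_simps
lemmas integrable_dom = Bochner_Integration.integrable_bound
notation pair_measure (infixr "><" 80) and LIMSEQ ("((_)/ ----> (_))" [60, 60] 60) and iff (infixr "<->" 25)
abbreviation BM where "BM \<equiv> borel_measurable"
abbreviation lnc :: "complex => real" where "lnc z \<equiv> ln (cmod z)"
abbreviation area :: "complex => real" where "area z \<equiv> pi * (cmod z)^2"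

abbreviation nn_lebesgue (binder "NINT " 10) where "nn_lebesgue \<equiv> nn_integral lborel"

lemma measurable_app2:
 assumes "case_prod f \<in> BM (N >< K)" "p \<in> measurable L N" "q \<in> measurable L K" shows "(%x. f (p x) (q x)) \<in> BM L"
 using measurable_compose[OF measurable_Pair[OF assms(2,3)] assms(1)] by simp

lemmas measurable_app2' = measurable_app2[unfolded split_beta']

lemma measurable_Complex [measurable]:
 "(%p. Complex (fst p) (snd p)) \<in> BM (borel >< borel)" unfolding Complex_eq by simp

lemma lborel_complex_distr:
 "(lborel :: complex measure) = distr (lborel >< lborel) borel (%p. Complex (fst p) (snd p))"
proof (rule lborel_eqI)
 fix l u :: complex
 assume le: "!!b. b \<in> Basis ==> l \<bullet> b <= u \<bullet> b"
 let ?a = "emeasure (distr (lborel >< lborel) borel (%p. Complex (fst p) (snd p))) (box l u) "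
 let ?b = "ennreal (\<Prod>b\<in>Basis. (u - l) \<bullet> b)"
 have le': "Re l <= Re u" "Im l <= Im u" using le[of 1] le[of \<i>] by auto
 have "?a = emeasure (lborel >< lborel) ({Re l<..<Re u} \<times> {Im l<..<Im u})" by (subst emeasure_distr)
    (auto intro!: arg_cong2[where f=emeasure] simp: box_def Basis_complex_def space_pair_measure)
 also have "... = ennreal (Re u - Re l) * ennreal (Im u - Im l)" using le' by (subst lborel.emeasure_pair_measure_Times) auto
 also have "... = ?b" using le' by (simp add: Basis_complex_def ennreal_mult)
 finally show "?a = ?b" .
qed auto

lemma nn_integral_complex:
 assumes [measurable]: "f \<in> BM borel" shows "(NINT z. f z) = (NINT y x. f (Complex x y))"
proof -
 have "(NINT z. f z) = (\<integral>\<^sup>+p. f (Complex (fst p) (snd p)) \<partial>(lborel >< lborel))"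
  by (subst lborel_complex_distr, subst nn_integral_distr) auto
 also have "... = (NINT y x. f (Complex x y))" by (subst lborel_pair.nn_integral_snd[symmetric]) auto
 finally show ?thesis .
qed

lemma measurable_Complex2 [measurable (raw)]:
 assumes [measurable]: "f \<in> BM M" "k \<in> BM M" shows "(%x. Complex (f x) (k x)) \<in> BM M" unfolding Complex_eq by simp

text \<open>A rotation is an affine substitution in \<open>x\<close> alone with Jacobian
  \<open>1 / |Re u|\<close>, followed by one in \<open>y\<close> alone with Jacobian
  \<open>|Re u|\<close>. The two factors cancel.\<close>

lemma lborel_complex_mult_unit_aux:
 fixes u :: complex
 assumes u: "cmod u = 1" "Re u ~= 0" and [measurable]: "f \<in> BM borel" shows "(NINT z. f (u * z)) = (NINT z. f z)"
proof -
 let ?d = "NINT x y. f (Complex x y)"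
 let ?e = "NINT z. f z"
 define a b where "a = Re u" and "b = Im u"
 let ?a = "%x y. Complex x (y/a + (b/a)*x)"
 let ?c = "%x y. Complex (a * x - b * y) (b * x + a * y)"
 let ?g = "NINT y x. f (?a x y)"
 have ab: "a^2 + b^2 = 1" "a ~= 0" using u by (auto simp: a_def b_def cmod_def)
 have b2: "a * (a * y) + b * (b * y) = y" for y
 proof -
  have "a * (a * y) + b * (b * y) = (a^2 + b^2) * y" by (simp add: alg_simps power2)
  thus ?thesis using ab by simp
 qed
 have "(NINT z. f (u * z))
   = (NINT y x. f (?c x y))"
  by (subst nn_integral_complex) (auto simp: a_def b_def complex_eq_iff intro!: nn_integral_cong arg_cong[where f=f])
 also have "... = (NINT y. abs (1/a) * (NINT x. f (?a x y)))"
 proof (rule nn_integral_cong)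
  fix y :: real
  let ?b = "%x. Complex (a * ((b/a)*y + (1/a) * x) - b * y) (b * ((b/a)*y + (1/a) * x) + a * y)"
  let ?f = "(NINT x. f (?c x y)) "
  have "?f = abs (1/a) * (NINT x. f (?b x))"
   using ab by (subst nn_integral_real_affine[where c="1/a" and t="(b/a)*y"]) auto
  also have "(%x. f (?b x))
    = (%x. f (?a x y))" using ab(2) by (intro ext arg_cong[where f=f]) (auto simp: field_simps b2)
  finally show "?f = abs (1/a) * (NINT x. f (?a x y))" .
 qed
 also have "... = abs (1/a) * ?g" by (rule nn_integral_cmult) measurable
 also have "?g
   = (NINT x y. f (?a x y))" by (rule lborel_pair.Fubini') measurable
 also have "... = (NINT x. abs a * (NINT y. f (Complex x y)))"
 proof (rule nn_integral_cong)
  fix x :: real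
  show "(NINT y. f (Complex x (y/a + (b/a)*x))) = abs a * (NINT y. f (Complex x y))"
   using ab by (subst nn_integral_real_affine[where c="a" and t="-b*x"]) (auto simp: field_simps)
 qed
 also have "... = abs a * ?d" by (rule nn_integral_cmult) measurable
 also have "?d = (NINT y x. f (Complex x y))" by (rule lborel_pair.Fubini') measurable
 also have "... = ?e" by (rule nn_integral_complex[symmetric]) measurable
 also have "ennreal (abs (1/a)) * (ennreal (abs a) * ?e) = ?e"
  using ab by (simp add: mult.assoc[symmetric] ennreal_mult'[symmetric])
 finally show ?thesis .
qed

lemma nn_integral_lborel_complex_mult_unit:
 fixes u :: complex
 assumes u: "cmod u = 1" and [measurable]: "f \<in> BM borel" shows "(NINT z. f (u * z)) = (NINT z. f z)"
proof -
 \<comment> \<open>For \<open>u\<close> equal to \<open>i\<close> or \<open>- i\<close> the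
   substitutions degenerate; a square root of \<open>u\<close> has nonzero real part and is applied
   twice.\<close>
 consider v where "v^2 = u" "Re v ~= 0" "cmod v = 1" | "Re u ~= 0"
 proof (cases "Re u = 0")
  case True
  with u have "Im u = 1 \<or> Im u = -1" by (auto simp: cmod_def)
  hence "(Complex (sqrt (1/2)) (Im u * sqrt (1/2)))^2 = u" using True by (auto simp: complex_eq_iff power2)
  moreover have "cmod (Complex (sqrt (1/2)) (Im u * sqrt (1/2))) = 1" using \<open>Im u = 1 \<or> Im u = -1\<close> by (auto simp: cmod_def)
  moreover have "Re (Complex (sqrt (1/2)) (Im u * sqrt (1/2))) ~= 0" by simp
  ultimately show ?thesis using that(1) by auto
 qed (use that(2) in auto)
 thus ?thesis
 proof cases
  case 1
  have "(NINT z. f (u * z)) = (NINT z. f (v * (v * z)))" by (simp flip: 1(1) add: power2 mult.assoc)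
  also have "... = (NINT z. f (v * z))" by (rule lborel_complex_mult_unit_aux[OF 1(3) 1(2), of "%z. f (v * z)"]) measurable
  also have "... = (NINT z. f z)" by (rule lborel_complex_mult_unit_aux[OF 1(3) 1(2)]) measurable
  finally show ?thesis .
 next
  case 2
  thus ?thesis using lborel_complex_mult_unit_aux[OF u] by simp
 qed
qed

text \<open>The modulus of \<open>c\<close> acts as a real dilation, which contributes one factor
  \<open>|c|\<close> per dimension; the phase is a rotation.\<close>

lemma nn_integral_lborel_complex_affine:
 fixes c t :: complex
 assumes c: "c ~= 0" and [measurable]: "f \<in> BM borel" shows "(NINT z. f z) = ennreal ((cmod c)^2) * (NINT z. f (t + c * z))"
proof -
 let ?a = "NINT z. f (t + cmod c *\<^sub>R z)"
 define u where "u = c / cmod c"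
 have u: "cmod u = 1" using c by (simp add: u_def norm_divide)
 have cu: "c * z = cmod c *\<^sub>R (u * z)" for z by (simp add: u_def scaleR_conv_of_real)
 have "(NINT z. f z) = ennreal ((cmod c)^2) * ?a" using c by (subst lborel_affine[of "cmod c" t])
    (simp_all add: nn_integral_density nn_integral_distr nn_integral_cmult)
 also have "?a = (NINT z. f (t + cmod c *\<^sub>R (u * z)))"
  by (rule nn_integral_lborel_complex_mult_unit[OF u, of "%z. f (t + cmod c *\<^sub>R z)", symmetric]) measurable
 finally show ?thesis by (simp add: cu)
qed

lemma lborel_complex_affine:
 fixes c t :: complex
 assumes c: "c ~= 0" shows "lborel = density (distr lborel borel (%z. t + c * z)) (%_. ennreal ((cmod c)^2))"
proof (rule measure_eqI)
 fix A :: "complex set" assume "A \<in> sets lborel"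
 hence [measurable]: "A \<in> sets borel" by simp
 show "emeasure lborel A = emeasure (density (distr lborel borel (%z. t + c * z)) (%_. ennreal ((cmod c)^2))) A"
  using nn_integral_lborel_complex_affine[OF c, of "indicator A" t] by (subst (1 2) nn_integral_indicator[symmetric])
    (simp_all add: nn_integral_density nn_integral_distr nn_integral_cmult del: nn_integral_indicator)
qed auto

lemma lborel_complex_mult_unit:
 fixes u :: complex
 assumes u: "cmod u = 1" shows "distr lborel borel (%z. u * z) = lborel"
proof -
 have "u ~= 0" using u by auto
 thus ?thesis using lborel_complex_affine[of u 0] u by (simp add: density_1)
qed

lemma integral_lborel_complex_mult_unit:
 fixes u :: complex and f :: "complex => 'b::{banach, second_countable_topology}"
 assumes u: "cmod u = 1" and [measurable]: "f \<in> BM borel" shows "(LBINT z. f (u * z)) = (LBINT z. f z)"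
  "integrable lborel (%z. f (u * z)) <-> integrable lborel f"
proof -
 show "(LBINT z. f (u * z)) = (LBINT z. f z)" by (subst (2) lborel_complex_mult_unit[OF u, symmetric], subst integral_distr) auto
 show "integrable lborel (%z. f (u * z)) <-> integrable lborel f"
  by (subst (2) lborel_complex_mult_unit[OF u, symmetric], subst integrable_distr_eq) auto
qed

lemma emeasure_ball_complex: "0 <= r ==> emeasure lborel (ball (c::complex) r) = ennreal (pi * r^2)"
 by (simp add: emeasure_ball unit_ball_vol_2)

text \<open>With the area \<open>\<pi>|z|\<^sup>2\<close> in place of the radius, integration of radial functions needs
 no polar coordinates and no Jacobian.\<close>

lemma distr_lborel_area: "distr lborel borel (%z::complex. area z) = density lborel (indicator {0..})"
proof -
 let ?a = "%z::complex. - (area z)"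
 let ?b = "density lborel (indicator {..0})"
 let ?c = "distr lborel borel ?a"
 let ?f = "distr ?b borel uminus"
 \<comment> \<open>Comparing measures on half-lines \<open>{x<..}\<close> requires finite values.
   The minus sign turns these preimages into discs instead of exteriors of discs.\<close>
 have eq: "distr lborel borel ?a = density lborel (indicator {..0})"
 proof (rule measure_eqI_lessThan)
  fix x :: real
  let ?e = "max 0 (-x) / pi"
  have m: "emeasure ?c {x<..} = ennreal (max 0 (-x))"
  proof -
   have "(?a -` {x<..}) = ball 0 (sqrt ?e)"
   proof (intro set_eqI)
    fix z :: complex
    have "cmod z < sqrt ?e <-> (cmod z)\<^sup>2 < max 0 (-x) / pi"
     by (metis norm_ge_zero real_sqrt_less_iff real_sqrt_unique)
    also have "... <-> pi * (cmod z)^2 < -x"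
    proof (cases "x < 0")
     case True thus ?thesis by (simp add: field_simps)
    next
     case False
     hence "max 0 (-x) = 0" by simp
     moreover have "0 <= area z" by simp
     ultimately show ?thesis by (smt (verit) zero_le_power2 div_0)
    qed
    finally show "z \<in> (?a -` {x<..}) <-> z \<in> ball 0 (sqrt ?e)" by auto
   qed
   thus ?thesis by (subst emeasure_distr) (auto simp: emeasure_ball_complex)
  qed
  have "emeasure ?b {x<..} = emeasure lborel ({..0} \<inter> {x<..})"
   by (subst emeasure_density) (auto simp flip: indicator_inter_arith)
  also have "{..0} \<inter> {x<..} = {x<..0}" by auto
  also have "emeasure lborel {x<..0} = ennreal (max 0 (-x))" by (cases "x <= 0") auto
  finally show "emeasure ?c {x <..} = emeasure ?b {x <..}"
   using m by simp
   show "emeasure ?c {x <..} < \<infinity>" using m by simp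
 qed auto
 have "distr lborel borel (%z::complex. area z) =
  distr ?c borel uminus" by (subst distr_distr) (auto simp: o_def)
 also have "... = density lborel (indicator {0..})"
 proof (subst eq, rule measure_eqI)
  fix A :: "real set" assume "A \<in> sets (distr (density lborel (indicator {..0})) borel uminus)"
  hence [measurable]: "A \<in> sets borel" by simp
  let ?d = "emeasure (density lborel (indicator {0..})) A"
  have *: "uminus -` A \<in> sets borel" using measurable_sets[of "uminus :: real => real" borel borel A] by simp
  have "emeasure ?f A
   = (NINT x. indicator {..0} x * indicator A (-x))"
   using * by (subst emeasure_distr) (auto simp: emeasure_density indicator_def)
  also have "... = (NINT x. indicator {..0} (-x) * indicator A x)" by (subst nn_integral_real_affine[where c="-1" and t=0]) auto
  also have "... = ?d"
   by (subst emeasure_density) (auto simp: indicator_def)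
  finally show "emeasure ?f A = ?d" .
 qed auto
 finally show ?thesis .
qed

lemma nn_integral_area:
 assumes [measurable]: "f \<in> BM borel" shows "(NINT z. f (area z)) = (NINT x. indicator {0..} x * f x)"
proof -
 have "(NINT z. f (area z)) = integral\<^sup>N (distr lborel borel (%z::complex. area z)) f" by (subst nn_integral_distr) auto
 thus ?thesis by (simp add: distr_lborel_area nn_integral_density)
qed

lemma integral_area:
 fixes f :: "real => 'b::{banach, second_countable_topology}"
 assumes [measurable]: "f \<in> BM borel" shows "(LBINT z. f (area z)) = (LINT x:{0..}|lborel. f x)"
  "integrable lborel (%z. f (area z)) <-> set_integrable lborel {0..} f"
proof -
 let ?a = "distr lborel borel (%z::complex. area z)"
 let ?b = "LINT x:{0..}|lborel. f x"
 let ?c = "LBINT z. f (area z)"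
 have d: "density lborel (indicator {0..}) = density lborel (%x::real. ennreal (indicator {0..} x))" by (simp add: ennreal_indicator)
 have "?c = integral\<^sup>L ?a f" by (subst integral_distr) auto
 also have "... = ?b" by (simp add: distr_lborel_area d integral_density set_lebesgue_integral_def)
 finally show "?c = ?b" .
 have "integrable lborel (%z. f (area z)) <-> integrable ?a f" by (subst integrable_distr_eq) auto
 also have "... <-> set_integrable lborel {0..} f" by (simp add: distr_lborel_area d integrable_density set_integrable_def)
 finally show "integrable lborel (%z. f (area z)) <-> set_integrable lborel {0..} f" .
qed

section \<open>Averages over circles\<close>

definition U01 :: "real measure" where "U01 = density lborel (indicator {0..1})"

abbreviation U01_mean (binder "MEAN " 10) where "U01_mean \<equiv> lebesgue_integral U01"
abbreviation nn_U01_mean (binder "NMEAN " 10) where "nn_U01_mean \<equiv> nn_integral U01"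

lemma sets_U01 [measurable_cong, simp]: "sets U01 = sets borel" by (simp add: U01_def)
lemma space_U01 [simp]: "space U01 = UNIV" by (simp add: U01_def)

interpretation U01: prob_space U01 by (rule prob_spaceI) (auto simp: U01_def emeasure_density)

lemma integral_U01:
 fixes f :: "real => 'b::{banach, second_countable_topology}"
 assumes [measurable]: "f \<in> BM borel" shows "(MEAN th. f th) = (LINT th:{0..1}|lborel. f th)"
  "integrable U01 f <-> set_integrable lborel {0..1} f"
proof -
 have d: "U01 = density lborel (%x::real. ennreal (indicator {0..1} x))" by (simp add: ennreal_indicator U01_def)
 show "(MEAN th. f th) = (LINT th:{0..1}|lborel. f th)" by (simp add: d integral_density set_lebesgue_integral_def)
 show "integrable U01 f <-> set_integrable lborel {0..1} f" by (simp add: d integrable_density set_integrable_def)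
qed

definition circ :: "real => complex" where "circ th = cis (2 * pi * th)"

lemma continuous_circ [continuous_intros]: "continuous_on A circ"
 unfolding circ_def by (intro continuous_intros)

lemma measurable_circ [measurable]: "circ \<in> BM borel"
 by (intro cont_measurable continuous_intros)

lemma norm_circ [simp]: "cmod (circ th) = 1" by (simp add: circ_def)
lemma integral_cis_U01:
 fixes l :: int shows "(MEAN th. cis (2 * pi * of_int l * th)) = (if l = 0 then 1 else 0)"
proof (cases "l = 0")
 case True thus ?thesis by (simp add: U01.prob_space[simplified])
next
 case False
 define c where "c = 2 * pi * of_int l * \<i>"
 let ?a = "%x. (%th. exp (c * of_real th) / c) has_vector_derivative exp (c * of_real x)"
 have c: "c ~= 0" using False by (auto simp: c_def)
 have e: "cis (2 * pi * of_int l * th) = exp (c * of_real th)" for th by (simp add: cis_conv_exp c_def mult_ac)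
 have "(MEAN th. cis (2 * pi * of_int l * th)) = (LBINT th. indicator {0..1} th *\<^sub>R exp (c * of_real th))"
  unfolding e by (subst integral_U01) (auto simp: set_lebesgue_integral_def)
 also have "... = exp (c * of_real 1) / c - exp (c * of_real 0) / c"
 proof (rule integral_FTC_Icc)
  show "(?a x) (at x within {0..1})" for x :: real
  proof (rule has_vector_derivative_at_within)
   show "(?a x) (at x)"
    using c by (auto intro!: derivative_eq_intros has_vector_derivative_real_field)
  qed
 qed (auto intro!: continuous_intros)
 also have "exp (c * of_real 1) = 1" by (simp add: c_def exp_eq_1)
 finally show ?thesis using False by simp
qed

text \<open>Each rotation preserves \<open>N\<close>, so Fubini moves the average over the phase
  inside. Planar integrals are reduced in this way to circle means of the integrand.\<close>

lemma integral_rotation_average: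
 fixes f :: "complex => 'b::{banach, second_countable_topology}"
 assumes f: "integrable N f" and sf: "sigma_finite_measure N" and N[measurable_cong, simp]: "sets N = sets borel"
  and inv: "!!u. cmod u = 1 ==> distr N borel (%z. u * z) = N"
 shows "(\<integral>z. f z \<partial>N) = (\<integral>z. (MEAN th. f (circ th * z)) \<partial>N)"
proof -
 let ?a = "%p. f (circ (fst p) * snd p)"
 interpret N: sigma_finite_measure N by (rule sf)
 interpret pair_sigma_finite U01 N ..
 have [measurable]: "f \<in> BM borel" using borel_measurable_integrable[OF f] by simp
 have rot: "(\<integral>z. k (circ th * z) \<partial>N) = (\<integral>z. k z \<partial>N)" if [measurable]: "k \<in> BM borel"
  for k :: "complex => 'c::{banach, second_countable_topology}" and th
  by (subst (2) inv[of "circ th", symmetric], simp, subst integral_distr) auto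
 have rot': "integrable N (%z. f (circ th * z))" for th
 proof -
  have "integrable (distr N borel (%z. circ th * z)) f" using f by (subst inv) auto
  thus ?thesis by (subst (asm) integrable_distr_eq) auto
 qed
 have "integrable (U01 >< N) ?a"
 proof (rule Fubini_integrable)
  show "?a \<in> BM (U01 >< N)" by simp
  show "AE th in U01. integrable N (%z. f (circ (fst (th, z)) * snd (th, z)))" using rot' by simp
  show "integrable U01 (%th. \<integral>z. norm (f (circ (fst (th, z)) * snd (th, z))) \<partial>N)" using rot[of "%z. norm (f z)"] by simp
 qed
 hence "(\<integral>z. (MEAN th. f (circ th * z)) \<partial>N) = (MEAN th. (\<integral>z. f (circ th * z) \<partial>N))"
  by (intro Fubini_integral) (simp add: split_beta')
 also have "... = (MEAN th. (\<integral>z. f z \<partial>N))" by (simp add: rot)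
 finally show ?thesis by (simp add: U01.prob_space[simplified])
qed

lemma mean_value_circ:
 assumes f: "f holomorphic_on ball c R" and r: "0 < r" "r < R" shows "(MEAN th. f (c + of_real r * circ th)) = f c"
proof -
 let ?a = "%t. c + of_real r * circ t"
 let ?b = "2 * of_real pi * \<i> * f c"
 let ?c = "circlepath c r"
 let ?d = "%t. f (?a t)"
 let ?e = "%t. at t within {0..1}"
 have cont: "continuous_on (cball c r) f" using holomorphic_on_imp_continuous_on[OF f] by (rule continuous_on_subset) (use r in auto)
 have cl: "circlepath c r t = c + of_real r * circ t" for t
  by (simp add: circlepath_def part_circlepath_def circ_def cis_conv_exp mult_ac)
 have "((%u. f u / (u - c)) has_contour_integral ?b) ?c"
  by (rule Cauchy_integral_circlepath[OF cont]) (use r f in "auto intro: ")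
 hence "((%t. f (circlepath c r t) / (circlepath c r t - c) * vector_derivative ?c (?e t))
   has_integral ?b) {0..1}" unfolding has_contour_integral_def .
 hence "((%t. 2 * of_real pi * \<i> * f (?a t)) has_integral ?b) {0..1}"
 proof (rule has_integral_eq[rotated])
  fix t :: real assume t: "t \<in> {0..1}"
  have "vector_derivative ?c (?e t) = 2 * pi * \<i> * r * exp (2 * of_real pi * \<i> * t)"
   using t by (intro vector_derivative_circlepath01) auto
  thus "f (circlepath c r t) / (circlepath c r t - c) * vector_derivative ?c (?e t)
    = 2 * of_real pi * \<i> * f (?a t)" using r(1) by (simp add: cl circ_def cis_conv_exp mult_ac)
 qed
 from has_integral_divide[OF this, of "2 * of_real pi * \<i>"]
 have I: "(?d has_integral f c) {0..1}" by simp
 have ct: "continuous_on {0..1} ?d"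
  by (rule continuous_on_compose2[OF cont]) (use r in "auto intro!: continuous_intros simp: dist_norm norm_mult")
 have "set_integrable lborel {0..1} ?d" by (rule borel_integrable_atLeastAtMost'[OF ct])
 hence "(LINT t:{0..1}|lborel. f (?a t)) = f c"
  using I by (simp add: set_borel_integral_eq_integral(2) integral_unique)
 moreover have "(MEAN th. f (?a th)) = (LINT t:{0..1}|lborel. f (?a t))"
 proof -
  have cU: "continuous_on UNIV ?d"
   by (rule continuous_on_compose2[OF cont]) (use r in "auto intro!: continuous_intros simp: dist_norm norm_mult")
  show ?thesis by (intro integral_U01 cont_measurable cU)
 qed
 ultimately show ?thesis by simp
qed

lemma integrable_U01_continuous:
 fixes f :: "real => 'b::euclidean_space"
 assumes "continuous_on UNIV f" shows "integrable U01 f" using assms borel_integrable_atLeastAtMost'[of 0 1 f]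
 by (subst integral_U01) (auto intro: cont_measurable continuous_on_subset)

text \<open>If \<open>|B| < |A|\<close>, then \<open>Ln (1 + z * (B / A))\<close> is holomorphic on
  a disc of radius larger than 1, and its mean over the unit circle is its value 0 at the
  centre.\<close>

lemma mean_ln_circ:
 assumes AB: "cmod A ~= cmod B" shows "integrable U01 (%th. lnc (A + circ th * B))"
  and "(MEAN th. lnc (A + circ th * B)) = ln (max (cmod A) (cmod B))"
proof -
 let ?a = "%A B. MEAN th. lnc (A + circ th * B)"
 have ne: "A + circ th * B ~= 0" for th
 proof
  assume "A + circ th * B = 0"
  hence "A = - (circ th * B)" by (simp add: eq_neg_iff_add_eq_0)
  hence "cmod A = cmod (circ th * B)" by simp
  thus False using AB by (simp add: norm_mult)
 qed
 show "integrable U01 (%th. lnc (A + circ th * B))" by (rule integrable_U01_continuous) (use ne in "auto intro!: continuous_intros")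
 have main: "?a A B = lnc A" if lt: "cmod B < cmod A" for A B
 proof (cases "B = 0")
  case True thus ?thesis by (simp add: U01.prob_space[simplified])
 next
  case False
  have A: "A ~= 0" using lt by auto
  define f where "f z = Ln (1 + z * (B / A))" for z
  let ?c = "MEAN th. Re (f (circ th))"
  let ?e = "MEAN th. f (circ th)"
  have pos: "Re (1 + z * (B / A)) > 0" if "cmod z < cmod A / cmod B" for z
  proof -
   let ?d = "z * (B / A)"
   have "cmod ?d < 1" using that False A by (simp add: norm_mult norm_divide field_simps)
   moreover have "abs (Re ?d) <= cmod ?d" by (rule abs_Re_le_cmod)
   ultimately show ?thesis by simp
  qed
  have hol: "f holomorphic_on ball 0 (cmod A / cmod B)" unfolding f_def
  proof (intro holomorphic_intros)
   fix z :: complex assume "z \<in> ball 0 (cmod A / cmod B)"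
   hence "Re (1 + z * (B / A)) > 0" by (intro pos) simp
   thus "1 + z * (B / A) \<notin> \<real>\<^sub>\<le>\<^sub>0" by (auto simp: complex_nonpos_Reals_iff)
  qed
  have "(MEAN th. f (0 + of_real 1 * circ th)) = f 0" by (rule mean_value_circ[OF hol]) (use lt False in auto)
  hence m: "?e = 0" by (simp add: f_def)
  have c1: "cmod (circ th) < cmod A / cmod B" for th using lt False by simp
  have "continuous_on UNIV (%th. f (circ th))"
   by (rule continuous_on_compose2[OF holomorphic_on_imp_continuous_on[OF hol]]) (use c1 in "auto intro: continuous_intros")
  hence fi: "integrable U01 (%th. f (circ th))" by (rule integrable_U01_continuous)
  have "lnc (A + circ th * B) = lnc A + Re (f (circ th))" for th
  proof -
   have nz: "1 + circ th * (B / A) ~= 0" using pos[OF c1, of th] by (metis less_irrefl zero_complex.sel(1))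
   have "A + circ th * B = A * (1 + circ th * (B / A))" using A by (simp add: field_simps)
   thus ?thesis using nz by (simp add: norm_mult ln_mult f_def)
  qed
  hence "?a A B = (MEAN th. lnc A + Re (f (circ th)))" by simp
  also have "... = lnc A + ?c" using fi by (subst integral_plus) (auto simp: U01.prob_space[simplified])
  also have "?c = Re ?e" using fi by simp
  finally show ?thesis by (simp add: m)
 qed
 show "?a A B = ln (max (cmod A) (cmod B))"
 proof (cases "cmod B < cmod A")
  case True thus ?thesis using main by simp
 next
  case False
  \<comment> \<open>For \<open>u\<close> on the unit circle
    \<open>|A + u B| = |cnj B + u cnj A|\<close>, which exchanges the roles of \<open>A\<close> and
    \<open>B\<close>.\<close>
  let ?b = "%th. cnj B + circ th * cnj A"
  have "cmod (A + circ th * B) = cmod (?b th)" for th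
  proof -
   have u: "circ th * cnj (circ th) = 1" using complex_norm_square[of "circ th"] by simp
   have "cmod (?b th) = cmod (cnj (?b th))" by (rule complex_mod_cnj[symmetric])
   also have "... = cmod (circ th) * cmod (B + cnj (circ th) * A)" by simp
   also have "... = cmod (circ th * B + (circ th * cnj (circ th)) * A)" by (simp add: norm_mult[symmetric] alg_simps del: norm_circ)
   finally show ?thesis by (simp add: u add.commute)
  qed
  thus ?thesis using main[of "cnj A" "cnj B"] False AB by auto
 qed
qed

section \<open>Compactly supported continuous functions determine a measure\<close>

lemma measure_eqI_compact_support:
 fixes \<mu> \<nu> :: "'a::euclidean_space measure"
 assumes lf: "locally_finite_measure \<mu>" "locally_finite_measure \<nu>"
  and eq: "!!ph K. continuous_on UNIV ph ==> compact K ==> (!!x. x \<notin> K ==> ph x = 0) ==>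
    (!!x. 0 <= ph x & ph x <= 1) ==> (\<integral>x. ph x \<partial>\<mu>) = (\<integral>x. ph x \<partial>\<nu> :: real)"
 shows "\<mu> = \<nu>"
proof (rule measure_eqI_generator_eq)
 let ?E = "range (%(a, b). box a b::'a set)"
 have sets: "sets \<mu> = sets borel" "sets \<nu> = sets borel" using lf by (auto simp: locally_finite_measure_def)
 have fin: "emeasure \<mu> (box l u) < \<infinity>" if "locally_finite_measure \<mu>" for \<mu> and l u :: 'a
 proof -
  have "emeasure \<mu> (box l u) <= emeasure \<mu> (cbox l u)"
   using that by (intro emeasure_mono) (auto simp: locally_finite_measure_def box_subset_cbox)
  also have "... < \<infinity>" using that by (auto simp: locally_finite_measure_def)
  finally show ?thesis .
 qed
 show "Int_stable ?E" by (auto simp: Int_stable_def box_Int_box)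
 show "?E \<subseteq> Pow UNIV" "sets \<mu> = sigma_sets UNIV ?E" "sets \<nu> = sigma_sets UNIV ?E" by (simp_all add: borel_eq_box sets)
 let ?A = "%n::nat. box (- (real n *\<^sub>R One)) (real n *\<^sub>R One) :: 'a set"
 show "range ?A \<subseteq> ?E" "(\<Union>i. ?A i) = UNIV" unfolding UN_box_eq_UNIV by auto
 show "emeasure \<mu> (?A i) ~= \<infinity>" for i using fin[OF lf(1)] by (metis less_irrefl)
 fix X assume "X \<in> ?E"
 then obtain l u where X: "X = box l u" by auto
 let ?a = "%N x. real N * infdist x (- X)"
 \<comment> \<open>Continuous functions that vanish off the box and increase to its
   indicator.\<close>
 define ph where "ph = (%(n::nat) x. min 1 (real n * infdist x (- X)))"
 have ne: "- X ~= {}" using bounded_box[of l u] not_bounded_UNIV by (metis X Compl_UNIV_eq double_complement)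
 have cl: "closed (- X)" by (simp add: X closed_Compl open_box)
 have cont: "continuous_on UNIV (ph n)" for n unfolding ph_def by (intro continuous_intros)
 have bd: "0 <= ph n x & ph n x <= 1" for n x by (auto simp: ph_def infdist_nonneg)
 have out: "ph n x = 0" if "x \<notin> X" for n x using that by (simp add: ph_def)
 have lim: "(%n. ph n x) ----> indicator X x" for x
 proof (cases "x \<in> X")
  case False thus ?thesis by (simp add: out)
 next
  case True
  hence "infdist x (- X) > 0" using in_closed_iff_infdist_zero[OF cl ne, of x] infdist_nonneg[of x "-X"] by auto
  then obtain N :: nat where N: "1 < ?a N x" using reals_Archimedean3 by auto
  have "eventually (%n. ph n x = 1) sequentially" using eventually_ge_at_top[of N]
  proof eventually_elim
   case (elim n)
   have "?a N x <= ?a n x" using elim by (intro mult_right_mono) (auto simp: infdist_nonneg)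
   thus ?case using N by (simp add: ph_def)
  qed
  hence "(%n. ph n x) ----> 1" by (rule tendsto_eventually)
  thus ?thesis using True by simp
 qed
 have L: "(%n. \<integral>x. ph n x \<partial>\<mu>) ----> measure \<mu> X" if l: "locally_finite_measure \<mu>" for \<mu>
 proof -
  have [measurable_cong]: "sets \<mu> = sets borel" using l by (simp add: locally_finite_measure_def)
  have [measurable]: "ph n \<in> BM borel" for n by (intro cont_measurable cont)
  have [measurable]: "X \<in> sets borel" by (simp add: X)
  have "(%n. \<integral>x. ph n x \<partial>\<mu>) ----> (\<integral>x. indicator X x \<partial>\<mu>)"
  proof (rule integral_dominated_convergence[where w="indicator X"])
   show "integrable \<mu> (indicator X :: _ => real)"
    using fin[OF l, of l u] by (simp add: X)
    show "AE x in \<mu>. norm (ph n x) <= indicator X x" for n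
    using bd[of n] out[of _ n] by (intro AE_I2) (auto simp: indicator_def)
  qed (use lim in auto)
  moreover have "space \<mu> = UNIV" using sets_eq_imp_space_eq[of \<mu> borel] by (simp add: \<open>sets \<mu> = sets borel\<close>)
  ultimately show ?thesis by simp
 qed
 have "(\<integral>x. ph n x \<partial>\<mu>) = (\<integral>x. ph n x \<partial>\<nu>)" for n
  by (rule eq[OF cont compact_cbox[of l u]]) (use bd out box_subset_cbox[of l u] X in blast)+
 hence "measure \<mu> X = measure \<nu> X" using L[OF lf(1)] L[OF lf(2)] by (simp add: LIMSEQ_unique)
 thus "emeasure \<mu> X = emeasure \<nu> X"
  using fin[OF lf(1), of l u] fin[OF lf(2), of l u] by (simp add: emeasure_eq_ennreal_measure X)
qed

section \<open>The standard complex Gaussian distribution\<close>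

definition cgauss :: "complex measure" where
 "cgauss = density lborel (%z. ennreal (exp (- (cmod z)\<^sup>2) / pi))"

abbreviation cgauss_mean (binder "GAUSS " 10) where "cgauss_mean \<equiv> lebesgue_integral cgauss"
abbreviation nn_cgauss_mean (binder "NGAUSS " 10) where "nn_cgauss_mean \<equiv> nn_integral cgauss"

lemma sets_cgauss [measurable_cong, simp]: "sets cgauss = sets borel" by (simp add: cgauss_def)
lemma space_cgauss [simp]: "space cgauss = UNIV" by (simp add: cgauss_def)

lemma nn_integral_cgauss:
 assumes [measurable]: "f \<in> BM borel" shows "(NGAUSS z. f z) = (NINT z. ennreal (exp (- (cmod z)\<^sup>2) / pi) * f z)"
 unfolding cgauss_def by (simp add: nn_integral_density)

text \<open>Dividing the area by \<open>pi\<close> absorbs the normalization of the density, so the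
  squared modulus is exponential of rate 1.\<close>

lemma nn_integral_cgauss_norm:
 assumes [measurable]: "f \<in> BM borel" shows "(NGAUSS z. f ((cmod z)^2)) = (NINT q. ennreal (exponential_density 1 q) * f q)"
proof -
 let ?a = "%x. indicator {0..} (pi * x) * (ennreal (exp (- x) / pi) * f x)"
 have "(NGAUSS z. f ((cmod z)^2))
   = (NINT z. (%x. ennreal (exp (- x / pi) / pi) * f (x / pi)) (area z))" by (subst nn_integral_cgauss) auto
 also have "... = (NINT x. indicator {0..} x * (ennreal (exp (- x / pi) / pi) * f (x / pi)))" by (rule nn_integral_area) measurable
 also have "... = ennreal pi * (NINT x. indicator {0..} (pi * x) * (ennreal (exp (- x) / pi) * f x))"
  by (subst nn_integral_real_affine[where c=pi and t=0]) auto
 also have "... = (NINT x. ennreal pi * ?a x)"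
  by (rule nn_integral_cmult[symmetric]) measurable
 also have "... = (NINT q. ennreal (exponential_density 1 q) * f q)"
 proof (rule nn_integral_cong)
  fix x :: real
  have "ennreal pi * ennreal (exp (-x) / pi) = ennreal (exp (-x))" by (simp flip: ennreal_mult)
  with pi_gt_zero show "ennreal pi * ?a x = ennreal (exponential_density 1 x) * f x"
   by (auto simp: exponential_density_def zero_le_mult_iff mult.assoc[symmetric] not_le)
 qed
 finally show ?thesis .
qed

definition expo :: "real measure" where "expo = density lborel (%q. ennreal (exponential_density 1 q))"

abbreviation expo_mean (binder "EXPO " 10) where "expo_mean \<equiv> lebesgue_integral expo"
abbreviation nn_expo_mean (binder "NEXPO " 10) where "nn_expo_mean \<equiv> nn_integral expo"

lemma sets_expo [measurable_cong, simp]: "sets expo = sets borel" by (simp add: expo_def)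
lemma space_expo [simp]: "space expo = UNIV" by (simp add: expo_def)

interpretation expo: prob_space expo unfolding expo_def by (rule prob_space_exponential_density) simp

lemma distr_cgauss_norm: "distr cgauss borel (%z. (cmod z)^2) = expo"
proof (rule measure_eqI)
 fix A assume "A \<in> sets (distr cgauss borel (%z. (cmod z)^2))"
 hence [measurable]: "A \<in> sets borel" by simp
 have [measurable]: "(%z. (cmod z)^2) \<in> measurable cgauss borel" by simp
 show "emeasure (distr cgauss borel (%z. (cmod z)^2)) A = emeasure expo A" using nn_integral_cgauss_norm[of "indicator A"]
  by (subst (1 2) nn_integral_indicator[symmetric])
    (simp_all add: nn_integral_distr expo_def nn_integral_density del: nn_integral_indicator)
qed auto

interpretation cgauss: prob_space cgauss
proof (rule prob_spaceI)
 have "emeasure cgauss (space cgauss) = emeasure (distr cgauss borel (%z. (cmod z)^2)) UNIV" by (subst emeasure_distr) auto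
 thus "emeasure cgauss (space cgauss) = 1" unfolding distr_cgauss_norm using expo.emeasure_space_1 by simp
qed

lemma integral_cgauss_norm:
 fixes f :: "real => 'b::{banach, second_countable_topology}"
 assumes [measurable]: "f \<in> BM borel" shows "(GAUSS z. f ((cmod z)^2)) = (EXPO q. f q)"
  "integrable cgauss (%z. f ((cmod z)^2)) <-> integrable expo f" by (subst distr_cgauss_norm[symmetric], subst integral_distr, auto)
   (simp_all add: integrable_distr_eq flip: distr_cgauss_norm)

text \<open>The unitary substitution is a composition of two affine ones, in one variable each, with Jacobians \<open>|c|\<^sup>2\<close> and \<open>|c|\<^sup>-\<^sup>2\<close>.\<close>

lemma nn_integral_lborel_unitary:
 fixes c s :: complex and f :: "complex => complex => ennreal"
 assumes cs: "(cmod c)^2 + (cmod s)^2 = 1" and f: "case_prod f \<in> BM (borel >< borel)"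
 shows "(NINT x y. f (c * x + s * y) (- cnj s * x + cnj c * y))
    = (NINT x y. f x y)"
proof -
 let ?a = "%x y. - (cnj s / c) * x + (1 / c) * y"
 let ?b = "(NINT x y. f (c * x + s * y) (- cnj s * x + cnj c * y)) "
 let ?c = "%y x. - (s / c) * y + (1 / c) * x"
 let ?d = "NINT y x. f x (?a x y)"
 note [measurable] = measurable_app2[OF f]
 show ?thesis
 proof (cases "c = 0")
  case True
  hence s: "cmod s = 1" using cs by (simp add: power2_eq_1_iff) (smt (verit) norm_ge_zero)
  have "?b = (NINT x y. f y (- cnj s * x))" using True by (simp add: nn_integral_lborel_complex_mult_unit[OF s, of "%y. f y _"])
  also have "... = (NINT x y. f y x)" by (rule nn_integral_lborel_complex_mult_unit[of "- cnj s" "%x. NINT y. f y x"]) (use s in auto)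
  also have "... = (NINT x y. f x y)" by (rule lborel_pair.Fubini') measurable
  finally show ?thesis .
 next
  case False
  define k where "k = (cmod c)^2"
  have k: "k > 0" using False by (simp add: k_def)
  have cc: "c * cnj c = of_real k" unfolding k_def by (rule complex_norm_square[symmetric])
  have "(cmod s)^2 = 1 - k" using cs by (simp add: k_def)
  hence ss: "s * cnj s = 1 - of_real k" unfolding complex_norm_square[symmetric] by simp
  have "?b = (NINT y x. f (c * x + s * y) (- cnj s * x + cnj c * y))" by (rule lborel_pair.Fubini'[symmetric]) measurable
  also have "... = (NINT y. ennreal (1 / k) * (NINT x. f x (?a x y)))"
  proof (rule nn_integral_cong)
   fix y :: complex
   have e: "- cnj s * ?c y x + cnj c * y = - (cnj s / c) * x + (1 / c) * y" for x
   proof -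
    have "c * (- cnj s * ?c y x + cnj c * y) = (s * cnj s + c * cnj c) * y - cnj s * x"
     using False by (simp add: field_simps)
    also have "... = c * ?a x y" using False by (simp add: cc ss right_diff_distrib)
    finally show ?thesis by auto
   qed
   have e2: "c * ?c y x + s * y = x" for x using False by (simp add: field_simps)
   show "(NINT x. f (c * x + s * y) (- cnj s * x + cnj c * y))
     = ennreal (1 / k) * (NINT x. f x (?a x y))" using False
    by (subst nn_integral_lborel_complex_affine[where c="1 / c" and t="- (s / c) * y"])
      (simp_all only: e e2, auto simp: k_def norm_divide power_divide)
  qed
  also have "... = ennreal (1 / k) * ?d" by (rule nn_integral_cmult) measurable
  also have "?d
    = (NINT x y. f x (?a x y))" by (rule lborel_pair.Fubini') measurable
  also have "... = (NINT x. ennreal k * (NINT y. f x y))"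
  proof (rule nn_integral_cong)
   fix x :: complex
   have e: "- (cnj s / c) * x + (1 / c) * (cnj s * x + c * y) = y" for y using False by (simp add: field_simps)
   have "ennreal k * (NINT y. f x y)
     = ennreal k * (ennreal ((cmod (1/c))^2) * (NINT y. f x (?a x y)))"
    using False by (subst nn_integral_lborel_complex_affine[where c="1/c" and t="- (cnj s / c) * x"]) auto
   also have "ennreal k * (ennreal ((cmod (1/c))^2) * I) = I" for I
    using k by (simp add: k_def norm_divide power_divide mult.assoc[symmetric] flip: ennreal_mult)
   finally show "(NINT y. f x (?a x y)) = ennreal k * (NINT y. f x y)" by simp
  qed
  also have "... = ennreal k * (NINT x y. f x y)" by (rule nn_integral_cmult) measurable
  also have "ennreal (1 / k) * (ennreal k * I) = I" for I using k by (simp add: mult.assoc[symmetric] flip: ennreal_mult)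
  finally show ?thesis .
 qed
qed

lemma norm_unitary:
 fixes c s x y :: complex shows "(cmod (c * x + s * y))^2 + (cmod (- cnj s * x + cnj c * y))^2
    = ((cmod c)^2 + (cmod s)^2) * ((cmod x)^2 + (cmod y)^2)"
proof -
 have "complex_of_real ((cmod (c * x + s * y))^2 + (cmod (- cnj s * x + cnj c * y))^2)
    = of_real (((cmod c)^2 + (cmod s)^2) * ((cmod x)^2 + (cmod y)^2))"
  unfolding of_real_add of_real_mult complex_norm_square complex_cnj_add complex_cnj_mult complex_cnj_minus complex_cnj_cnj
  by (simp add: alg_simps)
 thus ?thesis by (simp only: of_real_eq_iff)
qed

text \<open>A unitary map preserves Lebesgue measure as well as the sum of squares on which the
  product density depends.\<close>

lemma nn_integral_cgauss_unitary:
 fixes c s :: complex and f :: "complex => complex => ennreal"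
 assumes cs: "(cmod c)^2 + (cmod s)^2 = 1" and f: "case_prod f \<in> BM (borel >< borel)"
 shows "(NGAUSS x y. f (c * x + s * y) (- cnj s * x + cnj c * y))
    = (NGAUSS x y. f x y)"
proof -
 let ?a = "%x y. - cnj s * x + cnj c * y"
 let ?b = "BM (borel >< borel)"
 note [measurable] = measurable_app2[OF f]
 define d where "d = (%z. exp (- (cmod z)\<^sup>2) / pi)"
 define F where "F x y = ennreal (d x * d y) * f x y" for x y
 have d0: "d x \<ge> 0" for x by (simp add: d_def)
 have [measurable]: "d \<in> BM borel" unfolding d_def by auto
 have Fm: "case_prod F \<in> ?b" unfolding F_def by simp
 have pull: "(NGAUSS x y. k x y) = (NINT x y. ennreal (d x * d y) * k x y)"
  if k: "case_prod k \<in> ?b" for k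
 proof -
  note [measurable] = measurable_app2[OF k]
  have "(NGAUSS x y. k x y) = (NINT x. ennreal (d x) * (NINT y. ennreal (d y) * k x y))" by (simp add: nn_integral_cgauss d_def)
  also have "... = (NINT x y. ennreal (d x) * (ennreal (d y) * k x y))" by (intro nn_integral_cong nn_integral_cmult[symmetric]) measurable
  finally show ?thesis using d0 by (simp add: ennreal_mult mult.assoc)
 qed
 have D: "d (c * x + s * y) * d (?a x y) = d x * d y" for x y
 proof -
  have e: "(cmod (c * x + s * y))^2 + (cmod (?a x y))^2 = (cmod x)^2 + (cmod y)^2"
   unfolding norm_unitary cs by simp
  have dd: "d a * d b = exp (- ((cmod a)^2 + (cmod b)^2)) / (pi * pi)" for a b
   by (simp only: d_def times_divide_times_eq minus_add_distrib exp_add)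
   show ?thesis unfolding dd e ..
 qed
 have "(NGAUSS x y. f (c * x + s * y) (?a x y))
   = (NINT x y. F (c * x + s * y) (?a x y))"
 proof (subst pull)
  show "(%(x, y). f (c * x + s * y) (?a x y)) \<in> ?b"
   by auto
 qed (simp only: F_def D)
 also have "... = (NINT x y. F x y)" using cs Fm by (rule nn_integral_lborel_unitary)
 also have "... = (NGAUSS x y. f x y)" unfolding pull[OF f] F_def ..
 finally show ?thesis .
qed

lemma cgauss_UNIV [simp]: "emeasure cgauss UNIV = 1"
 using cgauss.emeasure_space_1 by simp

lemma nn_integral_cgauss_mult_unit:
 assumes u: "cmod u = 1" and [measurable]: "f \<in> BM borel" shows "(NGAUSS x. f (u * x)) = (NGAUSS x. f x)"
proof -
 have "(NGAUSS x y. f (u * x + 0 * y)) = (NGAUSS x y. f x)"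
 proof (rule nn_integral_cgauss_unitary)
  show "(cmod u)^2 + (cmod 0)^2 = 1" using u by simp
  show "(%(x, y::complex). f x) \<in> BM (borel >< borel)" by auto
 qed
 thus ?thesis by simp
qed

lemma nn_integral_cgauss_combine:
 fixes si ta :: complex
 assumes [measurable]: "f \<in> BM borel" shows "(NGAUSS x y. f (si * x + ta * y))
  = (NGAUSS x. f (of_real (sqrt ((cmod si)^2 + (cmod ta)^2)) * x))"
proof (cases "si = 0 & ta = 0")
 case True thus ?thesis by simp
next
 case False
 let ?b = "(cmod si)^2 + (cmod ta)^2"
 define r where "r = sqrt ?b"
 let ?a = "(cmod (si / r))^2 + (cmod (ta / r))^2"
 have r: "r > 0" "r^2 = (cmod si)^2 + (cmod ta)^2" using False by (auto simp: r_def add_pos_nonneg add_nonneg_pos)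
 have "?a = ?b / r^2"
  by (simp add: norm_divide power_divide add_divide_distrib)
 hence cs: "?a = 1" using r(1) by (simp only: r(2)[symmetric]) simp
 have "(NGAUSS x y. f (r * (si / r * x + ta / r * y))) = (NGAUSS x y. f (r * x))"
 proof (rule nn_integral_cgauss_unitary[OF cs, where f="%(x::complex) y. f (r * x)"])
  show "(%(x::complex, y::complex). f (r * x)) \<in> BM (borel >< borel)" by auto
 qed
 moreover have "r * (si / r * x + ta / r * y) = si * x + ta * y" for x y using r(1) by (simp add: field_simps)
 ultimately show ?thesis by (simp add: r_def)
qed

interpretation cgauss_PiM: product_prob_space "%_::nat. cgauss" UNIV ..

interpretation cgauss_pair: pair_prob_space cgauss cgauss ..

text \<open>A Cholesky form of the joint law of two linear forms: the first uses a single Gaussian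
  \<open>x\<close>, the second is a multiple of \<open>x\<close> plus an independent remainder. In
  the induction each new coordinate is absorbed by a unitary rotation that eliminates it from the
  first form; quantifying over all \<open>f\<close> lets the induction hypothesis apply to the
  integral over the new coordinate.\<close>

lemma nn_integral_PiM_cgauss:
 fixes u v :: "nat => complex"
 assumes "finite I" "I ~= {}" "!!n. n \<in> I ==> u n ~= 0"
 shows "\<exists>si\<ge>0. (cmod ((\<Sum>n\<in>I. v n * cnj (u n)) / sqrt (\<Sum>n\<in>I. (cmod (u n))^2)))^2 + si^2 = (\<Sum>n\<in>I. (cmod (v n))^2) &
   (\<forall>f. case_prod f \<in> BM (borel >< borel) -->
    (\<integral>\<^sup>+x. f (\<Sum>n\<in>I. u n * x n) (\<Sum>n\<in>I. v n * x n) \<partial>PiM I (%_. cgauss))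
    = (NGAUSS x y. f (sqrt (\<Sum>n\<in>I. (cmod (u n))^2) * x)
       ((\<Sum>n\<in>I. v n * cnj (u n)) / sqrt (\<Sum>n\<in>I. (cmod (u n))^2) * x + of_real si * y)))" using assms
proof (induction I rule: finite_ne_induct)
 case (singleton n)
 hence u: "cmod (u n) > 0" by simp
 let ?t = "cmod (u n)"
 show ?case
 proof (intro exI[of _ 0] conjI allI impI)
  let ?c = "\<Sum>n\<in>{n}. (cmod (u n))^2"
  let ?j = "\<Sum>n\<in>{n}. v n * cnj (u n)"
  have "(cmod (v n * cnj (u n) / cmod (u n)))^2 = (cmod (v n))^2" using u by (simp add: norm_mult norm_divide)
  thus "(cmod (?j / sqrt ?c))^2 + 0^2 = (\<Sum>n\<in>{n}. (cmod (v n))^2)"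
   by simp
  fix f :: "complex => complex => ennreal"
  assume f: "case_prod f \<in> BM (borel >< borel)"
  note [measurable] = measurable_app2[OF f]
  have ph: "cmod (u n / cmod (u n)) = 1" using u by (simp add: norm_divide)
  have "(\<integral>\<^sup>+x. f (u n * x n) (v n * x n) \<partial>PiM {n} (%_. cgauss)) = (NGAUSS x. f (u n * x) (v n * x))"
   by (rule cgauss_PiM.product_nn_integral_singleton) measurable
  also have "... = (NGAUSS x. (%x. f (cmod (u n) * x) (v n * (cmod (u n) / u n) * x)) (u n / cmod (u n) * x))"
   using u by simp
  also have "... = (NGAUSS x. f (cmod (u n) * x) (v n * (cmod (u n) / u n) * x))" by (rule nn_integral_cgauss_mult_unit[OF ph]) measurable
  also have "of_real ?t / u n = cnj (u n) / cmod (u n)"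
  proof -
   have "of_real ?t * of_real ?t = u n * cnj (u n)"
    by (simp add: power2 flip: complex_norm_square)
   thus ?thesis using u by (simp add: field_simps)
  qed
  finally show "(\<integral>\<^sup>+x. f (\<Sum>n\<in>{n}. u n * x n) (\<Sum>n\<in>{n}. v n * x n) \<partial>PiM {n} (%_. cgauss))
    = (NGAUSS x y. f (sqrt ?c * x)
       (?j / sqrt ?c * x + of_real 0 * y))" by simp
 qed simp
next
 case (insert n I)
 let ?e = "\<Sum>n\<in>I. (cmod (u n))^2"
 let ?f = "borel >< borel"
 let ?o = "%x z. \<Sum>m\<in>insert n I. u m * (x(n := z)) m"
 let ?p = "%x z. \<Sum>m\<in>insert n I. v m * (x(n := z)) m"
 let ?u = "%_. cgauss"
 let ?v = "cmod (u n)"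
 define al where "al = sqrt ?e"
 define be where "be = (\<Sum>n\<in>I. v n * cnj (u n)) / al"
 let ?n = "(cmod be)^2 + (cmod (v n))^2"
 obtain si where si: "si \<ge> 0" "(cmod be)^2 + si^2 = (\<Sum>n\<in>I. (cmod (v n))^2)"
  and law: "!!f. case_prod f \<in> BM ?f ==>
    (\<integral>\<^sup>+x. f (\<Sum>n\<in>I. u n * x n) (\<Sum>n\<in>I. v n * x n) \<partial>PiM I ?u)
    = (NGAUSS x y. f (al * x) (be * x + of_real si * y))" using insert.IH insert.prems unfolding al_def be_def by auto
 let ?l = "cmod (of_real si :: complex)"
 define A where "A = sqrt (\<Sum>n\<in>insert n I. (cmod (u n))^2)"
 have al2: "al^2 = ?e" unfolding al_def by (simp add: sum_nonneg)
 have A2: "A^2 = al^2 + ?v^2" unfolding A_def al2 using insert by (simp add: sum_nonneg)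
 have al0: "al \<ge> 0" by (simp add: al_def sum_nonneg)
 have "?e > 0" using insert by (intro sum_pos) auto
 hence alpos: "al > 0" by (simp add: al_def)
 have Apos: "A > 0" unfolding A_def using insert by (intro real_sqrt_gt_zero sum_pos) auto
 \<comment> \<open>The rotation that takes the vector \<open>(al, u n)\<close> to the first axis;
   \<open>A\<close> is its length.\<close>
 define c where "c = complex_of_real (al / A)"
 define s where "s = u n / of_real A"
 let ?g = "%p q. cnj s * p + c * q"
 let ?m = "of_real al * c + u n * cnj s"
 let ?s = "(cmod c)^2 + (cmod s)^2"
 have cs: "?s = 1"
 proof -
  have "?s = (al^2 + ?v^2) / A^2"
   by (simp add: c_def s_def norm_divide power_divide add_divide_distrib)
  thus ?thesis using Apos by (simp add: A2[symmetric])
 qed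
 have cc: "cnj c = c" by (simp add: c_def)
 \<comment> \<open>After the rotation \<open>B\<close> is the coefficient of the Gaussian shared by
   both forms, and \<open>ta\<close> is what the second form loses to the independent
   remainder.\<close>
 define ta where "ta = v n * c - be * s"
 define B where "B = be * c + v n * cnj s"
 have uu: "u n * cnj (u n) = of_real (?v^2)" by (rule complex_norm_square[symmetric])
 have e1: "of_real al * c + u n * cnj s = of_real A"
 proof -
  have "of_real A * ?m = of_real (al^2) + u n * cnj (u n)"
   using Apos by (simp add: c_def s_def field_simps power2)
  also have "... = of_real A * of_real A" unfolding uu of_real_add[symmetric] A2[symmetric] by (simp add: power2)
  finally show ?thesis using Apos by simp
 qed
 have e2: "u n * c - of_real al * s = 0" by (simp add: c_def s_def)
 have B: "B = (\<Sum>n\<in>insert n I. v n * cnj (u n)) / A"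
  using insert(1,2,3) alpos by (auto simp: B_def be_def c_def s_def add_divide_distrib)
 define si' where "si' = sqrt (?l^2 + (cmod ta)^2)"
 let ?d = "(cmod B)^2 + si'^2 = (\<Sum>n\<in>insert n I. (cmod (v n))^2)"
 have S: "?d"
 proof -
  have "(cmod (c * be + cnj s * v n))^2 + (cmod (- cnj (cnj s) * be + cnj c * v n))^2 = ?n"
   unfolding norm_unitary using cs by simp
  hence "(cmod B)^2 + (cmod ta)^2 = ?n" by (simp add: B_def ta_def cc mult.commute)
  thus ?thesis using si insert by (simp add: si'_def)
 qed
 show ?case unfolding A_def[symmetric] B[symmetric]
 proof (intro exI[of _ si'] conjI allI impI)
  show "0 <= si'" by (simp add: si'_def)
  show "?d" by (rule S)
  fix f :: "complex => complex => ennreal"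
  assume f: "case_prod f \<in> BM ?f"
  let ?a = "(\<integral>\<^sup>+x. f (\<Sum>m\<in>insert n I. u m * x m) (\<Sum>m\<in>insert n I. v m * x m) \<partial>PiM (insert n I) (%_. cgauss)) "
  let ?h = "NGAUSS p y. f (A * p) (B * p + of_real si' * y)"
  note [measurable] = measurable_app2[OF f]
  define K where "K x z = (NGAUSS y. f (al * x + u n * z) (be * x + of_real si * y + v n * z))" for x z :: complex
  let ?k = "%p q. K (c * p - s * q) (?g p q)"
  have Km: "case_prod K \<in> BM ?f" unfolding K_def by simp
  note [measurable] = measurable_app2[OF Km]
  have "?a = (\<integral>\<^sup>+x. (NGAUSS z. f (?o x z) (?p x z)) \<partial>PiM I ?u)"
   by (rule cgauss_PiM.product_nn_integral_insert) (use insert in measurable)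
  also have "... = (\<integral>\<^sup>+x. (NGAUSS z. f ((\<Sum>m\<in>I. u m * x m) + u n * z) ((\<Sum>m\<in>I. v m * x m) + v n * z)) \<partial>PiM I ?u)"
  proof (intro nn_integral_cong arg_cong2[where f=f])
   have *: "(\<Sum>m\<in>insert n I. w m * (x(n := z)) m) = (\<Sum>m\<in>I. w m * x m) + w n * z" for w x :: "nat => complex" and z
   proof -
    have "(\<Sum>m\<in>I. w m * (x(n := z)) m) = (\<Sum>m\<in>I. w m * x m)" using insert by (intro sum.cong) auto
    thus ?thesis using insert by auto
   qed
   show "?o x z = (\<Sum>m\<in>I. u m * x m) + u n * z" for x z by (rule *)
   show "?p x z = (\<Sum>m\<in>I. v m * x m) + v n * z" for x z by (rule *)
  qed
  also have "... = (NGAUSS x y. (NGAUSS z. f (al * x + u n * z) (be * x + of_real si * y + v n * z)))"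
  proof (rule law)
   show "(%(x, y). NGAUSS z. f (x + u n * z) (y + v n * z)) \<in> BM ?f" by auto
  qed
  also have "... = (NGAUSS x z. K x z)" unfolding K_def by (intro nn_integral_cong cgauss_pair.Fubini') measurable
  also have "... = (NGAUSS x z. ?k (c * x + s * z) (- cnj s * x + cnj c * z))"
  proof (intro nn_integral_cong)
   fix x z
   let ?i = "- cnj s * x + cnj c * z"
   let ?q = "c * x + s * z"
   have 1: "c * c + s * cnj s = 1"
   proof -
    have "c * cnj c + s * cnj s = of_real ((cmod c)^2 + (cmod s)^2)" unfolding of_real_add complex_norm_square ..
    thus ?thesis using cs by (simp add: cc)
   qed
   have "c * ?q - s * ?i = (c * c + s * cnj s) * x" by (simp add: cc alg_simps)
   moreover have "cnj s * ?q + c * ?i = (c * c + s * cnj s) * z" by (simp add: cc alg_simps)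
   ultimately show "K x z = ?k ?q ?i"
    by (simp add: 1)
  qed
  also have "... = (NGAUSS p q. K (c * p - s * q) (?g p q))"
  proof (rule nn_integral_cgauss_unitary[OF cs])
   show "(%(p, q). K (c * p - s * q) (?g p q)) \<in> BM ?f"
    by auto
  qed
  also have "... = (NGAUSS p q. (NGAUSS y. f (A * p) (B * p + (ta * q + of_real si * y))))" unfolding K_def
  proof (intro nn_integral_cong arg_cong2[where f=f])
   fix p q y :: complex
   let ?r = "c * p - s * q"
   have "of_real al * ?r + u n * ?g p q
     = ?m * p + (u n * c - of_real al * s) * q" by (simp add: alg_simps)
   thus "of_real al * ?r + u n * ?g p q = of_real A * p" by (simp only: e1 e2) simp
   show "be * ?r + of_real si * y + v n * ?g p q = B * p + (ta * q + of_real si * y)"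
    by (simp add: B_def ta_def alg_simps)
  qed
  also have "... = ?h"
  proof (rule nn_integral_cong)
   fix p :: complex
   let ?b = "(NGAUSS q y. f (A * p) (B * p + (ta * q + of_real si * y))) "
   have "?b = (NGAUSS y. f (A * p) (B * p + of_real (sqrt ((cmod ta)^2 + ?l^2)) * y))"
    by (rule nn_integral_cgauss_combine[of "%w. f (A * p) (B * p + w)"]) measurable
   thus "?b = (NGAUSS y. f (A * p) (B * p + of_real si' * y))" by (simp add: si'_def add.commute)
  qed
  finally show "?a = ?h" .
 qed
qed

text \<open>A pair of centred Gaussians in Cholesky form: the second component is
  \<open>be / al\<close> times the first plus an independent Gaussian of deviation
  \<open>si\<close>.\<close>

definition gauss2 :: "real => complex => real => (complex \<times> complex) measure" where
 "gauss2 al be si = distr (cgauss >< cgauss) borel (%p. (of_real al * fst p, be * fst p + of_real si * snd p))"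

lemma sets_gauss2 [measurable_cong, simp]: "sets (gauss2 al be si) = sets borel" by (simp add: gauss2_def)

lemma measurable_gauss2_map [measurable]:
 "(%p. (of_real al * fst p, be * fst p + of_real si * snd p)) \<in> measurable (cgauss >< cgauss) (borel :: (complex \<times> complex) measure)"
 by auto

lemma prob_space_gauss2: "prob_space (gauss2 al be si)"
 unfolding gauss2_def by (rule cgauss_pair.prob_space_distr) simp

lemma nn_integral_gauss2:
 assumes [measurable]: "f \<in> BM borel"
 shows "(\<integral>\<^sup>+p. f p \<partial>gauss2 al be si) = (NGAUSS x y. f (of_real al * x, be * x + of_real si * y))"
 unfolding gauss2_def by (subst nn_integral_distr, simp, simp, subst cgauss.nn_integral_fst[symmetric]) auto

lemma distr_PiM_gauss2:
 fixes u v :: "nat => complex"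
 assumes I: "finite I" "I ~= {}" "!!n. n \<in> I ==> u n ~= 0"
 defines "al \<equiv> sqrt (\<Sum>n\<in>I. (cmod (u n))^2)"
 defines "be \<equiv> (\<Sum>n\<in>I. v n * cnj (u n)) / of_real al"
 shows "distr (PiM I (%_. cgauss)) borel (%x. (\<Sum>n\<in>I. u n * x n, \<Sum>n\<in>I. v n * x n))
   = gauss2 al be (sqrt ((\<Sum>n\<in>I. (cmod (v n))^2) - (cmod be)^2))" and "(cmod be)^2 <= (\<Sum>n\<in>I. (cmod (v n))^2)"
proof -
 let ?a = "%x. (\<Sum>n\<in>I. u n * x n, \<Sum>n\<in>I. v n * x n)"
 let ?b = "PiM I (%_. cgauss)"
 let ?c = "\<Sum>n\<in>I. (cmod (v n))^2"
 let ?d = "distr ?b borel ?a"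
 obtain si where si: "si \<ge> 0" "(cmod be)^2 + si^2 = (\<Sum>n\<in>I. (cmod (v n))^2)"
  and law: "!!f. case_prod f \<in> BM (borel >< borel) ==>
    (\<integral>\<^sup>+x. f (\<Sum>n\<in>I. u n * x n) (\<Sum>n\<in>I. v n * x n) \<partial>PiM I (%_. cgauss))
    = (NGAUSS x y. f (al * x) (be * x + of_real si * y))"
  using nn_integral_PiM_cgauss[where u=u and v=v, OF I] unfolding al_def be_def by auto
 show "(cmod be)^2 <= ?c" unfolding si(2)[symmetric] by simp
 have *: "sqrt (?c - (cmod be)^2) = si" using si(1) by (simp add: si(2)[symmetric])
 show "distr ?b borel ?a
   = gauss2 al be (sqrt (?c - (cmod be)^2))" unfolding *
 proof (rule measure_eqI)
  fix A :: "(complex \<times> complex) set"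
  assume "A \<in> sets ?d"
  hence A[measurable]: "A \<in> sets borel" by simp
  let ?e = "emeasure (gauss2 al be si) A"
  have [measurable]: "?a \<in> measurable ?b (borel :: (complex \<times> complex) measure)"
   by auto
  have Am: "(%(x, y). indicator A (x, y)) \<in> BM (borel >< borel)" unfolding borel_prod by auto
  have "emeasure ?d A
   = (\<integral>\<^sup>+x. indicator A (\<Sum>n\<in>I. u n * x n, \<Sum>n\<in>I. v n * x n) \<partial>PiM I (%_. cgauss))"
   by (subst nn_integral_indicator[symmetric], simp, subst nn_integral_distr) auto
  also have "... = (NGAUSS x y. indicator A (al * x, be * x + of_real si * y))" using law[OF Am] by simp
  also have "... = ?e" by (subst nn_integral_gauss2[symmetric]) auto
  finally show "emeasure ?d A = ?e" .
 qed simp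
qed

abbreviation (in prob_space) mean (binder "EE " 10) where "mean \<equiv> lebesgue_integral M"

section \<open>Linear forms in a sequence of independent standard Gaussians\<close>

locale gaussian_sequence = prob_space M for M :: "'w measure" +
 fixes a :: "nat => 'w => complex"
 assumes indep: "indep_vars (%_. borel) a UNIV" and distr_a: "distr M borel (a n) = cgauss"
begin

lemma measurable_a [measurable]: "a n \<in> BM M"
 using indep by (simp add: indep_vars_def)

lemma distr_a_PiM:
 assumes "I ~= {}" shows "distr M (PiM I (%_. borel)) (%w. \<lambda>n\<in>I. a n w) = PiM I (%_. cgauss)"
proof -
 have "indep_vars (%_. borel) a I" using indep by (rule indep_vars_subset) simp
 hence "distr M (PiM I (%_. borel)) (%w. \<lambda>n\<in>I. a n w) = PiM I (%n. distr M borel (a n))"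
  using assms by (subst (asm) indep_vars_iff_distr_eq_PiM') auto
 thus ?thesis by (simp add: distr_a)
qed

lemma distr_sum_gauss2:
 fixes u v :: "nat => complex"
 assumes I: "finite I" "I ~= {}" "!!n. n \<in> I ==> u n ~= 0"
 defines "al \<equiv> sqrt (\<Sum>n\<in>I. (cmod (u n))^2)"
 defines "be \<equiv> (\<Sum>n\<in>I. v n * cnj (u n)) / of_real al"
 shows "distr M borel (%w. (\<Sum>n\<in>I. u n * a n w, \<Sum>n\<in>I. v n * a n w))
   = gauss2 al be (sqrt ((\<Sum>n\<in>I. (cmod (v n))^2) - (cmod be)^2))"
proof -
 let ?a = "%x. (\<Sum>n\<in>I. u n * x n, \<Sum>n\<in>I. v n * x n)"
 have m: "?a \<in> measurable (PiM I (%_. borel)) (borel :: (complex \<times> complex) measure)"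
  by auto
 have "distr M borel (%w. (\<Sum>n\<in>I. u n * a n w, \<Sum>n\<in>I. v n * a n w))
   = distr (distr M (PiM I (%_. borel)) (%w. \<lambda>n\<in>I. a n w)) borel ?a"
  by (subst distr_distr[OF m]) (auto simp: o_def)
 also have "... = gauss2 al be (sqrt ((\<Sum>n\<in>I. (cmod (v n))^2) - (cmod be)^2))"
  unfolding distr_a_PiM[OF I(2)] al_def be_def by (rule distr_PiM_gauss2[OF I])
 finally show ?thesis .
qed

text \<open>The law of the partial sums is \<open>gauss2\<close> with converging parameters. Bounded
  continuous test functions pass to the limit on both sides: through almost sure convergence of the
  sums, and through pointwise convergence of the linear maps that define
  \<open>gauss2\<close>.\<close>

lemma distr_limit_gauss2:
 fixes u v :: "nat => complex" and S T :: "'w => complex"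
 assumes u0: "!!n. u n ~= 0" and su: "summable (%n. (cmod (u n))^2)" and sv: "summable (%n. (cmod (v n))^2)"
  and suv: "summable (%n. v n * cnj (u n))" and [measurable]: "S \<in> BM M" "T \<in> BM M"
  and S: "AE w in M. (%N. \<Sum>n<N. u n * a n w) ----> S w" and T: "AE w in M. (%N. \<Sum>n<N. v n * a n w) ----> T w"
 defines "al \<equiv> sqrt (\<Sum>n. (cmod (u n))^2)"
 defines "be \<equiv> (\<Sum>n. v n * cnj (u n)) / of_real al"
 shows "distr M borel (%w. (S w, T w)) = gauss2 al be (sqrt ((\<Sum>n. (cmod (v n))^2) - (cmod be)^2))"
proof (rule measure_eqI_compact_support)
 let ?a = "(\<Sum>n. (cmod (v n))^2) - (cmod be)^2"
 let ?f = "%N. %w. (\<Sum>n<N. u n * a n w, \<Sum>n<N. v n * a n w)"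
 let ?h = "%w. (S w, T w)"
 define alN where "alN N = sqrt (\<Sum>n<N. (cmod (u n))^2)" for N
 define beN where "beN N = (\<Sum>n<N. v n * cnj (u n)) / of_real (alN N)" for N
 define sg where "sg N = sqrt ((\<Sum>n<N. (cmod (v n))^2) - (cmod (beN N))^2)" for N
 define si where "si = sqrt ?a"
 have "(\<Sum>n. (cmod (u n))^2) > 0" using u0 su by (intro suminf_pos) auto
 hence al: "al > 0" by (simp add: al_def)
 have alN: "alN ----> al" unfolding alN_def al_def by (intro tendsto_intros summable_LIMSEQ su)
 have beN: "beN ----> be" unfolding beN_def be_def using al by (intro tendsto_intros summable_LIMSEQ suv alN) auto
 have sg: "sg ----> si" unfolding sg_def si_def by (intro tendsto_intros summable_LIMSEQ sv beN)
 have fin: "locally_finite_measure \<mu>" if "prob_space \<mu>" "sets \<mu> = sets borel" for \<mu> :: "(complex \<times> complex) measure"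
  using that(2) prob_space.emeasure_le_1[OF that(1)] by (auto simp: locally_finite_measure_def intro: le_less_trans[of _ 1])
 show "locally_finite_measure (gauss2 al be (sqrt ?a))" by (rule fin[OF prob_space_gauss2]) simp
 have [measurable]: "?h \<in> BM M" by auto
 show "locally_finite_measure (distr M borel ?h)" by (rule fin[OF prob_space_distr]) simp_all
 fix ph :: "complex \<times> complex => real" and K
 assume ph: "continuous_on UNIV ph" "!!x. 0 <= ph x & ph x <= 1"
 let ?b = "%N. \<integral>p. ph p \<partial>gauss2 (alN N) (beN N) (sg N)"
 let ?c = "%N. \<integral>p. ph p \<partial>gauss2 (alN N) (beN N) (sg N)"
 let ?d = "%N. EE w. ph (\<Sum>n<N. u n * a n w, \<Sum>n<N. v n * a n w)"
 let ?e = "\<integral>p. ph p \<partial>gauss2 al be si"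
 let ?g = "EE w. ph (S w, T w)"
 have [measurable]: "ph \<in> BM borel" using ph(1) by (rule cont_measurable)
 have phlim: "(%N. ph (p N)) ----> ph q" if "p ----> q" for p q using continuous_on_tendsto_compose[OF ph(1) that] by simp
 have [measurable]: "?f N \<in> BM M" for N
  by auto
 have L1: "(%N. EE w. ph (\<Sum>n<N. u n * a n w, \<Sum>n<N. v n * a n w)) ----> ?g"
 proof (rule integral_dominated_convergence[where w="%_. 1"])
  show "AE w in M. (%N. ph (\<Sum>n<N. u n * a n w, \<Sum>n<N. v n * a n w)) ----> ph (S w, T w)"
   using S T by eventually_elim (auto intro!: phlim tendsto_Pair)
  show "(%w. ph (\<Sum>n<N. u n * a n w, \<Sum>n<N. v n * a n w)) \<in> BM M" for N by simp
 qed (use ph(2) in auto)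
 have gm: "(%p. ph (of_real x * fst p, y * fst p + of_real z * snd p)) \<in> BM (cgauss >< cgauss)" for x y z
  by simp
 have gi: "(\<integral>p. ph p \<partial>gauss2 x y z) = (\<integral>p. ph (of_real x * fst p, y * fst p + of_real z * snd p) \<partial>(cgauss >< cgauss))" for x y z
  unfolding gauss2_def by (rule integral_distr) simp_all
 have L2: "?b ----> ?e"
  unfolding gi
 proof (rule integral_dominated_convergence[where w="%_. 1"])
  show "AE p in cgauss >< cgauss. (%N. ph (of_real (alN N) * fst p, beN N * fst p + of_real (sg N) * snd p))
    ----> ph (of_real al * fst p, be * fst p + of_real si * snd p)" by (intro AE_I2 phlim tendsto_intros alN beN sg)
 qed (use ph(2) gm in auto)
 have eq: "?d N = ?c N" if "N \<ge> 1" for N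
 proof -
  have "?d N = (\<integral>p. ph p \<partial>distr M borel (?f N))"
   by (rule integral_distr[symmetric]) simp_all
  also have "... = ?c N"
   unfolding alN_def beN_def sg_def using that u0 by (subst distr_sum_gauss2) (auto simp: lessThan_empty_iff)
  finally show ?thesis .
 qed
 have "?b ----> ?g"
  by (rule Lim_transform_eventually[OF L1]) (use eq in "auto intro!: eventually_sequentiallyI[of 1]")
 hence "?g = ?e" using L2 LIMSEQ_unique by auto
 thus "(\<integral>x. ph x \<partial>distr M borel ?h) = (\<integral>x. ph x \<partial>gauss2 al be (sqrt ?a))"
  by (subst integral_distr) (simp_all add: si_def)
qed

end

section \<open>Logarithmic moments of Gaussian variables\<close>

lemma integral_expo:
 fixes f :: "real => real"
 assumes [measurable]: "f \<in> BM borel" shows "(EXPO q. f q) = (LBINT q. indicator {0..} q * exp (- q) * f q)"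
  and "integrable expo f <-> integrable lborel (%q. indicator {0..} q * exp (- q) * f q)"
proof -
 have e: "exponential_density 1 q * f q = indicator {0..} q * exp (- q) * f q" for q by (auto simp: exponential_density_def)
 show "(EXPO q. f q) = (LBINT q. indicator {0..} q * exp (- q) * f q)"
  unfolding expo_def by (subst integral_density) (auto simp: e)
 show "integrable expo f <-> integrable lborel (%q. indicator {0..} q * exp (- q) * f q)"
  unfolding expo_def by (subst integrable_density) (auto simp: e)
qed

lemma AE_expo:
 assumes "AE q in lborel. 0 < q --> P q" shows "AE q in expo. P q" unfolding expo_def
proof (subst AE_density)
 have "AE q in lborel. q ~= (0::real)" by (rule AE_lborel_singleton)
 with assms show "AE q in lborel. 0 < ennreal (exponential_density 1 q) --> P q" by eventually_elim (auto simp: exponential_density_def)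
qed simp

lemma AE_cgauss_norm:
 assumes "AE q in expo. P q" shows "AE z in cgauss. P ((cmod z)^2)"
proof -
 have "AE q in distr cgauss borel (%z. (cmod z)^2). P q" unfolding distr_cgauss_norm by (rule assms)
 thus ?thesis by (rule AE_distrD[rotated]) simp
qed

lemma integrable_expo_powr:
 assumes s: "-1 < s" shows "integrable expo (%q. q powr s)"
proof -
 have e: "indicator {0..} q * exp (- q) * q powr s = indicator {0..} q * q powr (s + 1 - 1) / exp q" for q :: real
  by (simp add: exp_minus field_simps)
 have "integrable lborel (%q. indicator {0..} q * exp (- q) * q powr s)" unfolding e
 proof (rule integrableI_nonneg)
  show "(NINT q. ennreal (indicator {0..} q * q powr (s + 1 - 1) / exp q)) < \<infinity>"
   using s by (subst Gamma_conv_nn_integral_real[symmetric]) auto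
 qed (auto intro!: AE_I2)
 thus ?thesis by (subst integral_expo) auto
qed

lemma abs_ln_le_powr:
 assumes q: "(q::real) > 0" and s: "s > 0" shows "abs (ln q) <= (q powr s + q powr (- s)) / s"
proof (cases "q \<ge> 1")
 case True
 have "ln q <= q powr s / s" by (rule ln_powr_bound[OF True s])
 thus ?thesis using True s by (simp add: add_divide_distrib add_increasing2)
next
 case False
 have "ln (1/q) <= (1/q) powr s / s" by (rule ln_powr_bound) (use False q s in auto)
 hence "- ln q <= q powr (- s) / s" using q by (simp add: ln_div powr_divide powr_minus_divide)
 moreover have "0 <= q powr s / s" using s by simp
 ultimately show ?thesis using False q by (simp add: add_divide_distrib)
qed

lemma power4_add_le: "((a::real) + b) ^ 4 <= 8 * (a ^ 4 + b ^ 4)"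
proof -
 have s: "(x + y)^2 <= 2 * (x^2 + y^2)" for x y :: real using zero_le_power2[of "x - y"] by (simp add: power2 alg_simps)
 have "((a + b)^2)^2 <= (2 * (a^2 + b^2))^2" by (intro power_mono s) simp
 also have "... = 4 * (a^2 + b^2)^2" by (subst power_mult_distrib) simp
 also have "... <= 4 * (2 * ((a^2)^2 + (b^2)^2))" by (intro mult_left_mono s) simp
 finally show ?thesis by simp
qed

text \<open>\<open>|ln q| <= 8 * (q powr (1/8) + q powr (- (1/8)))\<close>, and the fourth powers of
  the two terms have exponents \<open>1/2\<close> and \<open>- 1/2\<close>, both above
  \<open>- 1\<close>.\<close>

lemma integrable_expo_ln4: "integrable expo (%q. (ln q) ^ 4)"
proof (rule integrable_dom)
 show "integrable expo (%q. 8 ^ 4 * (8 * (q powr (1/2) + q powr (- (1/2)))))"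
  by (intro integrable_mult_right integrable_plus integrable_expo_powr) auto
 let ?a = "%q. 8 * (q powr (1/2) + q powr (- (1/2)))"
 have "norm ((ln q) ^ 4) <= norm (8 ^ 4 * ?a q)" if q: "0 < q" for q :: real
 proof -
  let ?b = "q powr (1/8) + q powr (- (1/8))"
  have "abs (ln q) ^ 4 <= (8 * ?b) ^ 4"
   by (intro power_mono) (use abs_ln_le_powr[OF q, of "1/8"] in auto)
  also have "... = 8 ^ 4 * ?b ^ 4" by (rule power_mult_distrib)
  also have "... <= 8 ^ 4 * (8 * ((q powr (1/8)) ^ 4 + (q powr (- (1/8))) ^ 4))" by (intro mult_left_mono power4_add_le) simp
  also have "... = 8 ^ 4 * ?a q" by (simp add: powr_powr flip: powr_numeral)
  finally show ?thesis by simp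
 qed
 thus "AE q in expo. norm ((ln q) ^ 4) <= norm (8 ^ 4 * ?a q)" by (intro AE_expo AE_I2) simp
qed simp

lemma abs_le_1_power4: "abs (x::real) <= 1 + x ^ 4" "x^2 <= 1 + x ^ 4"
proof -
 have "2 * x^2 <= 1 + (x^2)^2" using zero_le_power2[of "x^2 - 1"] by (simp add: power2 alg_simps)
 hence a: "2 * x^2 <= 1 + x ^ 4" by simp
 moreover have "0 <= x^2" by simp
 ultimately show "x^2 <= 1 + x ^ 4" by linarith
 have "2 * abs x <= 1 + abs x^2" using zero_le_power2[of "abs x - 1"] by (simp add: power2 alg_simps)
 hence "2 * abs x <= 1 + x^2" by simp
 moreover have "0 <= x ^ 4" by simp
 ultimately show "abs x <= 1 + x ^ 4" using a by linarith
qed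

lemma integrable_expo_ln: "integrable expo ln" "integrable expo (%q. (ln q)^2)"
proof -
 have i: "integrable expo (%q. 1 + (ln q) ^ 4)" using integrable_expo_ln4 by simp
 show "integrable expo ln" by (rule integrable_dom[OF i]) (use abs_le_1_power4(1) in "auto simp: ")
 show "integrable expo (%q. (ln q)^2)"
  by (rule integrable_dom[OF i]) (use abs_le_1_power4(2) in "auto simp: ")
qed

lemma expo_tail:
 assumes t: "0 <= t" shows "emeasure expo {t<..} = ennreal (exp (- t))"
proof -
 have "prob_space.prob expo {..t} = 1 - exp (- t)" using emeasure_erlang_density[of 1 0 t] t
  by (simp add: expo_def measure_def erlang_CDF_def)
 moreover have "{t<..} = space expo - {..t}" by auto
 ultimately have "expo.prob {t<..} = exp (- t)" using expo.prob_compl[of "{..t}"] by simp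
 thus ?thesis by (simp add: expo.emeasure_eq_measure)
qed

text \<open>The tilt \<open>exp (- q * (1/c - 1))\<close> changes the rate from 1 to
  \<open>1 / c\<close>, which is the law of \<open>c * q\<close> with total mass
  \<open>c\<close>.\<close>

lemma integral_expo_scale:
 fixes f :: "real => real"
 assumes c: "0 < c" and [measurable]: "f \<in> BM borel" shows "(EXPO q. f q * exp (- q * (1/c - 1))) = c * (EXPO q. f (c * q))"
  "integrable expo (%q. f q * exp (- q * (1/c - 1))) <-> integrable expo (%q. f (c * q))"
proof -
 let ?a = "%q. - q * (1/c - 1)"
 have e: "indicator {0..} q * exp (- q) * (f q * exp (?a q)) = indicator {0..} q * exp (- q / c) * f q" for q
 proof -
  have "exp (- q) * exp (?a q) = exp (- q / c)"
   unfolding exp_add[symmetric] by (rule arg_cong[where f=exp]) (simp add: field_simps)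
  thus ?thesis by simp
 qed
 have e': "indicator {0..} (0 + c * q) * exp (- (0 + c * q) / c) * f (0 + c * q) = indicator {0..} q * exp (- q) * f (c * q)" for q
  using c by (auto simp: indicator_def zero_le_mult_iff)
  show "(EXPO q. f q * exp (?a q)) = c * (EXPO q. f (c * q))"
  by (subst (1 2) integral_expo, simp, simp, subst e, subst lborel_integral_real_affine[where c=c and t=0], use c in simp, subst e')
    (use c in simp)
    show "integrable expo (%q. f q * exp (?a q)) <-> integrable expo (%q. f (c * q))"
  by (subst (1 2) integral_expo, simp, simp, subst e, subst lborel_integrable_real_affine_iff[where c=c and t=0, symmetric], use c in simp, subst e')
    (use c in simp)
qed

section \<open>The logarithmic correlation of two correlated Gaussian variables\<close>

lemma nn_integral_inverse_logistic:
 assumes p: "0 < p" "p < 1" and r: "0 < r" "r < 1" shows "(NINT q. ennreal (indicator {p<..<1} q * indicator {..<r} q / (q * (1 - q))))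
   = ennreal (max 0 (ln (r / (1 - r)) - ln (p / (1 - p))))"
proof (cases "p < r")
 case True
 let ?a = "%q. indicator {p<..<1} q * indicator {..<r} q / (q * (1 - q))"
 let ?b = "%q. ln q - ln (1 - q)"
 have "(NINT q. ennreal (?a q))
  = (NINT q. ennreal (1 / (q * (1 - q))) * indicator {p..r} q)"
 proof (rule nn_integral_cong_AE)
  have "AE q in lborel. q ~= p & q ~= r" using AE_lborel_singleton[of p] AE_lborel_singleton[of r] by auto
  thus "AE q in lborel. ennreal (?a q) = ennreal (1 / (q * (1 - q))) * indicator {p..r} q"
   by eventually_elim (use r True in "auto simp: indicator_def")
 qed
 also have "... = ennreal (?b r - ?b p)"
 proof (rule nn_integral_FTC_Icc)
  fix q assume q: "q \<in> {p..r}"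
  hence q': "0 < q" "q < 1" using p r by auto
  thus "DERIV ?b q :> 1 / (q * (1 - q))" by (auto intro!: derivative_eq_intros simp: field_simps)
  show "0 <= 1 / (q * (1 - q))" using q' by simp
 qed (use True in auto)
 also have "(ln r - ln (1 - r)) - (ln p - ln (1 - p)) = ln (r / (1 - r)) - ln (p / (1 - p))" by (simp add: ln_div)
 also have "... = max 0 (ln (r / (1 - r)) - ln (p / (1 - p)))" using p r True by (simp add: frac_le)
 finally show ?thesis by simp
next
 case False
 have "(NINT q. ennreal (indicator {p<..<1} q * indicator {..<r} q / (q * (1 - q)))) = integral\<^sup>N lborel (%q::real. 0)"
  using False by (intro nn_integral_cong) (auto simp: indicator_def)
 moreover have "ln (r / (1 - r)) <= ln (p / (1 - p))" using p False r by (simp add: frac_le)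
 ultimately show ?thesis by simp
qed

text \<open>\<open>ln (q / (1 - q))\<close> is a primitive of \<open>1 / (q * (1 - q))\<close>, and
  the integrand lives on those \<open>q > p\<close> with \<open>q / (1 - q) < b / a\<close>. For
  fixed \<open>q\<close> the variables \<open>a\<close> and \<open>b\<close> are tied only by one
  inequality, so each can be integrated exactly against the exponential law.\<close>

lemma ln_max_as_integral:
 assumes p: "0 < p" "p < 1" and q: "0 < a" "0 < b" shows "ennreal (ln (max (p * a) ((1 - p) * b)) - ln (p * a))
  = (NINT q. ennreal (indicator {p<..<1} q / (q * (1 - q))) * indicator {q. q * a < (1 - q) * b} q)"
proof -
 let ?a = "ln (b / a) - ln (p / (1 - p))"
 let ?b = "(1 - p) * b"
 define r where "r = b / (a + b)"
 have r: "0 < r" "r < 1" using q by (auto simp: r_def)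
 have "1 - r = a / (a + b)" using q by (simp add: r_def field_simps)
 hence rr: "r / (1 - r) = b / a" using q by (simp add: r_def)
 have e: "indicator {q. q * a < (1 - q) * b} q = (indicator {..<r} q :: ennreal)" for q
  using q by (auto simp: r_def indicator_def field_simps)
 have "(NINT q. ennreal (indicator {p<..<1} q / (q * (1 - q))) * indicator {q. q * a < (1 - q) * b} q)
   = (NINT q. ennreal (indicator {p<..<1} q * indicator {..<r} q / (q * (1 - q))))"
  unfolding e by (intro nn_integral_cong) (auto simp: indicator_def)
 also have "... = ennreal (max 0 ?a)" by (subst nn_integral_inverse_logistic[OF p r]) (simp add: rr)
 also have "max 0 ?a = ln (max (p * a) ?b) - ln (p * a)"
 proof (cases "p * a <= (1 - p) * b")
  case True
  hence "ln (p * a) <= ln ?b" using p q by auto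
  with True show ?thesis using p q by (simp add: ln_div ln_mult)
 next
  case False
  hence "ln ?b < ln (p * a)" using p q by auto
  with False show ?thesis using p q by (simp add: ln_div ln_mult)
 qed
 finally show ?thesis by simp
qed

definition log_weight :: "real => real => real" where
 "log_weight p q = indicator {p<..<1} q / (q * (1 - q))"

lemma log_weight_nonneg: "0 < p ==> 0 <= log_weight p q"
 by (auto simp: log_weight_def indicator_def)

lemma measurable_log_weight [measurable]: "log_weight p \<in> BM borel"
 unfolding log_weight_def by simp

text \<open>For each \<open>q\<close> only the tail of \<open>b\<close> beyond
  \<open>a * q / (1 - q)\<close> enters. Writing \<open>q / (1 - q)\<close> as
  \<open>1 / (1 - q) - 1\<close> exhibits the result as an exponential tilt in \<open>a\<close>, in
  the form of \<open>integral_expo_scale\<close>.\<close>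

lemma expo_ln_max:
 assumes p: "0 < p" "p < 1" and a: "0 < a" shows "integrable expo (%b. ln (max (p * a) ((1 - p) * b)))"
  and "(EXPO b. ln (max (p * a) ((1 - p) * b)))
   = ln (p * a) + (LBINT q. log_weight p q * exp (- a * (1 / (1 - q) - 1)))"
proof -
 let ?a = "%b. max (p * a) ((1 - p) * b)"
 let ?b = "%q. 1 / (1 - q) - 1"
 let ?c = "LBINT q. log_weight p q * exp (- a * ?b q)"
 let ?d = "BM (expo >< lborel)"
 let ?e = "%ennreal. NINT q. ennreal (log_weight p q * exp (- a * ?b q))"
 let ?f = "%q. log_weight p q"
 let ?g = "%ennreal. %(b, q). ennreal (?f q) * indicator {q. q * a < (1 - q) * b} q"
 let ?h = "%ennreal. %(b, q). indicator {q. q * a < (1 - q) * b} q :: ennreal"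
 interpret P: pair_sigma_finite expo "lborel :: real measure" ..
 define k where "k b = ln (?a b) - ln (p * a)" for b
 have pos: "AE b in expo. 0 < b" by (rule AE_expo) simp
 have k0: "0 <= k b" for b
 proof -
  have "0 < p * a" "p * a <= max (p * a) ((1 - p) * b)" using p a by auto
  hence "ln (p * a) <= ln (?a b)" by simp
  thus ?thesis by (simp add: k_def)
 qed
 have [measurable]: "k \<in> BM borel" unfolding k_def by simp
 have kint: "integrable expo k"
 proof (rule integrable_dom)
  show "integrable expo (%b. (1 - p) * b powr 1 / (p * a))"
   by (intro integrable_mult_right integrable_divide integrable_expo_powr) simp
  have kb: "k b <= (1 - p) * b / (p * a)" if b: "0 < b" for b
  proof (cases "p * a <= (1 - p) * b")
   case True
   have "k b = ln ((1 - p) * b / (p * a))" using True p a b by (simp add: k_def ln_div)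
   also have "... <= (1 - p) * b / (p * a)" using p a b by (intro order.trans[OF ln_le_minus_one]) auto
   finally show ?thesis .
  next
   case False thus ?thesis using p a b by (simp add: k_def)
  qed
  show "AE b in expo. norm (k b) <= norm ((1 - p) * b powr 1 / (p * a))"
   using pos by eventually_elim (use k0 kb p a in "simp add: ")
 qed simp
 show i: "integrable expo (%b. ln (?a b))"
  using integrable_plus[OF kint, of "%_. ln (p * a)"] by (simp add: k_def)
 have "(NEXPO b. ennreal (k b))
  = (NEXPO b. (NINT q. ennreal (?f q) * indicator {q. q * a < (1 - q) * b} q))" unfolding k_def log_weight_def
 proof (rule nn_integral_cong_AE)
  show "AE b in expo. ennreal (ln (?a b) - ln (p * a))
    = (NINT q. ennreal (indicator {p<..<1} q / (q * (1 - q))) * indicator {q. q * a < (1 - q) * b} q)"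
   using pos by eventually_elim (rule ln_max_as_integral[OF p a])
 qed
 also have "... = (NINT q. (NEXPO b. ennreal (?f q) * indicator {q. q * a < (1 - q) * b} q))"
 proof (rule P.Fubini'[symmetric])
  have "?h ennreal = indicator {x. snd x * a < (1 - snd x) * fst x}"
   by (auto simp: indicator_def)
  also have "... \<in> ?d" by simp
  finally have [measurable]: "?h ennreal \<in> ?d" .
  have "?g ennreal
    = (%x. ennreal (log_weight p (snd x)) * (case x of (b, q) => indicator {q. q * a < (1 - q) * b} q))" by auto
  thus "?g ennreal \<in> ?d" by simp
 qed
 also have "... = ?e ennreal"
 proof (rule nn_integral_cong)
  fix q :: real
  show "(NEXPO b. ennreal (log_weight p q) * indicator {q. q * a < (1 - q) * b} q)
   = ennreal (log_weight p q * exp (- a * (1 / (1 - q) - 1)))"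
  proof (cases "p < q & q < 1")
   case False thus ?thesis by (auto simp: log_weight_def)
  next
   case True
   have e: "indicator {q. q * a < (1 - q) * b} q = (indicator {a * ?b q<..} b :: ennreal)" for b
   using True by (auto simp: field_simps indicator_def)
   have t: "0 <= a * ?b q" using True a p by simp
   show ?thesis unfolding e
    using log_weight_nonneg[OF p(1), of q]
    by (subst nn_integral_cmult, simp, subst nn_integral_indicator, simp, subst expo_tail[OF t]) (simp add: ennreal_mult)
  qed
 qed
 finally have nn: "(NEXPO b. ennreal (k b)) = ?e ennreal" .
 have "(EXPO b. k b) = ?c"
  using log_weight_nonneg[OF p(1)] k0 by (subst (1 2) integral_eq_nn_integral) (auto simp: nn)
 moreover have "(EXPO b. k b) = (EXPO b. ln (?a b)) - ln (p * a)"
  unfolding k_def using i by (subst Bochner_Integration.integral_diff) (auto simp: expo.prob_space[simplified])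
 ultimately show "(EXPO b. ln (?a b))
   = ln (p * a) + ?c" by simp
qed

lemma integrable_ln_1_minus: "integrable lborel (%q::real. indicator {0<..<1} q * ln (1 - q))"
proof -
 let ?a = "%q. indicator {0..} q * exp (- q) * ln q"
 let ?b = "%q. indicator {0<..<1} q * ln q :: real"
 have "integrable lborel (%q::real. exp 1 * (?a q) :: real)"
  using integrable_expo_ln(1) by (subst (asm) integral_expo) auto
 hence "integrable lborel (%q::real. indicator {0<..<1} q * ln q)"
 proof (rule integrable_dom)
  show "AE q in lborel. norm (?b q) <= norm (exp 1 * (?a q) :: real)"
  proof (rule AE_I2)
   fix q :: real
   have "1 <= exp 1 * exp (- q)" if "q < 1" using that by (simp flip: exp_add)
   hence "abs (ln q) * 1 <= abs (ln q) * (exp 1 * exp (- q))" if "q < 1" by (intro mult_left_mono) (use that in auto)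
   thus "norm (?b q) <= norm (exp 1 * (?a q) :: real)"
    by (auto simp: indicator_def abs_mult)
  qed
 qed simp
 from lborel_integrable_real_affine[OF this, of "-1" 1]
 have "integrable lborel (%q::real. indicator {0<..<1} (1 - q) * ln (1 - q))" by simp
 moreover have "indicator {0<..<1} (1 - q) = (indicator {0<..<1} q :: real)" for q :: real by (auto simp: indicator_def)
 ultimately show ?thesis by simp
qed

lemma integrable_ln_1_minus_over:
 assumes p: "0 < p" shows "integrable lborel (%q::real. indicator {p<..<1} q * ln (1 - q) / q)"
  "integrable lborel (%q::real. indicator {p<..<1} q / q)"
proof -
 show "integrable lborel (%q::real. indicator {p<..<1} q * ln (1 - q) / q)"
 proof (rule integrable_dom)
  show "integrable lborel (%q. (indicator {0<..<1} q * ln (1 - q)) / p)" by (intro integrable_divide integrable_ln_1_minus)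
  show "AE q in lborel. norm (indicator {p<..<1} q * ln (1 - q) / q) <= norm (indicator {0<..<1} q * ln (1 - q) / p)"
   using p by (intro AE_I2) (auto simp: indicator_def abs_mult divide_simps)
 qed simp
 show "integrable lborel (%q::real. indicator {p<..<1} q / q)"
 proof (rule integrable_dom)
  show "integrable lborel (%q::real. indicator {0<..<1} q / p :: real)" by simp
  show "AE q in lborel. norm (indicator {p<..<1} q / q) <= norm (indicator {0<..<1} q / p)"
   using p by (intro AE_I2) (auto simp: indicator_def divide_simps)
 qed simp
qed

lemma integral_inverse_p_1:
 assumes p: "0 < p" "p < 1" shows "(LBINT q. (indicator {p<..<1} q / q :: real)) = - ln p"
proof -
 let ?a = "%q. indicator {p<..<1} q / q :: real"
 have "(LBINT q. ?a q) = (LBINT q. 1 / q * indicator {p..1} q)"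
 proof (rule integral_cong_AE)
  have "AE q in lborel. q ~= p & q ~= 1" using AE_lborel_singleton[of p] AE_lborel_singleton[of 1] by simp
  thus "AE q in lborel. ?a q = 1 / q * indicator {p..1} q" by eventually_elim (auto simp: indicator_def)
 qed auto
 also have "... = ln 1 - ln p" using p by (intro integral_FTC_Icc_nonneg) (auto intro!: derivative_eq_intros)
 finally show ?thesis by simp
qed

text \<open>Termwise integration of the power series of \<open>- ln (1 - q) / q\<close>. The value
  is the dilogarithm at \<open>p\<close> minus the dilogarithm at 1.\<close>

lemma integral_ln_1_minus_over:
 assumes p: "0 < p" "p < 1" shows "(LBINT q. indicator {p<..<1} q * ln (1 - q) / q) = - (\<Sum>n. (1 - p ^ Suc n) / (real (Suc n))^2)"
proof -
 let ?a = "\<Sum>n. (1 - p ^ Suc n) / (real (Suc n))^2"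
 let ?b = "%q. indicator {p<..<1} q * ln (1 - q) / q"
 let ?c = "%n. real (Suc n)"
 let ?d = "%n. %q. q ^ Suc n / ?c n^2"
 let ?e = "NINT q. ennreal (- ?b q)"
 let ?f = "%q. %n. (-1) ^ n * (1 / real (n + 1)) * (1 - q - 1) ^ Suc n"
 let ?g = "%n. (1 - p ^ Suc n) / ?c n^2"
 let ?h = "%n q. (-1) ^ n * (1 / real (n + 1)) * (1 - q - 1) ^ Suc n"
 have ser: "(%n. q ^ n / real (Suc n)) sums (- ln (1 - q) / q)" if q: "0 < q" "q < 1" for q :: real
 proof -
  have "(?f q) sums (ln (1 - q))"
  proof -
   have "summable (?f q)"
   proof (rule summable_comparison_test')
    show "summable (%n. q ^ n)" using q by simp
    have "q ^ Suc n / real (n + 1) <= q ^ n / 1" for n using q by (intro frac_le) auto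
    thus "norm (?h n q) <= q ^ n" for n using q by (simp add: abs_mult)
   qed
   thus ?thesis using ln_series[of "1 - q"] q by auto
  qed
  from sums_mult[OF this, of "- 1 / q"]
  moreover have "- 1 / q * ?h n q = q ^ n / real (Suc n)" for n
  proof -
   have "(-1) ^ n * (- q) ^ n = q ^ n" by (simp flip: power_mult_distrib)
   hence "(-1) ^ n * (- q) ^ Suc n = - (q * q ^ n)" by simp
   thus ?thesis using q by simp
  qed
  ultimately show ?thesis by simp
 qed
 define F where "F n q = indicator {p<..<1} q * (q ^ n / real (Suc n))" for n and q :: real
 have F0: "F n q \<ge> 0" for n q using p by (auto simp: F_def indicator_def)
 have Fi: "(NINT q. ennreal (F n q)) = ennreal (?g n)" for n
 proof -
  have "(NINT q. ennreal (F n q)) = (NINT q. ennreal (q ^ n / real (Suc n)) * indicator {p..1} q)"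
  proof (rule nn_integral_cong_AE)
   have "AE q in lborel. q ~= p & q ~= 1" using AE_lborel_singleton[of p] AE_lborel_singleton[of 1] by simp
   thus "AE q in lborel. ennreal (F n q) = ennreal (q ^ n / real (Suc n)) * indicator {p..1} q"
    by eventually_elim (auto simp: indicator_def F_def)
  qed
  also have "... = ennreal ((?d n) 1 - (?d n) p)"
  proof (rule nn_integral_FTC_Icc)
   fix q :: real
   have "DERIV (?d n) q :> (real (Suc n) * q ^ n) / ?c n^2"
    by (rule DERIV_cdivide) (use DERIV_pow[of "Suc n" q] in simp)
   also have "(real (Suc n) * q ^ n) / ?c n^2 = q ^ n / real (Suc n)" by (simp add: power2)
   finally show "DERIV (?d n) q :> q ^ n / real (Suc n)" .
  qed (use p in auto)
  finally show ?thesis by (simp add: diff_divide_distrib)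
 qed
 have s2: "summable (%n. (1 - p ^ Suc n) / ?c n^2)"
 proof (rule summable_comparison_test')
  show "summable (%n. 1 / ?c n^2)"
   using inverse_power_summable[of 2, where ?'a=real] summable_Suc_iff[of "%n. inverse (real n ^ 2)"] by (simp add: divide_inverse)
  show "norm (?g n) <= 1 / ?c n^2" for n
   using p by (simp add: divide_right_mono power_le_one del: power_Suc)
 qed
 have nn: "?e = ennreal ?a"
 proof -
  have "?e = (NINT q. (\<Sum>n. ennreal (F n q)))"
  proof (rule nn_integral_cong)
   fix q :: real
   show "ennreal (- (indicator {p<..<1} q * ln (1 - q) / q)) = (\<Sum>n. ennreal (F n q))"
   proof (cases "p < q & q < 1")
    case True
    hence "(%n. F n q) sums (- ln (1 - q) / q)" using ser[of q] p by (simp add: F_def)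
    thus ?thesis using True F0 by (simp add: suminf_ennreal2 sums_iff)
   qed (auto simp: F_def indicator_def)
  qed
  also have "... = (\<Sum>n. ennreal (?g n))"
   by (subst nn_integral_suminf) (simp_all only: Fi, simp add: F_def)
  also have "... = ennreal ?a"
   using p by (intro suminf_ennreal2 s2) (simp add: power_le_one del: power_Suc)
  finally show ?thesis .
 qed
 have "(LBINT q. - ?b q) = ?a"
 proof (subst integral_eq_nn_integral)
  show "AE q in lborel. 0 <= - ?b q"
   using p by (intro AE_I2) (auto simp: indicator_def divide_nonpos_pos)
  show "enn2real ?e = ?a"
   unfolding nn using p by (intro enn2real_ennreal suminf_nonneg s2) (simp add: power_le_one del: power_Suc)
 qed simp
 thus ?thesis by simp
qed

text \<open>With \<open>expo_ln_max\<close>, integrating over \<open>a\<close> first turns the tilt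
  into the scaling of \<open>a\<close> by \<open>1 - q\<close>, and what remains is an elementary
  integral in \<open>q\<close>. The mean \<open>C\<close> of the logarithm enters twice, with
  factors \<open>ln p\<close> and \<open>- ln p\<close>, and cancels.\<close>

lemma expo_ln_correlation:
 assumes p: "0 < p" "p < 1" shows "(EXPO a. ln a * (EXPO b. ln (max (p * a) ((1 - p) * b))))
   = (EXPO q. (ln q)^2) - (\<Sum>n. (1 - p ^ Suc n) / (real (Suc n))^2)"
proof -
 let ?a = "%q. indicator {p<..<1} q / q"
 let ?b = "%a. EXPO b. ln (max (p * a) ((1 - p) * b))"
 let ?d = "%a q. - a * (1 / (1 - q) - 1)"
 let ?f = "%a. ln p * ln a + (ln a)^2"
 let ?h = "%q a. (1 - q) * a"
 let ?i = "lborel >< expo"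
 let ?l = "%q. log_weight p q * (1 - q) = 1 / q"
 let ?m = "%q. indicator {p<..<1} q * ln (1 - q) / q"
 interpret P: pair_sigma_finite "lborel :: real measure" expo ..
 define C where "C = (EXPO q. ln q)"
 define f where "f q a = log_weight p q * (ln a * exp (?d a q))" for q a
 let ?e = "%a. LBINT q. f q a"
 let ?j = "EXPO a. ?e a"
 let ?n = "%q a. f (fst (q, a)) (snd (q, a))"
 let ?o = "%x. f (fst x) (snd x)"
 have sc: "integrable expo (%a. k a * exp (?d a q))"
   "(EXPO a. k a * exp (?d a q)) = (1 - q) * (EXPO a. k (?h q a))"
  if "q < 1" "k \<in> BM borel" "integrable expo (%a. k (?h q a))" for q and k :: "real => real"
  using integral_expo_scale[of "1 - q" k] that by auto
 have lnc: "AE a in expo. ln (?h q a) = ln (1 - q) + ln a" if "q < 1" for q :: real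
  using that by (intro AE_expo AE_I2) (simp add: ln_mult)
 have lni: "integrable expo (%a. ln (?h q a))" if q: "q < 1" for q :: real
 proof (rule integrable_cong_AE_imp)
  show "integrable expo (%a. ln (1 - q) + ln a)" using integrable_expo_ln(1) by simp
  show "AE a in expo. ln (1 - q) + ln a = ln (?h q a)" using lnc[OF q] by auto
 qed simp
 have lnv: "(EXPO a. ln (?h q a)) = ln (1 - q) + C" if q: "q < 1" for q :: real
 proof -
  have "(EXPO a. ln (?h q a)) = (EXPO a. ln (1 - q) + ln a)" by (rule integral_cong_AE) (use lnc[OF q] in auto)
  thus ?thesis using integrable_expo_ln(1) by (simp add: C_def expo.prob_space[simplified])
 qed
 have out: "f q a = 0" if "\<not> (p < q & q < 1)" for q a using that by (auto simp: f_def log_weight_def)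
 have fi: "integrable expo (f q)" for q
 proof (cases "p < q & q < 1")
  case True
  thus ?thesis unfolding f_def by (intro integrable_mult_right sc lni) auto
 next
  case False
  hence "f q = (%_. 0)" using out by auto
  thus ?thesis by simp
 qed
 have fv: "(EXPO a. f q a) = C * ?a q + indicator {p<..<1} q * ln (1 - q) / q" for q
 proof (cases "p < q & q < 1")
  case True
  hence q: "q < 1" "q > 0" using p by auto
  have "(EXPO a. f q a) = log_weight p q * ((1 - q) * (ln (1 - q) + C))"
   unfolding f_def using sc(2)[OF q(1) _ lni[OF q(1)]] lnv[OF q(1)] by simp
  also have "... = (log_weight p q * (1 - q)) * (ln (1 - q) + C)" by simp
  also have "?l q" using True by (simp add: log_weight_def)
  finally show ?thesis using True by (simp add: add_divide_distrib)
 next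
  case False
  hence "f q = (%_. 0)" using out by auto
  thus ?thesis using False by auto
 qed
 define E where "E = (EXPO q. abs (ln q))"
 have fm[measurable]: "?o \<in> BM ?i" unfolding f_def by simp
 have pint: "integrable ?i ?o"
 proof (rule P.Fubini_integrable[OF fm])
  show "AE q in lborel. integrable expo (%a. f (fst (q, a)) (snd (q, a)))" using fi by simp
  show "integrable lborel (%q. EXPO a. norm (?n q a))"
  proof (rule integrable_dom)
   show "integrable lborel (%q. abs (?m q) + E * ?a q)"
    by (intro integrable_plus integrable_abs integrable_mult_right integrable_ln_1_minus_over p)
   show "AE q in lborel. norm (EXPO a. norm (?n q a))
     <= norm (abs (?m q) + E * ?a q)"
   proof (rule AE_I2)
    fix q :: real
    show "norm (EXPO a. norm (?n q a))
     <= norm (abs (?m q) + E * (indicator {p<..<1} q / q))"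
    proof (cases "p < q & q < 1")
     case False
     hence "f q = (%_. 0)" using out by auto
     thus ?thesis by simp
    next
     case True
     hence q: "q < 1" "q > 0" using p by auto
     let ?c = "EXPO a. norm (f (fst (q, a)) (snd (q, a)))"
     let ?g = "EXPO a. abs (ln (1 - q)) + abs (ln a)"
     let ?k = "EXPO a. abs (ln (?h q a))"
     have w: "?l q" using True by (simp add: log_weight_def)
     have w0: "log_weight p q \<ge> 0" using p(1) by (rule log_weight_nonneg)
     have "?c
       = log_weight p q * (EXPO a. abs (ln a) * exp (?d a q))" unfolding f_def using w0 by (simp add: abs_mult)
     also have "... = log_weight p q * ((1 - q) * ?k)"
      using sc(2)[OF q(1), of "%a. abs (ln a)"] lni[OF q(1)] by simp
     also have "... = 1 / q * ?k" by (simp only: w[symmetric])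
     also have "... <= 1 / q * ?g"
     proof (intro mult_left_mono integral_mono_AE)
      show "AE a in expo. abs (ln (?h q a)) <= abs (ln (1 - q)) + abs (ln a)"
       using lnc[OF q(1)] by auto
     qed (use q lni[OF q(1)] integrable_expo_ln(1) in auto)
     also have "?g = abs (ln (1 - q)) + E"
      using integrable_expo_ln(1) by (simp add: E_def expo.prob_space[simplified])
     also have "1 / q * (abs (ln (1 - q)) + E) = abs (?m q) + E * ?a q"
      using True q by (simp add: field_simps)
     finally have "?c <= abs (?m q) + E * ?a q" .
     moreover have "0 <= ?c" by simp
     ultimately show ?thesis by simp
    qed
   qed
  qed measurable
 qed
 have pint': "integrable ?i (%(q, a). f q a)" using pint by (simp add: split_beta')
 have swap: "?j = (LBINT q. (EXPO a. f q a))" using P.Fubini_integral[OF pint'] .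
 have int2: "integrable expo (%a. LBINT q. f q a)" by (rule P.integrable_snd[OF pint'])
 have "integrable expo (%a. ln p * ln a + (ln a)^2)" using integrable_expo_ln by simp
 have "(EXPO a. ln a * ?b a)
   = (EXPO a. ?f a + ?e a)"
 proof (rule integral_cong_AE)
  have "ln a * ?b a = ?f a + ?e a" if a: "0 < a" for a
  proof -
   have "?e a = (LBINT q. ln a * (log_weight p q * exp (?d a q)))" by (simp add: f_def mult_ac)
   also have "... = ln a * (LBINT q. log_weight p q * exp (?d a q))" by simp
   finally show ?thesis using expo_ln_max(2)[OF p a] p by (simp add: ln_mult power2 alg_simps)
  qed
  thus "AE a in expo. ln a * ?b a = ?f a + ?e a"
   by (intro AE_expo AE_I2) auto
   show "(%a. ln a * ?b a) \<in> BM expo" by simp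
  show "(%a. ?f a + ?e a) \<in> BM expo" using int2 by auto
 qed
 also have "... = (ln p * C + (EXPO q. (ln q)^2)) + ?j" using int2 integrable_expo_ln by (simp add: C_def)
 also have "?j = C * (- ln p) - (\<Sum>n. (1 - p ^ Suc n) / (real (Suc n))^2)"
 proof -
  have i: "integrable lborel (%q. C * ?a q)" by (intro integrable_mult_right integrable_ln_1_minus_over p)
  have v: "(LBINT q. C * ?a q) = C * (- ln p)"
   by (subst integral_mult_right_zero) (simp only: integral_inverse_p_1[OF p])
   show ?thesis
   unfolding swap fv integral_plus[OF i integrable_ln_1_minus_over(1)[OF p(1)]] v integral_ln_1_minus_over[OF p] by simp
 qed
 finally show ?thesis by simp
qed

lemma distr_cgauss_mult_unit:
 assumes u: "cmod u = 1" shows "distr cgauss borel (%z. u * z) = cgauss"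
proof (rule measure_eqI)
 fix A assume "A \<in> sets (distr cgauss borel (%z. u * z))"
 hence [measurable]: "A \<in> sets borel" by simp
 show "emeasure (distr cgauss borel (%z. u * z)) A = emeasure cgauss A"
  using nn_integral_cgauss_mult_unit[OF u, of "indicator A"]
  by (subst (1 2) nn_integral_indicator[symmetric]) (simp_all add: nn_integral_distr del: nn_integral_indicator)
qed simp

lemma distr_cgauss_combine:
 fixes si ta :: complex shows "distr (cgauss >< cgauss) borel (%p. si * fst p + ta * snd p)
  = distr cgauss borel (%x. of_real (sqrt ((cmod si)^2 + (cmod ta)^2)) * x)"
proof (rule measure_eqI)
 fix A assume "A \<in> sets (distr (cgauss >< cgauss) borel (%p. si * fst p + ta * snd p))"
 hence [measurable]: "A \<in> sets borel" by simp
 let ?a = "emeasure (distr cgauss borel (%x. of_real (sqrt ((cmod si)^2 + (cmod ta)^2)) * x)) A"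
 let ?b = "emeasure (distr (cgauss >< cgauss) borel (%p. si * fst p + ta * snd p)) A "
 have "?b = (\<integral>\<^sup>+p. indicator A (si * fst p + ta * snd p) \<partial>(cgauss >< cgauss))"
  by (subst nn_integral_indicator[symmetric], simp, subst nn_integral_distr) auto
 also have "... = (NGAUSS x y. indicator A (si * x + ta * y))" by (subst cgauss.nn_integral_fst[symmetric]) auto
 also have "... = (NGAUSS x. indicator A (of_real (sqrt ((cmod si)^2 + (cmod ta)^2)) * x))" by (rule nn_integral_cgauss_combine) simp
 also have "... = ?a"
  by (subst nn_integral_indicator[symmetric], simp, subst nn_integral_distr) auto
 finally show "?b = ?a" .
qed simp

lemma integrable_cgauss_ln:
 "integrable cgauss (%x. lnc x)" "integrable cgauss (%x. (lnc x)^2)" "integrable cgauss (%x. (lnc x) ^ 4)"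
proof -
 have e: "lnc x = ln ((cmod x)^2) / 2" for x by (cases "x = 0") (auto simp: ln_realpow)
 show "integrable cgauss (%x. lnc x)" unfolding e
  by (rule iffD2[OF integral_cgauss_norm(2)[of "%q. ln q / 2"]]) (use integrable_expo_ln(1) in auto)
 show "integrable cgauss (%x. (lnc x)^2)" unfolding e
  by (rule iffD2[OF integral_cgauss_norm(2)[of "%q. (ln q / 2)^2"]]) (use integrable_expo_ln(2) in "auto simp: power_divide")
 show "integrable cgauss (%x. (lnc x) ^ 4)" unfolding e
  by (rule iffD2[OF integral_cgauss_norm(2)[of "%q. (ln q / 2) ^ 4"]]) (use integrable_expo_ln4 in "auto simp: power_divide")
qed

text \<open>Averaging over the phase of the independent second variable replaces the second
  logarithm by that of the larger of two moduli. Only the exponential variables \<open>|x|^2\<close>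
  and \<open>|y|^2\<close> are left; each logarithm of a modulus is half the logarithm of its
  square, whence the 4.\<close>

theorem ln_gaussian_correlation:
 assumes p: "0 < p" "p <= 1" and be: "(cmod be)^2 = p"
 shows "integrable (cgauss >< cgauss) (%z. lnc (fst z) * lnc (be * fst z + of_real (sqrt (1 - p)) * snd z))"
  and "(\<integral>z. lnc (fst z) * lnc (be * fst z + of_real (sqrt (1 - p)) * snd z) \<partial>(cgauss >< cgauss))
   = ((EXPO q. (ln q)^2) - (\<Sum>n. (1 - p ^ Suc n) / (real (Suc n))^2)) / 4"
proof -
 let ?a = "cgauss >< cgauss"
 let ?b = "%a. EXPO b. ln (max (p * a) ((1 - p) * b))"
 let ?d = "%x. EXPO b. ln (max (p * (cmod x)^2) ((1 - p) * b))"
 let ?h = "\<Sum>n. (1 - p ^ Suc n) / (real (Suc n))^2"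
 let ?i = "EXPO a. ln a * ?b a"
 let ?k = "%z. be * fst z + of_real (sqrt (1 - p)) * snd z"
 define si where "si = sqrt (1 - p)"
 let ?l = "%z. lnc (be * fst z + of_real si * snd z)"
 have si: "si \<ge> 0" "si^2 = 1 - p" using p by (auto simp: si_def)
 define h where "h x y = lnc x * lnc (be * x + of_real si * y)" for x y
 let ?m = "%z. h (fst z) (snd z)"
 have one: "distr cgauss borel (%x. of_real 1 * x) = cgauss" using distr_cgauss_mult_unit[of 1] by simp
 have comb: "distr ?a borel (%z. s * fst z + t * snd z) = cgauss"
  if "(cmod s)^2 + (cmod t)^2 = 1" for s t using distr_cgauss_combine[of s t] one that by simp
 have i: "integrable ?a (%z. (lnc (s * fst z + t * snd z))^2)"
  if "(cmod s)^2 + (cmod t)^2 = 1" for s t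
 proof -
  have "integrable (distr ?a borel (%z. s * fst z + t * snd z)) (%x. (lnc x)^2)"
   unfolding comb[OF that] by (rule integrable_cgauss_ln)
  thus ?thesis by (subst (asm) integrable_distr_eq) auto
 qed
 have hm[measurable]: "?m \<in> BM ?a" unfolding h_def by simp
 have hint: "integrable ?a ?m"
 proof (rule integrable_dom[OF _ hm])
  show "integrable ?a (%z. (lnc (1 * fst z + 0 * snd z))^2 + ?l z^2)"
   by (intro integrable_plus i) (use be si in auto)
  have "abs (s * t) <= s^2 + t^2" for s t :: real
   using zero_le_power2[of "s - t"] zero_le_power2[of "s + t"] by (auto simp: power2 alg_simps abs_if)
  thus "AE z in cgauss >< cgauss. norm (h (fst z) (snd z))
   <= norm ((lnc (1 * fst z + 0 * snd z))^2 + ?l z^2)" by (intro AE_I2) (simp add: h_def)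
 qed
 thus "integrable ?a (%z. lnc (fst z) * lnc (?k z))" by (simp add: h_def si_def)
 have nz: "AE x in cgauss. x ~= 0"
 proof -
  have "AE q in expo. q ~= 0" by (intro AE_expo AE_I2) simp
  hence "AE x in cgauss. (cmod x)^2 ~= 0" by (rule AE_cgauss_norm)
  thus ?thesis by simp
 qed
 have ln2: "ln r = ln (r^2) / 2" if "r \<ge> 0" for r :: real by (cases "r = 0") (auto simp: ln_realpow)
 have hint': "integrable ?a (%(x, y). h x y)" using hint by (simp add: split_beta')
 have "(\<integral>z. h (fst z) (snd z) \<partial>?a) = (GAUSS x y. h x y)" using cgauss_pair.integral_fst'[OF hint] by simp
 also have "... = (GAUSS x. ln ((cmod x)^2) / 4 * ?d x)"
 proof (rule integral_cong_AE)
  show "AE x in cgauss. (GAUSS y. h x y) = ln ((cmod x)^2) / 4 * ?d x"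
   using nz cgauss_pair.AE_integrable_fst[OF hint']
  proof eventually_elim
   case (elim x)
   let ?e = "%y. max (p * (cmod x)^2) ((1 - p) * (cmod y)^2)"
   let ?f = "%y. MEAN th. h x (circ th * y)"
   let ?j = "(cmod x)^2"
   have av: "?f y = ln ?j / 4 * ln (?e y)"
    if ne: "p * (cmod x)^2 ~= (1 - p) * (cmod y)^2" for y
   proof -
    let ?c = "max (cmod (be * x)) (cmod (of_real si * y))"
    let ?g = "of_real si * y"
    have e1: "(cmod (be * x))^2 = p * (cmod x)^2" "(cmod ?g)^2 = (1 - p) * (cmod y)^2"
     using be si by (auto simp: norm_mult power_mult_distrib)
    hence ne': "cmod (be * x) ~= cmod ?g" using ne by auto
    have "?f y = lnc x * (MEAN th. lnc (be * x + circ th * ?g))"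
     unfolding h_def by (simp add: mult_ac)
    also have "... = lnc x * ln ?c" by (simp add: mean_ln_circ(2)[OF ne'])
    also have "ln ?c = ln (?c^2) / 2"
     by (rule ln2) (simp add: le_max_iff_disj)
    also have "?c^2 = max ((cmod (be * x))^2) ((cmod ?g)^2)"
     by (cases "cmod (be * x) <= cmod ?g") auto
    also have "lnc x = ln ?j / 2" by (rule ln2) simp
    finally show ?thesis unfolding e1 by simp
   qed
   have "(GAUSS y. h x y) = (GAUSS y. ?f y)"
    by (rule integral_rotation_average[OF elim(2)]) (auto intro: cgauss.sigma_finite_measure_axioms distr_cgauss_mult_unit)
   also have "... = (GAUSS y. ln ?j / 4 * ln (?e y))"
   proof (rule integral_cong_AE)
    \<comment> \<open>The circle mean was computed for unequal moduli. Equality is a null event; for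
      \<open>p = 1\<close> it amounts to \<open>x = 0\<close>.\<close>
    have "AE q in expo. p * (cmod x)^2 ~= (1 - p) * q"
    proof (cases "p = 1")
     case True thus ?thesis using elim(1) by simp
    next
     case False
     have "AE q in lborel. q ~= p * (cmod x)^2 / (1 - p)" by (rule AE_lborel_singleton)
     thus ?thesis by (intro AE_expo, eventually_elim) (use False in "auto simp: ")
    qed
    hence "AE y in cgauss. p * (cmod x)^2 ~= (1 - p) * (cmod y)^2" by (rule AE_cgauss_norm)
    thus "AE y in cgauss. ?f y = ln ?j / 4 * ln (?e y)"
     by eventually_elim (rule av)
     show "(%y. MEAN th. h x (circ th * y)) \<in> BM cgauss" unfolding h_def by simp
   qed measurable
   also have "... = ln ?j / 4 * ?d x"
    by (subst integral_mult_right_zero, subst integral_cgauss_norm(1)[of "%b. ln (max (p * (cmod x)^2) ((1 - p) * b))"]) auto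
   finally show ?case .
  qed
  show "(%x. GAUSS y. h x y) \<in> BM cgauss" by auto
 qed measurable
 also have "... = (EXPO a. ln a / 4 * ?b a)"
  by (rule integral_cgauss_norm(1)[of "%a. ln a / 4 * ?b a"]) measurable
 also have "... = ?i / 4" by simp
 also have "?i
   = (EXPO q. (ln q)^2) - ?h"
 proof (cases "p = 1")
  case False thus ?thesis using p by (intro expo_ln_correlation) auto
 next
  case True
  have "?i = (EXPO a. (ln a)^2)"
   by (rule integral_cong_AE, measurable, intro AE_expo AE_I2)
     (use True in "simp add: expo.prob_space[simplified] power2")
  thus ?thesis using True by simp
 qed
 finally show "(\<integral>z. lnc (fst z) * lnc (?k z) \<partial>?a)
   = ((EXPO q. (ln q)^2) - ?h) / 4" by (simp add: h_def si_def)
qed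

section \<open>Jensen's formula for two circles\<close>

text \<open>The difference of the Jensen kernels \<open>ln (max |z| R2)\<close> and
  \<open>ln (max |z| R1)\<close>: constant up to \<open>R1\<close>, zero from \<open>R2\<close>
  on.\<close>

definition tent :: "real => real => complex => real" where
 "tent R1 R2 z = ln R2 - ln (min R2 (max R1 (cmod z)))"

lemma tent_nonneg: "0 < R1 ==> R1 < R2 ==> 0 <= tent R1 R2 z"
 unfolding tent_def by simp

lemma tent_le: "0 < R1 ==> R1 < R2 ==> tent R1 R2 z <= ln R2 - ln R1"
 unfolding tent_def by simp

lemma tent_eq_0: "R1 < R2 ==> R2 <= cmod z ==> tent R1 R2 z = 0"
 unfolding tent_def by simp

lemma continuous_tent [continuous_intros]:
 assumes "0 < R1" "R1 < R2" shows "continuous_on A (tent R1 R2)"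
proof -
 have "min R2 (max R1 (cmod z)) ~= 0" for z using assms by simp
 thus ?thesis unfolding tent_def by (intro continuous_intros) auto
qed

lemma measurable_tent [measurable]: "tent R1 R2 \<in> BM borel"
 unfolding tent_def by simp

text \<open>Divide out one zero at a time. At another zero the derivative of the quotient can vanish
  only together with that of \<open>f\<close>, so simplicity survives the division.\<close>

lemma factor_simple_zeros:
 assumes "finite S" "open B" "f holomorphic_on B" "{z \<in> B. f z = 0} = S" and "!!z. z \<in> S ==> deriv f z ~= 0"
 shows "\<exists>G. G holomorphic_on B & (\<forall>z\<in>B. G z ~= 0) & (\<forall>z\<in>B. f z = (\<Prod>x\<in>S. z - x) * G z)" using assms
proof (induction S arbitrary: f rule: finite_induct)
 case empty
 thus ?case by auto
next
 case (insert a S f)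
 define k where "k z = (if z = a then deriv f a else (f z - f a) / (z - a))" for z
 have fa: "f a = 0" "a \<in> B" using insert.prems by auto
 have kh: "k holomorphic_on B" unfolding k_def by (rule pole_lemma_open) (use insert.prems in auto)
 have fk: "f z = (z - a) * k z" for z using fa by (auto simp: k_def)
 have ka: "k a ~= 0" using insert.prems by (simp add: k_def)
 have ks: "{z \<in> B. k z = 0} = S"
 proof (intro set_eqI iffI)
  fix z assume "z \<in> {z \<in> B. k z = 0}"
  hence "f z = 0" "z \<in> B" "z ~= a" using fk[of z] ka by auto
  thus "z \<in> S" using insert.prems by auto
 next
  fix z assume z: "z \<in> S"
  hence "f z = 0" "z \<in> B" "z ~= a" using insert by auto
  thus "z \<in> {z \<in> B. k z = 0}" using fk[of z] by simp
 qed
 have kd: "deriv k z ~= 0" if z: "z \<in> S" for z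
 proof
  assume d: "deriv k z = 0"
  have zB: "z \<in> B" "k z = 0" using ks z by auto
  have "(k has_field_derivative deriv k z) (at z)" using kh zB(1) \<open>open B\<close> holomorphic_derivI by auto
  hence "((%z. (z - a) * k z) has_field_derivative (1 * k z + (z - a) * deriv k z)) (at z)" by (auto intro!: derivative_eq_intros)
  hence "(f has_field_derivative 0) (at z)" using d zB by (simp add: fk[abs_def])
  thus False using insert.prems(4)[of z] z by (simp add: DERIV_imp_deriv)
 qed
 obtain G where G: "G holomorphic_on B" "\<forall>z\<in>B. G z ~= 0" "\<forall>z\<in>B. k z = (\<Prod>x\<in>S. z - x) * G z"
  using insert.IH[OF \<open>open B\<close> kh ks kd] by auto
 have "\<forall>z\<in>B. f z = (\<Prod>x\<in>insert a S. z - x) * G z" using G(3) fk insert(1,2) by simp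
 with G show ?case by auto
qed

text \<open>On a disc a nonvanishing \<open>G\<close> is an exponential, so \<open>ln |G|\<close>
  has the mean value property. Each linear factor contributes \<open>ln max\<close> by the circle
  mean of one logarithm.\<close>

lemma mean_ln_circle:
 assumes S: "finite S" and G: "G holomorphic_on ball t R" "!!z. z \<in> ball t R ==> G z ~= 0"
  and f: "!!z. z \<in> ball t R ==> f z = (\<Prod>x\<in>S. z - x) * G z"
  and r: "0 < r" "r < R" and sph: "!!x. x \<in> S ==> cmod (x - t) ~= r" shows "integrable U01 (%th. lnc (f (t + of_real r * circ th)))"
  and "(MEAN th. lnc (f (t + of_real r * circ th))) = lnc (G t) + (\<Sum>x\<in>S. ln (max (cmod (x - t)) r))"
proof -
 let ?a = "%th. t + of_real r * circ th"
 let ?b = "%th. \<Sum>x\<in>S. lnc ((t - x) + circ th * of_real r)"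
 let ?c = "\<Sum>x\<in>S. ln (max (cmod (x - t)) r)"
 obtain H where H: "H holomorphic_on ball t R" "!!z. z \<in> ball t R ==> G z = exp (H z)"
  using contractible_imp_holomorphic_log[OF G(1) _ G(2)] convex_imp_contractible[OF convex_ball] by auto
 let ?d = "MEAN th. Re (H (?a th))"
 have inb: "t + of_real r * circ th \<in> ball t R" for th using r by (simp add: dist_norm norm_mult)
 have tb: "t \<in> ball t R" using r by simp
 have AB: "cmod (t - x) ~= cmod (of_real r :: complex)" if "x \<in> S" for x using sph[OF that] r(1) by (simp add: norm_minus_commute)
 have nz: "t + of_real r * circ th - x ~= 0" if "x \<in> S" for x th
 proof
  assume "t + of_real r * circ th - x = 0"
  hence "x - t = of_real r * circ th" by auto
  hence "cmod (x - t) = r" using r by (simp add: norm_mult)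
  thus False using sph[OF that] by simp
 qed
 have e: "lnc (f (?a th))
   = Re (H (?a th)) + ?b th" for th
 proof -
  have "lnc (f (?a th)) = ln ((\<Prod>x\<in>S. cmod (t + of_real r * circ th - x)) * exp (Re (H (?a th))))"
   by (simp add: f[OF inb] H(2)[OF inb] norm_mult prod_norm)
  also have "... = (\<Sum>x\<in>S. lnc (t + of_real r * circ th - x)) + Re (H (?a th))"
   using nz S by (subst ln_mult) (auto simp: ln_prod)
  finally show ?thesis by (simp add: alg_simps)
 qed
 have "continuous_on UNIV (%th. H (?a th))" by (rule continuous_on_compose2[OF holomorphic_on_imp_continuous_on[OF H(1)]])
    (use inb in "auto intro!: continuous_intros")
 hence Hi: "integrable U01 (%th. H (?a th))" by (rule integrable_U01_continuous)
 have Si: "integrable U01 (%th. \<Sum>x\<in>S. lnc ((t - x) + circ th * of_real r))"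
  by (intro Bochner_Integration.integrable_sum mean_ln_circ AB)
  show "integrable U01 (%th. lnc (f (?a th)))"
  unfolding e using Hi Si by auto
 have "?d = Re (MEAN th. H (?a th))" using Hi by simp
 also have "... = lnc (G t)" using mean_value_circ[OF H(1) r] H(2)[OF tb] by simp
 finally have 1: "?d = lnc (G t)" .
 have "(MEAN th. ?b th) = (\<Sum>x\<in>S. ln (max (cmod (t - x)) (cmod (of_real r :: complex))))"
  by (subst integral_of_sum) (use mean_ln_circ AB in auto)
 hence 2: "(MEAN th. ?b th) = ?c"
  using r(1) by (simp add: norm_minus_commute)
 show "(MEAN th. lnc (f (?a th))) = lnc (G t) + ?c"
  unfolding e using Hi Si by (simp add: 1 2)
qed

lemma finite_zeros_cball:
 assumes "f holomorphic_on UNIV" "f z0 ~= 0" shows "finite {z \<in> cball t R. f z = 0}"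
using assms(2) holomorphic_compact_finite_zeros[OF assms(1) open_UNIV connected_UNIV compact_cball] by (fastforce simp: constant_on_def)

text \<open>The contribution \<open>ln |G t|\<close> of the zero-free factor cancels between the two
  circles, so the centre may itself be a zero.\<close>

theorem jensen_two_circles:
 assumes f: "f holomorphic_on UNIV" "f z0 ~= 0" and simple: "!!z. f z = 0 ==> deriv f z ~= 0" and r: "0 < R1" "R1 < R2"
  and sph: "!!x. f x = 0 ==> cmod (x - t) ~= R1 & cmod (x - t) ~= R2" shows "integrable U01 (%th. lnc (f (t + of_real R1 * circ th)))"
  and "integrable U01 (%th. lnc (f (t + of_real R2 * circ th)))"
  and "(MEAN th. lnc (f (t + of_real R2 * circ th))) - (MEAN th. lnc (f (t + of_real R1 * circ th)))
   = (\<Sum>x | f x = 0 & cmod (x - t) <= R2. tent R1 R2 (x - t))"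
proof -
 let ?a = "(MEAN th. lnc (f (t + of_real R2 * circ th))) - (MEAN th. lnc (f (t + of_real R1 * circ th))) "
 let ?b = "\<Sum>x | f x = 0 & cmod (x - t) <= R2. tent R1 R2 (x - t)"
 define B where "B = ball t (R2 + 1)"
 define S where "S = {z \<in> B. f z = 0}"
 have fin: "finite S" by (rule finite_subset[OF _ finite_zeros_cball[OF f, of t "R2 + 1"]]) (auto simp: S_def B_def)
 have "f holomorphic_on B" using f(1) by auto
 then obtain G where G: "G holomorphic_on B" "\<forall>z\<in>B. G z ~= 0" "\<forall>z\<in>B. f z = (\<Prod>x\<in>S. z - x) * G z"
  using factor_simple_zeros[of S B f] fin simple unfolding B_def S_def by auto
 note m = mean_ln_circle[of S G t "R2 + 1" f, OF fin G(1)[unfolded B_def]]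
 have G2: "!!z. z \<in> ball t (R2 + 1) ==> G z ~= 0" "!!z. z \<in> ball t (R2 + 1) ==> f z = (\<Prod>x\<in>S. z - x) * G z"
  using G(2,3) by (auto simp: B_def)
 have s1: "!!x. x \<in> S ==> cmod (x - t) ~= R1" and s2: "!!x. x \<in> S ==> cmod (x - t) ~= R2" using sph by (auto simp: S_def)
 show "integrable U01 (%th. lnc (f (t + of_real R1 * circ th)))" by (rule m(1)[OF G2]) (use r s1 in auto)
 show "integrable U01 (%th. lnc (f (t + of_real R2 * circ th)))" by (rule m(1)[OF G2]) (use r s2 in auto)
 have 1: "(MEAN th. lnc (f (t + of_real R1 * circ th))) = lnc (G t) + (\<Sum>x\<in>S. ln (max (cmod (x - t)) R1))"
  by (rule m(2)[OF G2]) (use r s1 in auto)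
 have 2: "(MEAN th. lnc (f (t + of_real R2 * circ th))) = lnc (G t) + (\<Sum>x\<in>S. ln (max (cmod (x - t)) R2))"
  by (rule m(2)[OF G2]) (use r s2 in auto)
 have "?a = (\<Sum>x\<in>S. ln (max (cmod (x - t)) R2) - ln (max (cmod (x - t)) R1))" by (simp add: 1 2 sum_subtractf)
 also have "... = (\<Sum>x\<in>S. tent R1 R2 (x - t))" using r by (intro sum.cong) (auto simp: tent_def min_def)
 also have "... = ?b" by (rule sum.mono_neutral_right)
    (use fin r in "auto simp: S_def B_def dist_norm norm_minus_commute intro!: tent_eq_0")
 finally show "?a = ?b" .
qed

section \<open>The Gaussian entire function\<close>

definition gwt :: "nat => real" where "gwt n = sqrt (pi ^ n) / sqrt (fact n)"

lemma gwt_pos: "0 < gwt n" by (simp add: gwt_def)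

lemma gwt_power2: "(gwt n)^2 = pi ^ n / fact n" by (simp add: gwt_def power_divide)

lemma gaf_gwt: "gaf b z = (\<Sum>n. b n * of_real (gwt n) * z ^ n)"
 by (simp add: gaf_def gwt_def)

text \<open>The weights are square roots of exponential-series terms. Splitting off a geometric
  factor and using \<open>sqrt (s * t) <= s + t\<close> compares them with a convergent sum.\<close>

lemma summable_gwt:
 assumes R: "0 <= R" shows "summable (%n. gwt n * R ^ n)"
proof (rule summable_comparison_test')
 let ?a = "4 * pi * R^2"
 have "summable (%n. c ^ n / fact n)" for c :: real using summable_exp_generic[of c] by (simp add: field_simps)
 thus "summable (%n. ?a ^ n / fact n + (1/4) ^ n)" by (intro summable_add summable_geometric) auto
 fix n
 let ?b = "?a ^ n / fact n + (1/4) ^ n"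
 have sq: "sqrt (s * t) <= s + t" if "0 <= s" "0 <= t" for s t :: real using that by (intro real_le_lsqrt) (auto simp: power2 alg_simps)
 have "?a ^ n * (1/4) ^ n = pi ^ n * (R^2) ^ n" by (simp flip: power_mult_distrib)
 moreover have "(R ^ n)^2 = (R^2) ^ n" by (metis power_mult mult.commute)
 ultimately have "(gwt n * R ^ n)^2 = ?a ^ n / fact n * (1/4) ^ n" unfolding power_mult_distrib[of "gwt n"] gwt_power2 by simp
 hence "gwt n * R ^ n = sqrt (?a ^ n / fact n * (1/4) ^ n)" using R gwt_pos[of n] by (simp add: real_sqrt_unique)
 also have "... <= ?b" by (rule sq) auto
 finally show "norm (gwt n * R ^ n) <= ?b" using R gwt_pos[of n] by simp
qed

text \<open>Integer radii make this a countable conjunction, suited to almost sure statements, and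
  still imply convergence everywhere.\<close>

definition good :: "(nat => complex) => bool" where
 "good b <-> (\<forall>R::nat. summable (%n. cmod (b n) * gwt n * real R ^ n))"

lemma good_summable_norm:
 assumes "good b" shows "summable (%n. norm (b n * of_real (gwt n) * z ^ n))"
proof (rule summable_comparison_test')
 let ?a = "nat \<lceil>cmod z\<rceil>"
 show "summable (%n. cmod (b n) * gwt n * real ?a ^ n)" using assms unfolding good_def by blast
 have "cmod z <= real ?a" by simp
 thus "norm (norm (b n * of_real (gwt n) * z ^ n)) <= cmod (b n) * gwt n * real ?a ^ n" for n
  using gwt_pos[of n] by (auto simp: norm_mult norm_power intro!: mult_left_mono power_mono)
qed

lemma good_summable: "good b ==> summable (%n. b n * of_real (gwt n) * z ^ n)"
 by (rule summable_norm_cancel[OF good_summable_norm])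

definition dgaf :: "(nat => complex) => complex => complex" where
 "dgaf b z = (\<Sum>n. diffs (%n. b n * of_real (gwt n)) n * z ^ n)"

lemma DERIV_gaf: "good b ==> (gaf b has_field_derivative dgaf b z) (at z)"
 unfolding gaf_gwt[abs_def] dgaf_def by (rule termdiffs_strong_converges_everywhere) (rule good_summable)

lemma holomorphic_gaf: "good b ==> gaf b holomorphic_on S"
 using DERIV_gaf by (auto simp: holomorphic_on_def field_differentiable_def intro: has_field_derivative_at_within)

lemma deriv_gaf: "good b ==> deriv (gaf b) = dgaf b"
 using DERIV_gaf DERIV_imp_deriv by blast

lemma holomorphic_dgaf: "good b ==> dgaf b holomorphic_on UNIV"
 using holomorphic_deriv[OF holomorphic_gaf[of b UNIV] open_UNIV] by (simp add: deriv_gaf)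

lemma gaf_0: "gaf b 0 = b 0"
proof -
 have "gaf b 0 = (\<Sum>n. if n = 0 then b 0 else 0)" unfolding gaf_gwt by (intro suminf_cong) (auto simp: gwt_def)
 thus ?thesis using suminf_split_initial_segment[of "%n. if n = 0 then b 0 else 0" 1] by auto
qed

lemma dgaf_0: "dgaf b 0 = b 1 * of_real (gwt 1)"
by (auto simp: dgaf_def diffs_def)

text \<open>Expresses a double zero in a disc through rational points only, so that the event is
  measurable in the coefficients.\<close>

definition near_double_zero :: "real => (nat => complex) => bool" where
 "near_double_zero R b <-> (\<forall>k::nat. \<exists>p q::rat. cmod (Complex (of_rat p) (of_rat q)) <= R &
   cmod (gaf b (Complex (of_rat p) (of_rat q))) + cmod (dgaf b (Complex (of_rat p) (of_rat q))) < 1 / real (Suc k))"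

text \<open>The continuous function \<open>|f| + |f'|\<close> attains its minimum on the closed
  disc, and its small values at rational points force this minimum to be 0.\<close>

lemma near_double_zero_imp:
 assumes b: "good b" and n: "near_double_zero R b" shows "\<exists>z. gaf b z = 0 & dgaf b z = 0"
proof -
 define F where "F z = cmod (gaf b z) + cmod (dgaf b z)" for z
 have cont: "continuous_on (cball 0 R) F"
  unfolding F_def using holomorphic_on_imp_continuous_on[OF holomorphic_gaf[OF b]] holomorphic_on_imp_continuous_on[OF holomorphic_dgaf[OF b]]
  by (intro continuous_intros) (auto intro: continuous_on_subset)
 obtain p q :: rat where "cmod (Complex (of_rat p) (of_rat q)) <= R" using n unfolding near_double_zero_def by auto
 hence "Complex (of_rat p) (of_rat q) \<in> cball 0 R" by simp
 hence "cball (0::complex) R ~= {}" by blast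
 then obtain z where z: "z \<in> cball 0 R" "!!y. y \<in> cball 0 R ==> F z <= F y"
  using continuous_attains_inf[OF compact_cball _ cont] by auto
 have "F z <= 0"
 proof (rule ccontr)
  assume "\<not> F z <= 0"
  then obtain k :: nat where k: "1 / real (Suc k) < F z" using reals_Archimedean[of "F z"] by (auto simp: inverse_eq_divide)
  obtain p q :: rat where "cmod (Complex (of_rat p) (of_rat q)) <= R" "F (Complex (of_rat p) (of_rat q)) < 1 / real (Suc k)"
   using n unfolding near_double_zero_def F_def by blast
  thus False using z(2)[of "Complex (of_rat p) (of_rat q)"] k by simp
 qed
 hence "cmod (gaf b z) = 0" "cmod (dgaf b z) = 0"
  using norm_ge_zero[of "gaf b z"] norm_ge_zero[of "dgaf b z"] unfolding F_def by linarith+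
 thus ?thesis by auto
qed

lemma double_zero_imp_near:
 assumes b: "good b" and z: "gaf b z = 0" "dgaf b z = 0" "cmod z < R" shows "near_double_zero R b" unfolding near_double_zero_def
proof
 let ?a = "%p q. Complex (of_rat p) (of_rat q)"
 fix k :: nat
 define F where "F z = cmod (gaf b z) + cmod (dgaf b z)" for z
 let ?b = "F -` {..<1 / real (Suc k)} \<inter> ball 0 R"
 have cont: "continuous_on UNIV F"
  unfolding F_def using holomorphic_on_imp_continuous_on[OF holomorphic_gaf[OF b]] holomorphic_on_imp_continuous_on[OF holomorphic_dgaf[OF b]]
  by (intro continuous_intros)
 have "open (F -` {..<1 / real (Suc k)} \<inter> ball 0 R)" using cont by (intro open_Int open_ball open_vimage) auto
 moreover have "z \<in> ?b" using z by (simp add: F_def)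
 ultimately obtain e where e: "e > 0" "ball z e \<subseteq> F -` {..<1 / real (Suc k)} \<inter> ball 0 R"
  using open_contains_ball_eq by blast
 obtain p :: rat where p: "Re z < of_rat p" "of_rat p < Re z + e / 2" using of_rat_dense[of "Re z" "Re z + e / 2"] e(1) by auto
 obtain q :: rat where q: "Im z < of_rat q" "of_rat q < Im z + e / 2" using of_rat_dense[of "Im z" "Im z + e / 2"] e(1) by auto
 have "dist z (?a p q) <= abs (Re z - of_rat p) + abs (Im z - of_rat q)"
  unfolding dist_norm by (rule order.trans[OF cmod_le]) simp
 also have "... < e" using p q by simp
 finally have inF: "Complex (of_rat p) (of_rat q) \<in> ?b" using e(2) by auto
 show "\<exists>p q::rat. cmod (?a p q) <= R &
   cmod (gaf b (?a p q)) + cmod (dgaf b (?a p q)) < 1 / real (Suc k)"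
  by (rule exI[of _ p], rule exI[of _ q]) (use inF in "auto simp: F_def")
qed

text \<open>For fixed higher coefficients the critical points do not depend on the constant
 coefficient, so a double zero confines the latter to a countable set.\<close>

lemma countable_double_zero:
 assumes b: "good b" and b1: "b 1 ~= 0" shows "countable {x. \<exists>z. gaf (b(0 := x)) z = 0 & dgaf (b(0 := x)) z = 0}"
proof -
 let ?a = "%z. - gaf (b(0 := 0)) z"
 have gx: "good (b(0 := x))" for x unfolding good_def
 proof
  fix R :: nat
  have "summable (%n. cmod (b (Suc n)) * gwt (Suc n) * real R ^ Suc n)" using b unfolding good_def by (subst summable_Suc_iff) auto
  hence "summable (%n. cmod ((b(0 := x)) (Suc n)) * gwt (Suc n) * real R ^ Suc n)" by simp
  thus "summable (%n. cmod ((b(0 := x)) n) * gwt n * real R ^ n)" by (subst (asm) summable_Suc_iff)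
 qed
 have e: "gaf (b(0 := x)) z = x + gaf (b(0 := 0)) z" for x z
 proof -
  have "gaf (b(0 := y)) z = y + (\<Sum>n. b (Suc n) * of_real (gwt (Suc n)) * z ^ Suc n)" for y
   unfolding gaf_gwt using suminf_split_head[OF good_summable[OF gx], of y z] by (simp add: gwt_def)
  from this[of x] this[of 0] show ?thesis by simp
 qed
 have d: "dgaf (b(0 := x)) = dgaf b" for x unfolding dgaf_def by (auto simp: diffs_def)
 have d0: "dgaf b 0 ~= 0" using b1 gwt_pos[of 1] by (simp add: dgaf_0)
 have "{z. dgaf b z = 0} = (\<Union>R::nat. {z \<in> cball 0 (real R). dgaf b z = 0})" by (auto simp: real_arch_simple)
 also have "countable ..." by (rule countable_UN) (simp, rule countable_finite, rule finite_zeros_cball[OF holomorphic_dgaf[OF b] d0])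
 finally have "countable {z. dgaf b z = 0}" .
 hence "countable (?a ` {z. dgaf b z = 0})" by simp
 thus ?thesis
 proof (rule countable_subset[rotated], intro subsetI)
  fix x assume "x \<in> {x. \<exists>z. gaf (b(0 := x)) z = 0 & dgaf (b(0 := x)) z = 0}"
  then obtain z where z: "gaf (b(0 := x)) z = 0" "dgaf b z = 0" by (auto simp: d)
  hence "x = - gaf (b(0 := 0)) z" using e[of x z] by (simp add: eq_neg_iff_add_eq_0)
  thus "x \<in> ?a ` {z. dgaf b z = 0}" using z(2) by auto
 qed
qed

lemma cgauss_null_countable: "countable A ==> emeasure cgauss A = 0"
proof -
 assume A: "countable A"
 have "A \<in> null_sets cgauss" unfolding cgauss_def using countable_imp_null_set_lborel[OF A] by (subst null_sets_density_iff) (auto intro: AE_not_in)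
 thus ?thesis by auto
qed

text \<open>The coefficients of \<open>exp (- pi |z|^2 / 2) * f z\<close>, normalized so that this
  value has variance one. Their squared moduli are the Poisson weights of mean
  \<open>area z\<close>.\<close>

definition ucoef :: "complex => nat => complex" where
 "ucoef z n = of_real (exp (- pi * (cmod z)^2 / 2) * gwt n) * z ^ n"

lemma ucoef_nonzero: "z ~= 0 ==> ucoef z n ~= 0"
 using gwt_pos[of n] by (simp add: ucoef_def)

lemma ucoef_mult_cnj:
 "ucoef z n * cnj (ucoef w n) = exp (of_real (- pi * ((cmod z)^2 + (cmod w)^2) / 2)) * ((of_real pi * z * cnj w) ^ n /\<^sub>R fact n)"
proof -
 let ?a = "- pi * (cmod z)^2 / 2"
 let ?b = "- pi * (cmod w)^2 / 2"
 define E where "E = - pi * ((cmod z)^2 + (cmod w)^2) / 2"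
 have "ucoef z n * cnj (ucoef w n) = of_real (exp ?a * exp ?b) * of_real ((gwt n)^2) * (z * cnj w) ^ n"
  by (simp add: ucoef_def power_mult_distrib power2)
 also have "exp ?a * exp ?b = exp E" by (simp add: exp_add[symmetric] field_simps E_def)
 finally show ?thesis unfolding E_def[symmetric] exp_of_real gwt_power2 by (simp add: scaleR_conv_of_real field_simps)
qed

lemma ucoef_sums:
 "(%n. ucoef z n * cnj (ucoef w n)) sums exp (of_real (- pi * ((cmod z)^2 + (cmod w)^2) / 2) + of_real pi * z * cnj w)"
 unfolding ucoef_mult_cnj exp_add by (intro sums_mult exp_converges)

lemma ucoef_norm_sums: "(%n. (cmod (ucoef z n))^2) sums 1"
proof -
 let ?a = "(cmod z)^2 + (cmod z)^2"
 have "of_real pi * z * cnj z = of_real (area z)" unfolding of_real_mult complex_norm_square by simp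
 moreover have "- pi * ?a / 2 + area z = 0" by simp
 ultimately have "exp (of_real (- pi * ?a / 2) + of_real pi * z * cnj z) = of_real 1"
  by (metis exp_zero of_real_0 of_real_1 of_real_add)
 hence "(%n. of_real ((cmod (ucoef z n))^2) :: complex) sums of_real 1" using ucoef_sums[of z z] unfolding complex_norm_square by simp
 thus ?thesis by (subst (asm) sums_of_real_iff)
qed

text \<open>The correlation itself is not a function of \<open>z - w\<close>, but the real part of
  its exponent completes to a square. Stationarity of the logarithmic covariance rests on
  this.\<close>

lemma norm_ucoef_corr:
 "(cmod (exp (of_real (- pi * ((cmod z)^2 + (cmod w)^2) / 2) + of_real pi * z * cnj w)))^2 = exp (- pi * (cmod (z - w))^2)"
proof -
 let ?a = "(cmod z)^2 + (cmod w)^2"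
 have "(cmod (z - w))^2 = (cmod z)^2 + (cmod w)^2 - 2 * Re (z * cnj w)" unfolding cmod_power2 by (simp add: power2 alg_simps)
 moreover have "Re (of_real pi * z * cnj w) = pi * Re (z * cnj w)" by (simp add: mult.assoc)
 moreover have "Re (of_real (- pi * ?a / 2)) = - pi * ?a / 2" by simp
 ultimately have "2 * Re (of_real (- pi * ?a / 2) + of_real pi * z * cnj w) = - pi * (cmod (z - w))^2"
  by (simp only:) (simp add: alg_simps diff_divide_distrib)
 thus ?thesis unfolding norm_exp_eq_Re exp_double[symmetric] by simp
qed

section \<open>Almost sure convergence of the series and simplicity of its zeros\<close>

context gaussian_sequence
begin

definition coef :: "'w => nat => complex" where "coef w n = a n w"

text \<open>For each radius the majorant series has finite expectation, because \<open>|a n|\<close>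
  has a first moment that does not depend on \<open>n\<close>.\<close>

lemma AE_good: "AE w in M. good (coef w)"
 unfolding good_def AE_all_countable
proof
 fix R :: nat
 let ?a = "%w. \<Sum>n. ennreal (cmod (coef w n) * gwt n * real R ^ n)"
 let ?b = "\<integral>\<^sup>+w. (?a w) \<partial>M"
 define m where "m = (NGAUSS x. ennreal (cmod x))"
 have m: "m < \<infinity>"
 proof -
  have "m = (NGAUSS x. ennreal (((cmod x)^2) powr (1/2)))" unfolding m_def by simp
  also have "... < \<infinity>" using integral_cgauss_norm(2)[of "%q. q powr (1/2)"] integrable_expo_powr[of "1/2"]
   by (simp add: integrable_iff_bounded)
  finally show ?thesis .
 qed
 have E: "(\<integral>\<^sup>+w. ennreal (cmod (a n w)) \<partial>M) = m" for n
  unfolding m_def by (subst distr_a[symmetric, of n], subst nn_integral_distr) auto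
 have "?b
   = (\<Sum>n. \<integral>\<^sup>+w. ennreal (cmod (a n w)) * ennreal (gwt n * real R ^ n) \<partial>M)"
  unfolding coef_def by (subst nn_integral_suminf) (auto simp: ennreal_mult' mult.assoc)
 also have "... = (\<Sum>n. m * ennreal (gwt n * real R ^ n))" by (subst nn_integral_multc) (auto simp: E)
 also have "... = m * ennreal (\<Sum>n. gwt n * real R ^ n)"
  using gwt_pos summable_gwt[of "real R"] by (subst ennreal_suminf_cmult, subst suminf_ennreal2) (auto simp: less_imp_le)
 also have "... < \<infinity>" using m by (simp add: ennreal_mult_less_top)
 finally have "?b ~= \<infinity>" by simp
 hence "AE w in M. ?a w ~= \<infinity>"
  by (intro nn_integral_PInf_AE) (auto simp: coef_def)
 thus "AE w in M. summable (%n. cmod (coef w n) * gwt n * real R ^ n)"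
  by eventually_elim (intro summable_suminf_not_top, use gwt_pos in "auto simp: less_imp_le")
qed

lemma AE_coef_nonzero: "AE w in M. coef w n ~= 0"
proof -
 have "AE x in cgauss. x ~= 0" using cgauss_null_countable[of "{0}"] by (intro AE_I[of _ _ "{0}"]) auto
 hence "AE x in distr M borel (a n). x ~= 0" unfolding distr_a .
 thus ?thesis unfolding coef_def by (rule AE_distrD[rotated]) simp
qed

lemma nn_integral_indep:
 assumes AB: "A \<inter> B = {}" and F: "case_prod F \<in> BM (PiM A (%_. borel) >< PiM B (%_. borel))"
 shows "(\<integral>\<^sup>+w. F (restrict (coef w) A) (restrict (coef w) B) \<partial>M)
  = (\<integral>\<^sup>+w. \<integral>\<^sup>+w'. F (restrict (coef w') A) (restrict (coef w) B) \<partial>M \<partial>M)"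
proof -
 let ?S = "PiM A (%_. borel :: complex measure)" and ?T = "PiM B (%_. borel :: complex measure)"
 let ?X = "%w. restrict (coef w) A" and ?Y = "%w. restrict (coef w) B"
 let ?a = "?X \<in> measurable M ?S"
 let ?b = "?Y \<in> measurable M ?T"
 have "indep_var ?S ?X ?T ?Y" unfolding coef_def using indep_var_restrict[OF indep AB] by simp
 hence m: "?a" "?b"
  and d: "distr M ?S ?X >< distr M ?T ?Y = distr M (?S >< ?T) (%w. (?X w, ?Y w))" unfolding indep_var_distribution_eq by auto
 interpret S: prob_space "distr M ?S ?X" using m(1) by (rule prob_space_distr)
 interpret T: prob_space "distr M ?T ?Y" using m(2) by (rule prob_space_distr)
 interpret ST: pair_sigma_finite "distr M ?S ?X" "distr M ?T ?Y" ..
 have [measurable]: "?a" "?b" by fact+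
 note F' = F[unfolded split_beta']
 have "(\<integral>\<^sup>+w. F (?X w) (?Y w) \<partial>M) = (\<integral>\<^sup>+p. F (fst p) (snd p) \<partial>distr M (?S >< ?T) (%w. (?X w, ?Y w)))"
  using F' by (subst nn_integral_distr) auto
 also have "... = (\<integral>\<^sup>+p. F (fst p) (snd p) \<partial>(distr M ?S ?X >< distr M ?T ?Y))" by (simp add: d)
 also have "... = (\<integral>\<^sup>+y. \<integral>\<^sup>+x. F x y \<partial>distr M ?S ?X \<partial>distr M ?T ?Y)"
  using F' by (subst ST.nn_integral_snd[symmetric]) auto
 also have "... = (\<integral>\<^sup>+w. \<integral>\<^sup>+x. F x (?Y w) \<partial>distr M ?S ?X \<partial>M)"
 proof (rule nn_integral_distr)
  have "(%(y, x). F x y) \<in> BM (distr M ?T ?Y >< distr M ?S ?X)"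
   using measurable_compose[OF measurable_pair_swap' F, unfolded split_beta'] by auto
  thus "(%y. \<integral>\<^sup>+x. F x y \<partial>distr M ?S ?X) \<in> BM (distr M ?T ?Y)"
   by auto
 qed measurable
 also have "... = (\<integral>\<^sup>+w. \<integral>\<^sup>+w'. F (?X w') (?Y w) \<partial>M \<partial>M)"
 proof (rule nn_integral_cong)
  fix w assume "w \<in> space M"
  hence "?Y w \<in> space ?T" using m(2) by (rule measurable_space[rotated])
  hence "(%x. F x (?Y w)) \<in> BM ?S"
   using F by simp
  thus "(\<integral>\<^sup>+x. F x (?Y w) \<partial>distr M ?S ?X) = (\<integral>\<^sup>+w'. F (?X w') (?Y w) \<partial>M)"
   by (subst nn_integral_distr) auto
 qed
 finally show ?thesis .
qed

text \<open>The constant coefficient is independent of the others and its law has no atoms. Given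
  the others, it avoids the countable set of values that create a double zero; Fubini removes the
  conditioning.\<close>

lemma AE_simple_zeros: "AE w in M. \<forall>z. gaf (coef w) z = 0 --> deriv (gaf (coef w)) z ~= 0"
proof -
 let ?f = "%w x. (coef w)(0 := x)"
 have nd: "AE w in M. \<not> near_double_zero (real R) (coef w)" for R :: nat
 proof -
  define J where "J x y n = (if n = 0 then x 0 else y n)" for x y :: "nat => complex" and n :: nat
  let ?A = "{0::nat}" and ?B = "{1::nat..}"
  let ?a = "%w. restrict (coef w) ?B"
  let ?b = "%w'. restrict (coef w') ?A"
  let ?c = "PiM ?A (%_. borel) >< PiM ?B (%_. borel)"
  define F where "F x y = (if near_double_zero (real R) (J x y) then 1 else 0 :: ennreal)" for x y
  let ?d = "%w. \<integral>\<^sup>+w'. F (?b w') (?a w) \<partial>M"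
  let ?e = "\<integral>\<^sup>+w. F (?b w) (?a w) \<partial>M"
  have [measurable]: "(%p. J (fst p) (snd p) n) \<in> BM ?c" for n
  proof (cases "n = 0")
   case True
   thus ?thesis by (simp add: J_def) measurable
  next
   case False
   hence "n \<in> ?B" by simp
   hence "(%p. snd p n) \<in> BM (PiM ?A (%_. borel) >< PiM ?B (%_. borel :: complex measure))" by simp
   thus ?thesis using False by (simp add: J_def)
  qed
  have "Measurable.pred ?c (%p. near_double_zero (real R) (J (fst p) (snd p)))"
   unfolding near_double_zero_def gaf_gwt dgaf_def diffs_def by measurable
  hence Fm: "case_prod F \<in> BM ?c" unfolding F_def by simp
  have J: "J (?b w') (?a w) = (coef w)(0 := coef w' 0)" for w w' by (auto simp: J_def)
  have z: "?d w = 0" if g: "good (coef w)" "coef w 1 ~= 0" for w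
  proof -
   define D where "D = {x. \<exists>z. gaf (?f w x) z = 0 & dgaf (?f w x) z = 0}"
   have cD: "countable D" unfolding D_def by (rule countable_double_zero[OF g])
   have gx: "good (?f w x)" for x unfolding good_def
   proof
    fix R :: nat
    have "summable (%n. cmod (coef w (Suc n)) * gwt (Suc n) * real R ^ Suc n)"
     using g(1) unfolding good_def by (subst summable_Suc_iff) auto
    hence "summable (%n. cmod ((?f w x) (Suc n)) * gwt (Suc n) * real R ^ Suc n)" by simp
    thus "summable (%n. cmod ((?f w x) n) * gwt n * real R ^ n)" by (subst (asm) summable_Suc_iff)
   qed
   have "AE x in cgauss. x \<notin> D" using cgauss_null_countable[OF cD] cD by (intro AE_I[of _ _ D]) (auto intro: sets.countable)
   hence "AE x in distr M borel (a 0). x \<notin> D" unfolding distr_a .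
   hence "AE w' in M. a 0 w' \<notin> D" by (rule AE_distrD[rotated]) simp
   hence "AE w' in M. F (?b w') (?a w) = 0"
   proof eventually_elim
    case (elim w')
    have "\<not> near_double_zero (real R) ((coef w)(0 := coef w' 0))"
    proof
     assume "near_double_zero (real R) ((coef w)(0 := coef w' 0))"
     from near_double_zero_imp[OF gx this] show False using elim by (simp add: D_def coef_def)
    qed
    thus ?case unfolding F_def J by simp
   qed
   hence "?d w = (\<integral>\<^sup>+w'. 0 \<partial>M)"
    by (rule nn_integral_cong_AE)
   thus ?thesis by simp
  qed
  have "?e
    = (\<integral>\<^sup>+w. \<integral>\<^sup>+w'. F (?b w') (?a w) \<partial>M \<partial>M)"
   by (rule nn_integral_indep[OF _ Fm]) auto
  also have "... = (\<integral>\<^sup>+w. 0 \<partial>M)"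
  proof (rule nn_integral_cong_AE)
   show "AE w in M. ?d w = 0"
    using AE_good AE_coef_nonzero[of 1] by eventually_elim (rule z)
  qed
  finally have *: "?e = 0" by simp
  have "(%w. (restrict (coef w) ?A, restrict (coef w) ?B)) \<in> measurable M ?c"
   unfolding coef_def by auto
  from measurable_compose[OF this Fm] have "(%w. F (?b w) (?a w)) \<in> BM M" by simp
  with * have Z: "AE w in M. F (?b w) (?a w) = 0" by (subst (asm) nn_integral_0_iff_AE)
  have J': "J (?b w) (?a w) = coef w" for w by (auto simp: J_def)
  show ?thesis using Z unfolding F_def J' by auto
 qed
 have "AE w in M. \<forall>R::nat. \<not> near_double_zero (real R) (coef w)" unfolding AE_all_countable using nd by auto
 with AE_good show ?thesis
 proof eventually_elim
  case (elim w)
  show ?case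
  proof (intro allI impI notI)
   fix z assume "gaf (coef w) z = 0" "deriv (gaf (coef w)) z = 0"
   moreover have "cmod z < real (nat \<lceil>cmod z\<rceil> + 1)" by linarith
   ultimately show False using double_zero_imp_near[OF elim(1)] elim(2) by (metis deriv_gaf elim(1))
  qed
 qed
qed

end

section \<open>Gaussian variables and their logarithms\<close>

text \<open>The expected product of \<open>ln |U|\<close> and \<open>ln |V|\<close> for the
  normalized values at two points with difference \<open>z\<close>: up to a constant a quarter of
  the dilogarithm of their squared correlation.\<close>

definition ln_kernel :: "complex => real" where
 "ln_kernel z = ((EXPO q. (ln q)^2) - (\<Sum>n. (1 - exp (- pi * (cmod z)^2) ^ Suc n) / (real (Suc n))^2)) / 4"

text \<open>A bound on the fourth logarithmic moment uniform over standard deviations between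
  \<open>1/2\<close> and 1; \<open>ln 2\<close> pays for the scaling.\<close>

definition ln4_bound :: real where
 "ln4_bound = 8 * ((ln 2) ^ 4 + (GAUSS x. (lnc x) ^ 4))"

text \<open>\<open>8 ^ 4\<close> stems from the pointwise bound \<open>ln_diff_power4_le\<close>,
  and the 2 from deviations that are at least \<open>1/2\<close>, which at most double the mean of
  \<open>1 / |x|\<close>.\<close>

definition ln_diff_const :: real where
 "ln_diff_const = 8 ^ 4 * ((GAUSS x. cmod x) + 2 * (GAUSS x. 1 / cmod x))"

lemma integrable_cgauss_cmod: "integrable cgauss cmod" "integrable cgauss (%x. 1 / cmod x)"
proof -
 have "integrable cgauss (%x. ((cmod x)^2) powr (1/2))"
  by (rule iffD2[OF integral_cgauss_norm(2)[of "%q. q powr (1/2)"]]) (auto intro: integrable_expo_powr)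
 thus "integrable cgauss cmod" by simp
 have "integrable cgauss (%x. ((cmod x)^2) powr (-(1/2)))"
  by (rule iffD2[OF integral_cgauss_norm(2)[of "%q. q powr (-(1/2))"]]) (auto intro: integrable_expo_powr)
 thus "integrable cgauss (%x. 1 / cmod x)" by (simp add: powr_minus inverse_eq_divide)
qed

text \<open>With \<open>v\<close> the eighth root of \<open>u\<close>, the inequality
  \<open>1 + v ^ 8 <= (1 + v) ^ 8\<close> gives \<open>ln (1 + u) <= 8 * v\<close>.\<close>

lemma ln_1_plus_power4_le:
 assumes u: "0 <= (u::real)" shows "(ln (1 + u)) ^ 4 <= 8 ^ 4 * sqrt u"
proof -
 define v where "v = sqrt (sqrt (sqrt u))"
 have v: "0 <= v" "v ^ 8 = u" "v ^ 4 = sqrt u"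
 proof -
  have "v ^ 8 = ((v^2)^2)^2" "v ^ 4 = (v^2)^2" by auto
  thus "0 <= v" "v ^ 8 = u" "v ^ 4 = sqrt u" using u by (simp_all add: v_def)
 qed
 have "1 + v ^ 8 <= (1 + v) ^ 8"
 proof -
  have "(1 + v) ^ 8 = (\<Sum>k\<le>8. of_nat (8 choose k) * v ^ k)" using binomial_ring[of v 1 8] by (simp add: add.commute)
  also have "... \<ge> (\<Sum>k\<in>{0,8}. of_nat (8 choose k) * v ^ k)" using v(1) by (intro sum_mono2) auto
  finally show ?thesis by simp
 qed
 hence "ln (1 + u) <= ln ((1 + v) ^ 8)" unfolding v(2) using u v(1) by auto
 also have "... = 8 * ln (1 + v)" by (simp add: ln_realpow)
 also have "... <= 8 * v" using ln_add_one_self_le_self[of v] v(1) by simp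
 finally have "(ln (1 + u)) ^ 4 <= (8 * v) ^ 4" using u by (intro power_mono) auto
 thus ?thesis by (simp add: v(3))
qed

lemma ln_diff_power4_le:
 assumes x: "x ~= 0" and y: "y ~= (0::complex)"
 shows "(lnc x - lnc y) ^ 4 <= 8 ^ 4 * (sqrt (cmod (x - y) / cmod x) + sqrt (cmod (x - y) / cmod y))"
proof -
 let ?a = "%x y. (lnc x - lnc y) ^ 4 <= 8 ^ 4 * sqrt (cmod (x - y) / cmod y)"
 have main: "?a x y"
  if le: "cmod y <= cmod x" and y: "y ~= 0" for x y
 proof -
  define u where "u = (cmod x - cmod y) / cmod y"
  have u: "0 <= u" using le by (simp add: u_def)
  have "1 + u = cmod x / cmod y" using y by (simp add: u_def field_simps)
  moreover have "x ~= 0" using le y by auto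
  ultimately have "lnc x - lnc y = ln (1 + u)" using y by (simp add: ln_div)
  hence "(lnc x - lnc y) ^ 4 <= 8 ^ 4 * sqrt u" using ln_1_plus_power4_le[OF u] by simp
  also have "sqrt u <= sqrt (cmod (x - y) / cmod y)"
   unfolding u_def using norm_triangle_ineq2[of x y] by (intro real_sqrt_le_mono divide_right_mono) auto
  finally show ?thesis by simp
 qed
 show ?thesis
 proof (cases "cmod y <= cmod x")
  case True
  thus ?thesis using main[OF True y] by (simp add: add_increasing)
 next
  case False
  hence "?a y x" using x by (intro main) auto
  moreover have "(lnc y - lnc x) ^ 4 = (lnc x - lnc y) ^ 4" using power_minus_even[of 4 "lnc x - lnc y"] by simp
  ultimately show ?thesis by (simp add: norm_minus_commute add_increasing2)
 qed
qed

text \<open>Arithmetic and geometric mean of \<open>d / et\<close> and \<open>1 / c\<close>. The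
  scale \<open>et\<close> will be the deviation of a difference of modulus \<open>d\<close>, so
  \<open>d / et\<close> has a fixed mean and the prefactor \<open>sqrt et\<close> carries the
  smallness.\<close>

lemma sqrt_div_le:
 assumes "0 < et" "0 <= d" "0 < (c::real)" shows "sqrt (d / c) <= sqrt et / 2 * (d / et + 1 / c)"
proof -
 have "sqrt (d / c) = sqrt et * sqrt ((d / et) * (1 / c))" using assms by (simp flip: real_sqrt_mult)
 also have "sqrt ((d / et) * (1 / c)) <= (d / et + 1 / c) / 2" by (rule arith_geo_mean_sqrt) (use assms in auto)
 finally show ?thesis using assms by simp
qed

context prob_space
begin

definition is_gauss :: "real => ('a => complex) => bool" where
 "is_gauss al X <-> X \<in> BM M & distr M borel X = distr cgauss borel (%x. of_real al * x)"

lemma is_gaussD: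
 fixes k :: "complex => real"
 assumes X: "is_gauss al X" and [measurable]: "k \<in> BM borel"
 shows "integrable M (%w. k (X w)) <-> integrable cgauss (%x. k (of_real al * x))" and "(EE w. k (X w)) = (GAUSS x. k (of_real al * x))"
proof -
 let ?a = "GAUSS x. k (of_real al * x)"
 let ?b = "%x. k (of_real al * x)"
 have [measurable]: "X \<in> BM M" using X by (simp add: is_gauss_def)
 have d: "distr M borel X = distr cgauss borel (%x. of_real al * x)" using X by (simp add: is_gauss_def)
 have "integrable M (%w. k (X w)) <-> integrable (distr M borel X) k" by (subst integrable_distr_eq) auto
 also have "... <-> integrable cgauss ?b" unfolding d by (subst integrable_distr_eq) auto
 finally show "integrable M (%w. k (X w)) <-> integrable cgauss ?b" .
 have "(EE w. k (X w)) = (\<integral>x. k x \<partial>distr M borel X)" by (subst integral_distr) auto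
 also have "... = ?a" unfolding d by (subst integral_distr) auto
 finally show "(EE w. k (X w)) = ?a" .
qed

lemma AE_cgauss_nonzero: "AE x in cgauss. x ~= 0"
 using cgauss_null_countable[of "{0}"] by (intro AE_I[of _ _ "{0}"]) auto

lemma is_gauss_nonzero:
 assumes X: "is_gauss al X" and al: "al ~= 0" shows "AE w in M. X w ~= 0"
proof -
 have [measurable]: "X \<in> BM M" using X by (simp add: is_gauss_def)
 have d: "distr M borel X = distr cgauss borel (%x. of_real al * x)" using X by (simp add: is_gauss_def)
 have "AE y in distr cgauss borel (%x. of_real al * x). y ~= 0" by (subst AE_distr_iff) (use AE_cgauss_nonzero al in auto)
 hence "AE y in distr M borel X. y ~= 0" unfolding d .
 thus ?thesis by (rule AE_distrD[rotated]) simp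
qed

lemma is_gauss_ln4:
 assumes X: "is_gauss al X" and al: "1/2 <= al" "al <= 1" shows "integrable M (%w. (lnc (X w)) ^ 4)" "(EE w. (lnc (X w)) ^ 4) <= ln4_bound"
proof -
 let ?a = "%x. lnc (of_real al * x)"
 let ?b = "%x. (ln 2) ^ 4 + (lnc x) ^ 4"
 let ?c = "EE w. (lnc (X w)) ^ 4"
 have le: "AE x in cgauss. ?a x ^ 4 <= 8 * ?b x" using AE_cgauss_nonzero
 proof eventually_elim
  case (elim x)
  have "lnc (of_real al * x) = ln al + lnc x" using elim al by (simp add: norm_mult ln_mult)
  hence "?a x ^ 4 <= 8 * ((ln al) ^ 4 + (lnc x) ^ 4)" by (simp only: power4_add_le)
  also have "(ln al) ^ 4 <= (ln 2) ^ 4"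
  proof -
   have "ln (1 / al) <= ln 2" using al by (subst ln_le_cancel_iff) (auto simp: field_simps)
   hence "- ln al <= ln 2" using al by (simp add: ln_div)
   moreover have "0 <= - ln al" using al by simp
   ultimately have "(- ln al) ^ 4 <= (ln 2) ^ 4" by (intro power_mono)
   thus ?thesis by simp
  qed
  finally show ?case by simp
 qed
 have i: "integrable cgauss (%x. 8 * ?b x)" using integrable_cgauss_ln(3) by simp
 have ii: "integrable cgauss (%x. ?a x ^ 4)"
  by (rule integrable_dom[OF i]) (use le in "auto elim!: ")
 thus "integrable M (%w. (lnc (X w)) ^ 4)" by (subst is_gaussD(1)[OF X, of "%x. (lnc x) ^ 4"]) auto
 have "?c = (GAUSS x. ?a x ^ 4)" by (rule is_gaussD(2)[OF X, of "%x. (lnc x) ^ 4"]) simp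
 also have "... <= (GAUSS x. 8 * ?b x)" by (rule integral_mono_AE[OF ii i le])
 also have "... = ln4_bound" using integrable_cgauss_ln(3) by (simp add: ln4_bound_def cgauss.prob_space[simplified])
 finally show "?c <= ln4_bound" .
qed

text \<open>The pointwise bound involves only the marginal laws of \<open>X\<close>,
  \<open>Y\<close> and \<open>X - Y\<close>, so any dependence between \<open>X\<close> and
  \<open>Y\<close> is allowed; \<open>1 / |X|\<close> is integrable because the plane has dimension
  two.\<close>

lemma is_gauss_ln_diff4:
 assumes X: "is_gauss al X" "1/2 <= al" and Y: "is_gauss be Y" "1/2 <= be" and XY: "is_gauss et (%w. X w - Y w)" "0 < et"
 shows "integrable M (%w. (lnc (X w) - lnc (Y w)) ^ 4)"
  "(EE w. (lnc (X w) - lnc (Y w)) ^ 4) <= ln_diff_const * sqrt et"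
proof -
 let ?a = "GAUSS x. 1 / cmod x"
 let ?b = "%w. lnc (X w) - lnc (Y w)"
 let ?c = "(EE w. cmod (X w - Y w) / et) = (GAUSS x. cmod x)"
 let ?d = "integrable M (%w. cmod (X w - Y w) / et)"
 let ?e = "%Z. EE w. 1 / cmod (Z w)"
 let ?f = "%Z. integrable M (%w. 1 / cmod (Z w))"
 let ?g = "ln_diff_const * sqrt et"
 have [measurable]: "X \<in> BM M" "Y \<in> BM M" using X Y by (simp_all add: is_gauss_def)
 define B where "B w = 8 ^ 4 * (sqrt et / 2 * (2 * (cmod (X w - Y w) / et) + 1 / cmod (X w) + 1 / cmod (Y w)))" for w
 have inv: "?f Z" "?e Z <= 2 * ?a"
  if Z: "is_gauss ze Z" "1/2 <= ze" for Z ze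
 proof -
  have e: "1 / cmod (of_real ze * x) = 1 / ze * (1 / cmod x)" for x using Z by (simp add: norm_mult)
  have m: "(%x::complex. 1 / cmod x) \<in> BM borel" by simp
  have "integrable cgauss (%x. 1 / cmod (of_real ze * x))" unfolding e by (intro integrable_mult_right integrable_cgauss_cmod(2))
  thus "?f Z" by (simp only: is_gaussD(1)[OF Z(1) m])
  have "?e Z = 1 / ze * ?a" unfolding is_gaussD(2)[OF Z(1) m] e by (rule integral_mult_right_zero)
  also have "... <= 2 * ?a" using Z by (intro mult_right_mono integral_nonneg_AE AE_I2) (auto simp: field_simps)
  finally show "?e Z <= 2 * ?a" .
 qed
 have dif: "?d" "?c"
 proof -
  have e: "cmod (of_real et * x) / et = cmod x" for x using XY by (simp add: norm_mult)
  show "?d"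
   using is_gaussD(1)[OF XY(1), of "%x. cmod x / et"] integrable_cgauss_cmod(1) unfolding e by simp
  show "?c" using is_gaussD(2)[OF XY(1), of "%x. cmod x / et"] unfolding e by simp
 qed
 have Bi: "integrable M B" unfolding B_def by (intro integrable_mult_right integrable_plus inv(1)[OF X] inv(1)[OF Y] dif(1))
 have "AE w in M. X w ~= 0" "AE w in M. Y w ~= 0" using is_gauss_nonzero[OF X(1)] is_gauss_nonzero[OF Y(1)] X(2) Y(2) by auto
 hence nz: "AE w in M. X w ~= 0 & Y w ~= 0" by simp
 have le: "AE w in M. ?b w ^ 4 <= B w" using nz
 proof eventually_elim
  case (elim w)
  have "?b w ^ 4 <= 8 ^ 4 * (sqrt (cmod (X w - Y w) / cmod (X w)) + sqrt (cmod (X w - Y w) / cmod (Y w)))"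
   by (rule ln_diff_power4_le) (use elim in auto)
  also have "... <= 8 ^ 4 * (sqrt et / 2 * (cmod (X w - Y w) / et + 1 / cmod (X w)) + sqrt et / 2 * (cmod (X w - Y w) / et + 1 / cmod (Y w)))"
   using elim XY(2) by (intro mult_left_mono add_mono sqrt_div_le) auto
  also have "... = B w" by (simp add: B_def alg_simps)
  finally show ?case .
 qed
 show i: "integrable M (%w. ?b w ^ 4)"
  by (rule integrable_dom[OF Bi]) (use le in "auto elim!: ")
 have "(EE w. ?b w ^ 4) <= (EE w. B w)" by (rule integral_mono_AE[OF i Bi le])
 also have "... = 8 ^ 4 * (sqrt et / 2 * (2 * (GAUSS x. cmod x) + (EE w. 1 / cmod (X w)) + (EE w. 1 / cmod (Y w))))"
  unfolding B_def dif(2)[symmetric]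
  by (simp only: integral_mult_right_zero integral_plus integrable_plus integrable_mult_right inv(1)[OF X] inv(1)[OF Y] dif(1))
 also have "... <= 8 ^ 4 * (sqrt et / 2 * (2 * (GAUSS x. cmod x) + 2 * ?a + 2 * ?a))"
  using XY(2) by (intro mult_left_mono add_mono inv(2)[OF X] inv(2)[OF Y] order_refl) auto
 also have "... = ?g" by (simp add: ln_diff_const_def)
 finally show "(EE w. ?b w ^ 4) <= ?g" .
qed

end

lemma distr_fst_gauss2: "distr (gauss2 al be si) borel fst = distr cgauss borel (%x. of_real (abs al) * x)"
proof -
 have "distr (gauss2 al be si) borel fst = distr (cgauss >< cgauss) borel (%p. of_real al * fst p + 0 * snd p)"
  unfolding gauss2_def by (subst distr_distr) (auto simp: o_def borel_prod[symmetric])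
 thus ?thesis unfolding distr_cgauss_combine by simp
qed

context gaussian_sequence
begin

lemma shift: "gaussian_sequence M (%n. a (n + m))"
proof
 have "indep_vars (%j. PiM {j + m} (%_. borel)) (%j w. restrict (%i. a i w) {j + m}) UNIV"
  by (rule indep_vars_restrict[OF indep]) (auto simp: disjoint_family_on_def)
 hence "indep_vars (%_. borel) (%j w. (%x. x (j + m)) (restrict (%i. a i w) {j + m})) UNIV" by (rule indep_vars_compose2) measurable
 thus "indep_vars (%_. borel) (%n. a (n + m)) UNIV" by simp
 show "distr M borel (a (n + m)) = cgauss" for n by (rule distr_a)
qed

lemma is_gauss_series:
 assumes u0: "!!n. u n ~= 0" and su: "(%n. (cmod (u n))^2) sums A"
  and S[measurable]: "S \<in> BM M" and lim: "AE w in M. (%N. \<Sum>n<N. u n * a n w) ----> S w" shows "is_gauss (sqrt A) S"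
proof -
 have uu: "u n * cnj (u n) = of_real ((cmod (u n))^2)" for n by (rule complex_norm_square[symmetric])
 have suv: "summable (%n. u n * cnj (u n))" unfolding uu using su by (intro summable_of_real) (rule sums_summable)
 have "distr M borel S = distr (distr M borel (%w. (S w, S w))) borel fst" by (subst distr_distr) (auto simp: o_def borel_prod[symmetric])
 also have "... = distr cgauss borel (%x. of_real (sqrt A) * x)" using su suminf_nonneg[of "%n. (cmod (u n))^2"] by (subst distr_limit_gauss2[OF u0 _ _ suv S S lim lim]) (auto simp: distr_fst_gauss2 sums_iff)
 finally show ?thesis by (simp add: is_gauss_def)
qed

lemma is_gauss_sum:
 assumes I: "finite I" "I ~= {}" "!!n. n \<in> I ==> u n ~= 0"
 shows "is_gauss (sqrt (\<Sum>n\<in>I. (cmod (u n))^2)) (%w. \<Sum>n\<in>I. u n * a n w)"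
proof -
 have "distr M borel (%w. \<Sum>n\<in>I. u n * a n w) = distr (distr M borel (%w. (\<Sum>n\<in>I. u n * a n w, \<Sum>n\<in>I. u n * a n w))) borel fst"
  by (subst distr_distr) (auto simp: o_def borel_prod[symmetric])
 also have "... = distr cgauss borel (%x. of_real (sqrt (\<Sum>n\<in>I. (cmod (u n))^2)) * x)"
  by (subst distr_sum_gauss2[OF I]) (auto simp: distr_fst_gauss2 sum_nonneg)
 finally show ?thesis by (simp add: is_gauss_def)
qed

lemma is_gauss_a: "is_gauss 1 (a n)"
 using distr_cgauss_mult_unit[of 1] by (simp add: is_gauss_def distr_a)

subsection \<open>The normalized field, its head and its tail\<close>

definition NF :: "'w => complex => complex" where
 "NF w z = (\<Sum>n. ucoef z n * coef w n)"

definition NFhead :: "nat => 'w => complex => complex" where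
 "NFhead m w z = (\<Sum>n<m. ucoef z n * coef w n)"

definition NFtail :: "nat => 'w => complex => complex" where
 "NFtail m w z = (\<Sum>n. ucoef z (n + m) * coef w (n + m))"

definition head_mass :: "nat => complex => real" where
 "head_mass m z = (\<Sum>n<m. (cmod (ucoef z n))^2)"

lemma ucoef_coef_sums:
 assumes "good (coef w)" shows "(%n. ucoef z n * coef w n) sums (of_real (exp (- pi * (cmod z)^2 / 2)) * gaf (coef w) z)"
proof -
 let ?a = "exp (- pi * (cmod z)^2 / 2)"
 have "(%n. of_real ?a * (coef w n * of_real (gwt n) * z ^ n)) sums (of_real ?a * gaf (coef w) z)"
  unfolding gaf_gwt by (intro sums_mult summable_sums good_summable assms)
 thus ?thesis by (simp add: ucoef_def mult_ac)
qed

lemma NF_eq: "good (coef w) ==> NF w z = of_real (exp (- pi * (cmod z)^2 / 2)) * gaf (coef w) z"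
 unfolding NF_def by (rule sums_unique[symmetric, OF ucoef_coef_sums])

lemma NF_split: "good (coef w) ==> NF w z = NFhead m w z + NFtail m w z"
 unfolding NF_def NFhead_def NFtail_def using suminf_split_initial_segment[OF sums_summable[OF ucoef_coef_sums], of w z m] by simp

lemma measurable_ucoef [measurable]: "(%z. ucoef z n) \<in> BM borel"
 unfolding ucoef_def by auto

lemma measurable_coef [measurable]: "(%w. coef w n) \<in> BM M"
 unfolding coef_def by auto

lemma measurable_NF [measurable]: "(%p. NF (fst p) (snd p)) \<in> BM (M >< borel)"
 unfolding NF_def by simp

lemma measurable_NFhead [measurable]: "(%p. NFhead m (fst p) (snd p)) \<in> BM (M >< borel)"
 unfolding NFhead_def by auto

lemma measurable_NFtail [measurable]: "(%p. NFtail m (fst p) (snd p)) \<in> BM (M >< borel)"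
 unfolding NFtail_def by simp

lemma is_gauss_NF: "is_gauss 1 (%w. NF w z)"
proof (cases "z = 0")
 case True
 \<comment> \<open>At the origin all coefficients but one vanish, so the series lemma for nonzero
   coefficients does not apply and the value is \<open>a 0\<close> itself.\<close>
 have "ucoef z n = (if n = 0 then 1 else 0)" for n using True by (auto simp: ucoef_def gwt_def)
 hence "NF w z = a 0 w" for w unfolding NF_def coef_def using suminf_finite[of "{0}" "%n. ucoef z n * a n w"] by simp
 thus ?thesis using is_gauss_a by simp
next
 case False
 have "is_gauss (sqrt 1) (%w. NF w z)"
 proof (rule is_gauss_series[where u="ucoef z"])
  show "AE w in M. (%N. \<Sum>n<N. ucoef z n * a n w) ----> NF w z"
   using AE_good by eventually_elim (use ucoef_coef_sums NF_eq in "simp add: sums_def coef_def")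
  show "(%w. NF w z) \<in> BM M" unfolding NF_def by simp
 qed (use ucoef_nonzero[OF False] ucoef_norm_sums in auto)
 thus ?thesis by simp
qed

lemma head_mass_le: "head_mass m z <= 1"
 unfolding head_mass_def sums_unique[OF ucoef_norm_sums[of z]] by (rule sum_le_suminf) (use ucoef_norm_sums sums_summable in auto)

lemma is_gauss_NFhead:
 assumes m: "0 < m" shows "is_gauss (sqrt (head_mass m z)) (%w. NFhead m w z)"
proof (cases "z = 0")
 case True
 have u: "ucoef z n = (if n = 0 then 1 else 0)" for n using True by (auto simp: ucoef_def gwt_def)
 have "NFhead m w z = a 0 w" for w unfolding NFhead_def coef_def using m by (simp add: u if_distrib[of "%x. x * _"] cong: if_cong)
 moreover have "head_mass m z = 1"
  unfolding head_mass_def using m by (simp add: u if_distrib[of cmod] if_distrib[of "%x. x ^ 2"] cong: if_cong)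
 ultimately show ?thesis using is_gauss_a by simp
next
 case False
 show ?thesis unfolding NFhead_def head_mass_def coef_def by (rule is_gauss_sum) (use m ucoef_nonzero[OF False] in "auto simp: ")
qed

lemma is_gauss_NFtail:
 assumes z: "z ~= 0" shows "is_gauss (sqrt (1 - head_mass m z)) (%w. NFtail m w z)"
proof -
 interpret S: gaussian_sequence M "%n. a (n + m)" by (rule shift)
 show ?thesis
 proof (rule S.is_gauss_series[where u="%n. ucoef z (n + m)"])
  show "(%n. (cmod (ucoef z (n + m)))^2) sums (1 - head_mass m z)"
   unfolding head_mass_def by (rule sums_split_initial_segment[OF ucoef_norm_sums])
  show "(%w. NFtail m w z) \<in> BM M" unfolding NFtail_def by simp
  show "AE w in M. (%N. \<Sum>n<N. ucoef z (n + m) * a (n + m) w) ----> NFtail m w z" using AE_good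
  proof eventually_elim
   case (elim w)
   have "summable (%n. ucoef z (n + m) * coef w (n + m))" using sums_summable[OF ucoef_coef_sums[OF elim]] by (subst summable_iff_shift)
   thus ?case unfolding NFtail_def coef_def by (rule summable_LIMSEQ)
  qed
 qed (use ucoef_nonzero[OF z] in auto)
qed

lemma NF_ln_correlation:
 "integrable M (%w. lnc (NF w z) * lnc (NF w y))"
 "(EE w. lnc (NF w z) * lnc (NF w y)) = ln_kernel (z - y)"
proof -
 let ?a = "%z y. integrable M (%w. lnc (NF w z) * lnc (NF w y)) & (EE w. lnc (NF w z) * lnc (NF w y)) = ln_kernel (z - y)"
 let ?c = "%x. lnc x * lnc x"
 let ?f = "%z y. ln_kernel (z - y)"
 have main: "?a z y" if z: "z ~= 0" for z y
 proof -
  define p where "p = exp (- pi * (cmod (y - z))^2)"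
  let ?e = "sqrt (1 - p)"
  define be where "be = exp (of_real (- pi * ((cmod y)^2 + (cmod z)^2) / 2) + of_real pi * y * cnj z)"
  have be: "(cmod be)^2 = p" unfolding be_def p_def by (rule norm_ucoef_corr)
  have p: "0 < p" "p <= 1" by (auto simp: p_def)
  have [measurable]: "(%w. NF w z) \<in> BM M" for z unfolding NF_def by simp
  have lim: "AE w in M. (%N. \<Sum>n<N. ucoef z n * a n w) ----> NF w z" for z
   using AE_good by eventually_elim (use ucoef_coef_sums NF_eq in "simp add: sums_def coef_def")
  let ?b = "(\<Sum>n. ucoef y n * cnj (ucoef z n)) / of_real (sqrt (\<Sum>n. (cmod (ucoef z n))^2))"
  let ?d = "%w. (NF w z, NF w y)"
  note sm = sums_summable[OF ucoef_norm_sums]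
  have "distr M borel ?d = gauss2 (sqrt (\<Sum>n. (cmod (ucoef z n))^2))
    ?b
    (sqrt ((\<Sum>n. (cmod (ucoef y n))^2) - (cmod ?b)^2))"
   by (rule distr_limit_gauss2[OF ucoef_nonzero[OF z] sm sm sums_summable[OF ucoef_sums] _ _ lim lim]) simp_all
  also have "... = gauss2 1 be ?e"
   unfolding sums_unique[OF ucoef_norm_sums, symmetric] sums_unique[OF ucoef_sums, symmetric] be_def[symmetric] real_sqrt_one of_real_1 div_by_1 be ..
  finally have d: "distr M borel ?d = gauss2 1 be ?e" .
  have [measurable]: "?d \<in> BM M" by auto
  define k where "k x = lnc (fst x) * lnc (snd x)" for x :: "complex \<times> complex"
  let ?g = "EE w. k (NF w z, NF w y)"
  have [measurable]: "k \<in> BM borel" unfolding k_def borel_prod[symmetric] by auto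
  have "integrable (gauss2 1 be ?e) k"
   unfolding gauss2_def using ln_gaussian_correlation(1)[OF p be] by (subst integrable_distr_eq) (auto simp: k_def)
  hence "integrable M (%w. k (NF w z, NF w y))" unfolding d[symmetric] by (subst (asm) integrable_distr_eq) auto
  moreover have "?g = ?f z y"
  proof -
   have "?g = (\<integral>x. k x \<partial>gauss2 1 be ?e)"
    unfolding d[symmetric] by (subst integral_distr) auto
   also have "... = ?f z y" unfolding gauss2_def using ln_gaussian_correlation(2)[OF p be]
    by (subst integral_distr) (auto simp: k_def ln_kernel_def p_def norm_minus_commute)
   finally show ?thesis .
  qed
  ultimately show ?thesis by (simp add: k_def)
 qed
 have "?a z y"
 proof (cases "z = 0 & y = 0")
  case False
  then consider "z ~= 0" | "y ~= 0" by auto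
  thus ?thesis
  proof cases
   case 1 thus ?thesis by (rule main)
  next
   case 2
   have "?f y z = ?f z y" by (simp add: ln_kernel_def norm_minus_commute)
   thus ?thesis using main[OF 2, of z] by (simp add: mult.commute)
  qed
 next
  case True
  \<comment> \<open>With both points at the origin the integrand depends on one standard Gaussian,
    so it has the same expectation as at any other coinciding pair, for instance at 1.\<close>
  have i: "is_gauss 1 (%w. NF w 0)" "is_gauss 1 (%w. NF w 1)" by (rule is_gauss_NF)+
  have e: "integrable M (%w. lnc (NF w 0) * lnc (NF w 0)) <-> integrable M (%w. lnc (NF w 1) * lnc (NF w 1))"
   using is_gaussD(1)[OF i(1), of "?c"] is_gaussD(1)[OF i(2), of "?c"] by simp
  have e': "(EE w. lnc (NF w 0) * lnc (NF w 0)) = (EE w. lnc (NF w 1) * lnc (NF w 1))"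
   using is_gaussD(2)[OF i(1), of "?c"] is_gaussD(2)[OF i(2), of "?c"] by simp
  show ?thesis using main[of 1 1] True e e' by simp
 qed
 thus "integrable M (%w. lnc (NF w z) * lnc (NF w y))"
  "(EE w. lnc (NF w z) * lnc (NF w y)) = ?f z y" by auto
qed

end

subsection \<open>Concentration of the coefficients\<close>

text \<open>For Poisson weights mean and variance coincide. The coefficients that matter at
  \<open>z\<close> thus have indices at distance of order \<open>|z|\<close> from
  \<open>area z\<close>.\<close>

lemma ucoef_variance_sums:
 "(%n. (real n - area z)^2 * (cmod (ucoef z n))^2) sums (area z)"
proof -
 define l where "l = area z"
 define p where "p n = (cmod (ucoef z n))^2" for n
 let ?a = "%n. real (Suc n) * (real (Suc n) - 1) * p (Suc n)"
 have p: "p n = exp (- l) * (l ^ n / fact n)" for n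
 proof -
  have "p n = (exp (- l / 2))^2 * (gwt n)^2 * ((cmod z)^2) ^ n" unfolding p_def ucoef_def by (simp add: norm_mult norm_power power_mult_distrib l_def power_mult[symmetric] mult.commute)
  also have "(exp (- l / 2))^2 = exp (- l)" by (simp add: power2 flip: exp_add)
  finally show ?thesis by (simp add: gwt_power2 l_def power_mult_distrib)
 qed
 have s0: "p sums 1" unfolding p_def by (rule ucoef_norm_sums)
 have e: "real (Suc n) * p (Suc n) = l * p n" for n unfolding p by auto
 have s1: "(%n. real n * p n) sums l"
 proof -
  have "(%n. real (Suc n) * p (Suc n)) sums (l * 1)" unfolding e by (intro sums_mult s0)
  from sums_Suc[OF this] show ?thesis by simp
 qed
 have s2: "(%n. real n * (real n - 1) * p n) sums (l * l)"
 proof -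
  have e2: "?a n = l * (real n * p n)" for n
  using e by simp
  have "(%n. real (Suc n) * (real (Suc n) - 1) * p (Suc n)) sums (l * l)" unfolding e2 by (intro sums_mult s1)
  from sums_Suc[OF this] show ?thesis by simp
 qed
 have "(%n. real n * (real n - 1) * p n + (1 - 2 * l) * (real n * p n) + l^2 * p n) sums (l * l + (1 - 2 * l) * l + l^2 * 1)"
  by (intro sums_add sums_mult s0 s1 s2)
 moreover have "real n * (real n - 1) * p n + (1 - 2 * l) * (real n * p n) + l^2 * p n = (real n - l)^2 * p n" for n
  by (simp add: power2 alg_simps)
 moreover have "l * l + (1 - 2 * l) * l + l^2 * 1 = l" by (simp add: power2 alg_simps)
 ultimately show ?thesis by (simp add: l_def p_def)
qed

section \<open>Fourth moments of circle averages\<close>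

lemma abs_mult4_le: "abs (a * b * c * d) <= (a ^ 4 + b ^ 4 + c ^ 4 + (d::real) ^ 4) / 4"
proof -
 have s: "abs (x * y) <= (x^2 + y^2) / 2" for x y :: real
 proof -
  have "2 * (abs x * abs y) <= abs x^2 + abs y^2" using sum_squares_bound[of "abs x" "abs y"] by simp
  thus ?thesis by (simp add: abs_mult)
 qed
 have "abs ((a * b) * (c * d)) <= ((a * b)^2 + (c * d)^2) / 2" by (rule s)
 moreover have "(a * b)^2 <= (a ^ 4 + b ^ 4) / 2" using s[of "a^2" "b^2"] by (simp add: power_mult_distrib)
 moreover have "(c * d)^2 <= (c ^ 4 + d ^ 4) / 2" using s[of "c^2" "d^2"] by (simp add: power_mult_distrib)
 ultimately show ?thesis by simp
qed

context prob_space
begin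

text \<open>Twice the inequality between the square of a mean and the mean of a square. The
  nonnegative integral on the right also covers an infinite fourth moment.\<close>

lemma expectation_power4_le:
 assumes [measurable]: "A \<in> BM M" shows "ennreal ((EE x. A x) ^ 4) <= (\<integral>\<^sup>+x. ennreal ((A x) ^ 4) \<partial>M)"
proof (cases "(\<integral>\<^sup>+x. ennreal ((A x) ^ 4) \<partial>M) < \<infinity>")
 case True
 hence i4: "integrable M (%x. (A x) ^ 4)" by (intro integrableI_nonneg) auto
 hence b: "integrable M (%x. 1 + (A x) ^ 4)" by simp
 have i2: "integrable M (%x. (A x)^2)"
  by (rule integrable_dom[OF b]) (use abs_le_1_power4(2) in "auto simp: ")
 have i1: "integrable M A" by (rule integrable_dom[OF b]) (use abs_le_1_power4(1) in "auto simp: ")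
 have "(EE x. A x)^2 <= (EE x. (A x)^2)" using variance_eq[OF i1 i2] variance_positive[of A] by simp
 hence "((EE x. A x)^2)^2 <= (EE x. (A x)^2)^2" by (intro power_mono) auto
 also have "... <= (EE x. ((A x)^2)^2)" using variance_eq[OF i2] i4 variance_positive[of "%x. (A x)^2"] by auto
 finally have "(EE x. A x) ^ 4 <= (EE x. (A x) ^ 4)" by simp
 thus ?thesis using i4 by (subst nn_integral_eq_integral) auto
qed (simp add: not_less top_unique)

text \<open>With the nonnegative integral a finite bound already contains integrability of the
  fourth power.\<close>

definition mom4 :: "('a => real) => real => bool" where
 "mom4 X C <-> X \<in> BM M & (\<integral>\<^sup>+w. ennreal ((X w) ^ 4) \<partial>M) <= ennreal C"

lemma mom4D:
 assumes "mom4 X C" "0 <= C" shows "X \<in> BM M" "integrable M (%w. (X w) ^ 4)" "(EE w. (X w) ^ 4) <= C"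
proof -
 show X[measurable]: "X \<in> BM M" using assms by (simp add: mom4_def)
 let ?a = "\<integral>\<^sup>+w. ennreal ((X w) ^ 4) \<partial>M"
 have le: "?a <= ennreal C" using assms by (simp add: mom4_def)
 hence "?a < \<infinity>" by (rule le_less_trans) simp
 thus i: "integrable M (%w. (X w) ^ 4)" by (intro integrableI_nonneg) auto
 hence "ennreal (EE w. (X w) ^ 4) <= ennreal C" using le by (subst nn_integral_eq_integral[symmetric]) auto
 thus "(EE w. (X w) ^ 4) <= C" using assms(2) by auto
qed

lemma mom4I:
 assumes "X \<in> BM M" "integrable M (%w. (X w) ^ 4)" "(EE w. (X w) ^ 4) <= C" shows "mom4 X C"
 using assms unfolding mom4_def by (subst nn_integral_eq_integral) (auto intro: ennreal_leI)

lemma mom4_const: "c ^ 4 <= C ==> mom4 (%_. c) C"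
 by (simp add: mom4_def emeasure_space_1 ennreal_leI)

lemma mom4_mono: "mom4 X C ==> C <= D ==> mom4 X D"
 by (auto simp: mom4_def intro: order.trans ennreal_leI)

lemma mom4_mult:
 assumes X: "mom4 X C" and C: "0 <= C" shows "mom4 (%w. c * X w) (c ^ 4 * C)"
 using mom4D[OF X C] by (intro mom4I) (auto simp: power_mult_distrib intro!: mult_left_mono)

lemma mom4_add:
 assumes X: "mom4 X C" "0 <= C" and Y: "mom4 Y D" "0 <= D" shows "mom4 (%w. X w + Y w) (8 * (C + D))"
proof (rule mom4I)
 let ?a = "EE w. (X w + Y w) ^ 4"
 note x = mom4D[OF X] and y = mom4D[OF Y]
 have [measurable]: "X \<in> BM M" "Y \<in> BM M" using x y by auto
 show "(%w. X w + Y w) \<in> BM M" by simp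
 have i: "integrable M (%w. 8 * ((X w) ^ 4 + (Y w) ^ 4))" using x y by simp
 show ii: "integrable M (%w. (X w + Y w) ^ 4)"
  by (rule integrable_dom[OF i]) (use power4_add_le in auto)
 have "?a <= (EE w. 8 * ((X w) ^ 4 + (Y w) ^ 4))" by (rule integral_mono[OF ii i]) (rule power4_add_le)
 also have "... <= 8 * (C + D)" using x y by simp
 finally show "?a <= 8 * (C + D)" .
qed

lemma mom4_prod:
 assumes X: "mom4 X1 C1" "mom4 X2 C2" "mom4 X3 C3" "mom4 X4 C4" and C: "0 <= C1" "0 <= C2" "0 <= C3" "0 <= C4"
 shows "integrable M (%w. X1 w * X2 w * X3 w * X4 w)"
  "(EE w. abs (X1 w * X2 w * X3 w * X4 w)) <= (C1 + C2 + C3 + C4) / 4"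
  "abs (EE w. X1 w * X2 w * X3 w * X4 w) <= (C1 + C2 + C3 + C4) / 4"
proof -
 let ?a = "EE w. abs (X1 w * X2 w * X3 w * X4 w)"
 let ?b = "%w. (X1 w) ^ 4 + (X2 w) ^ 4 + (X3 w) ^ 4 + (X4 w) ^ 4"
 let ?c = "C1 + C2 + C3 + C4"
 note m = mom4D[OF X(1) C(1)] mom4D[OF X(2) C(2)] mom4D[OF X(3) C(3)] mom4D[OF X(4) C(4)]
 have [measurable]: "X1 \<in> BM M" "X2 \<in> BM M" "X3 \<in> BM M" "X4 \<in> BM M" using m by auto
 have i: "integrable M (%w. ?b w / 4)" using m by simp
 show ii: "integrable M (%w. X1 w * X2 w * X3 w * X4 w)"
  by (rule integrable_dom[OF i]) (use abs_mult4_le in "auto simp: ")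
 have "?a <= (EE w. ?b w / 4)"
  by (rule integral_mono[OF _ i]) (use ii abs_mult4_le in auto)
 also have "... <= ?c / 4" using m by simp
 finally show le: "?a <= ?c / 4" .
 show "abs (EE w. X1 w * X2 w * X3 w * X4 w) <= ?c / 4"
  using integral_abs_bound[of M "%w. X1 w * X2 w * X3 w * X4 w"] le by linarith
qed

text \<open>Dividing the small factor by \<open>de\<close> before applying the four-term mean
  inequality makes the bound linear in \<open>de\<close>.\<close>

lemma mom4_prod_small:
 assumes X: "mom4 X1 (de ^ 4)" "mom4 X2 C" "mom4 X3 C" "mom4 X4 C" and C: "0 <= C" and de: "0 < de"
 shows "abs (EE w. X1 w * X2 w * X3 w * X4 w) <= de * (1 + 3 * C) / 4"
proof -
 let ?a = "EE w. (1 / de) * X1 w * X2 w * X3 w * X4 w"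
 let ?b = "%w. (1 / de) * X1 w"
 have "mom4 ?b ((1 / de) ^ 4 * de ^ 4)" by (rule mom4_mult[OF X(1)]) simp
 hence 1: "mom4 ?b 1" using de by (simp add: power_divide)
 have "abs ?a <= (1 + C + C + C) / 4" by (rule mom4_prod(3)[OF 1 X(2-4)]) (use C in auto)
 moreover have "?a = (1 / de) * (EE w. X1 w * X2 w * X3 w * X4 w)"
  by simp
 ultimately show ?thesis using de by (simp add: field_simps)
qed

text \<open>Each replacement of a factor by its approximation costs at most a multiple of \<open>de\<close>,
 and the approximations decorrelate exactly.\<close>

lemma decorrelation_transfer:
 assumes X: "mom4 X1 C" "mom4 X2 C" "mom4 X3 C" "mom4 X4 C" and Y: "mom4 Y1 C" "mom4 Y2 C" "mom4 Y3 C" "mom4 Y4 C"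
  and d: "mom4 (%w. X1 w - Y1 w) (de ^ 4)" "mom4 (%w. X2 w - Y2 w) (de ^ 4)"
    "mom4 (%w. X3 w - Y3 w) (de ^ 4)" "mom4 (%w. X4 w - Y4 w) (de ^ 4)" and C: "1 <= C" and de: "0 < de"
  and ind: "(EE w. Y1 w * Y2 w * Y3 w * Y4 w) = (EE w. Y1 w * Y2 w) * (EE w. Y3 w * Y4 w)"
 shows "abs ((EE w. X1 w * X2 w * X3 w * X4 w) - (EE w. X1 w * X2 w) * (EE w. X3 w * X4 w))
   <= de * (1 + 3 * C) * (1 + C)"
proof -
 let ?a = "EE w. X1 w * X2 w * X3 w * X4 w"
 let ?b = "%A B. mom4 (%w. A w - B w) (de ^ 4)"
 let ?c = "EE w. Y1 w * Y2 w * Y3 w * Y4 w"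
 let ?e = "%A1 A2. EE w. A1 w * A2 w"
 have C0: "0 <= C" "0 <= de ^ 4" using C by auto
 \<comment> \<open>The constant 1 is padding: products of two factors are treated as products of
   four.\<close>
 have one: "mom4 (%_. 1) C" using C by (intro mom4_const) simp
 define E where "E = de * (1 + 3 * C) / 4"
 let ?d = "%x x' y. abs (x - x') * abs y <= 2 * E * C"
 have E0: "0 <= E" using C de by (simp add: E_def)
 have sm: "abs (EE w. (A w - B w) * P w * Q w * S w) <= E" "integrable M (%w. (A w - B w) * P w * Q w * S w)"
  if "?b A B" "mom4 P C" "mom4 Q C" "mom4 S C" for A B P Q S
  unfolding E_def using mom4_prod_small[OF that C0(1) de] mom4_prod(1)[OF that C0(2) C0(1) C0(1) C0(1)] by auto
 have "?a - ?c
  = (EE w. X1 w * X2 w * X3 w * X4 w - Y1 w * Y2 w * Y3 w * Y4 w)"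
  using mom4_prod(1)[OF X C0(1) C0(1) C0(1) C0(1)] mom4_prod(1)[OF Y C0(1) C0(1) C0(1) C0(1)] by simp
 also have "... = (EE w. (X1 w - Y1 w) * X2 w * X3 w * X4 w + (X2 w - Y2 w) * Y1 w * X3 w * X4 w
   + (X3 w - Y3 w) * Y1 w * Y2 w * X4 w + (X4 w - Y4 w) * Y1 w * Y2 w * Y3 w)" by (simp add: alg_simps)
 also have "... = (EE w. (X1 w - Y1 w) * X2 w * X3 w * X4 w) + (EE w. (X2 w - Y2 w) * Y1 w * X3 w * X4 w)
   + (EE w. (X3 w - Y3 w) * Y1 w * Y2 w * X4 w) + (EE w. (X4 w - Y4 w) * Y1 w * Y2 w * Y3 w)"
  using sm(2)[OF d(1) X(2-4)] sm(2)[OF d(2) Y(1) X(3,4)] sm(2)[OF d(3) Y(1,2) X(4)] sm(2)[OF d(4) Y(1-3)] by simp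
 finally have 4: "abs (?a - ?c) <= 4 * E"
  using sm(1)[OF d(1) X(2-4)] sm(1)[OF d(2) Y(1) X(3,4)] sm(1)[OF d(3) Y(1,2) X(4)] sm(1)[OF d(4) Y(1-3)] by auto
 have pair: "abs (?e A1 A2 - ?e B1 B2) <= 2 * E"
  if A: "mom4 A1 C" "mom4 A2 C" and B: "mom4 B1 C" "mom4 B2 C" and dd: "?b A1 B1" "?b A2 B2"
  for A1 A2 B1 B2
 proof -
  have "?e A1 A2 - ?e B1 B2 = (EE w. A1 w * A2 w - B1 w * B2 w)"
   using mom4_prod(1)[OF A one one C0(1) C0(1) C0(1) C0(1)] mom4_prod(1)[OF B one one C0(1) C0(1) C0(1) C0(1)] by simp
  also have "... = (EE w. (A1 w - B1 w) * A2 w * 1 * 1 + (A2 w - B2 w) * B1 w * 1 * 1)" by (simp add: alg_simps)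
  also have "... = (EE w. (A1 w - B1 w) * A2 w * 1 * 1) + (EE w. (A2 w - B2 w) * B1 w * 1 * 1)"
   by (rule integral_plus) (rule sm(2)[OF dd(1) A(2) one one], rule sm(2)[OF dd(2) B(1) one one])
  finally show ?thesis using sm(1)[OF dd(1) A(2) one one] sm(1)[OF dd(2) B(1) one one] by simp
 qed
 have pb: "abs (?e A1 A2) <= C" if "mom4 A1 C" "mom4 A2 C" for A1 A2
  using mom4_prod(3)[OF that one one C0(1) C0(1) C0(1) C0(1)] by simp
 define x y x' y' where "x = (EE w. X1 w * X2 w)" and "y = (EE w. X3 w * X4 w)"
  and "x' = (EE w. Y1 w * Y2 w)" and "y' = (EE w. Y3 w * Y4 w)"
 let ?f = "abs (x * y - x' * y')"
 have "abs (x - x') <= 2 * E" "abs (y - y') <= 2 * E" "abs y <= C" "abs x' <= C"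
  unfolding x_def y_def x'_def y'_def using pair pb X Y d by blast+
 hence "?d x x' y" "?d y y' x'"
  by (intro mult_mono; simp)+
 moreover have "x * y - x' * y' = (x - x') * y + x' * (y - y')" by (simp add: alg_simps)
 hence "?f <= abs (x - x') * abs y + abs (y - y') * abs x'"
  using abs_triangle_ineq[of "(x - x') * y" "(y - y') * x'"] by (simp add: abs_mult mult.commute)
 ultimately have "?f <= 4 * E * C" by simp
 hence "abs (?a - x * y) <= 4 * E + 4 * E * C"
  using 4 ind unfolding x'_def[symmetric] y'_def[symmetric] by simp
 also have "4 * E + 4 * E * C = 4 * E * (1 + C)" by (simp add: alg_simps)
 also have "4 * E = de * (1 + 3 * C)" by (simp add: E_def)
 finally show ?thesis by (simp add: x_def y_def)
qed

end

text \<open>The constant compensates the factor \<open>exp (- pi |z|^2 / 2)\<close>: the mean of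
  \<open>pi |z|^2 / 2\<close> over a circle of radius \<open>R\<close> exceeds its value at the
  centre by \<open>pi R^2 / 2\<close>.\<close>

definition ring_mean :: "real => real => (complex => complex) => complex => real" where
 "ring_mean R1 R2 G t = (MEAN th. pi * (R2^2 - R1^2) / 2
   + (lnc (G (t + of_real R2 * circ th)) - lnc (G (t + of_real R1 * circ th))))"

lemma measurable_ring_mean [measurable]:
 assumes [measurable]: "(%p. G (fst p) (snd p)) \<in> BM (N >< borel)"
 shows "(%p. ring_mean R1 R2 (G (fst p)) (snd p)) \<in> BM (N >< borel)"
proof -
 note [measurable] = measurable_app2'[where f=G, OF assms]
 show ?thesis unfolding ring_mean_def by simp
qed

context prob_space
begin

text \<open>The fourth power moves inside the circle mean by convexity, and Fubini exchanges the
  circle mean with the expectation. The constant is that of \<open>mom4_add\<close> used twice,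
  first for the difference of logarithms and then for the added number.\<close>

lemma ring_mean_mom4:
 assumes G[measurable]: "(%p. G (fst p) (snd p)) \<in> BM (M >< borel)"
  and B: "0 <= B" "!!z. cmod (z - t) = R1 \<or> cmod (z - t) = R2 ==> mom4 (%w. lnc (G w z)) B" and R: "0 < R1" "0 < R2"
 shows "mom4 (%w. ring_mean R1 R2 (G w) t) (8 * ((pi * (R2^2 - R1^2) / 2) ^ 4 + 16 * B))"
  and "AE w in M. integrable U01 (%th. pi * (R2^2 - R1^2) / 2
    + (lnc (G w (t + of_real R2 * circ th)) - lnc (G w (t + of_real R1 * circ th))))"
proof -
 let ?a = "8 * ((pi * (R2^2 - R1^2) / 2) ^ 4 + 16 * B)"
 let ?c = "%w th. G w (t + of_real R1 * circ th)"
 let ?d = "%w th. G w (t + of_real R2 * circ th)"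
 let ?e = "\<integral>\<^sup>+w. ennreal ((ring_mean R1 R2 (G w) t) ^ 4) \<partial>M"
 let ?f = "R2^2 - R1^2"
 let ?g = "%w. ring_mean R1 R2 (G w) t"
 interpret P: pair_sigma_finite M U01 ..
 define A where "A w th = pi * ?f / 2
   + (lnc (?d w th) - lnc (?c w th))" for w th
 let ?b = "\<integral>\<^sup>+w. (NMEAN th. ennreal ((A w th) ^ 4)) \<partial>M"
 let ?h = "%w. NMEAN th. ennreal ((A w th) ^ 4)"
 note [measurable] = measurable_app2'[where f=G, OF G]
 have Am[measurable]: "(%p. A (fst p) (snd p)) \<in> BM (M >< U01)" unfolding A_def by simp
 have A4: "mom4 (%w. A w th) ?a" for th
 proof -
  have m: "mom4 (%w. lnc (?d w th)) B" "mom4 (%w. lnc (?c w th)) B"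
   by (rule B(2), use R in "simp add: norm_mult")+
  have "mom4 (%w. (-1) * lnc (?c w th)) ((-1) ^ 4 * B)" by (rule mom4_mult[OF m(2) B(1)])
  hence m': "mom4 (%w. - lnc (?c w th)) B" by simp
  have s: "mom4 (%w. lnc (?d w th) + - lnc (?c w th)) (8 * (B + B))"
   by (rule mom4_add[OF m(1) B(1) m' B(1)])
  have k: "mom4 (%_. pi * ?f / 2) ((pi * ?f / 2) ^ 4)" by (rule mom4_const) simp
  have "mom4 (%w. pi * ?f / 2 + (lnc (?d w th) + - lnc (?c w th)))
    (8 * ((pi * ?f / 2) ^ 4 + 8 * (B + B)))" by (rule mom4_add[OF k _ s]) (use B(1) in auto)
  thus ?thesis by (simp add: A_def)
 qed
 have I: "?b <= ennreal ?a"
 proof -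
  have "?b = (NMEAN th. \<integral>\<^sup>+w. ennreal ((A w th) ^ 4) \<partial>M)"
   by (rule P.Fubini'[symmetric]) (simp add: split_beta')
  also have "... <= (NMEAN th. ennreal ?a)"
   using A4 by (intro nn_integral_mono) (simp add: mom4_def)
  also have "... = ennreal ?a" using U01.emeasure_space_1 by simp
  finally show ?thesis .
 qed
 show "mom4 ?g ?a" unfolding mom4_def
 proof
  show "?g \<in> BM M" unfolding ring_mean_def by simp
  have "?e <= ?b"
  proof (rule nn_integral_mono)
   fix w assume w: "w \<in> space M"
   have "A w \<in> BM U01" using measurable_compose[OF measurable_Pair1'[OF w] Am] by simp
   thus "ennreal ((ring_mean R1 R2 (G w) t) ^ 4) <= ?h w"
    unfolding ring_mean_def A_def[symmetric] by (rule U01.expectation_power4_le)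
  qed
  thus "?e <= ennreal ?a"
   using I by simp
 qed
 have "AE w in M. ?h w ~= \<infinity>"
  by (rule nn_integral_PInf_AE) (measurable, use I in "auto simp: top_unique")
 thus "AE w in M. integrable U01 (%th. pi * ?f / 2
    + (lnc (?d w th) - lnc (?c w th)))" using AE_space
 proof eventually_elim
  case (elim w)
  have Awm[measurable]: "A w \<in> BM U01" using measurable_compose[OF measurable_Pair1'[OF elim(2)] Am] by simp
  have "integrable U01 (%th. (A w th) ^ 4)" using elim(1) by (intro integrableI_nonneg) (auto simp: less_top)
  hence b: "integrable U01 (%th. 1 + (A w th) ^ 4)" by simp
  have "integrable U01 (A w)" by (rule integrable_dom[OF b Awm]) (use abs_le_1_power4(1) in "auto simp: ")
  thus ?case by (simp add: A_def[abs_def])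
 qed
qed

text \<open>The additive constants cancel, so only the pointwise errors on the two circles remain;
  \<open>16 * e\<close> is \<open>8 * (e + e)\<close>.\<close>

lemma ring_mean_diff_mom4:
 assumes G[measurable]: "(%p. G (fst p) (snd p)) \<in> BM (M >< borel)" and H[measurable]: "(%p. H (fst p) (snd p)) \<in> BM (M >< borel)"
  and B: "0 <= B" "!!z. cmod (z - t) = R1 \<or> cmod (z - t) = R2 ==> mom4 (%w. lnc (G w z)) B"
   "!!z. cmod (z - t) = R1 \<or> cmod (z - t) = R2 ==> mom4 (%w. lnc (H w z)) B"
  and e: "0 <= e" "!!z. cmod (z - t) = R1 \<or> cmod (z - t) = R2 ==> mom4 (%w. lnc (G w z) - lnc (H w z)) e" and R: "0 < R1" "0 < R2"
 shows "mom4 (%w. ring_mean R1 R2 (G w) t - ring_mean R1 R2 (H w) t) (16 * e)"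
proof -
 let ?a = "%th. t + of_real R1 * circ th"
 let ?b = "%th. t + of_real R2 * circ th"
 let ?c = "\<integral>\<^sup>+w. ennreal ((ring_mean R1 R2 (G w) t - ring_mean R1 R2 (H w) t) ^ 4) \<partial>M"
 let ?d = "%w th. lnc (G w (?a th)) - lnc (H w (?a th))"
 interpret P: pair_sigma_finite M U01 ..
 define A where "A w th = (lnc (G w (?b th)) - lnc (H w (?b th)))
  - ?d w th" for w th
 let ?e = "%w. NMEAN th. ennreal ((A w th) ^ 4)"
 note [measurable] = measurable_app2'[where f=G, OF G]
 note [measurable] = measurable_app2'[where f=H, OF H]
 have Am[measurable]: "(%p. A (fst p) (snd p)) \<in> BM (M >< U01)" unfolding A_def by simp
 have A4: "mom4 (%w. A w th) (16 * e)" for th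
 proof -
  have m: "mom4 (%w. lnc (G w (?b th)) - lnc (H w (?b th))) e"
   "mom4 (%w. lnc (G w (?a th)) - lnc (H w (?a th))) e"
   by (rule e(2), use R in "simp add: norm_mult")+
  have "mom4 (%w. (-1) * ?d w th) ((-1) ^ 4 * e)"
   by (rule mom4_mult[OF m(2) e(1)])
  hence m': "mom4 (%w. (-1) * ?d w th) e" by simp
  have eq: "(%w. A w th) = (%w. (lnc (G w (?b th)) - lnc (H w (?b th)))
    + (-1) * ?d w th)" by (simp add: A_def fun_eq_iff)
  show ?thesis unfolding eq using mom4_add[OF m(1) e(1) m' e(1)] by simp
 qed
 have iG: "AE w in M. integrable U01 (%th. pi * (R2^2 - R1^2) / 2
    + (lnc (G w (?b th)) - lnc (G w (?a th))))" by (rule ring_mean_mom4(2)[OF G B(1) _ R]) (rule B(2))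
 have iH: "AE w in M. integrable U01 (%th. pi * (R2^2 - R1^2) / 2
    + (lnc (H w (?b th)) - lnc (H w (?a th))))" by (rule ring_mean_mom4(2)[OF H B(1) _ R]) (rule B(3))
 have "AE w in M. ring_mean R1 R2 (G w) t - ring_mean R1 R2 (H w) t = (MEAN th. A w th)" using iG iH
 proof eventually_elim
  case (elim w)
  show ?case unfolding ring_mean_def by (subst Bochner_Integration.integral_diff[OF elim, symmetric])
     (intro integral_congr refl, simp add: A_def)
 qed
 hence le: "AE w in M. ennreal ((ring_mean R1 R2 (G w) t - ring_mean R1 R2 (H w) t) ^ 4) <= ?e w"
  using AE_space
 proof eventually_elim
  case (elim w)
  have "A w \<in> BM U01" using measurable_compose[OF measurable_Pair1'[OF elim(2)] Am] by simp
  thus ?case unfolding elim(1) by (rule U01.expectation_power4_le)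
 qed
 show ?thesis unfolding mom4_def
 proof
  show "(%w. ring_mean R1 R2 (G w) t - ring_mean R1 R2 (H w) t) \<in> BM M" unfolding ring_mean_def by simp
  have "?c <= (\<integral>\<^sup>+w. (?e w) \<partial>M)"
   by (rule nn_integral_mono_AE[OF le])
  also have "... = (NMEAN th. \<integral>\<^sup>+w. ennreal ((A w th) ^ 4) \<partial>M)"
   by (rule P.Fubini'[symmetric]) (simp add: split_beta')
  also have "... <= (NMEAN th. ennreal (16 * e))" using A4 by (intro nn_integral_mono) (simp add: mom4_def)
  also have "... = ennreal (16 * e)" using U01.emeasure_space_1 by simp
  finally show "?c <= ennreal (16 * e)" .
 qed
qed

end

section \<open>Decorrelation of distant rings\<close>

lemma ln4_bound_nonneg: "0 <= ln4_bound"
 unfolding ln4_bound_def by auto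

lemma ln_diff_const_nonneg: "0 <= ln_diff_const"
 unfolding ln_diff_const_def by simp

lemma (in prob_space) is_gauss_cong_AE:
 assumes X: "is_gauss al X" and Y[measurable]: "Y \<in> BM M" and eq: "AE w in M. X w = Y w" shows "is_gauss al Y"
proof -
 have [measurable]: "X \<in> BM M" using X by (simp add: is_gauss_def)
 have "distr M borel Y = distr M borel X" by (rule distr_cong_AE) (use eq in auto)
 thus ?thesis using X by (simp add: is_gauss_def)
qed

context gaussian_sequence
begin

lemma tail_mass_sums: "(%n. (cmod (ucoef z (n + m)))^2) sums (1 - head_mass m z)"
 unfolding head_mass_def by (rule sums_split_initial_segment[OF ucoef_norm_sums])

text \<open>Chebyshev for the Poisson law of mean \<open>area z\<close>: indices from
  \<open>m\<close> on differ from the mean by at least \<open>pi * gap * |z|\<close>, while the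
  variance is \<open>pi |z|^2\<close>. The modulus of \<open>z\<close> drops out of the
  quotient.\<close>

lemma tail_mass_le:
 assumes m: "pi * y^2 <= real m" and gap: "0 < gap" "cmod z + gap <= y" and z: "z ~= 0" shows "1 - head_mass m z <= 1 / (pi * gap^2)"
proof -
 let ?a = "pi * gap * cmod z"
 let ?b = "1 - head_mass m z"
 define l where "l = area z"
 define p where "p n = (cmod (ucoef z n))^2" for n
 define q where "q n = (real n - l)^2 * p n" for n
 have q: "q sums l" unfolding q_def p_def l_def by (rule ucoef_variance_sums)
 have le: "?a^2 * p (n + m) <= q (n + m)" for n
 proof -
  have "0 <= y" using gap norm_ge_zero[of z] by linarith
  hence "gap * cmod z <= (y - cmod z) * (y + cmod z)" using gap by (intro mult_mono) auto
  also have "... = y^2 - (cmod z)^2" by (simp add: power2 alg_simps)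
  finally have "pi * (gap * cmod z) <= pi * (y^2 - (cmod z)^2)" by simp
  also have "... <= real (n + m) - l" using m by (simp add: l_def right_diff_distrib)
  finally have "?a^2 <= (real (n + m) - l)^2" using gap by (intro power_mono) auto
  thus ?thesis unfolding q_def by (intro mult_right_mono) (auto simp: p_def)
 qed
 have sp: "(%n. p (n + m)) sums ?b" unfolding p_def by (rule tail_mass_sums)
 have "?a^2 * ?b = (\<Sum>n. ?a^2 * p (n + m))"
  using sums_mult[OF sp] sums_unique by auto
 also have "... <= (\<Sum>n. q (n + m))"
  using sums_summable[OF sums_mult[OF sp]] q by (intro suminf_le le) (auto simp: sums_iff)
 also have "... <= l"
 proof -
  have "l = (\<Sum>n. q (n + m)) + (\<Sum>n<m. q n)" using q suminf_split_initial_segment[of q m] by (simp add: sums_iff)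
  moreover have "0 <= (\<Sum>n<m. q n)" by (intro sum_nonneg) (auto simp: q_def p_def)
  ultimately show ?thesis by simp
 qed
 finally have "?a^2 * ?b <= area z" by (simp add: l_def)
 hence "(area z) * (?b * (pi * gap^2)) <= (area z) * 1" by (simp add: power2 mult_ac)
 hence "?b * (pi * gap^2) <= 1" using z by simp
 thus ?thesis using gap by (simp add: field_simps)
qed

text \<open>The same Chebyshev estimate on the lower side, for a point far outside the radius
  \<open>y\<close>.\<close>

lemma head_mass_le_far:
 assumes m: "!!n. n < m ==> real n <= pi * y^2" and gap: "0 < gap" "0 <= y" "y + gap <= cmod z" shows "head_mass m z <= 1 / (pi * gap^2)"
proof -
 let ?a = "pi * gap * cmod z"
 define l where "l = area z"
 define p where "p n = (cmod (ucoef z n))^2" for n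
 define q where "q n = (real n - l)^2 * p n" for n
 have z: "cmod z > 0" using gap by auto
 have q: "q sums l" unfolding q_def p_def l_def by (rule ucoef_variance_sums)
 have le: "?a^2 * p n <= q n" if n: "n < m" for n
 proof -
  have "gap * cmod z <= (cmod z - y) * (cmod z + y)" using gap by (intro mult_mono) auto
  also have "... = (cmod z)^2 - y^2" by (simp add: power2 alg_simps)
  finally have "pi * (gap * cmod z) <= pi * ((cmod z)^2 - y^2)" by simp
  also have "... <= l - real n" using m[OF n] by (simp add: l_def right_diff_distrib)
  finally have "?a^2 <= (l - real n)^2" using gap by (intro power_mono) auto
  thus ?thesis unfolding q_def power2_commute[of l] by (intro mult_right_mono) (auto simp: p_def)
 qed
 have "?a^2 * head_mass m z = (\<Sum>n<m. ?a^2 * p n)"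
  unfolding head_mass_def p_def by (rule sum_distrib_left)
 also have "... <= (\<Sum>n<m. q n)" by (intro sum_mono le) auto
 also have "... <= l"
 proof -
  have "(\<Sum>n<m. q n) <= suminf q" by (rule sum_le_suminf[OF sums_summable[OF q]]) (auto simp: q_def p_def)
  thus ?thesis using sums_unique[OF q] by simp
 qed
 finally have "(area z) * (head_mass m z * (pi * gap^2)) <= (area z) * 1" by (simp add: l_def power2 mult_ac)
 hence "head_mass m z * (pi * gap^2) <= 1" using z by simp
 thus ?thesis using gap by (simp add: field_simps)
qed

text \<open>The discarded part has deviation \<open>sqrt x\<close>, and passing to logarithms costs
  another square root. \<open>2 <= gap\<close> keeps the deviation of the retained part at least
  \<open>1/2\<close>.\<close>

lemma small_mass:
 assumes gap: "2 <= gap" and x: "x <= 1 / (pi * gap^2)" "0 <= x" shows "sqrt (sqrt x) <= 1 / sqrt gap" "1/2 <= sqrt (1 - x)"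
proof -
 have g2: "4 <= gap^2" using power_mono[of 2 gap 2] gap by simp
 have "1 / (pi * gap^2) <= 1 / (1 * gap^2)" using pi_gt3 gap(1) by (intro divide_left_mono mult_right_mono) auto
 hence x': "x <= 1 / gap^2" using x by simp
 have "sqrt x <= sqrt (1 / gap^2)" using x' by auto
 also have "... = 1 / gap" using gap by (simp add: real_sqrt_divide)
 finally have "sqrt (sqrt x) <= sqrt (1 / gap)" by simp
 thus "sqrt (sqrt x) <= 1 / sqrt gap" by (simp add: real_sqrt_divide)
 have "1 / gap^2 <= 1 / 4" using g2 by (intro divide_left_mono) auto
 hence "(1/2)^2 <= 1 - x" using x' by (simp add: power2)
 thus "1/2 <= sqrt (1 - x)" by (rule real_le_rsqrt)
qed

lemma mom4_ln_gauss: "is_gauss al X ==> 1/2 <= al ==> al <= 1 ==> mom4 (%w. lnc (X w)) ln4_bound"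
 using is_gauss_ln4[of al X] by (intro mom4I) (auto simp: is_gauss_def)

lemma mom4_ln_NF: "mom4 (%w. lnc (NF w z)) ln4_bound"
 by (rule mom4_ln_gauss[OF is_gauss_NF]) auto

lemma measurable_NF1 [measurable]: "(%w. NF w z) \<in> BM M" unfolding NF_def by simp
lemma measurable_NFhead1 [measurable]: "(%w. NFhead m w z) \<in> BM M" unfolding NFhead_def by auto
lemma measurable_NFtail1 [measurable]: "(%w. NFtail m w z) \<in> BM M" unfolding NFtail_def by simp

text \<open>For points inside radius \<open>y - gap\<close> the discarded tail is a Gaussian whose
  variance is a Poisson tail. At \<open>z = 0\<close> head and full value agree.\<close>

lemma NFhead_approx:
 assumes m: "pi * y^2 <= real m" and gap: "2 <= gap" "cmod z + gap <= y" shows "mom4 (%w. lnc (NFhead m w z)) ln4_bound"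
  and "mom4 (%w. lnc (NF w z) - lnc (NFhead m w z)) (ln_diff_const / sqrt gap)"
proof -
 let ?a = "%w. lnc (NF w z) - lnc (NFhead m w z)"
 let ?b = "ln_diff_const / sqrt gap"
 let ?c = "%w. lnc (NFhead m w z)"
 let ?e = "%w. lnc (NF w z) - lnc (NFhead m w z)"
 have "y > 0" using gap norm_ge_zero[of z] by linarith
 hence "0 < pi * y^2" by simp
 hence "0 < real m" using m by simp
 hence m0: "0 < m" by simp
 have H: "is_gauss (sqrt (head_mass m z)) (%w. NFhead m w z)" by (rule is_gauss_NFhead[OF m0])
 have "mom4 ?c ln4_bound & mom4 ?a ?b"
 proof (cases "z = 0")
  case True
  have u: "ucoef z n = (if n = 0 then 1 else 0)" for n using True by (auto simp: ucoef_def gwt_def)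
  have "NFhead m w z = a 0 w" "NF w z = a 0 w" for w
   unfolding NFhead_def NF_def coef_def using m0 suminf_finite[of "{0}" "%n. ucoef z n * a n w"]
   by (auto simp: u if_distrib[of "%x. x * _"] cong: if_cong)
  thus ?thesis using mom4_ln_NF[of z] mom4_const[of 0 "ln_diff_const / sqrt gap"] ln_diff_const_nonneg gap by simp
 next
  case False
  define x where "x = 1 - head_mass m z"
  let ?d = "ln_diff_const * sqrt (sqrt x)"
  have x0: "0 < x" unfolding x_def sums_unique[OF tail_mass_sums]
   by (rule suminf_pos) (use tail_mass_sums[of z m] ucoef_nonzero[OF False] in "auto simp: sums_iff")
  have x1: "x <= 1 / (pi * gap^2)" unfolding x_def by (rule tail_mass_le[OF m _ gap(2) False]) (use gap in auto)
  note sm = small_mass[OF gap(1) x1 less_imp_le[OF x0]]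
  have al: "1/2 <= sqrt (head_mass m z)" using sm(2) by (simp add: x_def)
  have "is_gauss (sqrt x) (%w. NF w z - NFhead m w z)" unfolding x_def
  proof (rule is_gauss_cong_AE[OF is_gauss_NFtail[OF False, of m]])
   show "AE w in M. NFtail m w z = NF w z - NFhead m w z"
    using AE_good by eventually_elim (simp add: NF_split[of _ z m])
  qed measurable
  from is_gauss_ln_diff4[OF is_gauss_NF _ H al this] x0
  have "integrable M (%w. ?e w ^ 4)"
   "(EE w. ?e w ^ 4) <= ?d" by auto
  moreover have "?d <= ln_diff_const * (1 / sqrt gap)" by (rule mult_left_mono[OF sm(1) ln_diff_const_nonneg])
  ultimately have "mom4 ?a ?b" by (intro mom4I) auto
  moreover have "mom4 ?c ln4_bound" by (rule mom4_ln_gauss[OF H al]) (simp add: head_mass_le)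
  ultimately show ?thesis by simp
 qed
 thus "mom4 ?c ln4_bound" and "mom4 ?a ?b" by auto
qed

lemma NFtail_approx:
 assumes m: "!!n. n < m ==> real n <= pi * y^2" "0 < m" and gap: "2 <= gap" "0 <= y" "y + gap <= cmod z"
 shows "mom4 (%w. lnc (NFtail m w z)) ln4_bound" and "mom4 (%w. lnc (NF w z) - lnc (NFtail m w z)) (ln_diff_const / sqrt gap)"
proof -
 let ?b = "%w. lnc (NF w z) - lnc (NFtail m w z)"
 have z: "z ~= 0" using gap by auto
 define x where "x = head_mass m z"
 let ?a = "ln_diff_const * sqrt (sqrt x)"
 have x0: "0 < x" unfolding x_def head_mass_def using m(2) ucoef_nonzero[OF z] by (intro sum_pos) (auto simp: lessThan_empty_iff)
 have x1: "x <= 1 / (pi * gap^2)" unfolding x_def by (rule head_mass_le_far[OF m(1) _ gap(2,3)]) (use gap in auto)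
 note sm = small_mass[OF gap(1) x1 less_imp_le[OF x0]]
 have T: "is_gauss (sqrt (1 - x)) (%w. NFtail m w z)" unfolding x_def by (rule is_gauss_NFtail[OF z])
 show "mom4 (%w. lnc (NFtail m w z)) ln4_bound" by (rule mom4_ln_gauss[OF T sm(2)]) (use x0 in auto)
 have "is_gauss (sqrt x) (%w. NF w z - NFtail m w z)" unfolding x_def
 proof (rule is_gauss_cong_AE[OF is_gauss_NFhead[OF m(2), of z]])
  show "AE w in M. NFhead m w z = NF w z - NFtail m w z"
   using AE_good by eventually_elim (simp add: NF_split[of _ z m])
 qed measurable
 from is_gauss_ln_diff4[OF is_gauss_NF _ T sm(2) this] x0
 have "integrable M (%w. ?b w ^ 4)"
  "(EE w. ?b w ^ 4) <= ?a" by auto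
 moreover have "?a <= ln_diff_const * (1 / sqrt gap)" by (rule mult_left_mono[OF sm(1) ln_diff_const_nonneg])
 ultimately show "mom4 (%w. lnc (NF w z) - lnc (NFtail m w z)) (ln_diff_const / sqrt gap)" by (intro mom4I) auto
qed

definition ring :: "real => real => 'w => complex => real" where
 "ring R1 R2 w t = ring_mean R1 R2 (NF w) t"

definition ring_const :: "real => real => real" where
 "ring_const R1 R2 = max 1 (8 * ((pi * (R2^2 - R1^2) / 2) ^ 4 + 16 * ln4_bound))"

lemma ring_const_ge_1: "1 <= ring_const R1 R2" by (simp add: ring_const_def)

lemma measurable_ring [measurable]: "(%p. ring R1 R2 (fst p) (snd p)) \<in> BM (M >< borel)"
 unfolding ring_def by auto

lemma mom4_ring:
 assumes R: "0 < R1" "R1 < R2" shows "mom4 (%w. ring R1 R2 w t) (ring_const R1 R2)"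
proof -
 have "mom4 (%w. ring_mean R1 R2 (NF w) t) (8 * ((pi * (R2^2 - R1^2) / 2) ^ 4 + 16 * ln4_bound))"
  by (rule ring_mean_mom4) (use R ln4_bound_nonneg mom4_ln_NF in auto)
 thus ?thesis unfolding ring_def by (rule mom4_mono) (simp add: ring_const_def)
qed

text \<open>The circle means are rewritten as measurable functions \<open>kh\<close> and
  \<open>kt\<close> of disjoint blocks of coefficients, which are independent.\<close>

lemma indep_head_tail:
 fixes R1 R2 :: real and m :: nat
 defines "H \<equiv> (%w s. ring_mean R1 R2 (NFhead m w) s)" and "T \<equiv> (%w s. ring_mean R1 R2 (NFtail m w) s)"
 assumes i: "integrable M (%w. H w s1 * H w s2)" "integrable M (%w. T w t1 * T w t2)"
 shows "(EE w. H w s1 * H w s2 * T w t1 * T w t2) = (EE w. H w s1 * H w s2) * (EE w. T w t1 * T w t2)"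
proof -
 let ?A = "{..<m}" and ?B = "{m..}"
 let ?S = "PiM ?A (%_. borel :: complex measure)" and ?T = "PiM ?B (%_. borel :: complex measure)"
 let ?a = "%w. restrict (coef w) ?A"
 let ?b = "%w. restrict (coef w) ?B"
 have ind: "indep_var ?S ?a ?T ?b"
  unfolding coef_def by (rule indep_var_restrict[OF indep]) auto
 define kh where "kh x s = ring_mean R1 R2 (%z. \<Sum>n<m. ucoef z n * x n) s" for x s
 define kt where "kt x s = ring_mean R1 R2 (%z. \<Sum>n. ucoef z (n + m) * x (n + m)) s" for x s
 have hm: "(%p. \<Sum>n<m. ucoef (snd p) n * fst p n) \<in> BM (?S >< borel)"
 by simp
 have tm: "(%p. \<Sum>n. ucoef (snd p) (n + m) * fst p (n + m)) \<in> BM (?T >< borel)"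
 by simp
 have khm: "(%x. kh x s) \<in> BM ?S" for s
  using measurable_compose[OF measurable_Pair2' measurable_ring_mean[of "%x z. \<Sum>n<m. ucoef z n * x n" ?S R1 R2, OF hm], of s] by (simp add: kh_def)
 have ktm: "(%x. kt x s) \<in> BM ?T" for s
  using measurable_compose[OF measurable_Pair2' measurable_ring_mean[of "%x z. \<Sum>n. ucoef z (n + m) * x (n + m)" ?T R1 R2, OF tm], of s] by (simp add: kt_def)
 have H: "H w s = kh (restrict (coef w) ?A) s" for w s unfolding H_def kh_def NFhead_def by simp
 have T: "T w s = kt (restrict (coef w) ?B) s" for w s unfolding T_def kt_def NFtail_def by simp
 have "indep_var borel ((%x. kh x s1 * kh x s2) \<circ> ?a) borel ((%x. kt x t1 * kt x t2) \<circ> ?b)"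
  by (rule indep_var_compose[OF ind]) (use khm ktm in measurable)
 hence "indep_var borel (%w. H w s1 * H w s2) borel (%w. T w t1 * T w t2)" by (simp add: o_def H T)
 from indep_var_lebesgue_integral[OF this i] show ?thesis by (simp add: mult.assoc)
qed

text \<open>A single cut in the coefficient index separates the two pairs: the rings around
  \<open>s\<close> and \<open>s + c\<close> are replaced by heads, those around \<open>t\<close> and
  \<open>t + c\<close> by tails, and these are exactly independent.\<close>

lemma ring_decorrelation:
 assumes R: "0 < R1" "R1 < R2" and D: "8 <= D" "4 * (R2 + cmod c) <= D" and st: "cmod s + D <= cmod t"
  and de: "0 < de" "32 * ln_diff_const / sqrt D <= de ^ 4"
 shows "abs ((EE w. ring R1 R2 w s * ring R1 R2 w (s + c) * ring R1 R2 w t * ring R1 R2 w (t + c))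
   - (EE w. ring R1 R2 w s * ring R1 R2 w (s + c)) * (EE w. ring R1 R2 w t * ring R1 R2 w (t + c)))
   <= de * (1 + 3 * ring_const R1 R2) * (1 + ring_const R1 R2)"
proof -
 let ?f = "8 * ((pi * (R2^2 - R1^2) / 2) ^ 4 + 16 * ln4_bound)"
 let ?g = "%z u. cmod (z - u) = R1 \<or> cmod (z - u) = R2"
 define C where "C = ring_const R1 R2"
 \<comment> \<open>The cut lies \<open>D / 2\<close> beyond \<open>|s|\<close>. The radius of the
   rings and the shift \<open>c\<close> use up at most \<open>D / 4\<close>, which leaves a gap of
   \<open>D / 4\<close> on either side.\<close>
 define y where "y = cmod s + D / 2"
 define m where "m = nat \<lceil>pi * y^2\<rceil>"
 let ?b = "%u. mom4 (%w. ring R1 R2 w u - ring_mean R1 R2 (NFhead m w) u) (de ^ 4)"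
 let ?c = "%u. mom4 (%w. ring R1 R2 w u - ring_mean R1 R2 (NFtail m w) u) (de ^ 4)"
 let ?d = "%u. %w. ring_mean R1 R2 (NFhead m w) u"
 let ?e = "%u. %w. ring_mean R1 R2 (NFtail m w) u"
 define gp where "gp = D / 4"
 let ?a = "ln_diff_const / sqrt gp"
 have y: "0 < y" using D by (simp add: y_def add_nonneg_pos)
 have yp: "0 < pi * y^2" using y by simp
 have m: "pi * y^2 <= real m" "0 < m" "!!n. n < m ==> real n <= pi * y^2" unfolding m_def using yp by linarith+
 have gp: "2 <= gp" using D by (simp add: gp_def)
 have C1: "1 <= C" unfolding C_def by (rule ring_const_ge_1)
 \<comment> \<open>The 32 in the hypothesis is the 16 of the circle means times the 2 in
   \<open>sqrt D = 2 * sqrt gp\<close>.\<close>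
 have e: "16 * ?a <= de ^ 4"
 proof -
  have "sqrt D = 2 * sqrt gp" by (simp add: gp_def real_sqrt_divide)
  hence "32 * ln_diff_const / sqrt D = 16 * ?a" by simp
  thus ?thesis using de(2) by simp
 qed
 have e0: "0 <= ln_diff_const / sqrt gp" using ln_diff_const_nonneg gp by simp
 have near: "cmod z + gp <= y" if z: "?g z u" and u: "u = s \<or> u = s + c" for z u
 proof -
  have "cmod z <= cmod u + cmod (z - u)" by (metis add.commute diff_add_cancel norm_triangle_ineq)
  moreover have "cmod u <= cmod s + cmod c" using u norm_triangle_ineq[of s c] by auto
  moreover have "cmod (z - u) <= R2" using z R by auto
  ultimately show ?thesis using D by (simp add: y_def gp_def)
 qed
 have far: "y + gp <= cmod z" if z: "?g z u" and u: "u = t \<or> u = t + c" for z u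
 proof -
  have "cmod u <= cmod z + cmod (z - u)" by (metis add.commute diff_add_cancel norm_minus_commute norm_triangle_ineq)
  moreover have "cmod t <= cmod u + cmod c" using u norm_triangle_ineq[of "t + c" "- c"] by auto
  moreover have "cmod (z - u) <= R2" using z R by auto
  ultimately show ?thesis using D st by (simp add: y_def gp_def)
 qed
 have R2: "0 < R2" using R by simp
 have Hm: "mom4 (?d u) C" "?b u"
  if u: "u = s \<or> u = s + c" for u
 proof -
  have "mom4 (?d u) ?f"
   by (rule ring_mean_mom4(1)[OF measurable_NFhead ln4_bound_nonneg _ R(1) R2]) (rule NFhead_approx(1)[OF m(1) gp near[OF _ u]])
  thus "mom4 (?d u) C" by (rule mom4_mono) (simp add: C_def ring_const_def)
  have "mom4 (%w. ring_mean R1 R2 (NF w) u - ring_mean R1 R2 (NFhead m w) u) (16 * ?a)"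
   by (rule ring_mean_diff_mom4[OF measurable_NF measurable_NFhead ln4_bound_nonneg mom4_ln_NF _ e0 _ R(1) R2])
     (rule NFhead_approx[OF m(1) gp near[OF _ u]], assumption)+
  thus "?b u" unfolding ring_def by (rule mom4_mono) (rule e)
 qed
 have Tm: "mom4 (?e u) C" "?c u"
  if u: "u = t \<or> u = t + c" for u
 proof -
  have "mom4 (?e u) ?f"
   by (rule ring_mean_mom4(1)[OF measurable_NFtail ln4_bound_nonneg _ R(1) R2]) (rule NFtail_approx(1)[OF m(3,2) gp less_imp_le[OF y] far[OF _ u]])
  thus "mom4 (?e u) C" by (rule mom4_mono) (simp add: C_def ring_const_def)
  have "mom4 (%w. ring_mean R1 R2 (NF w) u - ring_mean R1 R2 (NFtail m w) u) (16 * ?a)"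
   by (rule ring_mean_diff_mom4[OF measurable_NF measurable_NFtail ln4_bound_nonneg mom4_ln_NF _ e0 _ R(1) R2])
     (rule NFtail_approx[OF m(3,2) gp less_imp_le[OF y] far[OF _ u]], assumption+)+
  thus "?c u" unfolding ring_def by (rule mom4_mono) (rule e)
 qed
 have one: "mom4 (%_. 1) C" using C1 by (intro mom4_const) simp
 have C0: "0 <= C" using C1 by simp
 have V: "mom4 (%w. ring R1 R2 w u) C" for u unfolding C_def by (rule mom4_ring[OF R])
 have i: "integrable M (%w. A w * B w)" if "mom4 A C" "mom4 B C" for A B using mom4_prod(1)[OF that one one C0 C0 C0 C0] by simp
 show ?thesis unfolding C_def[symmetric] by (rule decorrelation_transfer[OF V V V V Hm(1) Hm(1) Tm(1) Tm(1) Hm(2) Hm(2) Tm(2) Tm(2) C1 de(1)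
    indep_head_tail[OF i[OF Hm(1) Hm(1)] i[OF Tm(1) Tm(1)]]]) auto
qed

end

section \<open>A law of large numbers for products of ring averages\<close>

text \<open>The expected product of two ring averages with centres at difference \<open>c\<close>:
  one signed covariance kernel for each choice of the two radii. The one-point terms have cancelled
  because all normalized values have the same law.\<close>

definition ring_corr :: "real => real => complex => real" where
 "ring_corr R1 R2 c = (MEAN th ph. (pi * (R2^2 - R1^2) / 2)^2
   + (ln_kernel (of_real R2 * circ th - of_real R2 * circ ph - c) - ln_kernel (of_real R2 * circ th - of_real R1 * circ ph - c)
   - ln_kernel (of_real R1 * circ th - of_real R2 * circ ph - c) + ln_kernel (of_real R1 * circ th - of_real R1 * circ ph - c)))"

definition ball_measure :: "real => complex measure" where
 "ball_measure R = density lborel (indicator (ball 0 R))"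

lemma borel_ball_complex [measurable]: "ball (c::complex) r \<in> sets borel" by simp

lemma sets_ball_measure [measurable_cong, simp]: "sets (ball_measure R) = sets borel" by (simp add: ball_measure_def)
lemma space_ball_measure [simp]: "space (ball_measure R) = UNIV" by (simp add: ball_measure_def)

lemma emeasure_ball_measure: "A \<in> sets borel ==> emeasure (ball_measure R) A = emeasure lborel (A \<inter> ball 0 R)"
 unfolding ball_measure_def by (subst emeasure_density) (auto simp: indicator_inter_arith[symmetric] Int_commute)

lemma emeasure_ball_measure_UNIV: "0 <= R ==> emeasure (ball_measure R) UNIV = ennreal (pi * R^2)"
 by (simp add: emeasure_ball_measure emeasure_ball_complex)

lemma finite_ball_measure: "0 <= R ==> finite_measure (ball_measure R)"
 by (rule finite_measureI) (simp add: emeasure_ball_measure_UNIV)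

lemma AE_ball_measure: "AE t in ball_measure R. cmod t < R"
 unfolding ball_measure_def by (subst AE_density) (auto simp: indicator_def)

lemma integral_ball_measure:
 fixes f :: "complex => real"
 assumes [measurable]: "f \<in> BM borel" shows "(\<integral>t. f t \<partial>ball_measure R) = (LBINT t. indicator (ball 0 R) t * f t)"
  "integrable (ball_measure R) f <-> integrable lborel (%t. indicator (ball 0 R) t * f t)"
proof -
 have d: "ball_measure R = density lborel (%t. ennreal (indicator (ball 0 R) t))" by (simp add: ball_measure_def ennreal_indicator)
 show "(\<integral>t. f t \<partial>ball_measure R) = (LBINT t. indicator (ball 0 R) t * f t)" unfolding d by (subst integral_density) auto
 show "integrable (ball_measure R) f <-> integrable lborel (%t. indicator (ball 0 R) t * f t)"
  unfolding d by (subst integrable_density) auto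
qed

text \<open>This is the region where decorrelation gives nothing; its area is of order
  \<open>D * R\<close>, small against \<open>R^2\<close>.\<close>

lemma measure_annulus:
 assumes R: "0 <= R" and D: "0 <= D" and s: "cmod s < R"
 shows "measure (ball_measure R) {t. abs (cmod t - cmod s) < D} <= 4 * pi * D * (R + D)"
proof -
 define r where "r = cmod s"
 define q where "q = max 0 (r - D)"
 let ?a = "emeasure lborel (ball 0 (r + D) - ball (0::complex) q)"
 let ?b = "(r + D)^2 - q^2"
 have r: "0 <= r" "r <= R" using s by (auto simp: r_def)
 have q: "0 <= q" "q <= r + D" using r D by (auto simp: q_def)
 have "emeasure (ball_measure R) {t. abs (cmod t - cmod s) < D} <= ?a"
 proof (subst emeasure_ball_measure)
  show "{t::complex. abs (cmod t - cmod s) < D} \<in> sets borel" by simp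
  show "emeasure lborel ({t. abs (cmod t - cmod s) < D} \<inter> ball 0 R) <= ?a"
   by (rule emeasure_mono) (auto simp: r_def q_def max_def)
 qed
 also have "... = ennreal (pi * (r + D)^2) - ennreal (pi * q^2)" using q by (subst emeasure_Diff) (auto simp: emeasure_ball_complex)
 also have "... = ennreal (pi * (r + D)^2 - pi * q^2)" by (rule ennreal_minus) simp
 also have "... <= ennreal (4 * pi * D * (R + D))"
 proof (rule ennreal_leI)
  have "?b <= 4 * D * (R + D)"
  proof (cases "r \<ge> D")
   case True
   hence "?b = 4 * D * r" by (simp add: q_def power2 alg_simps)
   also have "... <= 4 * D * (R + D)" using r D by (intro mult_left_mono) auto
   finally show ?thesis .
  next
   case False
   hence "?b = (r + D) * (r + D)" by (simp add: q_def power2)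
   also have "... <= (4 * D) * (R + D)" using r False by (intro mult_mono) auto
   finally show ?thesis .
  qed
  hence "pi * ((r + D)^2 - q^2) <= pi * (4 * D * (R + D))" by simp
  thus "pi * (r + D)^2 - pi * q^2 <= 4 * pi * D * (R + D)" by (simp add: alg_simps)
 qed
 finally show ?thesis unfolding measure_def using R D by (intro enn2real_leI) auto
qed

context prob_space
begin

text \<open>The square of the integral is a double integral, and uniformly bounded second moments
  over a finite measure justify Fubini.\<close>

lemma second_moment_integral:
 fixes W :: "'a => complex => real"
 assumes W[measurable]: "(%p. W (fst p) (snd p)) \<in> BM (M >< borel)"
  and N: "finite_measure N" and sN[measurable_cong, simp]: "sets N = sets (borel :: complex measure)"
  and K: "!!t. integrable M (%w. (W w t)^2)" "!!t. (EE w. (W w t)^2) <= K" shows "integrable M (%w. (\<integral>t. W w t \<partial>N)^2)"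
  and "(EE w. (\<integral>t. W w t \<partial>N)^2) = (\<integral>s. \<integral>t. (EE w. W w s * W w t) \<partial>N \<partial>N)"
  and "AE w in M. integrable N (W w)" and "!!s t. abs (EE w. W w s * W w t) <= K"
  and "(%p. EE w. W w (fst p) * W w (snd p)) \<in> BM (N >< N)"
proof -
 let ?a = "%w. \<integral>p. W w (fst p) * W w (snd p) \<partial>(N >< N)"
 let ?b = "%w. \<integral>t. W w t \<partial>N"
 let ?c = "\<integral>s. \<integral>t. (EE w. W w s * W w t) \<partial>N \<partial>N"
 let ?d = "%x. W (snd x) (fst (fst x)) * W (snd x) (snd (fst x))"
 let ?e = "%p w. W (snd (p, w)) (fst (fst (p, w))) * W (snd (p, w)) (snd (fst (p, w)))"
 let ?f = "(N >< N) >< M"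
 let ?g = "%x. W (snd x) (fst x)"
 interpret N: finite_measure N by fact
 interpret NN: pair_sigma_finite N N ..
 interpret NN: finite_measure "N >< N" by (intro finite_measure_pair_measure N)
 interpret P: pair_sigma_finite "N >< N" M ..
 interpret Q: pair_sigma_finite N M ..
 note [measurable] = measurable_app2'[where f=W, OF W]
 have ab: "abs (x * y) <= (x^2 + y^2) / 2" for x y :: real
 proof -
  have "2 * (abs x * abs y) <= abs x^2 + abs y^2" using sum_squares_bound[of "abs x" "abs y"] by simp
  thus ?thesis by (simp add: abs_mult)
 qed
 have i: "integrable M (%w. W w s * W w t)" for s t
 proof (rule integrable_dom)
  show "integrable M (%w. ((W w s)^2 + (W w t)^2) / 2)" using K(1) by simp
  show "AE w in M. norm (W w s * W w t) <= norm (((W w s)^2 + (W w t)^2) / 2)" using ab by auto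
 qed measurable
 have b: "(EE w. abs (W w s * W w t)) <= K" for s t
 proof -
  have "(EE w. abs (W w s * W w t)) <= (EE w. ((W w s)^2 + (W w t)^2) / 2)"
   using K(1) by (intro integral_mono integrable_abs i ab) auto
  also have "... <= K" using K(1) K(2)[of s] K(2)[of t] by simp
  finally show ?thesis .
 qed
 show "abs (EE w. W w s * W w t) <= K" for s t using integral_abs_bound[of M "%w. W w s * W w t"] b[of s t] by linarith
 have fm: "?d \<in> BM ?f" by simp
 show "(%p. EE w. W w (fst p) * W w (snd p)) \<in> BM (N >< N)" by simp
 have f: "integrable ?f ?d"
 proof (rule P.Fubini_integrable[OF fm])
  show "AE p in N >< N. integrable M (%w. W (snd (p, w)) (fst (fst (p, w))) * W (snd (p, w)) (snd (fst (p, w))))" using i by simp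
  show "integrable (N >< N) (%p. EE w. norm (?e p w))"
  proof (rule NN.integrable_const_bound[where B=K])
   show "AE p in N >< N. norm (EE w. norm (?e p w)) <= K"
    using b by auto
  qed measurable
 qed
 hence f': "integrable ?f (%(p, w). W w (fst p) * W w (snd p))" by (simp add: split_beta')
 have sq: "AE w in M. ?a w = ?b w^2"
  using P.AE_integrable_snd[OF f']
 proof eventually_elim
  case (elim w)
  have "?a w = (\<integral>s. \<integral>t. W w s * W w t \<partial>N \<partial>N)"
   using NN.integral_fst'[OF elim] by simp
  thus ?case by (simp add: power2)
 qed
 have Wm: "(%w. \<integral>t. W w t \<partial>N) \<in> BM M" by simp
 show "integrable M (%w. ?b w^2)"
  by (rule integrable_cong_AE_imp[OF P.integrable_snd[OF f'] _ sq]) (use Wm in measurable)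
 have "(EE w. ?b w^2) = (EE w. ?a w)"
  by (rule integral_cong_AE) (use sq Wm in "auto elim!: ")
 also have "... = (\<integral>p. (EE w. W w (fst p) * W w (snd p)) \<partial>(N >< N))" by (rule P.Fubini_integral[OF f'])
 also have "... = ?c"
  using NN.integral_fst'[OF P.integrable_fst[OF f']] by simp
 finally show "(EE w. ?b w^2) = ?c" .
 have i1: "integrable M (%w. W w t)" for t
 proof (rule integrable_dom)
  show "integrable M (%w. (1 + (W w t)^2) / 2)" using K(1) by simp
  show "AE w in M. norm (W w t) <= norm ((1 + (W w t)^2) / 2)" using ab[of 1] by simp
 qed measurable
 have "integrable (N >< M) ?g"
 proof (rule Q.Fubini_integrable)
  show "?g \<in> BM (N >< M)" by simp
  show "AE t in N. integrable M (%w. W (snd (t, w)) (fst (t, w)))" using i1 by simp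
  show "integrable N (%t. EE w. norm (W (snd (t, w)) (fst (t, w))))"
  proof (rule N.integrable_const_bound[where B="(1 + K) / 2"])
   have "(EE w. abs (W w t)) <= (EE w. (1 + (W w t)^2) / 2)" for t using K(1) i1 ab[of 1] by (intro integral_mono) auto
   also have "(EE w. (1 + (W w t)^2) / 2) <= (1 + K) / 2" for t using K by (simp add: prob_space)
   finally show "AE t in N. norm (EE w. norm (W (snd (t, w)) (fst (t, w)))) <= (1 + K) / 2" by simp
  qed measurable
 qed
 hence "integrable (N >< M) (%(t, w). W w t)" by (simp add: split_beta')
 from Q.AE_integrable_snd[OF this] show "AE w in M. integrable N (W w)" by simp
qed

text \<open>For each point, partners with well separated modulus contribute at most
  \<open>\<epsilon>\<close> per unit area; the others fill an annulus and are bounded by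
  \<open>K\<close>.\<close>

lemma second_moment_ball:
 fixes W :: "'a => complex => real"
 assumes W[measurable]: "(%p. W (fst p) (snd p)) \<in> BM (M >< borel)"
  and K: "!!t. integrable M (%w. (W w t)^2)" "!!t. (EE w. (W w t)^2) <= K" and R: "0 < R" and D: "0 <= D" and \<epsilon>: "0 <= \<epsilon>"
  and far: "!!s t. D <= abs (cmod t - cmod s) ==> abs (EE w. W w s * W w t) <= \<epsilon>"
 shows "(EE w. (\<integral>t. W w t \<partial>ball_measure R)^2) <= (pi * R^2) * (\<epsilon> * (pi * R^2) + K * (4 * pi * D * (R + D)))"
proof -
 let ?N = "ball_measure R"
 interpret N: finite_measure ?N using R by (intro finite_ball_measure) simp
 note sm = second_moment_integral[OF W finite_ball_measure[OF less_imp_le[OF R]] sets_ball_measure K]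
 define F where "F s t = (EE w. W w s * W w t)" for s t
 let ?a = "%s. \<integral>t. F s t \<partial>?N"
 have Fm[measurable]: "(%p. F (fst p) (snd p)) \<in> BM (?N >< ?N)" unfolding F_def by (rule sm(5))
 have K0: "0 <= K" using K(2)[of 0] by (rule order.trans[rotated]) (intro integral_nonneg_AE AE_I2, simp)
 have mN: "measure ?N (space ?N) = pi * R^2" using emeasure_ball_measure_UNIV[of R] R by (simp add: measure_def)
 define b where "b = \<epsilon> * (pi * R^2) + K * (4 * pi * D * (R + D))"
 have inner: "abs (?a s) <= b" if s: "cmod s < R" for s
 proof -
  let ?b = "%t. cmod t - cmod s"
  have ii: "integrable ?N (%t. \<epsilon> + K * indicator {t. abs (?b t) < D} t)"
   by (intro integrable_plus integrable_mult_right) (auto simp: N.emeasure_eq_measure)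
  have le: "norm (F s t) <= \<epsilon> + K * indicator {t. abs (?b t) < D} t" for t
   using far[of t s] sm(4)[of s t] \<epsilon> by (auto simp: F_def indicator_def)
  have "(%t. F s t) \<in> BM ?N" using measurable_compose[OF measurable_Pair1'[of s ?N ?N] Fm] by simp
  hence Fi: "integrable ?N (F s)" by (intro integrable_dom[OF ii]) (use le \<epsilon> K0 in "auto simp: ")
  have "abs (?a s) <= (\<integral>t. norm (F s t) \<partial>?N)" by simp
  also have "... <= (\<integral>t. \<epsilon> + K * indicator {t. abs (?b t) < D} t \<partial>?N)"
   using Fi by (intro integral_mono ii le) auto
  also have "... = \<epsilon> * (pi * R^2) + K * measure ?N {t. abs (?b t) < D}"
   using mN by (subst integral_plus) (auto simp: N.emeasure_eq_measure)
  also have "... <= b" unfolding b_def using R D s K0 by (intro add_left_mono mult_left_mono measure_annulus) auto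
  finally show ?thesis .
 qed
 have Gm: "(%s. \<integral>t. F s t \<partial>?N) \<in> BM ?N" by simp
 have AEb: "AE s in ?N. norm (?a s) <= b" using AE_ball_measure[of R] by eventually_elim (use inner in auto)
 have "(EE w. (\<integral>t. W w t \<partial>?N)^2) = (\<integral>s. (?a s) \<partial>?N)"
  unfolding F_def by (rule sm(2))
 also have "... <= (\<integral>s. b \<partial>?N)"
  by (rule integral_mono_AE[OF N.integrable_const_bound[OF AEb Gm]]) (use AEb in "auto elim!: ")
 also have "... = (pi * R^2) * b" using mN by simp
 finally show ?thesis by (simp add: b_def)
qed

end

context gaussian_sequence
begin

lemma mom4_pair_integrable:
 assumes "mom4 A C" "mom4 B C" "1 <= C" shows "integrable M (%w. A w * B w)" "(EE w. abs (A w * B w)) <= C"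
proof -
 have C0: "0 <= C" using assms by simp
 have one: "mom4 (%_. 1) C" using assms by (intro mom4_const) simp
 show "integrable M (%w. A w * B w)" "(EE w. abs (A w * B w)) <= C"
  using mom4_prod(1,2)[OF assms(1,2) one one C0 C0 C0 C0] by auto
qed

lemma expectation_mult_average:
 assumes X: "mom4 X C" and A[measurable]: "(%p. A (fst p) (snd p)) \<in> BM (M >< borel)"
  and A4: "!!th. mom4 (%w. A w th) C" and C: "1 <= C" shows "(EE w. X w * (MEAN th. A w th)) = (MEAN th. (EE w. X w * A w th))"
proof -
 let ?a = "%x. X (snd x) * A (snd x) (fst x)"
 let ?b = "%th w. X (snd (th, w)) * A (snd (th, w)) (fst (th, w))"
 interpret P: pair_sigma_finite U01 M ..
 have [measurable]: "X \<in> BM M" using mom4D[OF X] C by simp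
 note [measurable] = measurable_app2'[where f=A, OF A]
 have "integrable (U01 >< M) ?a"
 proof (rule P.Fubini_integrable)
  show "?a \<in> BM (U01 >< M)" by simp
  show "AE th in U01. integrable M (%w. X (snd (th, w)) * A (snd (th, w)) (fst (th, w)))" using mom4_pair_integrable(1)[OF X A4 C] by simp
  show "integrable U01 (%th. EE w. norm (?b th w))"
  proof (rule U01.integrable_const_bound[where B=C])
   show "AE th in U01. norm (EE w. norm (?b th w)) <= C"
    using mom4_pair_integrable(2)[OF X A4 C] by auto
  qed measurable
 qed
 hence "integrable (U01 >< M) (%(th, w). X w * A w th)" by (simp add: split_beta')
 from P.Fubini_integral[OF this] show ?thesis by simp
qed

text \<open>The circle means are pulled out of the expectation one after the other. The result is
  independent of \<open>s\<close> because \<open>ln_kernel\<close> sees only differences of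
  points.\<close>

lemma expectation_ring_product:
 assumes R: "0 < R1" "R1 < R2" shows "(EE w. ring R1 R2 w s * ring R1 R2 w (s + c)) = ring_corr R1 R2 c"
proof -
 let ?b = "ln4_bound + ln4_bound"
 let ?e = "%t th. t + of_real R1 * circ th"
 define ka where "ka = pi * (R2^2 - R1^2) / 2"
 let ?d = "8 * (ka ^ 4 + 8 * ?b)"
 define L where "L w z = lnc (NF w z)" for w z
 define A where "A t w th = ka + (L w (t + of_real R2 * circ th) - L w (?e t th))" for t w th
 let ?c = "%th ph. EE w. A s w th * A (s + c) w ph"
 define C where "C = ring_const R1 R2"
 have C1: "1 <= C" unfolding C_def by (rule ring_const_ge_1)
 have Lm4: "mom4 (%w. L w z) ln4_bound" for z unfolding L_def by (rule mom4_ln_NF)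
 note [measurable] = measurable_app2'[where f=NF, OF measurable_NF]
 have Am: "(%p. A t (fst p) (snd p)) \<in> BM (M >< borel)" for t unfolding A_def L_def by auto
 have A4: "mom4 (%w. A t w th) C" for t th
 proof -
  let ?a = "%t. %w. ka + (L w (t + of_real R2 * circ th) + (-1) * L w (t + of_real R1 * circ th))"
  have m: "mom4 (%w. (-1) * L w (?e t th)) ln4_bound" using mom4_mult[OF Lm4 ln4_bound_nonneg, of "-1"] by simp
  have s: "mom4 (%w. L w (t + of_real R2 * circ th) + (-1) * L w (?e t th)) (8 * ?b)"
   by (rule mom4_add[OF Lm4 ln4_bound_nonneg m ln4_bound_nonneg])
  have k: "mom4 (%_. ka) (ka ^ 4)" by (rule mom4_const) simp
  have "mom4 (?a t) ?d"
   by (rule mom4_add[OF k _ s]) (use ln4_bound_nonneg in auto)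
  moreover have "(%w. A t w th) = ?a t" by (simp add: A_def)
  ultimately have "mom4 (%w. A t w th) ?d" by simp
  thus ?thesis by (rule mom4_mono) (simp add: C_def ring_const_def ka_def)
 qed
 have ring: "ring R1 R2 w t = (MEAN th. A t w th)" for w t unfolding ring_def ring_mean_def A_def L_def ka_def ..
 have V4: "mom4 (%w. ring R1 R2 w t) C" for t unfolding C_def by (rule mom4_ring[OF R])
 have "(EE w. ring R1 R2 w s * ring R1 R2 w (s + c)) = (EE w. ring R1 R2 w (s + c) * (MEAN th. A s w th))"
  by (simp add: ring[of _ s] mult.commute)
 also have "... = (MEAN th. (EE w. ring R1 R2 w (s + c) * A s w th))" by (rule expectation_mult_average[OF V4 Am A4 C1])
 also have "... = (MEAN th. (EE w. A s w th * (MEAN ph. A (s + c) w ph)))" by (simp add: ring[of _ "s + c"] mult.commute)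
 also have "... = (MEAN th ph. ?c th ph)" by (intro integral_congr refl expectation_mult_average[OF A4 Am A4 C1])
 also have "... = ring_corr R1 R2 c" unfolding ring_corr_def ka_def[symmetric]
 proof (intro integral_congr refl)
  fix th ph :: real
  define z2 z1 y2 y1 where "z2 = s + of_real R2 * circ th" and "z1 = s + of_real R1 * circ th"
   and "y2 = s + c + of_real R2 * circ ph" and "y1 = s + c + of_real R1 * circ ph"
  have d: "z2 - y2 = of_real R2 * circ th - of_real R2 * circ ph - c" "z2 - y1 = of_real R2 * circ th - of_real R1 * circ ph - c"
   "z1 - y2 = of_real R1 * circ th - of_real R2 * circ ph - c" "z1 - y1 = of_real R1 * circ th - of_real R1 * circ ph - c"
   by (simp_all add: z2_def z1_def y2_def y1_def)
  have Li: "integrable M (%w. L w z)" for z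
   using is_gaussD(1)[OF is_gauss_NF[of z], of "%x. lnc x"] integrable_cgauss_ln(1) by (simp add: L_def)
  have Lv: "(EE w. L w z) = (GAUSS x. lnc x)" for z using is_gaussD(2)[OF is_gauss_NF[of z], of "%x. lnc x"] by (simp add: L_def)
  have LL: "integrable M (%w. L w z * L w y)" "(EE w. L w z * L w y) = ln_kernel (z - y)" for z y
   unfolding L_def by (rule NF_ln_correlation)+
  have "?c th ph
    = (EE w. ka^2 + ka * (L w y2 - L w y1) + ka * (L w z2 - L w z1) + (L w z2 * L w y2 - L w z2 * L w y1 - L w z1 * L w y2 + L w z1 * L w y1))"
   by (simp add: A_def z2_def z1_def y2_def y1_def power2 alg_simps)
  also have "... = ka^2 + (ln_kernel (z2 - y2) - ln_kernel (z2 - y1) - ln_kernel (z1 - y2) + ln_kernel (z1 - y1))"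
   using Li LL(1) by (simp add: Lv LL(2) prob_space)
  finally show "?c th ph = ka^2
   + (ln_kernel (of_real R2 * circ th - of_real R2 * circ ph - c) - ln_kernel (of_real R2 * circ th - of_real R1 * circ ph - c)
   - ln_kernel (of_real R1 * circ th - of_real R2 * circ ph - c) + ln_kernel (of_real R1 * circ th - of_real R1 * circ ph - c))"
   unfolding d .
 qed
 finally show ?thesis .
qed

text \<open>Chebyshev and Borel-Cantelli in summed form: along the radii \<open>k ^ 32\<close> the
  normalized second moments are \<open>O(1 / k^2)\<close>, so the sum of the squared deviations has
  finite expectation and its terms tend to 0.\<close>

lemma AE_ring_product_average:
 assumes R: "0 < R1" "R1 < R2"
 shows "AE w in M. (%k. (\<integral>t. ring R1 R2 w t * ring R1 R2 w (t + c) \<partial>ball_measure (real k ^ 32)) / (pi * (real k ^ 32)^2)) ----> ring_corr R1 R2 c"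
proof -
 let ?a = "%W w k. \<integral>t. W w t \<partial>ball_measure (real k ^ 32)"
 let ?d = "%k. pi * (real k ^ 32)^2"
 let ?g = "%k. ball_measure (real k ^ 32)"
 define C where "C = ring_const R1 R2"
 define e where "e = ring_corr R1 R2 c"
 define U where "U w t = ring R1 R2 w t * ring R1 R2 w (t + c)" for w t
 define W where "W w t = U w t - e" for w t
 have C1: "1 <= C" unfolding C_def by (rule ring_const_ge_1)
 hence C0: "0 <= C" by simp
 have V4: "mom4 (%w. ring R1 R2 w t) C" for t unfolding C_def by (rule mom4_ring[OF R])
 note [measurable] = measurable_app2'[where f="ring R1 R2", OF measurable_ring]
 have Wm[measurable]: "(%p. W (fst p) (snd p)) \<in> BM (M >< borel)" unfolding W_def U_def by simp
 have Ui: "integrable M (%w. U w t)" for t unfolding U_def by (rule mom4_pair_integrable(1)[OF V4 V4 C1])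
 have Ue: "(EE w. U w t) = e" for t unfolding U_def e_def by (rule expectation_ring_product[OF R])
 have UU: "integrable M (%w. U w s * U w t)" "abs (EE w. U w s * U w t) <= C" for s t
  unfolding U_def using mom4_prod(1,3)[OF V4 V4 V4 V4 C0 C0 C0 C0, of s "s + c" t "t + c"] by (simp_all add: mult.assoc)
 have ex: "(%w. W w s * W w t) = (%w. U w s * U w t - e * U w t - e * U w s + e * e)" for s t by (auto simp: W_def alg_simps)
 have WW: "integrable M (%w. W w s * W w t)" "(EE w. W w s * W w t) = (EE w. U w s * U w t) - e * e" for s t
  unfolding ex using UU(1) Ui by (simp_all add: Ue prob_space)
 have W2: "integrable M (%w. (W w t)^2)" "(EE w. (W w t)^2) <= C" for t
 proof -
  show "integrable M (%w. (W w t)^2)" using WW(1)[of t t] by (simp add: power2)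
  have "(EE w. (W w t)^2) = (EE w. U w t * U w t) - e * e" using WW(2)[of t t] by (simp add: power2)
  thus "(EE w. (W w t)^2) <= C" using UU(2)[of t t] zero_le_square[of e] by linarith
 qed
 \<comment> \<open>Large enough that \<open>Kd ^ 4\<close> exceeds the constant in the smallness
   condition of \<open>ring_decorrelation\<close>.\<close>
 define Kd where "Kd = 1 + 32 * ln_diff_const"
 let ?l = "32 * ln_diff_const <= Kd ^ 4"
 have Kd: "1 <= Kd" "?l"
 using Kd_def ln_diff_const_nonneg self_le_power[of Kd 4] by auto
 define K1 where "K1 = Kd * (1 + 3 * C) * (1 + C)"
 let ?c = "%s t k. abs (EE w. W w s * W w t) <= K1 / (real k)^2"
 let ?e = "K1 + 8 * C"
 have K1: "0 <= K1" unfolding K1_def using Kd C0 by simp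
 \<comment> \<open>From this index on the separation \<open>k ^ 16\<close> satisfies the conditions
   on \<open>D\<close> in \<open>ring_decorrelation\<close>.\<close>
 obtain k0 :: nat where k0: "max 8 (4 * (R2 + cmod c)) <= real k0" using real_arch_simple by blast
 let ?i = "%w k. \<integral>t. W w t \<partial>ball_measure (real (k + k0) ^ 32)"
 let ?j = "%k. real (k + k0)"
 have main: "integrable M (%w. (?a W w k / ?d k)^2) &
   (EE w. (?a W w k / ?d k)^2) <= ?e / (real k)^2"
  if k: "k0 <= k" for k
 proof -
  \<comment> \<open>Both errors become \<open>O(1 / k^2)\<close>: \<open>sqrt D = k ^ 8\<close> is
    what the fourth power of \<open>de = Kd / k^2\<close> asks for, and with
    \<open>r = D * D\<close> the annulus has relative area of order
    \<open>D / r = 1 / D\<close>.\<close>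
  define D where "D = real k ^ 16"
  let ?h = "32 * ln_diff_const / sqrt D"
  define r where "r = real k ^ 32"
  let ?b = "%w. \<integral>t. W w t \<partial>ball_measure r"
  let ?k = "EE w. ?b w^2"
  have k1: "max 8 (4 * (R2 + cmod c)) <= real k" using k0 k by simp
  hence kk: "1 <= real k" by simp
  have "real k <= D" unfolding D_def using self_le_power[OF kk, of 16] by simp
  hence D: "8 <= D" "4 * (R2 + cmod c) <= D" using k1 by auto
  have DR: "D <= r" unfolding D_def r_def using kk by (intro power_increasing) auto
  have r0: "0 < r" using kk by (simp add: r_def)
  have rr: "r = D * D" by (simp add: r_def D_def)
  have kD: "(real k)^2 <= D" unfolding D_def using kk by (intro power_increasing) auto
  define de where "de = Kd / (real k)^2"
  have de: "0 < de" "?h <= de ^ 4"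
  proof -
   show "0 < de" using Kd kk by (simp add: de_def)
   have "sqrt D = real k ^ 8"
   proof -
    have "(real k ^ 8)^2 = D" by (simp add: D_def)
    thus ?thesis by (rule real_sqrt_unique) simp
   qed
   hence "?h <= Kd ^ 4 / real k ^ 8" using Kd by (simp add: divide_right_mono)
   also have "... = de ^ 4" by (simp add: de_def power_divide)
   finally show "?h <= de ^ 4" .
  qed
  have far1: "?c s t k" if st: "cmod s + D <= cmod t" for s t
  proof -
   have "abs ((EE w. U w s * U w t) - e * e) <= de * (1 + 3 * C) * (1 + C)"
    using ring_decorrelation[OF R D st de] unfolding C_def[symmetric] U_def e_def by (simp add: expectation_ring_product[OF R] mult.assoc)
   thus ?thesis by (simp add: WW(2) K1_def de_def)
  qed
  have far: "?c s t k" if st: "D <= abs (cmod t - cmod s)" for s t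
  proof (cases "cmod s <= cmod t")
   case True thus ?thesis using st by (intro far1) auto
  next
   case False
   hence "?c t s k" using st by (intro far1) auto
   thus ?thesis by (simp add: mult.commute)
  qed
  have i: "integrable M (%w. ?b w^2)"
   by (rule second_moment_integral(1)[OF Wm finite_ball_measure sets_ball_measure W2]) (use r0 in simp)
  have "?k <= (pi * r^2) * (K1 / (real k)^2 * (pi * r^2) + C * (4 * pi * D * (r + D)))"
   by (rule second_moment_ball[OF Wm W2 r0 _ _ far]) (use D K1 in auto)
  also have "... <= (pi * r^2) * (K1 / (real k)^2 * (pi * r^2) + C * (8 / (real k)^2 * (pi * r^2)))"
  proof (intro mult_left_mono add_left_mono)
   have "4 * pi * D * (r + D) <= 4 * pi * D * (2 * r)" using DR D by simp
   also have "... = pi * (8 * (D * r))" by simp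
   also have "8 * (D * r) <= 8 / (real k)^2 * r^2"
   proof -
    have "8 * (D * r) * (real k)^2 <= 8 * (D * r) * D" using kD D r0 by simp
    also have "... = 8 * r^2" by (simp add: rr power2)
    finally show ?thesis using kk by (simp add: field_simps)
   qed
   finally show "4 * pi * D * (r + D) <= 8 / (real k)^2 * (pi * r^2)" by (simp add: mult_ac)
  qed (use C0 in auto)
  also have "... = (pi * r^2)^2 * (?e / (real k)^2)" by (simp add: power2 add_divide_distrib alg_simps)
  finally have le: "?k <= (pi * r^2)^2 * (?e / (real k)^2)" .
  have p: "0 < (pi * r^2)^2" using r0 by simp
  have "(EE w. (?b w / (pi * r^2))^2) = ?k / (pi * r^2)^2"
   by (simp add: power_divide)
  also have "... <= ?e / (real k)^2" using le p by (simp add: pos_divide_le_eq mult.commute)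
  finally show ?thesis using i by (simp add: r_def power_divide)
 qed
 define Z where "Z k w = (?i w k / (pi * (real (k + k0) ^ 32)^2))^2" for k w
 let ?f = "\<integral>\<^sup>+w. (\<Sum>k. ennreal (Z k w)) \<partial>M"
 have Zi: "integrable M (Z k)" "(EE w. Z k w) <= ?e / ?j k^2" for k
  using main[of "k + k0"] by (auto simp: Z_def[abs_def])
 have Z0: "0 <= Z k w" for k w by (simp add: Z_def)
 have sm: "summable (%k. ?e / ?j k^2)"
 proof -
  have "summable (%n. 1 / (real n)^2)" using inverse_power_summable[of 2, where ?'a=real] by (simp add: divide_inverse)
  hence "summable (%k. 1 / ?j k^2)" by (subst summable_iff_shift)
  from summable_mult[OF this, of "K1 + 8 * C"] show ?thesis by simp
 qed
 have "?f = (\<Sum>k. \<integral>\<^sup>+w. ennreal (Z k w) \<partial>M)"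
  using Zi by (intro nn_integral_suminf) auto
 also have "... <= (\<Sum>k. ennreal (?e / ?j k^2))"
  using Zi Z0 by (intro suminf_le) (auto simp: nn_integral_eq_integral ennreal_leI)
 also have "... = ennreal (\<Sum>k. ?e / ?j k^2)" using K1 C0 by (intro suminf_ennreal2 sm) auto
 finally have "?f ~= \<infinity>" by (auto simp: top_unique)
 hence "AE w in M. (\<Sum>k. ennreal (Z k w)) ~= \<infinity>" using Zi by (intro nn_integral_PInf_AE) auto
 hence AEz: "AE w in M. (%k. Z k w) ----> 0" by eventually_elim (intro summable_LIMSEQ_zero summable_suminf_not_top, use Z0 in auto)
 have "AE w in M. integrable (?g k) (W w)" for k
  by (rule second_moment_integral(3)[OF Wm finite_ball_measure sets_ball_measure W2]) simp
 hence "AE w in M. \<forall>k. integrable (?g k) (W w)" unfolding AE_all_countable by auto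
 with AEz show ?thesis
 proof eventually_elim
  case (elim w)
  have "(%k. sqrt (Z k w)) ----> sqrt 0" by (rule tendsto_real_sqrt[OF elim(1)])
  hence l: "(%k. ?i w k / (pi * (real (k + k0) ^ 32)^2)) ----> 0"
   unfolding Z_def real_sqrt_abs real_sqrt_zero by (rule tendsto_rabs_zero_cancel)
  have l': "(%k. ?a W w k / ?d k) ----> 0" by (rule LIMSEQ_offset[OF l])
  have eq: "?a U w k / ?d k = ?a W w k / ?d k + e"
   if "1 <= k" for k
  proof -
   interpret N: finite_measure "ball_measure (real k ^ 32)" by (rule finite_ball_measure) simp
   have "?a U w k = (\<integral>t. W w t + e \<partial>ball_measure (real k ^ 32))" by (simp add: W_def)
   also have "... = ?a W w k + e * measure (?g k) UNIV"
    using elim(2) by simp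
   also have "measure (?g k) UNIV = pi * (real k ^ 32)^2"
    using emeasure_ball_measure_UNIV[of "real k ^ 32"] by (simp add: measure_def)
   finally show ?thesis using that by (simp add: add_divide_distrib)
  qed
  have "(%k. ?a U w k / ?d k) ----> 0 + e"
   by (rule Lim_transform_eventually[OF tendsto_add[OF l' tendsto_const[of e]]])
     (use eq in "auto intro!: eventually_sequentiallyI[of 1]")
  thus ?case by (simp add: U_def e_def)
 qed
qed

end

section \<open>Pair sums over the zeros\<close>

lemma AE_norm_neq: "AE t in lborel. cmod (x - t) ~= (r::real)"
proof -
 have "sphere x r \<in> null_sets lebesgue" using negligible_sphere[of x r] by (simp add: negligible_iff_null_sets)
 hence "sphere x r \<in> null_sets lborel" by (subst (asm) null_sets_completion_iff) auto
 hence "AE t in lborel. t \<notin> sphere x r" by (rule AE_not_in)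
 thus ?thesis by eventually_elim (simp add: dist_norm)
qed

lemma mean_circ: "(MEAN th. circ th) = 0"
 using integral_cis_U01[of 1] by (simp add: circ_def)

lemma mean_norm_square_circle:
 "integrable U01 (%th. (cmod (t + of_real r * circ th))^2)"
 "(MEAN th. (cmod (t + of_real r * circ th))^2) = (cmod t)^2 + r^2"
proof -
 let ?a = "%th. cmod (t + of_real r * circ th)"
 let ?b = "MEAN th. Re (2 * cnj t * of_real r * circ th)"
 have e: "?a th^2 = (cmod t)^2 + r^2 + Re (2 * cnj t * of_real r * circ th)" for th
 proof -
  have "?a th^2 = (cmod t)^2 + (cmod (of_real r * circ th))^2 + 2 * Re (cnj t * (of_real r * circ th))"
   unfolding cmod_power2 by (simp add: power2 alg_simps)
  thus ?thesis by (simp add: norm_mult)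
 qed
 have "integrable U01 circ" by (rule integrable_U01_continuous) (rule continuous_circ)
 hence i2: "integrable U01 (%th. 2 * cnj t * of_real r * circ th)" by simp
 show "integrable U01 (%th. ?a th^2)" unfolding e using i2 by (intro integrable_plus integrable_Re) auto
 have "?b = Re (MEAN th. 2 * cnj t * of_real r * circ th)" using i2 by (rule integral_Re)
 also have "... = 0" by (simp add: mean_circ)
 finally have 0: "?b = 0" .
 show "(MEAN th. ?a th^2) = (cmod t)^2 + r^2"
  unfolding e using 0 by (subst integral_plus[OF _ integrable_Re[OF i2]]) (simp_all add: U01.prob_space[simplified])
qed

text \<open>The Gaussian factor adds a difference of two circle means of \<open>|z|^2\<close>, which
  the constant in \<open>ring_mean\<close> removes; what is left is Jensen's formula for
  \<open>f\<close>.\<close>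

lemma ring_mean_eq_sum:
 assumes f: "f holomorphic_on UNIV" "f z0 ~= 0" and simple: "!!z. f z = 0 ==> deriv f z ~= 0" and r: "0 < R1" "R1 < R2"
  and sph: "!!x. f x = 0 ==> cmod (x - t) ~= R1 & cmod (x - t) ~= R2"
 shows "ring_mean R1 R2 (%z. of_real (exp (- pi * (cmod z)^2 / 2)) * f z) t
   = (\<Sum>x | f x = 0 & cmod (x - t) <= R2. tent R1 R2 (x - t))"
proof -
 have nz: "f (t + of_real R * circ th) ~= 0" if "R = R1 \<or> R = R2" for R th
  using sph[of "t + of_real R * circ th"] that r by (auto simp: norm_mult)
 have l: "lnc (of_real (exp (- pi * (cmod z)^2 / 2)) * f z) = lnc (f z) - pi / 2 * (cmod z)^2" if "f z ~= 0" for z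
  using that by (simp add: norm_mult ln_mult)
 note J = jensen_two_circles[OF f simple r sph]
 define L where "L R th = lnc (f (t + of_real R * circ th))" for R th
 define S where "S R th = (cmod (t + of_real R * circ th))^2" for R th
 have i: "integrable U01 (L R1)" "integrable U01 (L R2)" "integrable U01 (S R1)" "integrable U01 (S R2)"
  using J(1,2) mean_norm_square_circle(1) by (auto simp: L_def[abs_def] S_def[abs_def])
 have "ring_mean R1 R2 (%z. of_real (exp (- pi * (cmod z)^2 / 2)) * f z) t
  = (MEAN th. pi * (R2^2 - R1^2) / 2 + ((L R2 th - pi / 2 * S R2 th) - (L R1 th - pi / 2 * S R1 th)))"
  unfolding ring_mean_def L_def S_def by (intro integral_congr refl) (subst (1 2) l, use nz in auto)
 also have "... = pi * (R2^2 - R1^2) / 2 + (((MEAN th. L R2 th) - pi / 2 * (MEAN th. S R2 th)) - ((MEAN th. L R1 th) - pi / 2 * (MEAN th. S R1 th)))"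
  using i by (simp add: U01.prob_space[simplified])
 also have "... = (MEAN th. L R2 th) - (MEAN th. L R1 th)" unfolding S_def mean_norm_square_circle(2) by (simp add: field_simps)
 finally show ?thesis using J(3) by (simp add: L_def)
qed

definition tent_corr :: "real => real => complex => real" where
 "tent_corr R1 R2 u = (LBINT v. tent R1 R2 (u + v) * tent R1 R2 v)"

lemma integrable_tent_shift:
 assumes R: "0 < R1" "R1 < R2" shows "integrable lborel (%t. tent R1 R2 (x - t) * tent R1 R2 (y - t - c))"
proof (rule integrable_dom)
 let ?c = "cball x R2"
 show "integrable lborel (%t. (ln R2 - ln R1)^2 * indicator ?c t)"
  using emeasure_lborel_cball_finite[of x R2] by simp
 let ?a = "ln R2 - ln R1"
 let ?b = "%t. tent R1 R2 (x - t) * tent R1 R2 (y - t - c)"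
 show "AE t in lborel. norm (?b t) <= norm (?a^2 * indicator ?c t)"
 proof (rule AE_I2)
  fix t
  have b: "0 <= tent R1 R2 z" "tent R1 R2 z <= ln R2 - ln R1" for z using R by (auto simp: tent_nonneg tent_le)
  show "norm (?b t) <= norm (?a^2 * indicator ?c t)"
  proof (cases "t \<in> cball x R2")
   case True
   have "tent R1 R2 (x - t) * tent R1 R2 (y - t - c) <= ?a * ?a" using b[of 0] by (intro mult_mono b) linarith
   moreover have "ln R1 <= ln R2" using b[of 0] by auto
   ultimately show ?thesis using b True by (simp add: power2)
  next
   case False
   hence "tent R1 R2 (x - t) = 0" using R by (intro tent_eq_0) (auto simp: dist_norm)
   thus ?thesis by simp
  qed
 qed
qed measurable

lemma integral_lborel_reflect:
 fixes f :: "complex => real"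
 assumes [measurable]: "f \<in> BM borel" shows "(LBINT t. f (c - t)) = (LBINT t. f t)"
proof -
 let ?a = "%z::complex. c + (-1) * z"
 have "lborel = distr lborel borel ?a" using lborel_complex_affine[of "-1" c] by (simp add: density_1)
 hence "(LBINT t. f t) = (\<integral>t. f t \<partial>distr lborel borel ?a)" by simp
 also have "... = (LBINT t. f (c - t))" by (subst integral_distr) auto
 finally show ?thesis by simp
qed

lemma tent_corr_eq: "(LBINT t. tent R1 R2 (x - t) * tent R1 R2 (y - t - c)) = tent_corr R1 R2 (x - y + c)"
proof -
 have "(LBINT t. tent R1 R2 (x - y + c + (y - c - t)) * tent R1 R2 (y - c - t)) = tent_corr R1 R2 (x - y + c)"
  unfolding tent_corr_def by (rule integral_lborel_reflect[of "%v. tent R1 R2 (x - y + c + v) * tent R1 R2 v" "y - c"]) measurable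
 thus ?thesis by (simp add: alg_simps)
qed

section \<open>Pair sums and ring averages for an entire function with simple zeros\<close>

locale simple_entire =
 fixes f :: "complex => complex"
 assumes hol: "f holomorphic_on UNIV" and nz0: "f 0 ~= 0" and simple: "f z = 0 ==> deriv f z ~= 0"
begin

definition zeros_in :: "real => complex set" where "zeros_in r = {x. f x = 0 & cmod x < r}"

lemma finite_zeros_in: "finite (zeros_in r)"
 by (rule finite_subset[OF _ finite_zeros_cball[OF hol nz0, of 0 r]]) (auto simp: zeros_in_def)

lemma countable_zeros: "countable {x. f x = 0}"
proof -
 have "{x. f x = 0} = (\<Union>n::nat. zeros_in (real n))" using reals_Archimedean2 by (auto simp: zeros_in_def)
 thus ?thesis by (simp add: countable_finite finite_zeros_in)
qed

definition rmean :: "real => real => complex => real" where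
 "rmean R1 R2 t = ring_mean R1 R2 (%z. of_real (exp (- pi * (cmod z)^2 / 2)) * f z) t"

text \<open>A truncation to finitely many zeros: it agrees almost everywhere with the ring average
  inside a ball, and its products are integrable over the whole plane.\<close>

definition tsum :: "real => real => real => complex => real" where
 "tsum R1 R2 r t = (\<Sum>x\<in>zeros_in r. tent R1 R2 (x - t))"

lemma measurable_tsum [measurable]: "tsum R1 R2 r \<in> BM borel"
 unfolding tsum_def by simp

lemma tsum_nonneg: "0 < R1 ==> R1 < R2 ==> 0 <= tsum R1 R2 r t"
 unfolding tsum_def by (intro sum_nonneg tent_nonneg)

lemma tsum_mono: "0 < R1 ==> R1 < R2 ==> r <= r' ==> tsum R1 R2 r t <= tsum R1 R2 r' t"
 unfolding tsum_def by (intro sum_mono2 finite_zeros_in tent_nonneg) (auto simp: zeros_in_def)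

lemma tsum_eq_0:
 assumes "R1 < R2" "r + R2 <= cmod t" shows "tsum R1 R2 r t = 0" unfolding tsum_def
proof (intro sum.neutral ballI tent_eq_0)
 fix x assume "x \<in> zeros_in r"
 hence "cmod x < r" by (simp add: zeros_in_def)
 moreover have "cmod t <= cmod x + cmod (x - t)" by (metis add.commute diff_add_cancel norm_minus_commute norm_triangle_ineq)
 ultimately show "R2 <= cmod (x - t)" using assms by simp
qed (use assms in auto)

text \<open>Jensen's formula excludes centres with a zero on one of the two circles. These centres
  lie on countably many circles, a null set.\<close>

lemma AE_rmean:
 assumes R: "0 < R1" "R1 < R2" shows "AE t in lborel. \<forall>r. cmod t + R2 < r --> rmean R1 R2 t = tsum R1 R2 r t"
proof -
 have "AE t in lborel. \<forall>x\<in>{x. f x = 0}. cmod (x - t) ~= R1 & cmod (x - t) ~= R2"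
  by (subst AE_ball_countable[OF countable_zeros]) (use AE_norm_neq in "auto intro: ")
 thus ?thesis
 proof eventually_elim
  case (elim t)
  let ?a = "\<Sum>x | f x = 0 & cmod (x - t) <= R2. tent R1 R2 (x - t)"
  have e: "rmean R1 R2 t = ?a"
   unfolding rmean_def by (rule ring_mean_eq_sum[OF hol nz0 simple R]) (use elim in auto)
   show ?case
  proof (intro allI impI)
   fix r assume r: "cmod t + R2 < r"
   have "?a = tsum R1 R2 r t" unfolding tsum_def
   proof (rule sum.mono_neutral_left[OF finite_zeros_in])
    show "{x. f x = 0 & cmod (x - t) <= R2} \<subseteq> zeros_in r"
    proof (intro subsetI)
     fix x assume x: "x \<in> {x. f x = 0 & cmod (x - t) <= R2}"
     have "cmod x <= cmod t + cmod (x - t)" by (metis add.commute diff_add_cancel norm_triangle_ineq)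
     thus "x \<in> zeros_in r" using x r by (simp add: zeros_in_def)
    qed
    show "\<forall>x\<in>zeros_in r - {x. f x = 0 & cmod (x - t) <= R2}. tent R1 R2 (x - t) = 0"
     using R by (auto simp: zeros_in_def intro!: tent_eq_0)
   qed
   thus "rmean R1 R2 t = tsum R1 R2 r t" using e by simp
  qed
 qed
qed

lemma AE_rmean_shift:
 assumes R: "0 < R1" "R1 < R2" shows "AE t in lborel. \<forall>r. cmod t + cmod c + R2 < r --> rmean R1 R2 (t + c) = tsum R1 R2 r (t + c)"
proof -
 let ?a = "%z::complex. c + 1 * z"
 have eq: "lborel = distr lborel borel ?a" using lborel_complex_affine[of 1 c] by (simp add: density_1)
 have "AE t in distr lborel borel ?a. \<forall>r. cmod t + R2 < r --> rmean R1 R2 t = tsum R1 R2 r t"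
  unfolding eq[symmetric] by (rule AE_rmean[OF R])
 hence "AE t in lborel. \<forall>r. cmod (c + 1 * t) + R2 < r --> rmean R1 R2 (c + 1 * t) = tsum R1 R2 r (c + 1 * t)"
  by (rule AE_distrD[rotated]) simp
 thus ?thesis
 proof eventually_elim
  case (elim t)
  show ?case
  proof (intro allI impI)
   fix r assume "cmod t + cmod c + R2 < r"
   moreover have "cmod (c + t) <= cmod c + cmod t" by (rule norm_triangle_ineq)
   ultimately show "rmean R1 R2 (t + c) = tsum R1 R2 r (t + c)" using elim[rule_format, of r] by (simp add: add.commute)
  qed
 qed
qed

definition yint :: "real => real => complex => real => real" where
 "yint R1 R2 c R = (\<integral>t. rmean R1 R2 t * rmean R1 R2 (t + c) \<partial>ball_measure R)"

lemma measurable_rmean [measurable]: "rmean R1 R2 \<in> BM borel"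
proof -
 have [measurable]: "f \<in> BM borel" using hol by (intro cont_measurable holomorphic_on_imp_continuous_on)
 have "(%p. ring_mean R1 R2 ((%_ z. of_real (exp (- pi * (cmod z)^2 / 2)) * f z) (fst p)) (snd p)) \<in> BM (lborel >< borel)" for x :: real
  by simp
 from measurable_compose[OF measurable_Pair1'[of "0::real"] this] show ?thesis by (simp add: rmean_def[abs_def])
qed

lemma integrable_tsum_product:
 assumes R: "0 < R1" "R1 < R2" shows "integrable lborel (%t. tsum R1 R2 r t * tsum R1 R2 r' (t + c))"
proof -
 have "tsum R1 R2 r t * tsum R1 R2 r' (t + c) = (\<Sum>x\<in>zeros_in r. \<Sum>y\<in>zeros_in r'. tent R1 R2 (x - t) * tent R1 R2 (y - t - c))" for t
  unfolding tsum_def sum_product by (simp add: diff_diff_eq)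
 thus ?thesis using integrable_tent_shift[OF R] by simp
qed

lemma pair_sum_eq_integral:
 assumes R: "0 < R1" "R1 < R2"
 shows "(\<Sum>x\<in>zeros_in r. \<Sum>y\<in>zeros_in r. tent_corr R1 R2 (x - y + c)) = (LBINT t. tsum R1 R2 r t * tsum R1 R2 r (t + c))"
proof -
 have "(LBINT t. tsum R1 R2 r t * tsum R1 R2 r (t + c))
  = (LBINT t. (\<Sum>x\<in>zeros_in r. \<Sum>y\<in>zeros_in r. tent R1 R2 (x - t) * tent R1 R2 (y - t - c)))"
  unfolding tsum_def sum_product by (simp add: diff_diff_eq)
 also have "... = (\<Sum>x\<in>zeros_in r. \<Sum>y\<in>zeros_in r. tent_corr R1 R2 (x - y + c))"
  using integrable_tent_shift[OF R] by (subst integral_of_sum, simp add: Bochner_Integration.integrable_sum) (simp add: tent_corr_eq)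
 finally show ?thesis by simp
qed

lemma yint_eq:
 assumes R: "0 < R1" "R1 < R2" and m: "r + cmod c + R2 <= m"
 shows "yint R1 R2 c r = (LBINT t. indicator (ball 0 r) t * (tsum R1 R2 m t * tsum R1 R2 m (t + c)))"
proof -
 let ?a = "%t. tsum R1 R2 m t * tsum R1 R2 m (t + c)"
 let ?b = "%t. rmean R1 R2 t * rmean R1 R2 (t + c)"
 have "yint R1 R2 c r = (LBINT t. indicator (ball 0 r) t * ?b t)"
  unfolding yint_def by (rule integral_ball_measure) measurable
 also have "... = (LBINT t. indicator (ball 0 r) t * ?a t)"
 proof (rule integral_cong_AE)
  show "AE t in lborel. indicator (ball 0 r) t * ?b t = indicator (ball 0 r) t * ?a t"
   using AE_rmean[OF R] AE_rmean_shift[OF R, of c]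
  proof eventually_elim
   case (elim t)
   show ?case
   proof (cases "t \<in> ball 0 r")
    case True
    hence "cmod t < r" by simp
    hence "cmod t + R2 < m" "cmod t + cmod c + R2 < m" using m norm_ge_zero[of c] by linarith+
    thus ?thesis using elim by auto
   qed simp
  qed
 qed measurable
 finally show ?thesis .
qed

text \<open>Almost everywhere ring averages are sums of tents, so the integrand is
  nonnegative.\<close>

lemma yint_mono:
 assumes R: "0 < R1" "R1 < R2" and r: "r <= r'" shows "yint R1 R2 c r <= yint R1 R2 c r'"
proof -
 define m where "m = r' + cmod c + R2"
 let ?a = "%t. tsum R1 R2 m t * tsum R1 R2 m (t + c)"
 note i = integrable_tsum_product[OF R, of m m c]
 have n: "0 <= tsum R1 R2 m t * tsum R1 R2 m (t + c)" for t using R by (intro mult_nonneg_nonneg tsum_nonneg)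
 have ii: "integrable lborel (%t. indicator (ball 0 s) t * ?a t)" for s
  by (rule integrable_dom[OF i]) (auto simp: indicator_def)
 have 1: "yint R1 R2 c r = (LBINT t. indicator (ball 0 r) t * ?a t)"
  by (rule yint_eq[OF R]) (use r in "simp add: m_def")
 have 2: "yint R1 R2 c r' = (LBINT t. indicator (ball 0 r') t * ?a t)"
  by (rule yint_eq[OF R]) (simp add: m_def)
  show ?thesis unfolding 1 2
  by (rule integral_mono[OF ii ii]) (use n r in "auto simp: indicator_def")
qed

text \<open>A zero affects ring averages only within distance \<open>R2\<close>, and the second
  factor is shifted by \<open>c\<close>. Shrinking or enlarging the ball by \<open>R2 + |c|\<close>
  therefore decides all pairs near the boundary, and every term is nonnegative.\<close>

lemma pair_sum_bounds:
 assumes R: "0 < R1" "R1 < R2"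
 shows "yint R1 R2 c (r - (R2 + cmod c)) <= (\<Sum>x\<in>zeros_in r. \<Sum>y\<in>zeros_in r. tent_corr R1 R2 (x - y + c))"
  and "(\<Sum>x\<in>zeros_in r. \<Sum>y\<in>zeros_in r. tent_corr R1 R2 (x - y + c)) <= yint R1 R2 c (r + (R2 + cmod c))"
proof -
 let ?a = "\<Sum>x\<in>zeros_in r. \<Sum>y\<in>zeros_in r. tent_corr R1 R2 (x - y + c)"
 let ?b = "%s' t. tsum R1 R2 s' t * tsum R1 R2 s' (t + c)"
 define d where "d = R2 + cmod c"
 define m where "m = r + 2 * d"
 have d: "0 <= d" using R by (simp add: d_def)
 have n: "0 <= tsum R1 R2 s t * tsum R1 R2 s' (t + c)" for s s' t using R by (intro mult_nonneg_nonneg tsum_nonneg)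
 have ii: "integrable lborel (%t. indicator (ball 0 s) t * ?b s' t)" for s s'
  by (rule integrable_dom[OF integrable_tsum_product[OF R, of s' s' c]]) (auto simp: indicator_def)
 have 1: "yint R1 R2 c (r - d) = (LBINT t. indicator (ball 0 (r - d)) t * (tsum R1 R2 r t * tsum R1 R2 r (t + c)))"
  by (rule yint_eq[OF R]) (simp add: d_def)
 have 2: "yint R1 R2 c (r + d) = (LBINT t. indicator (ball 0 (r + d)) t * ?b m t)"
  by (rule yint_eq[OF R]) (simp add: m_def d_def)
 show "yint R1 R2 c (r - (R2 + cmod c)) <= ?a"
  unfolding pair_sum_eq_integral[OF R] d_def[symmetric] 1
  by (rule integral_mono[OF ii integrable_tsum_product[OF R]]) (use n in "auto simp: indicator_def")
 show "?a <= yint R1 R2 c (r + (R2 + cmod c))"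
  unfolding pair_sum_eq_integral[OF R] d_def[symmetric] 2
 proof (rule integral_mono[OF integrable_tsum_product[OF R] ii])
  fix t
  let ?c = "tsum R1 R2 r t * tsum R1 R2 r (t + c)"
  have le: "?c <= tsum R1 R2 m t * tsum R1 R2 m (t + c)"
   using R d by (intro mult_mono tsum_mono tsum_nonneg) (auto simp: m_def)
  show "?c <= indicator (ball 0 (r + d)) t * ?b m t"
  proof (cases "t \<in> ball 0 (r + d)")
   case False
   hence "tsum R1 R2 r t = 0" using R norm_ge_zero[of c] by (intro tsum_eq_0) (unfold d_def mem_ball dist_0_norm, linarith+)
   thus ?thesis using False by simp
  qed (use le in simp)
 qed
qed

end

text \<open>Consecutive radii \<open>k ^ 32\<close> and \<open>(k + 1) ^ 32\<close> have ratio
  tending to 1, so monotonicity squeezes the values in between. The exponent 64 in \<open>q\<close>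
  is that of the squared radius.\<close>

lemma mono_average_limit:
 fixes Y :: "real => real"
 assumes mono: "!!r r'. r <= r' ==> Y r <= Y r'" and Y0: "!!r. 0 <= Y r" and lim: "(%k. Y (real k ^ 32) / (pi * (real k ^ 32)^2)) ----> e"
 shows "((%r. Y r / (pi * r^2)) \<longlongrightarrow> e) at_top"
proof -
 define p where "p r = nat \<lfloor>root 32 r\<rfloor>" for r :: real
 let ?a = "%r. (real (p r) + 1) ^ 32"
 have ev: "\<forall>\<^sub>F r in at_top. (1::real) <= r" by simp
 have rt: "filterlim (root 32) at_top (at_top :: real filter)" unfolding filterlim_at_top
 proof
  fix Z :: real
  show "\<forall>\<^sub>F r in at_top. Z <= root 32 r" using eventually_ge_at_top[of "abs Z ^ 32"]
  proof eventually_elim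
   case (elim r)
   hence "root 32 (abs Z ^ 32) <= root 32 r" by simp
   moreover have "root 32 (abs Z ^ 32) = abs Z" by (rule real_root_power_cancel) auto
   ultimately show ?case by linarith
  qed
 qed
 have pl: "filterlim p sequentially at_top"
  unfolding p_def by (rule filterlim_compose[OF filterlim_nat_sequentially filterlim_compose[OF filterlim_floor_sequentially rt]])
 have bd: "1 <= p r" "real (p r) ^ 32 <= r" "r <= ?a r" if r: "1 <= r" for r
 proof -
  have r1: "1 <= root 32 r" using r by simp
  thus "1 <= p r" unfolding p_def by linarith
  have "real (p r) <= root 32 r" unfolding p_def using r1 by auto
  hence "real (p r) ^ 32 <= root 32 r ^ 32" by (intro power_mono) auto
  thus "real (p r) ^ 32 <= r" using r by simp
  have "root 32 r <= real (p r) + 1" unfolding p_def by linarith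
  hence "root 32 r ^ 32 <= ?a r" using r1 by (intro power_mono) auto
  thus "r <= ?a r" using r by simp
 qed
 define y where "y k = Y (real k ^ 32) / (pi * (real k ^ 32)^2)" for k :: nat
 define q where "q k = (real k / (real k + 1)) ^ 64" for k :: nat
 have ql: "q ----> 1"
 proof -
  have "(%k. real k / (real k + 1)) ----> 1" by real_asymp
  hence "(%k. (real k / (real k + 1)) ^ 64) ----> 1 ^ 64" by (rule tendsto_power)
  thus ?thesis by (simp add: q_def[abs_def])
 qed
 have yl: "y ----> e" using lim by (simp add: y_def[abs_def])
 have y1: "(%k. y (Suc k)) ----> e" using yl by (rule LIMSEQ_Suc)
 have lo: "(%k. y k * q k) ----> e * 1" by (intro tendsto_mult yl ql)
 have q1: "(%k. 1 / q k) ----> 1 / 1" by (intro tendsto_divide tendsto_const ql) simp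
 have hi: "(%k. y (Suc k) * (1 / q k)) ----> e * (1 / 1)" by (intro tendsto_mult y1 q1)
 show ?thesis
 proof (rule tendsto_sandwich)
  show "((%r. y (p r) * q (p r)) \<longlongrightarrow> e) at_top" using filterlim_compose[OF lo pl] by simp
  show "((%r. y (Suc (p r)) * (1 / q (p r))) \<longlongrightarrow> e) at_top" using filterlim_compose[OF hi pl] by simp
  show "\<forall>\<^sub>F r in at_top. y (p r) * q (p r) <= Y r / (pi * r^2)" using ev
  proof eventually_elim
   case (elim r)
   define k where "k = real (p r)"
   have k: "1 <= k" "k ^ 32 <= r" "r <= (k + 1) ^ 32" using bd[OF elim] by (auto simp: k_def)
   have "y (p r) * q (p r) = Y (k ^ 32) / (pi * ((k + 1) ^ 32)^2)" using k(1) by (simp add: y_def q_def k_def power_divide)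
   also have "... <= Y r / (pi * r^2)" using k elim Y0 by (intro frac_le mono mult_left_mono power_mono) auto
   finally show ?case .
  qed
  show "\<forall>\<^sub>F r in at_top. Y r / (pi * r^2) <= y (Suc (p r)) * (1 / q (p r))" using ev
  proof eventually_elim
   case (elim r)
   define k where "k = real (p r)"
   have k: "1 <= k" "k ^ 32 <= r" "r <= (k + 1) ^ 32" using bd[OF elim] by (auto simp: k_def)
   have "Y r / (pi * r^2) <= Y ((k + 1) ^ 32) / (pi * (k ^ 32)^2)" using k Y0 by (intro frac_le mono mult_left_mono power_mono) auto
   also have "... = y (Suc (p r)) * (1 / q (p r))" by (simp add: y_def q_def k_def power_divide add.commute)
   finally show ?case .
  qed
 qed
qed

lemma mono_average_squeeze:
 fixes Y :: "real => real" and X :: "nat => real"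
 assumes lim: "((%r. Y r / (pi * r^2)) \<longlongrightarrow> e) at_top" and X: "!!n. Y (real n - d) <= X n" "!!n. X n <= Y (real n + d)"
 shows "(%n. X n / (pi * (real n)^2)) ----> e"
proof -
 have *: "(%n. Y (real n + s) / (pi * (real n)^2)) ----> e" for s
 proof -
  let ?a = "%n. real n + s"
  have t: "filterlim (%n. real n + s) at_top sequentially" by real_asymp
  have "(%n. ?a n^2 / (real n)^2) ----> 1" by real_asymp
  hence "(%n. Y (?a n) / (pi * ?a n^2) * (?a n^2 / (real n)^2)) ----> e * 1"
   using filterlim_compose[OF lim t] by (intro tendsto_mult) auto
  moreover have "\<forall>\<^sub>F n in sequentially. Y (?a n) / (pi * ?a n^2) * (?a n^2 / (real n)^2) = Y (?a n) / (pi * (real n)^2)"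
   using filterlim_at_top_dense[THEN iffD1, OF t, rule_format, of 0] by eventually_elim (simp add: field_simps)
  ultimately show ?thesis by (simp add: filterlim_cong)
 qed
 show ?thesis by (rule tendsto_sandwich[OF _ _ *[of "- d"] *[of d]]) (use X in "auto intro!: always_eventually divide_right_mono")
qed

context gaussian_sequence
begin

lemma AE_simple_entire: "AE w in M. good (coef w) & simple_entire (gaf (coef w))"
 using AE_good AE_coef_nonzero[of 0] AE_simple_zeros by eventually_elim (auto simp: simple_entire_def holomorphic_gaf gaf_0)

lemma AE_pair_sums:
 assumes R: "0 < R1" "R1 < R2"
 shows "AE w in M. (%n. (\<Sum>x\<in>simple_entire.zeros_in (gaf (coef w)) (real n). \<Sum>y\<in>simple_entire.zeros_in (gaf (coef w)) (real n).
   tent_corr R1 R2 (x - y + c)) / (pi * (real n)^2)) ----> ring_corr R1 R2 c" using AE_ring_product_average[OF R, of c] AE_simple_entire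
proof eventually_elim
 case (elim w)
 interpret simple_entire "gaf (coef w)" using elim by simp
 have rm: "ring R1 R2 w = rmean R1 R2"
 proof -
  have e: "NF w = (%z. of_real (exp (- pi * (cmod z)^2 / 2)) * gaf (coef w) z)" using elim by (simp add: NF_eq fun_eq_iff)
  show ?thesis by (intro ext) (simp only: ring_def rmean_def e)
 qed
 have "0 <= yint R1 R2 c r" for r
  unfolding yint_eq[OF R order.refl] by (intro integral_nonneg_AE always_eventually allI mult_nonneg_nonneg tsum_nonneg R) auto
 hence "((%r. yint R1 R2 c r / (pi * r^2)) \<longlongrightarrow> ring_corr R1 R2 c) at_top"
  using elim yint_mono[OF R] by (intro mono_average_limit) (auto simp: rm yint_def)
 thus ?case by (rule mono_average_squeeze) (use pair_sum_bounds[OF R] in auto)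
qed

end

section \<open>The pair correlation function as a limit of approximate identities\<close>

lemma integral_power_exp:
 fixes c :: real
 assumes "0 < c" shows "set_integrable lborel {0..} (%x. x ^ k * exp (- c * x))"
  and "(LINT x:{0..}|lborel. x ^ k * exp (- c * x)) = fact k / c ^ Suc k"
proof -
 have "has_bochner_integral lborel (%x. (1 / c) * (erlang_density 0 c x * x ^ k)) ((1 / c) * (fact (0 + k) / (fact 0 * c ^ k)))"
  using assms nn_integral_erlang_ith_moment[OF assms, of 0 k]
  by (intro has_bochner_integral_mult_right has_bochner_integral_nn_integral) (auto simp: erlang_density_def)
 moreover have "(1 / c) * (erlang_density 0 c x * x ^ k) = indicator {0..} x *\<^sub>R (x ^ k * exp (- c * x))" for x
  using assms by (auto simp: erlang_density_def)
 ultimately have "has_bochner_integral lborel (%x. indicator {0..} x *\<^sub>R (x ^ k * exp (- c * x))) (fact k / c ^ Suc k)" by simp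
 thus "set_integrable lborel {0..} (%x. x ^ k * exp (- c * x))" "(LINT x:{0..}|lborel. x ^ k * exp (- c * x)) = fact k / c ^ Suc k"
  by (simp_all add: set_integrable_def set_lebesgue_integral_def has_bochner_integral_iff)
qed

lemma integral_power_exp_area:
 assumes "0 < c" shows "integrable lborel (%z. (area z) ^ k * exp (- c * (area z)))"
  and "(LBINT z. (area z) ^ k * exp (- c * (area z))) = fact k / c ^ Suc k"
 using integral_area[of "%x. x ^ k * exp (- c * x)"] integral_power_exp[OF assms, of k] by auto

text \<open>The generating function of the Bernoulli numbers; it absorbs the singularity of
  \<open>1 / (1 - exp (- x))\<close> at 0.\<close>

definition bern :: "real => real" where "bern x = x / (exp x - 1)"

lemma measurable_bern [measurable]: "bern \<in> BM borel" unfolding bern_def by auto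

lemma bern_bounds:
 assumes x: "0 < x" shows "0 < bern x" "bern x <= 1" "1 - x <= bern x" "bern x <= 2 * exp (- x / 2)"
proof -
 have e: "1 + x <= exp x" by simp
 hence p: "0 < exp x - 1" using x by simp
 show "0 < bern x" "bern x <= 1" using x e by (simp_all add: bern_def , linarith)
 have "(1 - x) * exp x <= exp (- x) * exp x" using exp_ge_add_one_self[of "- x"] by auto
 hence "(1 - x) * (exp x - 1) <= x" by (simp add: exp_minus alg_simps)
 thus "1 - x <= bern x" using p by (simp add: bern_def pos_le_divide_eq)
 define u where "u = exp (x / 2)"
 let ?a = "(2 * (u - 1)) * (u + 1)"
 have u: "x / 2 <= u - 1" "0 < u" by (simp_all add: u_def alg_simps)
 have E: "exp x = u * u" by (simp add: u_def flip: exp_add)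
 have "x * (u + 1) <= ?a" using u by simp
 moreover have "x * u <= x * (u + 1)" using x by simp
 moreover have "?a = 2 * (exp x - 1)" unfolding E by (simp add: alg_simps)
 ultimately have "x * u <= 2 * (exp x - 1)" by simp
 hence "x <= (2 * (exp x - 1)) / u" by (subst pos_le_divide_eq) (use u in auto)
 moreover have "exp (- x / 2) = inverse u" unfolding u_def by (subst exp_minus[symmetric]) simp
 ultimately have "x <= 2 * exp (- x / 2) * (exp x - 1)" by (simp only: divide_inverse mult_ac)
 thus "bern x <= 2 * exp (- x / 2)" unfolding bern_def using p by (simp only: pos_divide_le_eq)
qed

lemma bern_tendsto: "(%n. bern (x / real n)) ----> 1" if "0 < x"
 unfolding bern_def using that by real_asymp

definition pair_fun :: "real => real" where
 "pair_fun x = (exp (- x) * (- 2 + 4 * x - x^2) + exp (- 2 * x) * (4 - 4 * x - x^2) - 2 * exp (- 3 * x)) / (1 - exp (- x)) ^ 3"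

lemma g_eq_pair_fun: "g r = pair_fun (pi * r^2)"
 unfolding g_def pair_fun_def by (simp add: power_mult_distrib mult.assoc)

lemma measurable_pair_fun [measurable]: "pair_fun \<in> BM borel"
 unfolding pair_fun_def by simp

lemma measurable_g [measurable]: "g \<in> BM borel"
 unfolding g_eq_pair_fun[abs_def] by simp

lemma exp_multiples: "exp (- 2 * x) = inverse (exp x) ^ 2" "exp (- 3 * x) = inverse (exp x) ^ 3" for x :: real
 by (simp_all add: exp_minus power_inverse flip: exp_of_nat_mult)

text \<open>In this form the cubic pole is resolved: \<open>(1 - bern x - x) / x\<close> is bounded
  by 1 in modulus, and a common factor \<open>bern x\<close> decays exponentially. The integrable
  bound on \<open>g\<close> is read off from it.\<close>

lemma pair_fun_eq_bern:
 assumes x: "0 < x" shows "pair_fun x = bern x * (1 - bern x - x) / x * (2 * bern x + x - 2) + bern x"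
proof -
 define E where "E = exp x"
 have E: "E ~= 0" "E ~= 1" "E - 1 ~= 0" using x by (auto simp: E_def)
 have 1: "1 - inverse E = (E - 1) / E" using E by (simp add: field_simps)
 have "pair_fun x = (inverse E * (- 2 + 4 * x - x^2) + inverse E ^ 2 * (4 - 4 * x - x^2) - 2 * inverse E ^ 3) / (1 - inverse E) ^ 3"
  unfolding pair_fun_def exp_multiples by (simp add: exp_minus E_def)
 also have "... = (E^2 * (- 2 + 4 * x - x^2) + E * (4 - 4 * x - x^2) - 2) / (E - 1) ^ 3"
  using E by (simp add: divide_simps) (simp add: alg_simps power2 power3_eq_cube)
 also have "... = bern x * (1 - bern x - x) / x * (2 * bern x + x - 2) + bern x" unfolding bern_def E_def[symmetric] using E x
  by (simp add: divide_simps) (simp add: alg_simps power2 power3_eq_cube)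
 finally show ?thesis .
qed

lemma pair_fun_bound:
 assumes x: "0 < x" shows "abs (pair_fun x) <= 2 * (5 + x) * exp (- (1/2) * x)"
proof -
 let ?a = "(1 - bern x - x) / x"
 let ?b = "2 * bern x + x - 2"
 let ?c = "?a * ?b + 1"
 note b = bern_bounds[OF x]
 have 1: "abs ((1 - bern x - x) / x) <= 1" using b x by simp
 have 2: "abs (2 * bern x + x - 2) <= 4 + x" using b by auto
 have "abs (?a * ?b) <= 1 * (4 + x)" unfolding abs_mult using 1 2 by (intro mult_mono) auto
 hence "abs ?c <= 5 + x" by (intro order.trans[OF abs_triangle_ineq]) simp
 have "abs (bern x * ?c) <= 2 * exp (- x / 2) * (5 + x)"
  unfolding abs_mult using b \<open>_ <= 5 + x\<close> by (intro mult_mono) auto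
 also have "bern x * ?c = pair_fun x"
  unfolding pair_fun_eq_bern[OF x] by (simp add: distrib_left)
 finally show ?thesis by (simp add: alg_simps)
qed

text \<open>In terms of \<open>q = exp (- x / 2)\<close> the inequality follows by combining the two
  squares \<open>(1 - q^2 - x * q)^2\<close> and \<open>(1 - q)^2\<close>. It makes the density of
  the autocorrelation nonnegative.\<close>

lemma g_le_1: "g r <= 1"
proof (cases "r = 0")
 case True thus ?thesis by (simp add: g_def)
next
 case False
 define x where "x = pi * r^2"
 define q where "q = exp (- x / 2)"
 have x: "0 < x" using False by (simp add: x_def)
 have q: "0 < q" "q < 1" using x by (auto simp: q_def)
 have Q: "exp (- x) = q^2" "exp (- 2 * x) = q ^ 4" "exp (- 3 * x) = q ^ 6" unfolding q_def by (simp_all flip: exp_of_nat_mult)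
 have p: "0 < (1 - q^2) ^ 3" using q by (intro zero_less_power) (simp add: abs_square_less_1)
 have q2: "0 <= 1 - q^2" using q by (simp add: power_le_one)
 have "0 <= (1 - q^2 - x * q)^2" by simp
 hence a: "2 * x * q * (1 - q^2) <= (1 - q^2)^2 + x^2 * q^2" by (simp add: power2 alg_simps)
 have "0 <= (1 - q)^2" by simp
 hence b: "2 * q <= 1 + q^2" by (simp add: power2 alg_simps)
 have "2 * q * (2 * x * q * (1 - q^2)) <= (1 + q^2) * ((1 - q^2)^2 + x^2 * q^2)" using a b q q2 x by (intro mult_mono) auto
 hence "q^2 * (- 2 + 4 * x - x^2) + q ^ 4 * (4 - 4 * x - x^2) - 2 * q ^ 6 <= (1 - q^2) ^ 3"
  by (simp add: alg_simps power2 eval_nat_numeral)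
 thus ?thesis unfolding g_eq_pair_fun x_def[symmetric] pair_fun_def Q using p by simp
qed

lemma AE_area_pos: "AE z in lborel. 0 < area z"
proof -
 have "AE z::complex in lborel. z ~= 0" by (rule AE_lborel_singleton)
 thus ?thesis by auto
qed

lemma integrable_g: "integrable lborel (%z. g (cmod z))"
proof (rule integrable_dom)
 let ?a = "%z. - (1/2) * (area z)"
 have "integrable lborel (%z. 10 * ((area z) ^ 0 * exp (?a z)) + 2 * ((area z) ^ 1 * exp (?a z)))"
  by (intro integrable_plus integrable_mult_right integral_power_exp_area) auto
 thus "integrable lborel (%z. 2 * (5 + area z) * exp (?a z))"
  by (rule Bochner_Integration.integrable_cong[THEN iffD1, rotated 2]) (auto simp: alg_simps)
 show "AE z in lborel. norm (g (cmod z)) <= norm (2 * (5 + area z) * exp (?a z))" using AE_area_pos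
 proof eventually_elim
  case (elim z)
  thus ?case using pair_fun_bound[OF elim] by (simp only: g_eq_pair_fun) simp
 qed
qed simp

text \<open>The bi-Laplacian of \<open>exp (- n \<pi> |z|\<^sup>2) / (4 n\<^sup>2)\<close>, divided by \<open>4 \<pi>\<^sup>2\<close>, is \<open>lac n (\<pi> |z|\<^sup>2)\<close>.\<close>

definition lac :: "nat => real => real" where
 "lac n x = ((real n * x)^2 - 4 * (real n * x) + 2) * exp (- real n * x)"

lemma measurable_lac [measurable]: "lac n \<in> BM borel" unfolding lac_def by auto

lemma lac_area:
 "integrable lborel (%z. lac (Suc n) (area z))"
proof -
 define c where "c = real (Suc n)"
 have c: "0 < c" by (simp add: c_def)
 have e: "lac (Suc n) x = c^2 * (x ^ 2 * exp (- c * x)) - 4 * c * (x ^ 1 * exp (- c * x)) + 2 * (x ^ 0 * exp (- c * x))" for x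
  unfolding lac_def c_def[symmetric] by (simp add: alg_simps)
  show ?thesis
  unfolding e by (intro integrable_plus Bochner_Integration.integrable_diff integrable_mult_right integral_power_exp_area(1) c)
qed

text \<open>The part of the partial sums of \<open>lac\<close> that concentrates at the origin: a
  function of \<open>N * x\<close> times \<open>N\<close>, up to the slowly varying
  \<open>bern x\<close> and \<open>x\<close>.\<close>

definition delta_part :: "nat => real => real" where
 "delta_part N x = real N * (exp (- real N * x) * (bern x * (4 - 2 * bern x - 2 * x - real N * x)))"

lemma measurable_delta_part [measurable]: "delta_part n \<in> BM borel" unfolding delta_part_def by simp

text \<open>The increments of the right side in \<open>N\<close> equal \<open>lac\<close>. This
  summation is where the rational expression in \<open>g\<close> arises.\<close>

lemma sum_lac:
 assumes x: "0 < x" shows "(\<Sum>n<N. lac (Suc n) x) = exp (- real N * x) * pair_fun x + delta_part N x - pair_fun x"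
proof (induction N)
 case (Suc N)
 define E where "E = exp x"
 define F where "F = exp (- real N * x)"
 have E: "E ~= 0" "E - 1 ~= 0" using x by (auto simp: E_def)
 have F: "exp (- real (Suc N) * x) = F / E" unfolding E_def F_def by (simp add: alg_simps exp_diff exp_minus divide_inverse)
 have "(F / E - F) * pair_fun x
   + real (Suc N) * (F / E * (bern x * (4 - 2 * bern x - 2 * x - real (Suc N) * x)))
   - real N * (F * (bern x * (4 - 2 * bern x - 2 * x - real N * x)))
  = ((real (Suc N) * x)^2 - 4 * (real (Suc N) * x) + 2) * (F / E)"
  unfolding pair_fun_eq_bern[OF x] bern_def E_def[symmetric] of_nat_Suc using E x
  by (simp add: divide_simps) (simp add: alg_simps power2 power3_eq_cube)
 thus ?case
  unfolding sum.lessThan_Suc Suc.IH unfolding delta_part_def lac_def[of "Suc N"] F F_def[symmetric] left_diff_distrib by linarith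
qed (simp add: delta_part_def)

lemma integral_lborel_complex_scale:
 fixes f :: "complex => 'b::{banach, second_countable_topology}"
 assumes [measurable]: "f \<in> BM borel" and c: "0 < c" shows "(LBINT z. f z) = (LBINT z. c^2 *\<^sub>R f (of_real c * z))"
  and "integrable lborel (%z. c^2 *\<^sub>R f (of_real c * z)) <-> integrable lborel f"
proof -
 let ?a = "distr lborel borel (%z. 0 + of_real c * z)"
 let ?b = "%_. ennreal ((cmod (of_real c))^2)"
 let ?c = "LBINT z. c^2 *\<^sub>R f (of_real c * z)"
 let ?d = "%z. c^2 *\<^sub>R f (of_real c * z)"
 have eq: "(lborel :: complex measure) = density ?a ?b"
  by (rule lborel_complex_affine) (use c in auto)
 have [simp]: "cmod (of_real c) = c" using c by simp
 have "(LBINT z. f z) = (\<integral>z. f z \<partial>density ?a ?b)"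
  using eq by simp
 also have "... = ?c" by (subst integral_density, measurable, simp, subst integral_distr, auto)
 finally show "(LBINT z. f z) = ?c" .
 have "integrable lborel f <-> integrable (density ?a ?b) f"
  using eq by simp
 also have "... <-> integrable lborel ?d"
  by (subst integrable_density, measurable, simp, subst integrable_distr_eq, auto)
 finally show "integrable lborel ?d <-> integrable lborel f" by simp
qed

lemma delta_part_bound:
 assumes "0 < x" shows "abs (bern x * (4 - 2 * bern x - 2 * x - t)) <= 6 + 2 * x + abs t"
proof -
 note b = bern_bounds[OF assms]
 have "abs (bern x * (4 - 2 * bern x - 2 * x - t)) <= 1 * (6 + 2 * x + abs t)"
  unfolding abs_mult using b by (intro mult_mono) auto
 thus ?thesis by simp
qed

text \<open>Dilating by \<open>1 / sqrt N\<close> turns \<open>delta_part\<close> into a kernel that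
  converges to \<open>(2 - x) * exp (- x)\<close> in the area variable, of total mass
  \<open>2 - 1 = 1\<close>. A multiple of \<open>(6 + 3 * x) * exp (- x)\<close> dominates.\<close>

lemma delta_part_limit:
 fixes ps :: "complex => 'b::{banach, second_countable_topology}"
 assumes ps: "continuous_on UNIV ps" and C: "!!z. norm (ps z) <= C"
 shows "!!N. integrable lborel (%z. delta_part N (area z) *\<^sub>R ps z)"
  and "(%N. LBINT z. delta_part N (area z) *\<^sub>R ps z) ----> ps 0"
proof -
 let ?a = "%N z. of_real (1 / sqrt (real N)) * z"
 let ?c = "%z. (area z) ^ 0 * exp (- 1 * (area z))"
 let ?d = "%z. (area z) ^ 1 * exp (- 1 * (area z))"
 have [measurable]: "ps \<in> BM borel" using ps by (rule cont_measurable)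
 have C0: "0 <= C" using C[of 0] norm_ge_zero order.trans by blast
 define s where "s N z = (let x = area z in (exp (- x) * (bern (x / real N) * (4 - 2 * bern (x / real N) - 2 * (x / real N) - x))) *\<^sub>R ps (?a N z))" for N :: nat and z
 define w where "w z = (let x = area z in C * (6 * (x ^ 0 * exp (- 1 * x)) + 3 * (x ^ 1 * exp (- 1 * x))))" for z :: complex
 define l where "l z = (let x = area z in (2 * (x ^ 0 * exp (- 1 * x)) - (x ^ 1 * exp (- 1 * x))) *\<^sub>R ps 0)" for z :: complex
 have iw: "integrable lborel w" unfolding w_def Let_def by (intro integrable_mult_right integrable_plus integral_power_exp_area(1)) auto
 have il: "integrable lborel (%z. 2 * ?c z - ?d z)"
  by (intro integrable_mult_right Bochner_Integration.integrable_diff integral_power_exp_area(1)) auto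
 have "(LBINT z. 2 * ?c z - ?d z) = 2 * (fact 0 / 1 ^ Suc 0) - fact 1 / 1 ^ Suc 1"
  by (subst Bochner_Integration.integral_diff, intro integrable_mult_right integral_power_exp_area(1), simp, rule integral_power_exp_area(1), simp,
   subst integral_mult_right_zero, subst (1 2) integral_power_exp_area(2), auto)
 hence L: "(LBINT z. l z) = ps 0" unfolding l_def Let_def using il by simp
 have bnd: "AE z in lborel. norm (s N z) <= w z" if "0 < N" for N using AE_area_pos
 proof eventually_elim
  case (elim z)
  define x where "x = area z"
  have x: "0 < x" "0 < x / real N" "x / real N <= x" using elim that by (auto simp: x_def[symmetric] divide_le_eq)
  have "norm (s N z) <= (exp (- x) * (6 + 2 * (x / real N) + abs x)) * C"
   unfolding s_def Let_def x_def[symmetric] norm_scaleR abs_mult[of "exp _"]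
   using delta_part_bound[OF x(2), of x] C by (intro mult_mono) auto
  also have "... <= (exp (- x) * (6 + 3 * x)) * C" using x C0 by (intro mult_mono mult_nonneg_nonneg) auto
  finally show ?case unfolding w_def x_def[symmetric] by (simp add: alg_simps)
 qed
 have meas [measurable]: "s N \<in> BM borel" for N unfolding s_def Let_def by simp
 have lim: "AE z in lborel. (%N. s N z) ----> l z" using AE_area_pos
 proof eventually_elim
  case (elim z)
  define x where "x = area z"
  let ?b = "%z. (exp (- x) * (1 * (4 - 2 * 1 - 2 * 0 - x))) *\<^sub>R ps (of_real 0 * z)"
  have x: "0 < x" using elim by (simp add: x_def)
  have z: "(%N. of_real (1 / sqrt (real N)) * z) ----> of_real 0 * z" by (intro tendsto_mult tendsto_of_real tendsto_const) real_asymp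
  have "(%N. ps (?a N z)) ----> ps (of_real 0 * z)" by (intro continuous_on_tendsto_compose[OF ps z]) auto
  moreover have "(%N. x / real N) ----> 0" by real_asymp
  ultimately have "(%N. s N z) ----> (?b z)"
   unfolding s_def Let_def x_def[symmetric] by (intro tendsto_intros bern_tendsto x)
  also have "?b z = l z"
   unfolding l_def x_def[symmetric] by (simp add: alg_simps)
  finally show ?case .
 qed
 have d1: "(%N. LBINT z. s (Suc N) z) ----> (LBINT z. l z)"
  by (rule integral_dominated_convergence[OF _ _ iw]) (use lim bnd LIMSEQ_Suc in "auto simp: l_def[abs_def] Let_def")
 have si: "integrable lborel (s N)" if "0 < N" for N
  by (rule integrable_dom[OF iw]) (use bnd[OF that] in "auto elim!: ")
 have sc: "(1 / sqrt (real N))^2 *\<^sub>R (delta_part N (area (?a N z)) *\<^sub>R ps (?a N z)) = s N z" if "0 < N" for N z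
 proof -
  have "area (?a N z) = area z / real N" by (simp add: norm_divide power_divide)
  thus ?thesis using that by (simp add: s_def Let_def delta_part_def power_divide)
 qed
 note S = integral_lborel_complex_scale[of "%z. delta_part N (area z) *\<^sub>R ps z" "1 / sqrt (real N)" for N]
 have eq: "(LBINT z. delta_part N (area z) *\<^sub>R ps z) = (LBINT z. s N z)" if "0 < N" for N
  by (subst S(1)) (use that sc[OF that] in auto)
 have "(%N. LBINT z. delta_part (Suc N) (area z) *\<^sub>R ps z) ----> ps 0" using d1 L eq by simp
 thus "(%N. LBINT z. delta_part N (area z) *\<^sub>R ps z) ----> ps 0" by (rule LIMSEQ_imp_Suc)
 show "integrable lborel (%z. delta_part N (area z) *\<^sub>R ps z)" for N
 proof (cases "N = 0")
  case False
  hence N: "0 < N" by simp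
  show ?thesis by (subst S(2)[symmetric]) (use N sc[OF N] si[OF N] in auto)
 qed (simp add: delta_part_def)
qed

lemma integrable_g_scaleR:
 fixes ps :: "complex => 'b::{banach, second_countable_topology}"
 assumes [measurable]: "ps \<in> BM borel" and C: "!!z. norm (ps z) <= C" shows "integrable lborel (%z. g (cmod z) *\<^sub>R ps z)"
 by (rule integrable_dom[OF integrable_mult_left[of C, OF integrable_g]])
  (use C in "auto simp: abs_mult intro!: mult_left_mono order.trans[OF C]")

text \<open>Of the three parts of \<open>sum_lac\<close>, the first vanishes by dominated
  convergence and the second tends to evaluation at 0. Vector-valued \<open>ps\<close> cover real
  test functions, characters and Fourier transforms alike.\<close>

lemma integral_sum_lac_tendsto:
 fixes ps :: "complex => 'b::{banach, second_countable_topology}"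
 assumes ps: "continuous_on UNIV ps" and C: "!!z. norm (ps z) <= C"
 shows "(%n. LBINT z. lac (Suc n) (area z) *\<^sub>R ps z) sums (ps 0 - (LBINT z. g (cmod z) *\<^sub>R ps z))"
proof -
 let ?a = "LBINT z. g (cmod z) *\<^sub>R ps z"
 let ?b = "%N. \<Sum>n<N. LBINT z. lac (Suc n) (area z) *\<^sub>R ps z"
 let ?c = "%N. LBINT z. delta_part N (area z) *\<^sub>R ps z"
 have m [measurable]: "ps \<in> BM borel" using ps by (rule cont_measurable)
 note ig = integrable_g_scaleR[OF m C]
 note d = delta_part_limit[OF ps C]
 define e where "e N z = exp (- real N * (area z)) *\<^sub>R (g (cmod z) *\<^sub>R ps z)" for N :: nat and z
 have eb: "norm (e N z) <= norm (g (cmod z) *\<^sub>R ps z)" for N z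
  unfolding e_def norm_scaleR[of "exp _"] by (rule mult_left_le_one_le) auto
 have em [measurable]: "e N \<in> BM borel" for N unfolding e_def by simp
 have ei: "integrable lborel (e N)" for N by (rule integrable_dom[OF ig]) (use eb in auto)
 have e0: "(%N. LBINT z. e N z) ----> (\<integral>z. 0 \<partial>(lborel :: complex measure))"
 proof (rule integral_dominated_convergence[OF _ _ integrable_norm[OF ig]])
  show "AE z in lborel. (%N. e N z) ----> 0" using AE_area_pos
  proof eventually_elim
   case (elim z)
   have "(%N. exp (- real N * x)) ----> 0" if "0 < x" for x using that by real_asymp
   from tendsto_scaleR[OF this[OF elim] tendsto_const] show ?case unfolding e_def scaleR_zero_left .
  qed
 qed (use eb in auto)
 have ii: "integrable lborel (%z. lac (Suc n) (area z) *\<^sub>R ps z)" for n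
  by (rule integrable_dom[OF integrable_mult_left[of C, OF lac_area[of n]]])
   (use C in "auto simp: abs_mult intro!: mult_left_mono order.trans[OF C]")
 have "?b N
  = (LBINT z. e N z) + ?c N - ?a" for N
 proof -
  let ?d = "%z. \<Sum>n<N. lac (Suc n) (area z) *\<^sub>R ps z"
  have "?b N = (LBINT z. ?d z)"
   by (rule integral_of_sum[symmetric]) (rule ii)
  also have "... = (LBINT z. e N z + delta_part N (area z) *\<^sub>R ps z - g (cmod z) *\<^sub>R ps z)"
  proof (rule integral_cong_AE)
   show "AE z in lborel. ?d z = e N z + delta_part N (area z) *\<^sub>R ps z - g (cmod z) *\<^sub>R ps z"
    using AE_area_pos by eventually_elim (simp add: e_def g_eq_pair_fun sum_lac scaleR_sum_left[symmetric] scaleR_left.add scaleR_left.diff)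
  qed measurable
  finally show ?thesis using ei d(1) ig by simp
 qed
 moreover have "(%N. (LBINT z. e N z) + ?c N - ?a) ----> 0 + ps 0 - ?a"
  using e0 by (intro tendsto_intros d(2)) simp
 ultimately show ?thesis by (simp add: sums_def)
qed

section \<open>Ring averages of Gaussians\<close>

definition rad :: "real => real => real => real => real" where
 "rad al be c x = (al + be * x) * exp (- c * x)"

text \<open>\<open>(x F')'\<close> for \<open>F = rad al be c\<close>, a multiple of the Laplacian of \<open>z \<mapsto> F (\<pi> |z|\<^sup>2)\<close>.\<close>

definition rlap :: "real => real => real => real => real" where
 "rlap al be c x = (be - c * al + (c^2 * al - 3 * c * be) * x + c^2 * be * x^2) * exp (- c * x)"

lemma measurable_rlap [measurable]: "rlap al be c \<in> BM borel" "rad al be c \<in> BM borel"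
 unfolding rlap_def rad_def by auto

context
 fixes al be c :: real
 assumes c: "0 < c"
begin

private lemma rlap_bound:
 "set_integrable lborel {0..} (%x. (A + B * x) * abs (rlap al be c x))"
proof -
 define d where "d = abs (be - c * al)"
 define e where "e = abs (c^2 * al - 3 * c * be)"
 define k where "k = abs (c^2 * be)"
 note I = integral_power_exp(1)[OF c]
 have "set_integrable lborel {0..} (%x. abs A * d * (x ^ 0 * exp (- c * x)) + (abs A * e + abs B * d) * (x ^ 1 * exp (- c * x))
   + (abs A * k + abs B * e) * (x ^ 2 * exp (- c * x)) + abs B * k * (x ^ 3 * exp (- c * x)))"
  by (intro set_integral_add set_integrable_mult_right I)
 thus ?thesis
 proof (rule set_integrable_bound)
  show "set_borel_measurable lborel {0..} (%x. (A + B * x) * abs (rlap al be c x))" unfolding set_borel_measurable_def by simp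
  show "AE x in lborel. x \<in> {0..} --> norm ((A + B * x) * abs (rlap al be c x)) <= norm (abs A * d * (x ^ 0 * exp (- c * x)) + (abs A * e + abs B * d) * (x ^ 1 * exp (- c * x))
   + (abs A * k + abs B * e) * (x ^ 2 * exp (- c * x)) + abs B * k * (x ^ 3 * exp (- c * x)))"
  proof (intro AE_I2 impI)
   fix x :: real assume "x \<in> {0..}"
   hence x: "0 <= x" by simp
   have "abs (be - c * al + (c^2 * al - 3 * c * be) * x + c^2 * be * x^2) <= d + e * x + k * x^2"
    using x unfolding d_def e_def k_def by (intro order.trans[OF abs_triangle_ineq] add_mono) (auto simp: abs_mult)
   moreover have "abs (A + B * x) <= abs A + abs B * x"
    using x by (intro order.trans[OF abs_triangle_ineq]) (simp add: abs_mult)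
   ultimately have "norm ((A + B * x) * abs (rlap al be c x)) <= (abs A + abs B * x) * ((d + e * x + k * x^2) * exp (- c * x))"
    unfolding rlap_def by (auto simp: abs_mult intro!: mult_mono)
   also have "... = abs A * d * (x ^ 0 * exp (- c * x)) + (abs A * e + abs B * d) * (x ^ 1 * exp (- c * x))
   + (abs A * k + abs B * e) * (x ^ 2 * exp (- c * x)) + abs B * k * (x ^ 3 * exp (- c * x))"
    by (simp add: alg_simps power2 power3_eq_cube)
   finally show "norm ((A + B * x) * abs (rlap al be c x)) <= norm (abs A * d * (x ^ 0 * exp (- c * x)) + (abs A * e + abs B * d) * (x ^ 1 * exp (- c * x))
   + (abs A * k + abs B * e) * (x ^ 2 * exp (- c * x)) + abs B * k * (x ^ 3 * exp (- c * x)))"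
    by (rule order.trans) (unfold real_norm_def, rule abs_ge_self)
  qed
 qed
qed

private lemma rlap_bound_area: "integrable lborel (%z. (A + B * (area z)) * abs (rlap al be c (area z)))"
 using integral_area(2)[of "%x. (A + B * x) * abs (rlap al be c x)"] rlap_bound by simp

private lemma integral_rlap: "set_integrable lborel {0..} (rlap al be c)" "(LINT x:{0..}|lborel. rlap al be c x) = 0"
proof -
 have e: "rlap al be c x = (be - c * al) * (x ^ 0 * exp (- c * x)) + (c^2 * al - 3 * c * be) * (x ^ 1 * exp (- c * x)) + c^2 * be * (x ^ 2 * exp (- c * x))" for x
  by (simp add: rlap_def alg_simps)
 note I = integral_power_exp[OF c]
 show "set_integrable lborel {0..} (rlap al be c)"
  unfolding e[abs_def] by (intro set_integral_add set_integrable_mult_right I)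
 have "(LINT x:{0..}|lborel. rlap al be c x) = (be - c * al) * (fact 0 / c ^ Suc 0) + (c^2 * al - 3 * c * be) * (fact 1 / c ^ Suc 1) + c^2 * be * (fact 2 / c ^ Suc 2)"
  unfolding e[abs_def] by (subst set_integral_add, intro set_integral_add set_integrable_mult_right I, intro set_integrable_mult_right I,
   subst set_integral_add, intro set_integrable_mult_right I, intro set_integrable_mult_right I, simp only: set_integral_mult_right I(2))
 also have "... = 0" by (simp add: field_simps power2 power3_eq_cube)
 finally show "(LINT x:{0..}|lborel. rlap al be c x) = 0" .
qed

text \<open>\<open>W\<close> is \<open>x * F'\<close> for \<open>F = rad al be c\<close>, and
  \<open>W' = rlap\<close>. Hence \<open>ln x * W - F\<close> is a primitive of
  \<open>ln x * rlap\<close> that vanishes at infinity, and at \<open>p\<close> its term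
  \<open>ln p * W p\<close> cancels the integral over \<open>{0..p}\<close>.\<close>

private lemma ln_max_rlap:
 assumes p: "0 <= p" and i: "set_integrable lborel {0..} (%x. ln (max p x) * rlap al be c x)"
 shows "(LINT x:{0..}|lborel. ln (max p x) * rlap al be c x) = rad al be c p"
proof -
 define W where "W x = ((be - c * al) * x - c * be * x^2) * exp (- c * x)" for x
 have W: "(W has_real_derivative rlap al be c x) (at x)" for x
  unfolding W_def rlap_def by (auto intro!: derivative_eq_intros simp: alg_simps power2)
 have F: "(rad al be c has_real_derivative W x / x) (at x)" if "0 < x" for x
  unfolding W_def rad_def using that by (auto intro!: derivative_eq_intros simp: field_simps power2)
 define H where "H x = ln x * W x - rad al be c x" for x
 have H: "(H has_real_derivative ln x * rlap al be c x) (at x)" if "0 < x" for x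
  unfolding H_def using that by (auto intro!: derivative_eq_intros W F)
 have cr: "isCont (rlap al be c) x" for x unfolding rlap_def by auto
 have split: "{0..} = {0..p} \<union> {p<..}" using p by auto
 have i1: "set_integrable lborel {0..p} (%x. ln (max p x) * rlap al be c x)" "set_integrable lborel {p<..} (%x. ln (max p x) * rlap al be c x)"
  by (rule set_integrable_subset[OF i]; use p in auto)+
 have "(LINT x:{0..p}|lborel. ln (max p x) * rlap al be c x) = (LINT x:{0..p}|lborel. ln p * rlap al be c x)"
  by (intro set_lebesgue_integral_cong) auto
 also have "... = ln p * (LBINT x. rlap al be c x * indicator {0..p} x)"
  by (simp add: set_lebesgue_integral_def mult.commute)
 also have "(LBINT x. rlap al be c x * indicator {0..p} x) = W p - W 0" by (rule integral_FTC_Icc_real) (use W cr p in auto)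
 finally have 1: "(LINT x:{0..p}|lborel. ln (max p x) * rlap al be c x) = ln p * W p" by (simp add: W_def)
 have top: "(H \<longlongrightarrow> 0) at_top"
 proof -
  have t: "((%x. x ^ k * exp (- c * x)) \<longlongrightarrow> 0) at_top" "((%x. ln x * (x ^ k * exp (- c * x))) \<longlongrightarrow> 0) at_top" for k :: nat
   using c by real_asymp+
  have "((%x. (be - c * al) * (ln x * (x ^ 1 * exp (- c * x))) - c * be * (ln x * (x ^ 2 * exp (- c * x))) - (al * (x ^ 0 * exp (- c * x)) + be * (x ^ 1 * exp (- c * x)))) \<longlongrightarrow> (be - c * al) * 0 - c * be * 0 - (al * 0 + be * 0)) at_top"
   by (intro tendsto_intros t)
  thus ?thesis unfolding H_def[abs_def] W_def rad_def by (simp add: alg_simps)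
 qed
 have bot: "(H \<longlongrightarrow> ln p * W p - rad al be c p) (at_right p)"
 proof (cases "p = 0")
  case True
  have "((%x. (ln x * x) * ((be - c * al - c * be * x) * exp (- c * x)) - rad al be c x) \<longlongrightarrow> 0 * ((be - c * al - c * be * 0) * exp (- c * 0)) - rad al be c 0) (at_right 0)"
   unfolding rad_def by (intro tendsto_intros) real_asymp
  thus ?thesis using True by (simp add: H_def[abs_def] W_def alg_simps power2)
 next
  case False
  hence "isCont H p" using H[of p] p by (intro DERIV_isCont) auto
  hence "(H \<longlongrightarrow> H p) (at p)" by (rule isContD)
  thus ?thesis unfolding H_def by (rule tendsto_mono[rotated]) (simp add: at_le)
 qed
 have "(LINT x:{p<..}|lborel. ln (max p x) * rlap al be c x) = (LINT x:{p<..}|lborel. ln x * rlap al be c x)"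
  by (intro set_lebesgue_integral_cong) auto
 also have "... = (LBINT x=ereal p..\<infinity>. ln x * rlap al be c x)" by (simp add: interval_lebesgue_integral_def)
 also have "... = 0 - (ln p * W p - rad al be c p)"
 proof (rule interval_integral_FTC_integrable[where F = H])
  show "(H has_vector_derivative ln x * rlap al be c x) (at x)" if "ereal p < ereal x" for x
   using H[of x] that p by (simp add: has_real_derivative_iff_has_vector_derivative)
  show "isCont (%x. ln x * rlap al be c x) x" if "ereal p < ereal x" for x using that p by (intro continuous_intros cr) auto
  have "set_integrable lborel {p<..} (%x. ln x * rlap al be c x)"
   using i1(2) by (rule set_integrable_cong[THEN iffD1, rotated 3]) auto
  thus "set_integrable lborel (einterval (ereal p) \<infinity>) (%x. ln x * rlap al be c x)" by simp
 qed (use top bot in "auto simp: ereal_tendsto_simps")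
 finally show ?thesis unfolding split using 1 i1 by (subst set_integral_Un) auto
qed

text \<open>The logarithm is the fundamental solution of the planar Laplacian. Averaging over
  rotations reduces the potential to the one-dimensional \<open>ln max\<close> integral; the
  constant \<open>ln pi\<close> from the area variable drops out since \<open>rlap\<close> has
  integral 0.\<close>

lemma log_potential:
 assumes i: "integrable lborel (%ze. 2 * rlap al be c (area ze) * lnc (z - ze))"
 shows "(LBINT ze. 2 * rlap al be c (area ze) * lnc (z - ze)) = rad al be c (area z)"
proof -
 let ?c = "%ze. max (cmod z) (cmod ze)"
 define p where "p = area z"
 let ?b = "%x. abs (ln p) + (1 / p) * x"
 define D where "D = rlap al be c"
 let ?a = "%ze. MEAN th. 2 * D (area (circ th * ze)) * lnc (z - circ th * ze)"
 let ?d = "%x. D x * (ln (max p x) - ln pi)"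
 let ?e = "%x. D x * (ln x - ln pi)"
 have [measurable]: "D \<in> BM borel" by (simp add: D_def)
 have p: "0 <= p" by (simp add: p_def)
 have lnm: "2 * ln (?c ze) = ln (max p (area ze)) - ln pi" if "ze ~= 0" for ze
 proof -
  have 1: "max p (area ze) = pi * ?c ze^2" unfolding p_def max_def by auto
  show ?thesis unfolding 1 using that by (subst ln_mult) (auto simp: ln_realpow max_def)
 qed
 have D: "set_integrable lborel {0..} D" "(LINT x:{0..}|lborel. D x) = 0" unfolding D_def by (rule integral_rlap)+
 have I: "set_integrable lborel {0..} (%x. ln (max p x) * D x)"
 proof (cases "z = 0")
  case True
  have "integrable lborel (%ze. ?e (area ze))"
  proof (rule integrable_cong_AE_imp[OF i])
   show "AE ze in lborel. 2 * rlap al be c (area ze) * lnc (z - ze) = D (area ze) * (ln (area ze) - ln pi)"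
    using AE_lborel_singleton[of "0::complex"]
   proof eventually_elim
    case (elim ze)
    thus ?case using lnm[OF elim] True by (simp add: D_def p_def)
   qed
  qed measurable
  hence "set_integrable lborel {0..} ?e" by (subst (asm) integral_area(2)) simp
  hence "set_integrable lborel {0..} (%x. D x * (ln x - ln pi) + D x * ln pi)"
   using D by simp
  thus ?thesis by (rule set_integrable_cong[THEN iffD1, rotated 3]) (auto simp: True p_def alg_simps)
 next
  case False
  hence p: "0 < p" by (simp add: p_def)
  have "set_integrable lborel {0..} (%x. ?b x * abs (D x))" unfolding D_def by (rule rlap_bound)
  thus ?thesis
  proof (rule set_integrable_bound)
   show "AE x in lborel. x \<in> {0..} --> norm (ln (max p x) * D x) <= norm (?b x * abs (D x))"
   proof (intro AE_I2 impI)
    fix x :: real assume "x \<in> {0..}"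
    hence x: "0 <= x" by simp
    have "abs (ln (max p x)) <= abs (ln p) + x / p"
    proof (cases "x <= p")
     case False
     hence "ln x = ln p + ln (x / p)" "0 <= ln (x / p)" using p by (auto simp: ln_div)
     moreover have "ln (x / p) <= x / p" using p False by (intro ln_bound) auto
     ultimately have "abs (ln x) <= abs (ln p) + x / p" by simp
     thus ?thesis using False by simp
    qed (use x p in "auto simp: max_def")
    thus "norm (ln (max p x) * D x) <= norm (?b x * abs (D x))"
     by (auto simp: abs_mult intro!: mult_right_mono)
   qed
  qed (unfold set_borel_measurable_def, measurable)
 qed
 have "(LBINT ze. 2 * D (area ze) * lnc (z - ze))
  = (LBINT ze. ?a ze)"
  by (rule integral_rotation_average) (use i lborel_complex_mult_unit sigma_finite_lborel in "auto simp: D_def")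
 also have "... = (LBINT ze. ?d (area ze))"
 proof (rule integral_cong_AE)
  show "AE ze in lborel. ?a ze = ?d (area ze)"
   using AE_norm_neq[of 0 "cmod z"] AE_lborel_singleton[of "0::complex"]
  proof eventually_elim
   case (elim ze)
   hence "cmod z ~= cmod (- ze)" by auto
   from mean_ln_circ(2)[OF this] have m: "(MEAN th. lnc (z - circ th * ze)) = ln (?c ze)" by simp
   have "?a ze = D (area ze) * (2 * ln (?c ze))"
    unfolding norm_mult by (simp add: m)
   thus ?case using lnm[OF elim(2)] by simp
  qed
 qed measurable
 also have "... = (LINT x:{0..}|lborel. ln (max p x) * D x - ln pi * D x)" by (subst integral_area(1)) (simp_all add: alg_simps)
 also have "... = rad al be c p" using I D ln_max_rlap[OF p, folded D_def] by simp
 finally show ?thesis by (simp add: p_def D_def)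
qed

text \<open>Write \<open>rad\<close> as a logarithmic potential and take the circle mean under the
  integral, where it turns each logarithm into \<open>ln max\<close>.\<close>

lemma circle_mean_rad:
 assumes R: "0 < R" shows "integrable lborel (%ze. 2 * rlap al be c (area ze) * ln (max (cmod (t - ze)) R))"
  and "(MEAN th. rad al be c (area (t + of_real R * circ th)))
   = (LBINT ze. 2 * rlap al be c (area ze) * ln (max (cmod (t - ze)) R))"
proof -
 let ?a = "%ze th. t - ze + circ th * of_real R"
 let ?b = "%ze. max (cmod (t - ze)) R"
 let ?c = "MEAN th. rad al be c (area (t + of_real R * circ th))"
 let ?d = "%ze. MEAN th. abs (lnc (?a ze th))"
 let ?e = "%ze. cmod t + cmod ze + R"
 define D where "D ze = 2 * rlap al be c (area ze)" for ze
 have [measurable]: "D \<in> BM borel" unfolding D_def by simp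
 interpret pair_sigma_finite "lborel :: complex measure" U01 ..
 define C where "C = 2 * cmod t + 2 + 2 * R + abs (ln R)"
 have iD: "integrable lborel (%ze. (C + 2 * (area ze)) * abs (D ze))"
  using integrable_mult_right[of 2, OF rlap_bound_area[of C 2]] by (simp add: D_def abs_mult mult_ac)
 have sq: "cmod ze <= 1 + area ze" for ze
 proof -
  have "0 <= (cmod ze - 1/2)^2" by simp
  hence "cmod ze <= 1 + 1 * (cmod ze)^2" by (simp add: power2 alg_simps)
  moreover have "1 * (cmod ze)^2 <= area ze" using pi_gt3 by (intro mult_right_mono) auto
  ultimately show ?thesis by simp
 qed
 have mx: "abs (ln (?b ze)) <= C + 2 * (area ze)" for ze
 proof -
  have 1: "ln R <= ln (?b ze)" using R by simp
  have "ln (?b ze) <= max (cmod (t - ze)) R" using R by (intro ln_bound) auto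
  also have "... <= ?e ze" using norm_triangle_ineq4[of t ze] R by auto
  finally have 2: "ln (?b ze) <= ?e ze" .
  define L where "L = ln (?b ze)"
  define y where "y = area ze"
  have "L <= ?e ze" "ln R <= L" "cmod ze <= 1 + y" "0 <= y" using 1 2 sq[of ze] by (auto simp: L_def y_def)
  thus ?thesis unfolding C_def L_def[symmetric] y_def[symmetric] abs_le_iff[of L] using R norm_ge_zero[of t] norm_ge_zero[of ze] by (intro conjI) linarith+
 qed
 have "integrable lborel (%ze. D ze * ln (?b ze))" by (rule integrable_dom[OF iD])
   (auto simp: abs_mult mult.commute[of _ "abs (D _)"] intro!: mult_left_mono order.trans[OF mx abs_ge_self])
 thus "integrable lborel (%ze. 2 * rlap al be c (area ze) * ln (?b ze))" by (simp add: D_def)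
 define f where "f = (%(ze, th). D ze * lnc (?a ze th))"
 have [measurable]: "f \<in> BM (lborel >< U01)" unfolding f_def by simp
 have ne: "AE ze in lborel. cmod (t - ze) ~= cmod (of_real R :: complex)" using AE_norm_neq[of t R] R by simp
 have "integrable (lborel >< U01) f"
 proof (rule Fubini_integrable)
  show "AE ze in lborel. integrable U01 (%th. f (ze, th))"
   using ne by eventually_elim (auto simp: f_def intro!: mean_ln_circ)
  show "integrable lborel (%ze. MEAN th. norm (f (ze, th)))"
  proof (rule integrable_dom[OF iD])
   show "AE ze in lborel. norm (MEAN th. norm (f (ze, th))) <= norm ((C + 2 * (area ze)) * abs (D ze))" using ne
   proof eventually_elim
    case (elim ze)
    note m = mean_ln_circ[OF elim]
    define b where "b = ?e ze"
    \<comment> \<open>For \<open>0 < r <= b\<close> one has \<open>|ln r| <= 2 * b - ln r\<close>,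
      which bounds the mean of the absolute value by the known mean of the logarithm.\<close>
    have "?d ze <= (MEAN th. 2 * b - lnc (?a ze th))"
    proof (rule integral_mono)
     fix th
     have ub: "cmod (?a ze th) <= b"
      unfolding b_def using R by (intro order.trans[OF norm_triangle_ineq] add_mono norm_triangle_ineq4) (simp add: norm_mult)
     have "0 < cmod (?a ze th)"
     proof -
      have "t - ze ~= - (circ th * of_real R)" using elim by (auto simp: norm_mult)
      thus ?thesis by (simp add: add_eq_0_iff2)
     qed
     from ln_bound[OF this] ub norm_ge_zero[of "t - ze + circ th * of_real R"]
     show "abs (lnc (?a ze th)) <= 2 * b - lnc (?a ze th)" by linarith
    qed (use m(1) in auto)
    also have "... = 2 * b - ln (?b ze)" using m R by (simp add: U01.prob_space[simplified])
    also have "... <= C + 2 * (area ze)"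
    proof -
     have "ln R <= ln (?b ze)" using R by simp
     thus ?thesis using sq[of ze] unfolding b_def C_def by auto
    qed
    finally have "?d ze * abs (D ze) <= (C + 2 * (area ze)) * abs (D ze)"
     by (rule mult_right_mono) simp
    moreover have "(MEAN th. norm (f (ze, th))) = ?d ze * abs (D ze)"
     by (simp add: f_def abs_mult)
    ultimately show ?case by simp
   qed
  qed measurable
 qed measurable
 note F = Fubini_integral[OF this[unfolded f_def]] AE_integrable_snd[OF this[unfolded f_def]]
 have u: "D ze * lnc (?a ze th) = 2 * rlap al be c (area ze) * lnc ((t + of_real R * circ th) - ze)" for ze th
  by (simp add: D_def alg_simps)
 \<comment> \<open>Fubini gives integrability of the potential for almost every point of the circle,
   and this is enough for the mean.\<close>
 have "?c = (MEAN th. (LBINT ze. D ze * lnc (?a ze th)))"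
 proof (rule integral_cong_AE)
  show "AE th in U01. rad al be c (area (t + of_real R * circ th)) = (LBINT ze. D ze * lnc (?a ze th))"
   using F(2) unfolding u by eventually_elim (rule log_potential[symmetric])
 qed measurable
 also have "... = (LBINT ze. (MEAN th. D ze * lnc (?a ze th)))" by (rule F(1))
 also have "... = (LBINT ze. D ze * ln (?b ze))"
 proof (rule integral_cong_AE)
  show "AE ze in lborel. (MEAN th. D ze * lnc (?a ze th)) = D ze * ln (?b ze)"
   using ne by eventually_elim (use R mean_ln_circ(2) in simp)
 qed measurable
 finally show "?c = (LBINT ze. 2 * rlap al be c (area ze) * ln (?b ze))"
  by (simp add: D_def)
qed

text \<open>The two \<open>ln max\<close> kernels differ by the tent, so a ring difference is the
  Laplacian smoothed by the tent.\<close>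

lemma ring_mean_rad:
 assumes R: "0 < R1" "R1 < R2"
 shows "(MEAN th. rad al be c (area (t + of_real R2 * circ th))) - (MEAN th. rad al be c (area (t + of_real R1 * circ th)))
   = (LBINT ze. tent R1 R2 (ze - t) * (2 * rlap al be c (area ze)))"
proof -
 have 0: "0 < R2" using R by simp
 have "ln (max (cmod (t - ze)) R2) - ln (max (cmod (t - ze)) R1) = tent R1 R2 (ze - t)" for ze
  using R unfolding tent_def norm_minus_commute[of t] by (auto simp: min_def)
 hence "2 * rlap al be c (area ze) * ln (max (cmod (t - ze)) R2) - 2 * rlap al be c (area ze) * ln (max (cmod (t - ze)) R1)
   = tent R1 R2 (ze - t) * (2 * rlap al be c (area ze))" for ze by (simp add: right_diff_distrib[symmetric])
 thus ?thesis unfolding circle_mean_rad(2)[OF R(1)] circle_mean_rad(2)[OF 0]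
  using circle_mean_rad(1)[OF R(1)] circle_mean_rad(1)[OF 0] by (subst Bochner_Integration.integral_diff[symmetric]) auto
qed

end

section \<open>Evaluation of the ring correlation\<close>

lemma (in pair_sigma_finite) Fubini_dominated:
 fixes f :: "'a \<times> 'b => 'c::{banach, second_countable_topology}"
 assumes f [measurable]: "f \<in> BM (M1 >< M2)" and a: "integrable M1 a" and b: "integrable M2 (b :: 'b => real)"
  and le: "!!x y. norm (f (x, y)) <= a x * b y"
 shows "integrable (M1 >< M2) f" and "(\<integral>y. \<integral>x. f (x, y) \<partial>M1 \<partial>M2) = (\<integral>x. \<integral>y. f (x, y) \<partial>M2 \<partial>M1)"
proof -
 let ?a = "%x. \<integral>y. norm (f (x, y)) \<partial>M2"
 let ?b = "\<integral>y. b y \<partial>M2"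
 have i: "integrable M2 (%y. f (x, y))" if "x \<in> space M1" for x by (rule integrable_dom[OF integrable_mult_right[of "a x", OF b]]) (use le that in "auto intro!: order.trans[OF le abs_ge_self] simp del: ")
 show I: "integrable (M1 >< M2) f"
 proof (rule Fubini_integrable[OF f])
  show "integrable M1 (%x. \<integral>y. norm (f (x, y)) \<partial>M2)"
  proof (rule integrable_dom[OF integrable_mult_left[of "\<integral>y. b y \<partial>M2", OF a]])
   show "AE x in M1. norm (?a x) <= norm (a x * ?b)"
   proof (rule AE_I2)
    fix x assume x: "x \<in> space M1"
    have "?a x <= (\<integral>y. a x * b y \<partial>M2)"
     by (rule integral_mono) (use i[OF x] b le in auto)
    thus "norm (?a x) <= norm (a x * ?b)"
     by auto
   qed
  qed measurable
 qed (use i in auto)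
 thus "(\<integral>y. \<integral>x. f (x, y) \<partial>M1 \<partial>M2) = (\<integral>x. \<integral>y. f (x, y) \<partial>M2 \<partial>M1)"
  using Fubini_integral[of "%x y. f (x, y)"] by simp
qed

lemma integral_lborel_translate:
 fixes f :: "'a::euclidean_space => 'b::{banach, second_countable_topology}"
 assumes [measurable]: "f \<in> BM borel"
 shows "(LBINT z. f (c + z)) = (LBINT z. f z)" "integrable lborel (%z. f (c + z)) <-> integrable lborel f"
proof -
 have "(\<integral>z. f z \<partial>distr lborel borel ((+) c)) = (LBINT z. f (c + z))" by (rule integral_distr) auto
 thus "(LBINT z. f (c + z)) = (LBINT z. f z)" by (simp add: lborel_distr_plus)
 have "integrable (distr lborel borel ((+) c)) f <-> integrable lborel (%z. f (c + z))" by (rule integrable_distr_eq) auto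
 thus "integrable lborel (%z. f (c + z)) <-> integrable lborel f" by (simp add: lborel_distr_plus)
qed

section \<open>The correlation of two tents\<close>

context
 fixes R1 R2 :: real
 assumes R: "0 < R1" "R1 < R2"
begin

text \<open>In the area variable the tent is constant, then logarithmic, then zero. Its mass is the
  constant in \<open>ring_mean\<close>, in accordance with zeros of intensity one.\<close>

lemma integral_tent: "integrable lborel (tent R1 R2)" "(LBINT z. tent R1 R2 z) = pi * (R2^2 - R1^2) / 2"
proof -
 let ?a = "ln R2 - ln R1"
 let ?b = "%x X1. sqrt (x / pi) <= sqrt (X1 / pi)"
 let ?d = "%x. ln R2 - ln (x / pi) / 2"
 let ?e = "pi * (R2^2 - R1^2) / 2"
 define ta where "ta x = ln R2 - ln (min R2 (max R1 (sqrt (x / pi))))" for x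
 have [measurable]: "ta \<in> BM borel" unfolding ta_def by simp
 have t: "tent R1 R2 z = ta (area z)" for z by (simp add: tent_def ta_def)
 define X1 X2 where "X1 = pi * R1^2" and "X2 = pi * R2^2"
 have X: "0 < X1" "X1 < X2" using R by (auto simp: X1_def X2_def power_strict_mono)
 have sq: "sqrt (X1 / pi) = R1" "sqrt (X2 / pi) = R2" using R by (auto simp: X1_def X2_def)
 have ta1: "ta x = ln R2 - ln R1" if "x \<in> {0..X1}" for x
 proof -
  have "?b x X1" using that by (intro real_sqrt_le_mono divide_right_mono) auto
  thus ?thesis using R by (simp add: ta_def sq)
 qed
 have ta2: "ta x = ln R2 - ln (x / pi) / 2" if "x \<in> {X1..X2}" for x
 proof -
  have "?b X1 x" "?b x X2" using that by (intro real_sqrt_le_mono divide_right_mono; simp)+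
  thus ?thesis using R X that by (simp add: ta_def sq ln_sqrt)
 qed
 have ta3: "ta x = 0" if "X2 < x" for x
 proof -
  have "?b X2 x" using that by (intro real_sqrt_le_mono divide_right_mono) auto
  thus ?thesis by (simp add: ta_def sq)
 qed
 define H where "H x = x * ln R2 - (x * ln (x / pi) - x) / 2" for x
 let ?c = "H X2 - H X1"
 have 2: "has_bochner_integral lborel (%x. ?d x * indicator {X1..X2} x) ?c"
 proof (rule has_bochner_integral_FTC_Icc_real)
  fix x assume x: "X1 <= x" "x <= X2"
  show "(H has_real_derivative (?d x)) (at x)"
   unfolding H_def using x X by (auto intro!: derivative_eq_intros simp: field_simps)
  show "isCont (%x. ln R2 - ln (x / pi) / 2) x" using x X by (intro continuous_intros) auto
 qed (use X in auto)
 have 1: "has_bochner_integral lborel (%x. ?a * indicator {0..X1} x) (?a * X1)"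
  using X by (intro has_bochner_integral_mult_right has_bochner_integral_real_indicator[THEN has_bochner_integral_cong[THEN iffD1, rotated 3]]) auto
 have "has_bochner_integral lborel (%x. indicator {0..} x *\<^sub>R ta x) (?a * X1 + ?c)"
 proof (rule has_bochner_integral_cong_AE[THEN iffD1, OF _ _ _ has_bochner_integral_add[OF 1 2]])
  show "AE x in lborel. ?a * indicator {0..X1} x + ?d x * indicator {X1..X2} x = indicator {0..} x *\<^sub>R ta x"
   using AE_lborel_singleton[of X1]
  proof eventually_elim
   case (elim x)
   consider "x < 0" | "0 <= x" "x < X1" | "X1 < x" "x <= X2" | "X2 < x" using elim by linarith
   thus ?case using X ta1[of x] ta2[of x] ta3[of x] by cases auto
  qed
 qed measurable
 hence s: "set_integrable lborel {0..} ta" "(LINT x:{0..}|lborel. ta x) = ?a * X1 + ?c"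
  by (auto simp: set_integrable_def set_lebesgue_integral_def has_bochner_integral_iff)
 have "H X2 - H X1 = X2 * ln R2 - (X2 * (2 * ln R2) - X2) / 2 - (X1 * ln R2 - (X1 * (2 * ln R1) - X1) / 2)"
  by (simp add: H_def X1_def X2_def ln_realpow)
 hence "?a * X1 + ?c = (X2 - X1) / 2" by (simp add: field_simps)
 also have "... = ?e" by (simp add: X1_def X2_def alg_simps)
 finally show "integrable lborel (tent R1 R2)" "(LBINT z. tent R1 R2 z) = ?e"
  using s integral_area[of ta] by (simp_all add: t[abs_def])
qed

private lemma T: "0 <= tent R1 R2 z" "tent R1 R2 z <= ln R2 - ln R1" "0 <= ln R2 - ln R1"
 using R tent_nonneg[OF R] tent_le[OF R] by auto

lemma tent_corr_nonneg: "0 <= tent_corr R1 R2 u"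
 unfolding tent_corr_def using T by auto

private lemma tent_prod: "norm (tent R1 R2 x * tent R1 R2 y) <= (ln R2 - ln R1) * tent R1 R2 y"
 using T by (simp add: mult_right_mono)

lemma tent_corr_le: "tent_corr R1 R2 u <= (ln R2 - ln R1) * (pi * (R2^2 - R1^2) / 2)"
proof -
 have "tent_corr R1 R2 u <= (LBINT v. (ln R2 - ln R1) * tent R1 R2 v)" unfolding tent_corr_def
 proof (rule integral_mono)
  show "integrable lborel (%v. tent R1 R2 (u + v) * tent R1 R2 v)"
   by (rule integrable_dom[OF integrable_mult_right[of "ln R2 - ln R1", OF integral_tent(1)]]) (use tent_prod T in "auto intro!: ")
 qed (use T integral_tent in "auto intro: mult_right_mono")
 thus ?thesis by (simp add: integral_tent(2))
qed

lemma continuous_tent_corr: "continuous_on UNIV (tent_corr R1 R2)"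
proof (rule continuous_at_imp_continuous_on, intro ballI)
 fix u :: complex
 show "isCont (tent_corr R1 R2) u" unfolding continuous_at_sequentially comp_def
 proof (intro allI impI)
  fix s assume s: "s ----> u"
  show "(%n. tent_corr R1 R2 (s n)) ----> tent_corr R1 R2 u" unfolding tent_corr_def
  proof (rule integral_dominated_convergence[OF _ _ integrable_mult_right[of "ln R2 - ln R1", OF integral_tent(1)]])
   show "AE v in lborel. (%n. tent R1 R2 (s n + v) * tent R1 R2 v) ----> tent R1 R2 (u + v) * tent R1 R2 v"
   proof (intro AE_I2 tendsto_mult tendsto_const)
    fix v
    have "continuous_on UNIV (tent R1 R2)" using R by (intro continuous_tent) auto
    thus "(%n. tent R1 R2 (s n + v)) ----> tent R1 R2 (u + v)" by (rule continuous_on_tendsto_compose) (auto intro!: tendsto_intros s)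
   qed
  qed (use tent_prod in auto)
 qed
qed

lemma integral_tent_corr:
 "integrable lborel (tent_corr R1 R2)" "(LBINT u. tent_corr R1 R2 u) = (pi * (R2^2 - R1^2) / 2)^2"
proof -
 define f where "f = (%(v, u). tent R1 R2 (u + v) * tent R1 R2 v)"
 have [measurable]: "f \<in> BM (lborel >< lborel)" unfolding f_def by simp
 define ka where "ka = pi * (R2^2 - R1^2) / 2"
 have ka: "(LBINT u. tent R1 R2 u) = ka" unfolding ka_def by (rule integral_tent(2))
 have t: "integrable lborel (%u. tent R1 R2 (u + v))" "(LBINT u. tent R1 R2 (u + v)) = ka" for v
  using integral_lborel_translate[of "tent R1 R2" v] integral_tent(1) ka by (simp_all add: add.commute)
 have I: "integrable (lborel >< lborel) f" by (rule lborel_pair.Fubini_integrable) (use t integral_tent(1) T in "auto simp: f_def ")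
 from lborel_pair.integrable_snd[OF I[unfolded f_def]] lborel_pair.Fubini_integral[OF I[unfolded f_def]]
 show "integrable lborel (tent_corr R1 R2)" "(LBINT u. tent_corr R1 R2 u) = (pi * (R2^2 - R1^2) / 2)^2"
  unfolding ka_def[symmetric] by (simp_all add: tent_corr_def[abs_def] t ka power2)
qed

lemma integral_mult_tent_corr:
 assumes k: "integrable lborel k"
 shows "(LBINT et. tent R1 R2 et * (LBINT ze. tent R1 R2 (ze + et + c) * k ze)) = (LBINT ze. k ze * tent_corr R1 R2 (ze + c))"
proof -
 let ?a = "%(ze, et). tent R1 R2 et * (tent R1 R2 (ze + et + c) * k ze)"
 have [measurable]: "k \<in> BM borel" using borel_measurable_integrable[OF k] by simp
 have "(LBINT et. (LBINT ze. ?a (ze, et)))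
  = (LBINT ze. (LBINT et. ?a (ze, et)))"
 proof (rule lborel_pair.Fubini_dominated(2))
  show "integrable lborel (%ze. (ln R2 - ln R1) * abs (k ze))" using k by auto
  show "norm (?a (ze, et)) <= (ln R2 - ln R1) * abs (k ze) * tent R1 R2 et" for ze et
   using mult_right_mono[OF tent_prod[of "ze + et + c" et], of "abs (k ze)"] by (simp add: abs_mult mult_ac)
 qed (use integral_tent in measurable)
 moreover have "(LBINT et. tent R1 R2 et * (tent R1 R2 (ze + et + c) * k ze)) = k ze * tent_corr R1 R2 (ze + c)" for ze
 proof -
  have "tent R1 R2 et * (tent R1 R2 (ze + et + c) * k ze) = k ze * (tent R1 R2 (ze + c + et) * tent R1 R2 et)" for et by (simp add: ac_simps)
  thus ?thesis unfolding tent_corr_def by (simp only: integral_mult_right_zero)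
 qed
 ultimately show ?thesis by simp
qed

end

lemma rad_bound:
 assumes c: "0 < c" and x: "0 <= x" shows "abs (rad al be c x) <= abs al + abs be / c"
proof -
 have "c * x <= exp (c * x)" using exp_ge_add_one_self[of "c * x"] by linarith
 hence xe: "x * exp (- c * x) <= 1 / c" using c by (simp add: exp_minus field_simps)
 have "abs (rad al be c x) <= (abs al + abs be * x) * exp (- c * x)"
  using x unfolding rad_def abs_mult by (intro mult_mono order.trans[OF abs_triangle_ineq]) (auto simp: abs_mult)
 also have "... = abs al * exp (- c * x) + abs be * (x * exp (- c * x))" by (simp add: alg_simps)
 also have "... <= abs al * 1 + abs be * (1 / c)" using xe c x by (intro add_mono mult_left_mono) auto
 finally show ?thesis by simp
qed

lemma rad_even: "rad al be c (area (a - b)) = rad al be c (area (b - a))"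
 by (simp add: norm_minus_commute)

lemma rlap_Gauss: "rlap 1 0 c x = rad (- c) (c^2) c x"
 by (simp add: rlap_def rad_def)

lemma rlap_rlap_Gauss: "rlap (- real n) ((real n)^2) (real n) x = (real n)^2 * lac n x"
 by (simp add: rlap_def lac_def power2 alg_simps)

definition ring_diff :: "real => real => complex => (complex => real) => real => real => real" where
 "ring_diff R1 R2 c L th ph = L (of_real R2 * circ th - of_real R2 * circ ph - c) - L (of_real R2 * circ th - of_real R1 * circ ph - c)
   - L (of_real R1 * circ th - of_real R2 * circ ph - c) + L (of_real R1 * circ th - of_real R1 * circ ph - c)"

text \<open>Each ring difference costs one Laplacian and one tent: the inner one yields
  \<open>Q\<close>, the outer one \<open>lac\<close>, and the two tents combine into
  \<open>tent_corr\<close>. The factors \<open>2\<close> and \<open>2 * m^2\<close> picked up on the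
  way cancel the denominator.\<close>

lemma ring_diff_Gauss:
 assumes R: "0 < R1" "R1 < R2" shows "(MEAN th ph. ring_diff R1 R2 c (%z. exp (- real (Suc n) * (area z)) / (4 * (real (Suc n))^2)) th ph)
   = (LBINT ze. lac (Suc n) (area ze) * tent_corr R1 R2 (ze + c))"
proof -
 let ?a = "%et S th. - (et + c) + of_real S * circ th"
 let ?b = "%et. LBINT ze. tent R1 R2 (ze + et + c) * lac (Suc n) (area ze)"
 define m where "m = real (Suc n)"
 let ?d = "%th. MEAN ph. ring_diff R1 R2 c (%z. exp (- m * (area z)) / (4 * m^2)) th ph"
 have m: "0 < m" by (simp add: m_def)
 define Q where "Q z = rad (- m) (m^2) m (area z)" for z
 let ?e = "%S. integrable lborel (%et. tent R1 R2 et * (MEAN th. Q (?a et S th)))"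
 let ?g = "%et. MEAN th. Q (- (et + c) + of_real R2 * circ th)"
 let ?h = "%et. MEAN th. Q (- (et + c) + of_real R1 * circ th)"
 have [measurable]: "Q \<in> BM borel" unfolding Q_def by auto
 define V where "V S th = (LBINT et. tent R1 R2 et * Q (?a et S th))" for S th
 let ?c = "%S. (MEAN th. V S th) = (LBINT et. tent R1 R2 et * (MEAN th. Q (?a et S th)))"
 have G: "exp (- m * (area z)) = rad 1 0 m (area z)" for z by (simp add: rad_def)
 have inner: "(MEAN ph. exp (- m * (area (of_real S * circ th - of_real R2 * circ ph - c))))
   - (MEAN ph. exp (- m * (area (of_real S * circ th - of_real R1 * circ ph - c)))) = 2 * V S th" for S th
 proof -
  define t where "t = c - of_real S * circ th"
  have e: "exp (- m * (area (of_real S * circ th - of_real r * circ ph - c))) = rad 1 0 m (area (t + of_real r * circ ph))" for r ph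
   unfolding G t_def by (subst rad_even) (simp add: alg_simps)
  have "(LBINT ze. tent R1 R2 (ze - t) * (2 * Q ze)) = (LBINT et. tent R1 R2 (t + et - t) * (2 * Q (t + et)))"
   by (rule integral_lborel_translate(1)[symmetric]) measurable
  also have "... = 2 * V S th"
  proof -
   have "tent R1 R2 (t + et - t) * (2 * Q (t + et)) = 2 * (tent R1 R2 et * Q (?a et S th))" for et
   proof -
    have "Q (t + et) = Q (?a et S th)" unfolding Q_def t_def
     by (metis (no_types) norm_minus_cancel add.commute add_diff_eq diff_diff_eq2 minus_diff_eq uminus_add_conv_diff)
    thus ?thesis by auto
   qed
   thus ?thesis unfolding V_def by (simp only: integral_mult_right_zero)
  qed
  finally show ?thesis unfolding e ring_mean_rad[OF m R] rlap_Gauss Q_def by simp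
 qed
 have bQ: "abs (Q z) <= m + m" for z using rad_bound[OF m, of "area z" "- m" "m^2"] m by (simp add: Q_def power2)
 have fub: "?c S"
  "integrable U01 (V S)" "?e S" for S
 proof -
  interpret pair_sigma_finite "lborel :: complex measure" U01 ..
  let ?f = "%(et, th). tent R1 R2 et * Q (- (et + c) + of_real S * circ th)"
  have le: "norm (?f (et, th)) <= (m + m) * tent R1 R2 et * 1" for et th
   using bQ[of "- (et + c) + of_real S * circ th"] tent_nonneg[OF R, of et] by (simp add: abs_mult mult.commute[of "tent _ _ _"] mult_right_mono)
  have mf: "?f \<in> BM (lborel >< U01)" by simp
  note F = Fubini_dominated[where b = "%_. 1", OF mf integrable_mult_right[of "m + m", OF integral_tent(1)[OF R]] _ le]
  show "?c S" using F(2) by (simp add: V_def)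
  have I: "integrable (lborel >< U01) ?f" by (rule F(1)) simp
  show "integrable U01 (V S)" using integrable_snd[OF I] by (simp add: V_def[abs_def])
  show "?e S" using integrable_fst'[OF I] by simp
 qed
 have i: "integrable U01 (%ph. exp (- m * (area (of_real S * circ th - of_real r * circ ph - c))))" for S r th
  by (intro integrable_U01_continuous continuous_intros)
 have in2: "?d th = (V R2 th - V R1 th) / (2 * m^2)" for th
 proof -
  have "?d th = (2 * V R2 th - 2 * V R1 th) / (4 * m^2)"
   unfolding ring_diff_def inner[symmetric] using i by (simp add: diff_divide_distrib)
  thus ?thesis by (simp add: diff_divide_distrib)
 qed
 have "?g et - ?h et
   = 2 * m^2 * ?b et" for et
 proof -
  have "tent R1 R2 (ze - - (et + c)) * (2 * (m^2 * lac (Suc n) (area ze))) = 2 * m^2 * (tent R1 R2 (ze + et + c) * lac (Suc n) (area ze))" for ze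
  proof -
   have "ze - - (et + c) = ze + et + c" by simp
   thus ?thesis by (simp only: mult_ac)
  qed
  thus ?thesis unfolding Q_def ring_mean_rad[OF m R] unfolding m_def rlap_rlap_Gauss unfolding m_def[symmetric] by (simp only: integral_mult_right_zero)
 qed
 hence diff: "tent R1 R2 et * ?g et - tent R1 R2 et * ?h et
   = 2 * m^2 * (tent R1 R2 et * ?b et)" for et
  by (simp only: right_diff_distrib[symmetric] mult_ac)
 have "(MEAN th. (V R2 th - V R1 th) / (2 * m^2)) = ((MEAN th. V R2 th) - (MEAN th. V R1 th)) / (2 * m^2)" using fub(2) by simp
 also have "(MEAN th. V R2 th) - (MEAN th. V R1 th) = 2 * m^2 * (LBINT et. tent R1 R2 et * ?b et)"
  unfolding fub(1) by (subst Bochner_Integration.integral_diff[OF fub(3) fub(3), symmetric]) (simp only: diff integral_mult_right_zero)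
 finally show ?thesis unfolding m_def[symmetric] in2 integral_mult_tent_corr[OF R lac_area] using m by simp
qed

lemma U01_sums_bounded:
 fixes f :: "nat => real => 'b::{banach, second_countable_topology}"
 assumes [measurable]: "!!n. f n \<in> BM borel" and b: "!!n th. norm (f n th) <= b n" "summable b"
 shows "(%n. MEAN th. f n th) sums (MEAN th. (\<Sum>n. f n th))" "integrable U01 (%th. \<Sum>n. f n th)"
proof -
 have i: "integrable U01 (f n)" for n by (rule U01.integrable_const_bound[of _ "b n"]) (use b in auto)
 have s: "AE th in U01. summable (%n. norm (f n th))" by (intro AE_I2 summable_comparison_test'[OF b(2)]) (use b in auto)
 have "summable (%n. MEAN th. norm (f n th))"
 proof (rule summable_comparison_test'[OF b(2)])
  fix n
  let ?a = "MEAN th. norm (f n th)"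
  have "?a <= (MEAN th. b n)" using i b by (intro integral_mono) auto
  thus "norm ?a <= b n" by (simp add: U01.prob_space[simplified])
 qed
 from sums_integral[OF i s this] integrable_suminf[OF i s this]
 show "(%n. MEAN th. f n th) sums (MEAN th. (\<Sum>n. f n th))" "integrable U01 (%th. \<Sum>n. f n th)" by auto
qed

text \<open>Up to a constant \<open>ln_kernel\<close> is a series of Gaussians divided by
  \<open>4 * n^2\<close>. The double ring difference kills the constant and turns the series into
  that of \<open>lac\<close>, which yields \<open>tent_corr\<close> at \<open>c\<close> and the
  integral against \<open>- g\<close>; the squared mass of the tent is the integral of
  \<open>tent_corr\<close> and supplies the 1 in \<open>1 - g\<close>.\<close>

theorem ring_corr_eq:
 assumes R: "0 < R1" "R1 < R2" shows "integrable lborel (%ze. (1 - g (cmod ze)) * tent_corr R1 R2 (ze + c))"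
  "ring_corr R1 R2 c = tent_corr R1 R2 c + (LBINT ze. (1 - g (cmod ze)) * tent_corr R1 R2 (ze + c))"
proof -
 let ?a = "%n. real (Suc n)"
 let ?c = "%n z. - real (Suc n) * (area z)"
 let ?d = "ring_corr R1 R2 c"
 let ?e = "%a q. abs a <= q / 4"
 let ?g = "%th. MEAN ph. ring_diff R1 R2 c ln_kernel th ph"
 let ?h = "\<Sum>n. 1 / ?a n^2"
 let ?i = "%ze. 1 - g (cmod ze)"
 define ka where "ka = pi * (R2^2 - R1^2) / 2"
 define K where "K n z = exp (?c n z) / (4 * ?a n^2)" for n and z :: complex
 have [measurable]: "K n \<in> BM borel" for n unfolding K_def by simp
 have sq: "summable (%n. 1 / ?a n^2)" using inverse_squares_sums by (simp add: sums_iff)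
 have K0: "abs (K n z) <= 1 / ?a n^2 / 4" for n z
 proof -
  have "0 <= real (Suc n) * (area z)" by simp
  hence "exp (?c n z) <= 1" by (simp only: exp_le_one_iff)
  hence "exp (?c n z) / (4 * ?a n^2) <= 1 / (4 * ?a n^2)" by (rule divide_right_mono) simp
  thus ?thesis unfolding K_def by simp
 qed
 have sK: "summable (%n. K n z)" for z by (rule summable_comparison_test'[OF summable_divide[OF sq, of 4]]) (use K0 in auto)
 have lk: "ln_kernel z = ((EXPO q. (ln q)^2) - ?h) / 4 + (\<Sum>n. K n z)" for z
 proof -
  let ?f = "- pi * (cmod z)^2"
  have e: "(1 - exp ?f ^ Suc n) / ?a n^2 = 1 / ?a n^2 - 4 * K n z" for n
  proof -
   have "exp ?f ^ Suc n = exp (?c n z)"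
    by (subst exp_of_nat_mult[symmetric]) (simp only: mult_minus_left mult_minus_right)
   thus ?thesis by (simp add: K_def diff_divide_distrib)
  qed
  have "(\<Sum>n. (1 - exp ?f ^ Suc n) / ?a n^2) = ?h - 4 * (\<Sum>n. K n z)"
   unfolding e by (subst suminf_diff[symmetric], rule sq, rule summable_mult[OF sK], subst suminf_mult[OF sK, symmetric], rule refl)
  thus ?thesis unfolding ln_kernel_def by simp
 qed
 define D where "D n th ph = ring_diff R1 R2 c (K n) th ph" for n th ph
 let ?b = "MEAN th. (\<Sum>n. MEAN ph. D n th ph)"
 have [measurable]: "(%(th, ph). D n th ph) \<in> BM (borel >< borel)" for n unfolding D_def ring_diff_def by auto
 have [measurable]: "(%th. MEAN ph. D n th ph) \<in> BM borel" for n by simp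
 have ln: "ring_diff R1 R2 c ln_kernel th ph = (\<Sum>n. D n th ph)" for th ph
  unfolding ring_diff_def lk D_def using sK by (simp add: suminf_diff[symmetric] suminf_add[symmetric] summable_diff)
 have bD: "abs (D n th ph) <= 1 / ?a n^2" for n th ph
 proof -
  have "abs (a - b - d + e) <= q" if "?e a q" "?e b q" "?e d q" "?e e q" for a b d e q :: real using that by auto
  from this[OF K0 K0 K0 K0] show ?thesis unfolding D_def ring_diff_def .
 qed
 have 1: "(%n. MEAN ph. D n th ph) sums (?g th)" "integrable U01 (ring_diff R1 R2 c ln_kernel th)" for th
  using U01_sums_bounded[of "%n. D n th", OF _ bD[folded real_norm_def] sq] by (simp_all flip: ln)
 have b2: "abs (MEAN ph. D n th ph) <= 1 / ?a n^2" for n th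
 proof -
  have i: "integrable U01 (D n th)" by (rule U01.integrable_const_bound[OF _ , of _ "1 / ?a n^2"]) (use bD in auto)
  have "abs (MEAN ph. D n th ph) <= (MEAN ph. abs (D n th ph))" by simp
  also have "... <= (MEAN ph. 1 / ?a n^2)" using i bD by (intro integral_mono) auto
  finally show ?thesis by (simp add: U01.prob_space[simplified])
 qed
 note U = U01_sums_bounded[of "%n th. MEAN ph. D n th ph", OF _ b2[folded real_norm_def] sq]
 have s: "?g th = (\<Sum>n. MEAN ph. D n th ph)" for th by (rule sums_unique[OF 1(1)])
 have "?d = (MEAN th ph. ka^2 + ring_diff R1 R2 c ln_kernel th ph)" unfolding ring_corr_def ka_def ring_diff_def by simp
 also have "... = ka^2 + ?b" using 1(2) U(2) by (simp add: s U01.prob_space[simplified])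
 finally have rc: "?d = ka^2 + ?b" .
 define ps where "ps ze = tent_corr R1 R2 (ze + c)" for ze
 have cps: "continuous_on UNIV ps" unfolding ps_def by (intro continuous_on_compose2[OF continuous_tent_corr[OF R]] continuous_intros) auto
 have bps: "norm (ps ze) <= (ln R2 - ln R1) * ka" for ze using tent_corr_nonneg[OF R] tent_corr_le[OF R] by (simp add: ps_def ka_def)
 have mps: "ps \<in> BM borel" using cps by (rule cont_measurable)
 have "(%n. MEAN th. (MEAN ph. D n th ph)) sums (ps 0 - (LBINT ze. g (cmod ze) *\<^sub>R ps ze))"
  using integral_sum_lac_tendsto[OF cps bps] unfolding D_def K_def ring_diff_Gauss[OF R] ps_def by simp
 from sums_unique2[OF U(1) this]
 have e: "?b = ps 0 - (LBINT ze. g (cmod ze) * ps ze)" by simp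
 have tps: "integrable lborel ps" "(LBINT ze. ps ze) = ka^2"
  using integral_lborel_translate[of "tent_corr R1 R2" c] integral_tent_corr[OF R] by (simp_all add: ps_def[abs_def] ka_def add.commute)
 have "integrable lborel (%ze. g (cmod ze) * ps ze)" using integrable_g_scaleR[OF mps bps] by simp
 hence "integrable lborel (%ze. ?i ze * ps ze)"
  "?d = ps 0 + (LBINT ze. ?i ze * ps ze)" using tps rc e unfolding left_diff_distrib by auto
 thus "integrable lborel (%ze. ?i ze * tent_corr R1 R2 (ze + c))"
  "?d = tent_corr R1 R2 c + (LBINT ze. ?i ze * tent_corr R1 R2 (ze + c))" by (simp_all add: ps_def)
qed

section \<open>Radial Fourier transforms\<close>

text \<open>The Bessel function \<open>J_0 (2 * sqrt v)\<close>, written as a power series in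
  \<open>v\<close> itself.\<close>

definition bess :: "real => real" where "bess v = (\<Sum>k. (- v) ^ k / (fact k)^2)"

lemma bess_summable: "summable (%k. norm ((- v) ^ k / (fact k :: real)^2))"
proof (rule summable_comparison_test'[OF summable_exp[of "abs v"]])
 fix k :: nat
 have "(fact k :: real) * 1 <= fact k * fact k" by simp
 hence "abs v ^ k / (fact k)^2 <= abs v ^ k / fact k" by (intro divide_left_mono) (auto simp: power2)
 thus "norm (norm ((- v) ^ k / (fact k :: real)^2)) <= inverse (fact k) * abs v ^ k"
  by (simp add: abs_mult power_abs divide_inverse mult.commute)
qed

definition character :: "complex => complex => complex" where
 "character s z = exp (- 2 * of_real pi * \<i> * of_real (z \<bullet> s))"

lemma norm_character [simp]: "norm (character s z) = 1"
 unfolding character_def by simp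

lemma continuous_character [continuous_intros]: "continuous_on A (character s)"
 unfolding character_def by (intro continuous_intros)

lemma measurable_character [measurable]: "character s \<in> BM borel"
 by (intro cont_measurable continuous_character)

lemma mean_circ_power: "(MEAN th. circ th ^ j * cnj (circ th) ^ k) = (if j = k then 1 else 0)"
using circ_def cis_cnj Complex.DeMoivre cis_mult integral_cis_U01[of "int j - int k"] by (auto simp: alg_simps)

lemma mean_cos_power:
 "(MEAN th. (circ th * rh + cnj (circ th * rh)) ^ m) = (if even m then of_nat (m choose (m div 2)) * of_real (cmod rh) ^ m else 0)"
proof -
 have "(MEAN th. (circ th * rh + cnj (circ th * rh)) ^ m)
   = (MEAN th. (\<Sum>j\<le>m. of_nat (m choose j) * rh ^ j * cnj rh ^ (m - j) * (circ th ^ j * cnj (circ th) ^ (m - j))))"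
  unfolding binomial_ring by (simp add: power_mult_distrib mult_ac)
 also have "... = (\<Sum>j\<le>m. of_nat (m choose j) * rh ^ j * cnj rh ^ (m - j) * (if j = m - j then 1 else 0))"
  by (subst integral_of_sum) (auto simp: mean_circ_power intro!: integrable_U01_continuous continuous_intros)
 also have "... = (\<Sum>j\<in>(if even m then {m div 2} else {}). of_nat (m choose j) * rh ^ j * cnj rh ^ (m - j))"
  by (rule sum.mono_neutral_cong_right) (auto split: if_splits elim!: , presburger +)
 also have "... = (if even m then of_nat (m choose (m div 2)) * of_real (cmod rh) ^ m else 0)"
 proof (cases "even m")
  case True
  then obtain k where m: "m = 2 * k" by auto
  have "rh ^ k * cnj rh ^ k = of_real (cmod rh) ^ (2 * k)"
   unfolding power_mult power_mult_distrib[symmetric] complex_norm_square[symmetric] by simp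
  thus ?thesis by (simp add: m)
 qed simp
 finally show ?thesis .
qed

text \<open>Expand the exponential in powers of a cosine. Only even powers have nonzero mean, and
  the central binomial coefficient turns \<open>1 / (2k)!\<close> into
  \<open>1 / (k!)^2\<close>.\<close>

lemma mean_character:
 "(MEAN th. character s (circ th * z)) = of_real (bess ((area s) * (area z)))"
proof -
 let ?b = "(area s) * (area z)"
 let ?d = "MEAN th. character s (circ th * z)"
 let ?f = "%k. (- ?b) ^ k / (fact k)^2"
 define rh where "rh = z * cnj s"
 let ?c = "%th. circ th * rh + cnj (circ th * rh)"
 define c where "c = - (of_real pi * \<i>)"
 let ?a = "%k. c ^ (2 * k) * (of_nat ((2 * k) choose k) * of_real (cmod rh) ^ (2 * k))"
 let ?e = "%m. c ^ m * (of_nat (m choose (m div 2)) * of_real (cmod rh) ^ m)"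
 define f where "f m th = (c * ?c th) ^ m /\<^sub>R fact m" for m th
 have in_eq: "of_real (2 * ((circ th * z) \<bullet> s)) = circ th * rh + cnj (circ th * rh)" for th
  unfolding complex_add_cnj rh_def inner_complex_def by (simp add: alg_simps)
 have ch: "character s (circ th * z) = exp (c * ?c th)" for th
  unfolding in_eq[symmetric] character_def c_def by (simp add: mult_ac)
 have fs: "(\<Sum>m. f m th) = character s (circ th * z)" for th unfolding ch f_def by (rule sums_unique[symmetric]) (rule exp_converges)
 have bd: "norm (f m th) <= inverse (fact m) * (pi * (2 * cmod rh)) ^ m" for m th
 proof -
  have "cmod (?c th) <= 2 * cmod rh" by (rule order.trans[OF norm_triangle_ineq]) (simp add: norm_mult)
  hence "cmod (c * ?c th) <= pi * (2 * cmod rh)" by (simp add: c_def norm_mult)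
  thus ?thesis unfolding f_def norm_scaleR norm_power by (intro mult_mono power_mono) auto
 qed
 have "(%m. MEAN th. f m th) sums (MEAN th. (\<Sum>m. f m th))"
 proof (rule U01_sums_bounded(1)[OF _ bd summable_exp])
  show "f m \<in> BM borel" for m unfolding f_def by (intro cont_measurable continuous_intros)
 qed
 moreover have "(MEAN th. f m th) = (if even m then (?e m) /\<^sub>R fact m else 0)" for m
  unfolding f_def power_mult_distrib by (simp only: integral_scaleR_right integral_mult_right_zero mean_cos_power) simp
 ultimately have S: "(%m. if even m then (?e m) /\<^sub>R fact m else 0) sums ?d"
  by (simp only: fs)
 have "(%k. ?a k /\<^sub>R fact (2 * k)) sums ?d"
  using S by (subst (asm) sums_mono_reindex[of "%k. 2 * k", symmetric]) (auto simp: strict_mono_def)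
 moreover have "?a k /\<^sub>R fact (2 * k) = of_real (?f k)" for k
 proof -
  have c2: "c^2 = - of_real (pi^2)" by (simp add: c_def power_mult_distrib)
  have b: "of_nat ((2 * k) choose k) = (fact (2 * k) :: complex) / (fact k)^2" by (subst binomial_fact) (auto simp: power2)
  have "?a k /\<^sub>R fact (2 * k) = (c^2 * (of_real (cmod rh))^2) ^ k / (fact k)^2"
   unfolding b power_mult power_mult_distrib by (simp add: scaleR_conv_of_real)
  also have "c^2 * (of_real (cmod rh))^2 = of_real (- ?b)" unfolding c2 rh_def norm_mult by (simp add: power2)
  finally show ?thesis by simp
 qed
 ultimately have "(%k. of_real (?f k)) sums ?d" by simp
 moreover have "(%k. complex_of_real (?f k)) sums of_real (bess ?b)"
  unfolding bess_def by (intro sums_of_real summable_sums summable_norm_cancel[OF bess_summable])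
 ultimately show ?thesis by (rule sums_unique2)
qed

lemma summable_moments:
 fixes c y :: real
 assumes c: "0 < c" shows "summable (%k. abs y ^ k / (fact k)^2 * (fact (k + j) / c ^ Suc (k + j)))"
proof (rule summable_ratio_test[of "1/2" "nat \<lceil>2 * abs y * real (1 + j) / c\<rceil>"])
 fix k assume "nat \<lceil>2 * abs y * real (1 + j) / c\<rceil> <= k"
 hence "2 * abs y * real (1 + j) / c <= real k" by simp
 hence k: "2 * abs y * real (1 + j) <= real k * c" using c by (simp add: divide_le_eq)
 let ?a = "abs y * real (Suc k + j) / ((real (Suc k))^2 * c)"
 let ?b = "fact (Suc k + j) / c ^ Suc (Suc k + j)"
 let ?c = "fact (k + j) / c ^ Suc (k + j)"
 define F where "F = abs y ^ k / (fact k)^2 * ?c"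
 have F0: "0 <= F" using c by (simp add: F_def)
 have S: "abs y ^ Suc k / (fact (Suc k))^2 * ?b = F * ?a"
  unfolding F_def using c by (simp add: field_simps del: of_nat_Suc)
 have "real (Suc k + j) <= real (1 + j) * real (Suc k)" by (simp add: alg_simps)
 hence "abs y * real (Suc k + j) <= abs y * real (1 + j) * real (Suc k)" using mult_left_mono[of _ _ "abs y"] by (simp add: mult.assoc)
 also have "... <= (real k * c / 2) * real (Suc k)" using k by (intro mult_right_mono) auto
 also have "... <= (real (Suc k) * c / 2) * real (Suc k)" using c by simp
 finally have "abs y * real (Suc k + j) / ((real (Suc k))^2 * c) <= 1 / 2"
  using c by (simp add: power2 mult_ac)
 hence "F * ?a <= F * (1/2)" using F0 by (rule mult_left_mono)
 thus "norm (abs y ^ Suc k / (fact (Suc k))^2 * ?b) <= 1 / 2 * norm (abs y ^ k / (fact k)^2 * ?c)"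
  unfolding S F_def[symmetric] using F0 c by (simp add: abs_mult)
qed simp

text \<open>Rotation averaging replaces the character by a Bessel series, whose terms are integrated
  as higher moments of the same Gaussian.\<close>

lemma fourier_moment:
 assumes c: "0 < c"
 defines "w \<equiv> %z j. (area z) ^ j * exp (- c * (area z))" shows "integrable lborel (%z. of_real (w z j) * character s z)"
  and "(%k. of_real ((- (area s)) ^ k / (fact k)^2 * (fact (k + j) / c ^ Suc (k + j)))) sums (LBINT z. of_real (w z j) * character s z)"
proof -
 have [measurable]: "(%z. w z j) \<in> BM borel" for j unfolding w_def by simp
 have iw: "integrable lborel (%z. w z j)" "(LBINT z. w z j) = fact j / c ^ Suc j" for j
  unfolding w_def by (rule integral_power_exp_area[OF c])+
 have w0: "0 <= w z j" for z j by (simp add: w_def)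
 show I: "integrable lborel (%z. of_real (w z j) * character s z)"
  by (rule integrable_dom[OF iw(1)]) (auto simp: norm_mult)
 let ?a = "%z. MEAN th. of_real (w (circ th * z) j) * character s (circ th * z)"
 let ?b = "LBINT z. of_real (w z j) * character s z"
 define y where "y = area s"
 define T where "T k z = complex_of_real ((- y) ^ k / (fact k)^2 * w z (k + j))" for k z
 let ?c = "LBINT z. (\<Sum>k. T k z)"
 have Tw: "of_real (w z j) * of_real ((- (y * (area z))) ^ k / (fact k)^2) = T k z" for k z
  unfolding T_def w_def minus_mult_left power_mult_distrib power_add by auto
 have Ts: "(%k. T k z) sums (of_real (w z j) * of_real (bess (y * (area z))))" for z
  unfolding Tw[symmetric] bess_def by (intro sums_mult sums_of_real summable_sums summable_norm_cancel[OF bess_summable])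
 have Ti: "integrable lborel (T k)" "(LBINT z. T k z) = of_real ((- y) ^ k / (fact k)^2 * (fact (k + j) / c ^ Suc (k + j)))" for k
  unfolding T_def using iw by auto
 have nT: "norm (T k z) = abs y ^ k / (fact k)^2 * w z (k + j)" for k z
  unfolding T_def norm_of_real using w0[of z "k + j"] by (simp add: abs_mult power_abs)
 have "?b = (LBINT z. ?a z)"
  by (rule integral_rotation_average[OF I]) (use lborel_complex_mult_unit sigma_finite_lborel in auto)
 also have "... = ?c"
 proof (rule integral_congr[OF refl])
  fix z
  have "w (circ th * z) j = w z j" for th by (simp add: w_def norm_mult)
  thus "?a z = (\<Sum>k. T k z)"
   using sums_unique[OF Ts[of z]] by (simp add: mean_character y_def)
 qed
 also have "(%k. LBINT z. T k z) sums ?c"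
 proof (rule sums_integral[OF Ti(1)])
  have "summable (%k. T k z)" "summable (%k. norm (T k z))" for z
  proof -
   show "summable (%k. norm (T k z))"
    unfolding Tw[symmetric] norm_mult norm_of_real by (intro summable_mult) (use bess_summable[of "y * (area z)"] in simp)
   thus "summable (%k. T k z)" by (rule summable_norm_cancel)
  qed
  thus "AE z in lborel. summable (%k. norm (T k z))" by simp
  show "summable (%k. LBINT z. norm (T k z))"
   unfolding nT integral_mult_right_zero iw(2) by (rule summable_moments[OF c])
 qed
 ultimately show "(%k. of_real ((- (area s)) ^ k / (fact k)^2 * (fact (k + j) / c ^ Suc (k + j)))) sums ?b"
  unfolding Ti(2) y_def by simp
qed

lemma fourier_Gauss:
 assumes c: "0 < c" shows "integrable lborel (%z. of_real (exp (- c * (area z))) * character s z)"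
  "(LBINT z. of_real (exp (- c * (area z))) * character s z) = of_real (exp (- (area s) / c) / c)"
proof -
 note m = fourier_moment[OF c, where j = 0 and s = s]
 show "integrable lborel (%z. of_real (exp (- c * (area z))) * character s z)" using m(1) by simp
 define y where "y = area s"
 have "(%k. (- y / c) ^ k /\<^sub>R fact k * (1 / c)) sums (exp (- y / c) * (1 / c))" by (intro sums_mult2 exp_converges)
 moreover have "(- y / c) ^ k /\<^sub>R fact k * (1 / c) = (- y) ^ k / (fact k)^2 * (fact (k + 0) / c ^ Suc (k + 0))" for k
 proof -
  have "(- y / c) ^ k = (- y) ^ k / c ^ k" by (rule power_divide)
  thus ?thesis by (simp only: add_0_right) (simp add: divide_simps power2)
 qed
 ultimately have "(%k. (- y) ^ k / (fact k)^2 * (fact (k + 0) / c ^ Suc (k + 0))) sums (exp (- y / c) / c)" by simp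
 from sums_unique2[OF m(2)[folded y_def] sums_of_real[OF this]]
 show "(LBINT z. of_real (exp (- c * (area z))) * character s z) = of_real (exp (- (area s) / c) / c)" by (simp add: y_def)
qed

text \<open>In the combination of the three moment series the coefficients reduce to
  \<open>k * (k - 1)\<close>. The first two terms vanish, and shifting the index by 2 leaves an
  exponential series with the factor \<open>(area s)^2\<close>.\<close>

lemma fourier_lac:
 "(LBINT z. of_real (lac (Suc n) (area z)) * character s z)
  = of_real ((area s)^2 / real (Suc n) ^ 3 * exp (- (area s) / real (Suc n)))"
proof -
 let ?a = "LBINT z. of_real (lac (Suc n) (area z)) * character s z"
 let ?c = "%k. fact (k + 2) = (real k + 2) * ((real k + 1) * fact k)"
 define c where "c = real (Suc n)"
 have c: "0 < c" by (simp add: c_def)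
 define y where "y = area s"
 let ?b = "y^2 / c ^ 3"
 define w where "w z j = complex_of_real ((area z) ^ j * exp (- c * (area z))) * character s z" for z j
 define S where "S j = (%k. complex_of_real ((- y) ^ k / (fact k)^2 * (fact (k + j) / c ^ Suc (k + j))))" for j
 have w: "integrable lborel (%z. w z j)" "S j sums (LBINT z. w z j)" for j unfolding w_def S_def y_def by (rule fourier_moment[OF c])+
 have "of_real (lac (Suc n) (area z)) * character s z = of_real (c^2) * w z 2 - of_real (4 * c) * w z 1 + of_real 2 * w z 0" for z
  unfolding w_def lac_def c_def[symmetric] by (simp add: alg_simps)
 hence I: "?a
   = of_real (c^2) * (LBINT z. w z 2) - of_real (4 * c) * (LBINT z. w z 1) + of_real 2 * (LBINT z. w z 0)" using w(1) by simp
 have s: "(%k. of_real (c^2) * S 2 k - of_real (4 * c) * S 1 k + of_real 2 * S 0 k) sums ?a"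
  unfolding I by (intro sums_add sums_diff sums_mult w(2))
 define t where "t k = (- y) ^ k / fact k * (real k * (real k - 1)) / c ^ Suc k" for k
 have "of_real (c^2) * S 2 k - of_real (4 * c) * S 1 k + of_real 2 * S 0 k = of_real (t k)" for k
 using c t_def S_def of_real_mult[symmetric] of_real_add[symmetric] by (auto simp: alg_simps field_simps power2 t_def S_def)
 hence s2: "(%k. complex_of_real (t k)) sums ?a" using s by simp
 have "(%k. (- y / c) ^ k /\<^sub>R fact k * ?b) sums (exp (- y / c) * ?b)" by (intro sums_mult2 exp_converges)
 moreover have "(- y / c) ^ k /\<^sub>R fact k * ?b = t (k + 2)" for k
 proof -
  have f: "?c k" by (simp add: alg_simps)
  have "t (k + 2) = (- y) ^ (k + 2) / fact k / c ^ (k + 3)"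
  proof -
   have "c ^ Suc (k + 2) = c ^ (k + 3)" by (rule arg_cong[of _ _ "(^) c"]) simp
   moreover have "real (k + 2) * (real (k + 2) - 1) = (real k + 2) * (real k + 1)" by (simp add: alg_simps)
   moreover have "A / (p * (q * F)) * (p * q) / C = A / F / C" if "p ~= 0" "q ~= 0" for A p q F C :: real using that by simp
   ultimately show ?thesis unfolding t_def f by simp
  qed
  moreover have "(- y / c) ^ k = (- y) ^ k / c ^ k" by (rule power_divide)
  ultimately show ?thesis by (simp only: power_add) (simp add: divide_inverse)
 qed
 ultimately have "(%k. t (k + 2)) sums (exp (- y / c) * ?b)" by simp
 hence "t sums (exp (- y / c) * ?b + (\<Sum>k<2. t k))" by (subst (asm) sums_iff_shift) auto
 moreover have "(\<Sum>k<2. t k) = 0" by (simp add: t_def numeral_2_eq_2)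
 ultimately have "t sums (y^2 / c ^ 3 * exp (- y / c))" by (simp add: mult.commute)
 from sums_unique2[OF s2 sums_of_real[OF this]] show ?thesis by (simp add: c_def y_def)
qed

text \<open>The Fourier transform of \<open>lac (Suc n)\<close>. Its sign makes the diffraction
  density nonnegative.\<close>

definition structure_term :: "nat => complex => real" where
 "structure_term n s = (area s)^2 / real (Suc n) ^ 3 * exp (- (area s) / real (Suc n))"

lemma structure_term_nonneg: "0 <= structure_term n s" by (simp add: structure_term_def)

lemma measurable_structure_term [measurable]: "structure_term n \<in> BM borel"
 unfolding structure_term_def by auto

text \<open>Expanding the exponential gives an absolutely summable double series; summing over
  \<open>n\<close> first produces the zeta values.\<close>

lemma structure_term_sums_h: "(%n. structure_term n s) sums (1 - h (cmod s))"
proof -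
 define y where "y = area s"
 let ?a = "%n. y^2 / real (Suc n) ^ 3"
 let ?b = "%n. y / real (Suc n)"
 have y: "0 <= y" by (simp add: y_def)
 define F where "F = (%(n :: nat, k :: nat). (- 1) ^ k * y ^ (k + 2) / (fact k * real (Suc n) ^ (k + 3)))"
 let ?c = "%k n. \<Sum>\<^sub>\<infinity>k. norm (F (n, k))"
 have Fe: "F (n, k) = ?a n * ((- ?b n) ^ k /\<^sub>R fact k)" for n k
 proof -
  define m where "m = real (Suc n)"
  have "(- (y / m)) ^ k = (- 1) ^ k * (y ^ k / m ^ k)" by (subst power_minus) (simp only: power_divide)
  thus ?thesis unfolding F_def prod.case m_def[symmetric] by (simp only: power_add) (simp add: divide_inverse)
 qed
 have nF: "norm (F (n, k)) = ?a n * (?b n ^ k /\<^sub>R fact k)" for n k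
  unfolding Fe using y by (simp add: abs_mult)
 have hs: "((%k. ?a n * (x ^ k /\<^sub>R fact k)) has_sum (?a n * exp x)) UNIV" for n and x :: real
  by (intro has_sum_cmult_right norm_summable_imp_has_sum exp_converges summable_norm_exp)
 have a1: "(%k. norm (F (n, k))) summable_on UNIV" "?c k n = ?a n * exp (?b n)"
  "((%k. F (n, k)) has_sum structure_term n s) UNIV" for n unfolding nF using hs[of n "y / real (Suc n)"] hs[of n "- ?b n"]
  by (auto simp: has_sum_imp_summable infsumI Fe structure_term_def y_def)
 have cube: "summable (%n. 1 / real (Suc n) ^ j)" if "2 <= j" for j using inverse_power_summable[OF that, where 'a = real]
  unfolding summable_Suc_iff[of "%n. 1 / real n ^ j"] by (simp add: inverse_eq_divide)
 have "summable (%n. ?a n * exp (?b n))"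
 proof (rule summable_comparison_test'[OF summable_mult[of _ "y^2 * exp y", OF cube[of 3]]])
  fix n
  have "y / real (Suc n) <= y" using y by (simp add: divide_le_eq mult_le_cancel_left1)
  hence "?a n * exp (?b n) <= ?a n * exp y" by (intro mult_left_mono) auto
  thus "norm (?a n * exp (?b n)) <= y^2 * exp y * (1 / real (Suc n) ^ 3)"
   by auto
 qed simp
 hence a2: "(%n. norm (?c k n)) summable_on UNIV"
  unfolding a1(2) by (intro norm_summable_imp_summable_on) auto
 have "(%x. norm (F x)) summable_on Sigma UNIV (%_. UNIV)" using a1(1) a2 by (subst Infinite_Sum.abs_summable_on_Sigma_iff) auto
 hence sF: "F summable_on UNIV \<times> UNIV" by (rule Infinite_Sum.abs_summable_summable)
 obtain S where S: "(F has_sum S) (UNIV \<times> UNIV)" using sF by (auto simp: summable_on_def)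
 have r: "((%n. structure_term n s) has_sum S) UNIV" by (rule has_sum_SigmaD[OF S]) (use a1(3) in auto)
 have S': "((%(k, n). F (n, k)) has_sum S) (UNIV \<times> UNIV)" using S by (subst (asm) has_sum_swap) simp
 define z where "z k = (- 1) ^ k * y ^ (k + 2) / fact k * riemann_zeta (real (k + 3))" for k :: nat
 have zk: "((%n. F (n, k)) has_sum z k) UNIV" for k
 proof -
  have "riemann_zeta (real (k + 3)) = (\<Sum>n. 1 / real (Suc n) ^ (k + 3))" unfolding riemann_zeta_def by (subst powr_realpow) auto
  hence "((%n. 1 / real (Suc n) ^ (k + 3)) has_sum riemann_zeta (real (k + 3))) UNIV"
   using cube[of "k + 3"] by (intro norm_summable_imp_has_sum) auto
  from has_sum_cmult_right[OF this, of "(- 1) ^ k * y ^ (k + 2) / fact k"] show ?thesis by (simp add: F_def z_def)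
 qed
 have "(z has_sum S) UNIV" by (rule has_sum_SigmaD[OF S']) (use zk in auto)
 hence "((%k. - z k) has_sum - S) UNIV" by (simp add: has_sum_uminus)
 \<comment> \<open>The series in \<open>h\<close> starts at 2; this shift turns the argument
   \<open>k + 3\<close> of the zeta function into \<open>k + 1\<close>.\<close>
 moreover have "bij_betw (%k. k + 2) UNIV {2 :: nat..}" by (rule bij_betwI[of _ _ _ "%k. k - 2"]) auto
 ultimately have "((%k. - z (k - 2)) has_sum - S) {2..}" by (subst has_sum_reindex_bij_betw[symmetric]) auto
 moreover have "- z (k - 2) = (- 1) ^ (k + 1) / fact (k - 2) * pi ^ k * cmod s ^ (2 * k) * riemann_zeta (real (k + 1))" if "k \<in> {2..}" for k
 proof -
  obtain i where k: "k = i + 2" using \<open>k \<in> {2..}\<close> by (metis atLeast_iff le_add_diff_inverse2)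
  have "y ^ (i + 2) = pi ^ (i + 2) * cmod s ^ (2 * (i + 2))" unfolding y_def power_mult_distrib power_mult ..
  moreover have "real (i + 2 + 1) = real (i + 3)" by simp
  ultimately show ?thesis unfolding z_def k by (simp only: diff_add_inverse2) simp
 qed
 ultimately have "((%k. (- 1) ^ (k + 1) / fact (k - 2) * pi ^ k * cmod s ^ (2 * k) * riemann_zeta (real (k + 1))) has_sum - S) {2..}"
  by (subst (asm) has_sum_cong) auto
 from infsumI[OF this] have "1 - h (cmod s) = S" by (simp add: h_def)
 thus ?thesis using has_sum_imp_sums[OF r] by simp
qed

text \<open>Here the series of \<open>lac\<close> is tested against a character, and the point mass
  contributes 1. Thus \<open>h\<close> is the Fourier transform of \<open>g\<close>, which is not
  visible from its series.\<close>

lemma one_minus_h: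
 "1 - complex_of_real (h (cmod s)) = 1 - (LBINT z. of_real (g (cmod z)) * character s z)"
proof -
 have "(%n. LBINT z. lac (Suc n) (area z) *\<^sub>R character s z) sums (character s 0 - (LBINT z. g (cmod z) *\<^sub>R character s z))"
  by (rule integral_sum_lac_tendsto[of _ 1]) (auto intro: continuous_character)
 hence "(%n. complex_of_real (structure_term n s)) sums (1 - (LBINT z. of_real (g (cmod z)) * character s z))"
  unfolding scaleR_conv_of_real fourier_lac structure_term_def by (simp add: character_def)
 from sums_unique2[OF sums_of_real[OF structure_term_sums_h, of s] this] show ?thesis unfolding of_real_diff of_real_1 .
qed

text \<open>The lower bound comes from the nonnegative series, the upper bound from the
  representation as 1 minus the transform of an integrable function.\<close>

lemma one_minus_h_bounds: "0 <= 1 - h (cmod s)" "1 - h (cmod s) <= 1 + (LBINT z. abs (g (cmod z)))"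
proof -
 show "0 <= 1 - h (cmod s)" by (rule sums_le[OF _ sums_zero structure_term_sums_h]) (rule structure_term_nonneg)
 let ?a = "LBINT z. of_real (g (cmod z)) * character s z"
 let ?b = "1 - complex_of_real (h (cmod s))"
 have "norm ?b <= norm (1::complex) + norm ?a"
  unfolding one_minus_h by (rule norm_triangle_ineq4)
 also have "norm ?a <= (LBINT z. norm (of_real (g (cmod z)) * character s z))"
  by simp
 also have "norm ?b = abs (1 - h (cmod s))" unfolding norm_of_real[symmetric, where 'a = complex] by simp
 finally show "1 - h (cmod s) <= 1 + (LBINT z. abs (g (cmod z)))" by (simp add: norm_mult)
qed

lemma measurable_h [measurable]: "(%s. h (cmod s)) \<in> BM borel"
proof -
 have "(%s. 1 - (\<Sum>n. structure_term n s)) \<in> BM borel" by simp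
 moreover have "h (cmod s) = 1 - (\<Sum>n. structure_term n s)" for s using sums_unique[OF structure_term_sums_h, of s] by simp
 ultimately show ?thesis by simp
qed

section \<open>Fourier transforms of Schwartz functions\<close>

text \<open>Comparable to \<open>1 / (1 + x^2)\<close> in the area variable, hence integrable over
  the plane.\<close>

definition wt :: "complex => real" where "wt z = 1 / (1 + cmod z ^ 4)"

lemma wt_pos: "0 < wt z" unfolding wt_def by (auto intro!: add_pos_nonneg)

lemma measurable_wt [measurable]: "wt \<in> BM borel" unfolding wt_def by auto

lemma integrable_wt: "integrable lborel wt"
proof -
 let ?a = "%z. 1 + (area z)^2"
 have "set_integrable lborel {0::real..} (%x. inverse (1 + x^2))" by (rule set_integrable_subset[OF integrable_inverse_1_plus_square]) auto
 hence "integrable lborel (%z. inverse (?a z))" by (subst integral_area(2)) auto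
 hence "integrable lborel (%z. pi^2 * inverse (?a z))" by simp
 thus ?thesis
 proof (rule integrable_dom)
  have "1 <= pi^2" using pi_gt3 by simp
  have "1 + (area z)^2 <= pi^2 * (1 + cmod z ^ 4)" for z
   using \<open>1 <= pi^2\<close> by (simp add: alg_simps)
  hence "wt z <= pi^2 * inverse (?a z)" for z unfolding wt_def by (simp add: divide_simps add_pos_nonneg)
  thus "AE z in lborel. norm (wt z) <= norm (pi^2 * inverse (?a z))"
   using wt_pos by (auto simp: less_imp_le)
 qed measurable
qed

text \<open>From \<open>(|u| + 1) ^ 4 <= 8 * (|u| ^ 4 + 1)\<close>; the 9 is 8 plus 1. It controls
  difference quotients at intermediate points.\<close>

lemma wt_shift:
 assumes "cmod (u - x) <= 1" shows "wt u <= 9 * wt x"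
proof -
 have "cmod x <= cmod u + 1" using assms norm_triangle_ineq2[of x u] by (simp add: norm_minus_commute)
 hence "cmod x ^ 4 <= (cmod u + 1) ^ 4" by simp
 also have "... <= 8 * (cmod u ^ 4 + 1 ^ 4)" by (rule power4_add_le)
 finally have "1 + cmod x ^ 4 <= 9 * (1 + cmod u ^ 4)" using zero_le_power[OF norm_ge_zero, of u 4] unfolding distrib_left power_one by linarith
 thus ?thesis unfolding wt_def using add_pos_nonneg[of 1 "cmod x ^ 4"] by (simp add: divide_simps)
qed

lemma iterated_deriv_append: "iterated_deriv cs (iterated_deriv bs f) = iterated_deriv (cs @ bs) f"
 by (induction cs) auto

lemma schwartz_iterated_deriv: "schwartz f ==> set bs \<subseteq> Basis ==> schwartz (iterated_deriv bs f)"
 unfolding schwartz_def iterated_deriv_append by simp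

context
 fixes f :: "complex => complex"
 assumes f: "schwartz f"
begin

lemma schwartz_differentiable: "f differentiable (at x)"
 using f[unfolded schwartz_def, rule_format, of "[]"] by simp

lemma schwartz_continuous: "continuous_on A f"
 by (intro continuous_at_imp_continuous_on ballI differentiable_imp_continuous_within schwartz_differentiable)

lemma schwartz_measurable: "f \<in> BM borel"
 by (intro cont_measurable schwartz_continuous)

lemma schwartz_decay: obtains C where "0 <= C" "!!x. norm (f x) <= C * wt x"
proof -
 have "bounded (range (%x. norm x ^ k *\<^sub>R f x))" for k using f[unfolded schwartz_def, rule_format, of "[]"] by simp
 from this[of 0] this[of 4] obtain a b where ab: "!!x. norm (norm x ^ 0 *\<^sub>R f x) <= a" "!!x. norm (norm x ^ 4 *\<^sub>R f x) <= b"
  unfolding bounded_iff by auto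
 have "norm (f x) * (1 + cmod x ^ 4) <= a + b" for x using ab[of x] by (simp add: alg_simps)
 hence "norm (f x) <= (a + b) * wt x" for x unfolding wt_def by (simp add: pos_le_divide_eq add_pos_nonneg)
 moreover have "0 <= a + b" using ab[of 0] by (meson add_nonneg_nonneg norm_ge_zero order_trans)
 ultimately show ?thesis using that by auto
qed

lemma schwartz_integrable: "integrable lborel f"
proof -
 obtain C where C: "!!x. norm (f x) <= C * wt x" by (rule schwartz_decay) blast
 show ?thesis
  by (rule integrable_dom[OF integrable_mult_right[of C, OF integrable_wt]]) (use C schwartz_measurable in "auto intro!: order.trans[OF C abs_ge_self] simp del: ")
qed

lemma fourier_character: "fourier f y = (LBINT x. f x * character y x)"
 unfolding fourier_def character_def ..

lemma integrable_character: "integrable lborel (%x. f x * character y x)"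
 by (rule integrable_dom[OF schwartz_integrable]) (use schwartz_measurable in "auto simp: norm_mult")

lemma fourier_le: "norm (fourier f y) <= (LBINT x. norm (f x))"
 unfolding fourier_character using integral_norm_bound[of lborel "%x. f x * character y x"] by (simp add: norm_mult)

lemma character_tendsto: "s ----> y ==> (%n. character (s n) x) ----> character y x"
 unfolding character_def by (intro tendsto_intros)

lemma continuous_fourier: "continuous_on A (fourier f)"
proof (intro continuous_at_imp_continuous_on ballI)
 fix y
 show "isCont (fourier f) y" unfolding continuous_at_sequentially comp_def
 proof (intro allI impI)
  fix s assume "s ----> y"
  thus "(%n. fourier f (s n)) ----> fourier f y" unfolding fourier_character by (intro integral_dominated_convergence[OF _ _ integrable_norm[OF schwartz_integrable]]) (use schwartz_measurable in "auto simp: norm_mult intro!: tendsto_mult character_tendsto ")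
 qed
qed

lemma measurable_fourier: "fourier f \<in> BM borel"
 by (intro cont_measurable continuous_fourier)

end

text \<open>In place of integration by parts, the transform of a difference quotient is computed
  exactly by translation. The mean value inequality with the decay of the derivative dominates the
  passage to the limit.\<close>

lemma fourier_deriv:
 fixes f :: "complex => complex"
 assumes f: "schwartz f" and b: "b \<in> Basis"
 shows "fourier (iterated_deriv [b] f) y = 2 * of_real pi * \<i> * of_real (b \<bullet> y) * fourier f y"
proof -
 let ?c = "%s x. s *\<^sub>R b + x"
 define D where "D = iterated_deriv [b] f"
 have D: "schwartz D" unfolding D_def using f b by (intro schwartz_iterated_deriv) auto
 obtain C where C: "0 <= C" "!!x. norm (D x) <= C * wt x" by (rule schwartz_decay[OF D]) blast
 note [measurable] = schwartz_measurable[OF f]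
 have nb: "norm b = 1" using b by simp
 have der: "(f has_derivative frechet_derivative f (at x)) (at x)" for x
  using schwartz_differentiable[OF f] frechet_derivative_works by auto
 have Dx: "D x = frechet_derivative f (at x) b" for x by (simp add: D_def)
 have lin: "frechet_derivative f (at x) (t *\<^sub>R b) = t *\<^sub>R D x" for x t
  unfolding Dx using has_derivative_bounded_linear[OF der] by (simp add: bounded_linear.linear linear_scale)
 define t where "t n = 1 / real (Suc n)" for n
 let ?a = "%x n. f (x + t n *\<^sub>R b) - f x - frechet_derivative f (at x) (t n *\<^sub>R b)"
 let ?d = "%n x. t n *\<^sub>R b + x"
 have t: "0 < t n" "t n <= 1" for n by (auto simp: t_def)
 have t0: "t ----> 0" unfolding t_def by real_asymp
 define q where "q n x = (f (?d n x) - f x) /\<^sub>R t n" for n x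
 let ?e = "%n. LBINT x. q n x * character y x"
 have [measurable]: "q n \<in> BM borel" for n unfolding q_def by auto
 have qlim: "(%n. q n x) ----> D x" for x
 proof -
  have "((%v. norm (f (x + v) - f x - frechet_derivative f (at x) v) / norm v) \<longlongrightarrow> 0) (at 0)"
   using der[of x] by (simp add: has_derivative_at)
  moreover have "filterlim (%n. t n *\<^sub>R b) (at 0) sequentially"
   unfolding filterlim_at using t t0 nb by (auto intro!: tendsto_eq_intros simp: less_imp_neq[symmetric])
  ultimately have "(%n. norm (?a x n) / norm (t n *\<^sub>R b)) ----> 0"
   by (rule filterlim_compose)
  moreover have "norm (?a x n) / norm (t n *\<^sub>R b) = norm (q n x - D x)" for n
  proof -
   have "q n x - D x = (f (x + t n *\<^sub>R b) - f x - t n *\<^sub>R D x) /\<^sub>R t n"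
    using t(1)[of n] by (simp add: q_def scaleR_right_diff_distrib add.commute)
   thus ?thesis using nb by (simp add: lin divide_inverse)
  qed
  ultimately show ?thesis by (simp add: LIM_zero_cancel tendsto_norm_zero_iff)
 qed
 have qb: "norm (q n x) <= 9 * C * wt x" for n x
 proof -
  have d: "((%s. f (?c s x)) has_derivative (%s. s *\<^sub>R D (?c s0 x))) (at s0)" for s0
  proof -
   have "((%s. s *\<^sub>R b + x) has_derivative (%s. s *\<^sub>R b)) (at s0)" by (auto intro!: derivative_eq_intros)
   from has_derivative_compose[OF this der] show ?thesis by (simp add: lin)
  qed
  obtain s where s: "0 < s" "s < t n" "norm (f (t n *\<^sub>R b + x) - f (0 *\<^sub>R b + x)) <= norm ((t n - 0) *\<^sub>R D (s *\<^sub>R b + x))"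
   using mvt_general[of 0 "t n" "%s. f (?c s x)" "%s0 s. s *\<^sub>R D (?c s0 x)"] d t(1)[of n] has_derivative_continuous[OF d]
   by (auto simp: continuous_at_imp_continuous_on)
  have "norm (q n x) = norm (f (?d n x) - f x) / t n" using t(1)[of n] by (simp add: q_def divide_inverse)
  also have "... <= norm (D (?c s x))" using s(3) t(1)[of n] by (simp add: pos_divide_le_eq mult.commute)
  also have "... <= C * wt (?c s x)" by (rule C)
  also have "... <= C * (9 * wt x)" using C s t(2)[of n] nb by (intro mult_left_mono wt_shift) auto
  finally show ?thesis by simp
 qed
 have L: "?e ----> fourier D y" unfolding fourier_def character_def[symmetric]
 proof (rule integral_dominated_convergence[OF _ _ integrable_mult_right[of "9 * C", OF integrable_wt]])
  show "(%x. D x * character y x) \<in> BM lborel" using schwartz_measurable[OF D] by auto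
 qed (use qlim qb in "auto simp: norm_mult intro!: AE_I2 tendsto_mult")
 define \<omega> where "\<omega> = 2 * of_real pi * \<i> * of_real (b \<bullet> y)"
 let ?b = "%n. \<omega> * of_real (t n)"
 have "(LBINT x. q n x * character y x) = (exp (?b n) - 1) / of_real (t n) * fourier f y" for n
 proof -
  define F where "F x = f x * character y x" for x
  have [measurable]: "F \<in> BM borel" unfolding F_def by simp
  have iF: "integrable lborel F" unfolding F_def by (rule integrable_character[OF f])
  have "f (?d n x) * character y x = exp (?b n) * F (?d n x)" for x
   unfolding F_def character_def \<omega>_def by (simp add: alg_simps flip: exp_add)
  hence "q n x * character y x = (exp (?b n) * F (?d n x) - F x) / of_real (t n)" for x
   by (simp add: q_def F_def scaleR_conv_of_real divide_inverse alg_simps)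
  thus ?thesis
   using iF integral_lborel_translate[of F "t n *\<^sub>R b"] by (simp add: fourier_character[OF f] F_def[symmetric] alg_simps)
 qed
 moreover have "(%n. (exp (?b n) - 1) / of_real (t n)) ----> \<omega>"
 proof -
  have "((%z. exp (\<omega> * z)) has_field_derivative \<omega>) (at 0)" by (auto intro!: derivative_eq_intros)
  hence "((%z. (exp (\<omega> * z) - 1) / z) \<longlongrightarrow> \<omega>) (at 0)" by (simp add: DERIV_def)
  moreover have "filterlim (%n. complex_of_real (t n)) (at 0) sequentially"
   unfolding filterlim_at using t(1) t0 by (auto intro!: tendsto_eq_intros simp: less_imp_neq[symmetric])
  ultimately show ?thesis by (rule filterlim_compose)
 qed
 ultimately have "?e ----> \<omega> * fourier f y" by (simp only: tendsto_mult_right)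
 from LIMSEQ_unique[OF L this] show ?thesis by (simp add: D_def \<omega>_def)
qed

text \<open>Four derivatives along one axis give fourth-order decay in that coordinate; the two
  coordinates together control the modulus.\<close>

lemma fourier_decay:
 fixes f :: "complex => complex"
 assumes f: "schwartz f"
 obtains C where "!!y. norm (fourier f y) <= C * wt y"
proof -
 let ?b = "%y. fourier f y"
 have b: "abs (b \<bullet> y) ^ 4 * norm (?b y) <= (LBINT x. norm (iterated_deriv [b, b, b, b] f x))" if b: "b \<in> Basis" for b y
 proof -
  define \<omega> where "\<omega> = 2 * of_real pi * \<i> * of_real (b \<bullet> y)"
  have s: "schwartz (iterated_deriv bs f)" if "set bs \<subseteq> {b}" for bs using schwartz_iterated_deriv[OF f, of bs] that b by auto
  have d: "fourier (iterated_deriv (b # bs) f) y = \<omega> * fourier (iterated_deriv bs f) y" if "set bs \<subseteq> {b}" for bs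
   using fourier_deriv[OF s[OF that] b, of y] by (simp add: \<omega>_def)
  have "fourier (iterated_deriv [b, b, b, b] f) y = \<omega> ^ 4 * fourier f y" by (subst d, simp)+ (simp add: eval_nat_numeral)
  moreover have "abs (b \<bullet> y) <= norm \<omega>"
   using mult_right_mono[of 1 "2 * pi" "abs (b \<bullet> y)"] pi_gt3 by (simp add: \<omega>_def norm_mult)
  hence "abs (b \<bullet> y) ^ 4 * norm (?b y) <= norm (\<omega> ^ 4 * fourier f y)"
   unfolding norm_mult norm_power by (intro mult_right_mono power_mono) auto
  ultimately show ?thesis using fourier_le[OF s[of "[b, b, b, b]"], of y] by simp
 qed
 obtain A B where AB: "!!y. abs (Re y) ^ 4 * norm (fourier f y) <= A" "!!y. abs (Im y) ^ 4 * norm (fourier f y) <= B"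
  using b[of 1] b[of \<i>] by auto
 define C where "C = (LBINT x. norm (f x)) + 8 * (A + B)"
 have "norm (?b y) <= C * wt y" for y
 proof -
  let ?a = "abs (Re y) ^ 4 + abs (Im y) ^ 4"
  have "cmod y ^ 4 <= (abs (Re y) + abs (Im y)) ^ 4" by (intro power_mono cmod_le) auto
  also have "... <= 8 * ?a" by (rule power4_add_le)
  finally have "cmod y ^ 4 * norm (?b y) <= 8 * ?a * norm (?b y)" by (rule mult_right_mono) simp
  also have "... <= 8 * (A + B)" using AB[of y] by (simp add: alg_simps)
  finally have "(1 + cmod y ^ 4) * norm (?b y) <= C" using fourier_le[OF f, of y] by (simp add: C_def alg_simps)
  thus ?thesis unfolding wt_def by (simp add: pos_le_divide_eq add_pos_nonneg mult.commute)
 qed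
 thus ?thesis using that by auto
qed

context
 fixes f :: "complex => complex"
 assumes f: "schwartz f"
begin

lemma integrable_fourier: "integrable lborel (fourier f)"
proof -
 obtain C where C: "!!y. norm (fourier f y) <= C * wt y" by (rule fourier_decay[OF f]) blast
 show ?thesis
  by (rule integrable_dom[OF integrable_mult_right[of C, OF integrable_wt]]) (use C measurable_fourier[OF f] in "auto intro!: order.trans[OF C abs_ge_self] simp del: ")
qed

lemma fourier_Fubini:
 assumes k: "integrable lborel (k :: complex => real)"
 shows "(LBINT y. of_real (k y) * fourier f y) = (LBINT x. f x * (LBINT y. of_real (k y) * character x y))"
proof -
 have [measurable]: "f \<in> BM borel" "k \<in> BM borel" using schwartz_measurable[OF f] borel_measurable_integrable[OF k] by auto
 have c: "character y x = character x y" for x y by (simp add: character_def inner_commute)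
 have [measurable]: "(%(x, y). character y x) \<in> BM (lborel >< lborel)" unfolding character_def by simp
 let ?F = "%(x, y). f x * of_real (k y) * character y x"
 have "(LBINT y. (LBINT x. ?F (x, y))) = (LBINT x. (LBINT y. ?F (x, y)))"
  by (rule lborel_pair.Fubini_dominated(2)[OF _ integrable_norm[OF schwartz_integrable[OF f]] integrable_abs[OF k]])
   (measurable, simp add: norm_mult)
 moreover have "(LBINT x. ?F (x, y)) = of_real (k y) * fourier f y" for y
 proof -
  have "?F (x, y) = of_real (k y) * (f x * character y x)" for x by simp
  thus ?thesis unfolding fourier_character[OF f] by (simp only: integral_mult_right_zero)
 qed
 moreover have "(LBINT y. ?F (x, y)) = f x * (LBINT y. of_real (k y) * character x y)" for x
 proof -
  have "?F (x, y) = f x * (of_real (k y) * character x y)" for y by (simp add: c)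
  thus ?thesis by (simp only: integral_mult_right_zero)
 qed
 ultimately show ?thesis by simp
qed

text \<open>Fourier inversion at 0: Gaussian damping of the integral is moved by Fubini onto
  \<open>f\<close>, where it becomes an approximate identity.\<close>

lemma integral_fourier: "(LBINT y. fourier f y) = f 0"
proof -
 let ?a = "%n v. of_real (1 / sqrt (real (Suc n))) * v"
 note [measurable] = schwartz_measurable[OF f] measurable_fourier[OF f]
 define k where "k n y = exp (- (1 / real (Suc n)) * (area y))" for n and y :: complex
 let ?b = "%n. LBINT y. of_real (k n y) * fourier f y"
 let ?d = "%n. LBINT y. of_real (k n y) * fourier f y"
 let ?e = "%y. %n. of_real (k n y) * fourier f y"
 have k: "integrable lborel (k n)" for n unfolding k_def using integral_power_exp_area(1)[of "1 / real (Suc n)" 0] by simp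
 define G where "G v = exp (- 1 * (area v))" for v :: complex
 let ?c = "LBINT v. of_real (G v) * f 0"
 have G: "integrable lborel G" "(LBINT v. G v) = 1" unfolding G_def using integral_power_exp_area[of 1 0] by auto
 have 1: "?b ----> (LBINT y. fourier f y)"
 proof (rule integral_dominated_convergence[OF _ _ integrable_norm[OF integrable_fourier]])
  show "AE y in lborel. (?e y) ----> fourier f y"
  proof (rule AE_I2)
   fix y
   have "(%n. - (1 / real (Suc n)) * (area y)) ----> - 0 * (area y)" by (intro tendsto_intros) real_asymp
   from tendsto_mult[OF tendsto_of_real[OF tendsto_exp[OF this]] tendsto_const[of "fourier f y"]]
   show "(?e y) ----> fourier f y" by (simp add: k_def)
  qed
 qed (auto simp: k_def norm_mult intro!: AE_I2 mult_left_le_one_le)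
 obtain C where C: "0 <= C" "!!x. norm (f x) <= C * wt x" by (rule schwartz_decay[OF f]) blast
 have fC: "norm (f x) <= C" for x
 proof -
  have "wt x <= 1" by (simp add: wt_def add_pos_nonneg)
  thus ?thesis using C mult_left_mono[of "wt x" 1 C] by (intro order.trans[OF C(2)]) auto
 qed
 have "?d n = (LBINT v. of_real (G v) * f (?a n v))" for n
 proof -
  define c where "c = 1 / sqrt (real (Suc n))"
  have c: "0 < c" "c^2 = 1 / real (Suc n)" by (auto simp: c_def power_divide)
  have "?d n = (LBINT x. f x * of_real (exp (- (area x) / c^2) / c^2))"
   unfolding fourier_Fubini[OF k] unfolding k_def using c by (subst fourier_Gauss) auto
  also have "... = (LBINT v. c^2 *\<^sub>R (f (of_real c * v) * of_real (exp (- (area (of_real c * v)) / c^2) / c^2)))"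
   by (rule integral_lborel_complex_scale(1)[OF _ c(1)]) measurable
  also have "... = (LBINT v. of_real (G v) * f (of_real c * v))"
   using c(1) by (intro integral_congr refl) (simp add: G_def norm_mult power_mult_distrib scaleR_conv_of_real)
  finally show ?thesis by (simp add: c_def)
 qed
 moreover have "(%n. LBINT v. of_real (G v) * f (?a n v)) ----> ?c"
 proof (rule integral_dominated_convergence[OF _ _ integrable_mult_right[of C, OF G(1)]])
  show "AE v in lborel. (%n. of_real (G v) * f (?a n v)) ----> of_real (G v) * f 0"
  proof (intro AE_I2 tendsto_mult tendsto_const)
   fix v :: complex
   have "(%n. of_real (1 / sqrt (real (Suc n))) * v) ----> of_real 0 * v" by (intro tendsto_mult tendsto_of_real tendsto_const) real_asymp
   from continuous_on_tendsto_compose[OF schwartz_continuous[OF f, of UNIV] this]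
   show "(%n. f (?a n v)) ----> f 0" by simp
  qed
 qed (use fC in "auto simp: G_def norm_mult intro!: AE_I2 mult_right_mono")
 moreover have "?c = f 0" using G by simp
 ultimately have "?b ----> f 0" by auto
 from LIMSEQ_unique[OF 1 this] show ?thesis .
qed

text \<open>The limit relation for \<open>lac\<close> is applied to \<open>fourier f\<close>, and
  Fubini moves the transform onto \<open>lac\<close>. The partial sums of the nonnegative transforms
  stay below \<open>1 - h\<close>, which provides the majorant.\<close>

lemma integral_schwartz_one_minus_h:
 "integrable lborel (%x. of_real (1 - h (cmod x)) * f x)"
 "(LBINT x. of_real (1 - h (cmod x)) * f x) = fourier f 0 - (LBINT y. of_real (g (cmod y)) * fourier f y)"
proof -
 let ?a = "LBINT y. of_real (g (cmod y)) * fourier f y"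
 let ?b = "%k. integrable lborel (%x. of_real (k x) * f x)"
 let ?d = "%n x. structure_term n x"
 note [measurable] = schwartz_measurable[OF f]
 define C where "C = 1 + (LBINT z. abs (g (cmod z)))"
 define H where "H x = 1 - h (cmod x)" for x
 let ?c = "LBINT x. of_real (H x) * f x"
 have [measurable]: "H \<in> BM borel" unfolding H_def by auto
 have H: "0 <= H x" "H x <= C" for x unfolding H_def C_def by (rule one_minus_h_bounds)+
 have nb: "norm (of_real a * (b::complex)) = abs a * norm b" for a b by (simp add: norm_mult)
 have ib: "?b k"
  if [measurable]: "k \<in> BM borel" and k: "!!x. 0 <= k x" "!!x. k x <= H x" for k
  by (rule integrable_dom[OF integrable_mult_right[of C, OF integrable_norm[OF schwartz_integrable[OF f]]]]) (use k H in "auto simp: nb abs_mult intro!: mult_right_mono order.trans[OF k(2)] order.trans[OF H(2) abs_ge_self] ")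
 have i: "?b H" by (rule ib) (use H in auto)
 thus "integrable lborel (%x. of_real (1 - h (cmod x)) * f x)" unfolding H_def .
 have "(%n. LBINT x. of_real (?d n x) * f x) sums (fourier f 0 - ?a)"
  using integral_sum_lac_tendsto[OF continuous_fourier[OF f] fourier_le[OF f]]
  unfolding scaleR_conv_of_real fourier_Fubini[OF lac_area] fourier_lac structure_term_def by (simp add: mult.commute)
 moreover have "(%N. \<Sum>n<N. LBINT x. of_real (?d n x) * f x) ----> ?c"
 proof -
  define S where "S N x = (\<Sum>n<N. structure_term n x)" for N x
  have [measurable]: "S N \<in> BM borel" for N unfolding S_def by auto
  have st: "structure_term n x <= S (Suc n) x" for n x using structure_term_nonneg by (simp add: S_def sum_nonneg)
  have S: "0 <= S N x" "S N x <= H x" "(%N. S N x) ----> H x" for N x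
  proof -
   note ss = structure_term_sums_h[of x, folded H_def]
   show "0 <= S N x" "(%N. S N x) ----> H x" using structure_term_nonneg ss by (auto simp: S_def sum_nonneg sums_def)
   show "S N x <= H x" unfolding S_def sums_unique[OF ss]
    by (rule sum_le_suminf[OF sums_summable[OF ss]]) (auto simp: structure_term_nonneg)
  qed
  have it: "integrable lborel (%x. of_real (?d n x) * f x)" for n
   by (rule ib) (use structure_term_nonneg order.trans[OF st S(2)] in auto)
  have "(%N. LBINT x. of_real (S N x) * f x) ----> ?c"
   by (rule integral_dominated_convergence[OF _ _ integrable_norm[OF i]]) (use S H in "auto simp: nb intro!: mult_right_mono tendsto_mult tendsto_of_real ")
  moreover have "(LBINT x. of_real (S N x) * f x) = (\<Sum>n<N. LBINT x. of_real (?d n x) * f x)" for N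
   unfolding S_def of_real_sum sum_distrib_right by (rule integral_of_sum) (rule it)
  ultimately show ?thesis by simp
 qed
 ultimately show "(LBINT x. of_real (1 - h (cmod x)) * f x) = fourier f 0 - ?a"
  unfolding sums_def H_def by (rule LIMSEQ_unique[rotated])
qed

end

section \<open>Gaussians as test functions\<close>

text \<open>Polynomials in the real and imaginary part, generated inductively so that closure under
  derivatives and polynomial growth follow by induction.\<close>

inductive polyfun :: "(complex => real) => bool" where
 const: "polyfun (%_. a)"
| Re: "polyfun Re"
| Im: "polyfun Im"
| add: "polyfun p ==> polyfun q ==> polyfun (%x. p x + q x)"
| mult: "polyfun p ==> polyfun q ==> polyfun (%x. p x * q x)"

lemma polyfun_deriv:
 "polyfun q ==> \<exists>q1 q2. polyfun q1 & polyfun q2 & (\<forall>x. (q has_derivative (%v. q1 x * Re v + q2 x * Im v)) (at x))"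
proof (induction rule: polyfun.induct)
 case (const a)
 show ?case by (intro exI[of _ "%_. 0"]) (auto intro: polyfun.const)
next
 case Re
 show ?case by (rule exI[of _ "%_. 1"], rule exI[of _ "%_. 0"]) (auto intro!: polyfun.const derivative_eq_intros)
next
 case Im
 show ?case by (rule exI[of _ "%_. 0"], rule exI[of _ "%_. 1"]) (auto intro!: polyfun.const derivative_eq_intros)
next
 case (add p q)
 then obtain p1 p2 q1 q2 where "polyfun p1" "polyfun p2" "polyfun q1" "polyfun q2"
  "!!x. (p has_derivative (%v. p1 x * Re v + p2 x * Im v)) (at x)" "!!x. (q has_derivative (%v. q1 x * Re v + q2 x * Im v)) (at x)" by auto
 thus ?case by (intro exI[of _ "%x. p1 x + q1 x"] exI[of _ "%x. p2 x + q2 x"])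
   (auto intro!: polyfun.intros derivative_eq_intros simp: alg_simps)
next
 case (mult p q)
 then obtain p1 p2 q1 q2 where "polyfun p1" "polyfun p2" "polyfun q1" "polyfun q2"
  "!!x. (p has_derivative (%v. p1 x * Re v + p2 x * Im v)) (at x)" "!!x. (q has_derivative (%v. q1 x * Re v + q2 x * Im v)) (at x)" by auto
 thus ?case using mult.hyps by (intro exI[of _ "%x. p x * q1 x + p1 x * q x"] exI[of _ "%x. p x * q2 x + p2 x * q x"])
   (auto intro!: polyfun.intros derivative_eq_intros simp: alg_simps)
qed

lemma polyfun_bound: "polyfun q ==> \<exists>C m. 0 <= C & (\<forall>x. abs (q x) <= C * (1 + cmod x) ^ m)"
proof (induction rule: polyfun.induct)
 case (const a)
 show ?case by (intro exI[of _ "abs a"] exI[of _ 0]) auto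
next
 case Re
 have "abs (Re x) <= 1 * (1 + cmod x) ^ 1" for x using abs_Re_le_cmod[of x] by auto
 thus ?case by (meson zero_le_one)
next
 case Im
 have "abs (Im x) <= 1 * (1 + cmod x) ^ 1" for x using abs_Im_le_cmod[of x] by simp
 thus ?case by (meson zero_le_one)
next
 case (add p q)
 then obtain C m D n where *: "0 <= C" "0 <= D" "!!x. abs (p x) <= C * (1 + cmod x) ^ m" "!!x. abs (q x) <= D * (1 + cmod x) ^ n" by auto
 let ?a = "%x. 1 + cmod x"
 have "abs (p x + q x) <= (C + D) * ?a x ^ (m + n)" for x
 proof -
  have "?a x ^ m <= ?a x ^ (m + n)" "?a x ^ n <= ?a x ^ (m + n)" by (intro power_increasing; simp)+
  hence "C * ?a x ^ m + D * ?a x ^ n <= (C + D) * ?a x ^ (m + n)"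
   using * unfolding distrib_right by (intro add_mono mult_left_mono) auto
  thus ?thesis using *(3,4)[of x] by simp
 qed
 thus ?case using * by (intro exI[of _ "C + D"] exI[of _ "m + n"]) auto
next
 case (mult p q)
 then obtain C m D n where *: "0 <= C" "0 <= D" "!!x. abs (p x) <= C * (1 + cmod x) ^ m" "!!x. abs (q x) <= D * (1 + cmod x) ^ n" by auto
 have "abs (p x * q x) <= (C * D) * (1 + cmod x) ^ (m + n)" for x
  using mult_mono[OF *(3,4)[of x]] * by (simp add: abs_mult power_add mult_ac)
 thus ?case using * by (intro exI[of _ "C * D"] exI[of _ "m + n"]) auto
qed

definition gaussian :: "real => complex => complex => real" where
 "gaussian c p x = exp (- c * (cmod (x - p))^2)"

lemma gaussian_pos: "0 < gaussian c p x" by (simp add: gaussian_def)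

lemma measurable_gaussian [measurable]: "gaussian c p \<in> BM borel"
 unfolding gaussian_def by simp

text \<open>Every iterated derivative is a polynomial times the same Gaussian, and the Gaussian is
  dominated by a multiple of \<open>exp (- |x|)\<close>.\<close>

lemma schwartz_gaussian:
 assumes c: "0 < c" shows "schwartz (%x. of_real (gaussian c p x))"
proof -
 let ?a = "%x v. (Re x - Re p) * Re v + (Im x - Im p) * Im v"
 let ?b = "%x. of_real (gaussian c p x)"
 let ?c = "%q x. q x * gaussian c p x"
 let ?e = "%q. %x. complex_of_real (?c q x)"
 let ?f = "%x b. (Re x + (- Re p)) * Re b + (Im x + (- Im p)) * Im b"
 let ?i = "%q. %x. of_real (?c q x)"
 have dG: "(gaussian c p has_derivative (%v. - 2 * c * ?a x v * gaussian c p x)) (at x)" for x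
  unfolding gaussian_def cmod_power2 by (auto intro!: derivative_eq_intros)
 have dq: "\<exists>q'. polyfun q' & (\<forall>x. ((?e q) has_derivative (%v. of_real ((q1 x * Re v + q2 x * Im v - 2 * c * q x * ?a x v) * gaussian c p x))) (at x))
   & (\<forall>x. q' x = q1 x * Re b + q2 x * Im b - 2 * c * q x * ?a x b)"
  if "polyfun q" "polyfun q1" "polyfun q2" "!!x. (q has_derivative (%v. q1 x * Re v + q2 x * Im v)) (at x)" for q q1 q2 b
 proof (intro exI[of _ "%x. q1 x * Re b + q2 x * Im b + (- 2 * c) * q x * ?f x b"] conjI allI)
  show "((?e q) has_derivative (%v. of_real ((q1 x * Re v + q2 x * Im v - 2 * c * q x * ?a x v) * gaussian c p x))) (at x)" for x
   by (rule has_derivative_of_real) (auto intro!: derivative_eq_intros that(4) dG simp: alg_simps)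
  show "polyfun (%x. q1 x * Re b + q2 x * Im b + (- 2 * c) * q x * ?f x b)"
   by (intro polyfun.intros that)
 qed (simp add: alg_simps)
 have it: "\<exists>q. polyfun q & iterated_deriv bs ?b = ?i q" for bs
 proof (induction bs)
  case Nil
  show ?case by (intro exI[of _ "%_. 1"]) (auto intro: polyfun.const)
 next
  case (Cons b bs)
  then obtain q where q: "polyfun q" "iterated_deriv bs ?b = ?i q" by auto
  obtain q1 q2 where q12: "polyfun q1" "polyfun q2" "!!x. (q has_derivative (%v. q1 x * Re v + q2 x * Im v)) (at x)"
   using polyfun_deriv[OF q(1)] by auto
  obtain q' where q': "polyfun q'"
   "!!x. ((?e q) has_derivative (%v. of_real ((q1 x * Re v + q2 x * Im v - 2 * c * q x * ?a x v) * gaussian c p x))) (at x)"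
   "!!x. q' x = q1 x * Re b + q2 x * Im b - 2 * c * q x * ?a x b"
   using dq[OF q(1) q12, of b] by auto
  have "iterated_deriv (b # bs) ?b = ?i q'"
   unfolding iterated_deriv.simps q(2) frechet_derivative_at[OF q'(2), symmetric] q'(3) ..
  thus ?case using q'(1) by auto
 qed
 show ?thesis unfolding schwartz_def
 proof (intro allI impI conjI)
  fix bs :: "complex list" and x k
  obtain q where q: "polyfun q" "iterated_deriv bs (%x. of_real (gaussian c p x)) = (%x. of_real (q x * gaussian c p x))" using it by auto
  let ?g = "%x. cmod x ^ k *\<^sub>R complex_of_real (?c q x)"
  obtain q1 q2 where q12: "polyfun q1" "polyfun q2" "!!x. (q has_derivative (%v. q1 x * Re v + q2 x * Im v)) (at x)"
   using polyfun_deriv[OF q(1)] by auto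
   show "iterated_deriv bs ?b differentiable at x"
   unfolding q(2) differentiable_def using dq[OF q(1) q12] by auto
  obtain C m where C: "0 <= C" "!!x. abs (q x) <= C * (1 + cmod x) ^ m" using polyfun_bound[OF q(1)] by auto
  \<comment> \<open>Completing the square gives \<open>u <= c * u^2 + 1 / (4 * c)\<close> for
    \<open>u = |x - p|\<close>, hence \<open>gaussian c p x <= exp (K - |x|)\<close>.\<close>
  define K where "K = cmod p + 1 / (4 * c)"
  let ?h = "C * (fact (m + k) * exp (1 + K))"
  have "norm (?g x) <= ?h" for x
  proof -
   let ?d = "1 + cmod x"
   have "(2 * c * u - 1)^2 / (4 * c) = c * u^2 - u + 1 / (4 * c)" for u using c by (simp add: power2 field_simps)
   moreover have "0 <= (2 * c * u - 1)^2 / (4 * c)" for u using c by simp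
   ultimately have "cmod (x - p) <= c * (cmod (x - p))^2 + 1 / (4 * c)" by (metis add.commute add_diff_eq diff_add_eq diff_ge_0_iff_ge)
   moreover have "cmod x <= cmod (x - p) + cmod p" using norm_triangle_ineq[of "x - p" p] by simp
   ultimately have G: "gaussian c p x <= exp (K - cmod x)" unfolding gaussian_def K_def by simp
   have "?d ^ (m + k) /\<^sub>R fact (m + k) <= exp ?d"
    using sum_le_suminf[OF summable_exp_generic, of "{m + k}" "1 + cmod x"] unfolding exp_def by simp
   hence "?d ^ (m + k) <= fact (m + k) * exp ?d" by (subst (asm) scaleR_conv_of_real) (simp add: inverse_eq_divide pos_divide_le_eq mult.commute)
   hence "?d ^ (m + k) * gaussian c p x <= (fact (m + k) * exp ?d) * exp (K - cmod x)"
    using G by (intro mult_mono) (auto simp: gaussian_def)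
   also have "... = fact (m + k) * exp (1 + K)" by (simp add: mult.assoc flip: exp_add)
   finally have B: "C * (?d ^ (m + k) * gaussian c p x) <= ?h" using C(1) by (rule mult_left_mono)
   have "norm (?g x) = cmod x ^ k * abs (q x) * gaussian c p x"
    by (simp add: norm_mult gaussian_def)
   also have "... <= ?d ^ k * (C * ?d ^ m) * gaussian c p x"
    using C by (intro mult_mono power_mono mult_nonneg_nonneg) (auto simp: gaussian_def)
   finally show ?thesis using B by (simp add: power_add mult_ac)
  qed
  thus "bounded (range (%x. cmod x ^ k *\<^sub>R iterated_deriv bs ?b x))"
   unfolding q(2) bounded_iff by auto
 qed
qed

lemma gaussian_integral:
 assumes c: "0 < c" shows "integrable lborel (gaussian c p)" "(LBINT x. gaussian c p x) = pi / c"
proof -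
 have e: "exp (- (c / pi) * (area x)) = gaussian c p (p + x)" for x by (simp add: gaussian_def)
 have "0 < c / pi" using c by simp
 from integral_power_exp_area[OF this, of 0] show "integrable lborel (gaussian c p)" "(LBINT x. gaussian c p x) = pi / c"
  using integral_lborel_translate[of "gaussian c p" p] by (simp_all add: e[simplified])
qed

lemma locally_finite_sigma_finite:
 fixes \<mu> :: "'a::euclidean_space measure"
 assumes "locally_finite_measure \<mu>" shows "sigma_finite_measure \<mu>"
proof
 have s: "sets \<mu> = sets borel" and f: "!!K. compact K ==> emeasure \<mu> K < \<infinity>"
  using assms by (auto simp: locally_finite_measure_def)
 show "\<exists>A. countable A & A \<subseteq> sets \<mu> & \<Union> A = space \<mu> & (\<forall>a\<in>A. emeasure \<mu> a ~= \<infinity>)"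
 proof (intro exI[of _ "range (%n. cball 0 (real n))"] conjI)
  show "\<Union> (range (%n. cball (0::'a) (real n))) = space \<mu>"
   using real_arch_simple sets_eq_imp_space_eq[OF s] by auto
 qed (use f[OF compact_cball] in "auto simp: s less_top")
qed

text \<open>A test function is the limit of its convolutions with narrow Gaussians.\<close>

lemma gaussians_determine_measure:
 fixes \<mu> \<nu> :: "complex measure"
 assumes lf: "locally_finite_measure \<mu>" "locally_finite_measure \<nu>"
  and i: "!!c p. 0 < c ==> integrable \<mu> (gaussian c p)" "!!c p. 0 < c ==> integrable \<nu> (gaussian c p)"
  and eq: "!!c p. 0 < c ==> (\<integral>x. gaussian c p x \<partial>\<mu>) = (\<integral>x. gaussian c p x \<partial>\<nu>)"
 shows "\<mu> = \<nu>"
proof (rule measure_eqI_compact_support[OF lf])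
 let ?c = "%n p x. (real n + 1/2) * gaussian (real n + 1/2) p x"
 let ?d = "%n p M. real (Suc n) / pi * (\<integral>x. gaussian (real (Suc n)) p x \<partial>M)"
 let ?g = "%c x. integrable lborel (%p. gaussian c p x)"
 fix ph :: "complex => real" and K
 assume ph: "continuous_on UNIV ph" "compact K" "!!x. x \<notin> K ==> ph x = 0" "!!x. 0 <= ph x & ph x <= 1"
 let ?e = "\<integral>x. ph x \<partial>\<mu>"
 have [measurable]: "ph \<in> BM borel" using ph(1) by (rule cont_measurable)
 obtain R where R: "!!x. x \<in> K ==> cmod x <= R" using compact_imp_bounded[OF ph(2)] by (auto simp: bounded_iff)
 define E where "E = exp (R^2 / 2)"
 \<comment> \<open>Part of the Gaussian is traded for decay in \<open>x\<close> that is uniform over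
   centres \<open>p\<close> in the support of \<open>ph\<close>; this yields one integrable majorant
   for all \<open>n\<close>.\<close>
 have low: "gaussian (c + 1/2) p x <= E * gaussian (1/4) 0 x * gaussian c p x" if "cmod p <= R" for c p x
 proof -
  have "cmod x <= cmod (x - p) + R" using norm_triangle_ineq[of "x - p" p] that by simp
  hence "(cmod x)^2 <= (cmod (x - p) + R)^2" by (intro power_mono) auto
  also have "... <= 2 * (cmod (x - p))^2 + 2 * R^2" using zero_le_power2[of "cmod (x - p) - R"] by (simp add: power2 alg_simps)
  finally show ?thesis unfolding gaussian_def E_def exp_add[symmetric] by (simp add: alg_simps)
 qed
 have phR: "ph p = 0" if "R < cmod p" for p using ph(3)[of p] R[of p] that by auto
 define F where "F n x p = ph p * (real (Suc n) / pi * gaussian (real (Suc n)) p x)" for n x p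
 have meas [measurable]: "(%(p, x). F n x p) \<in> BM (borel >< borel)" for n unfolding F_def gaussian_def by auto
 have F0: "0 <= F n x p" for n x p unfolding F_def using ph(4) gaussian_pos by (simp add: less_imp_le)
 have Fle: "F n x p <= 2 * E / pi * gaussian (1/4) 0 x * ?c n p x" for n x p
 proof (cases "cmod p <= R")
  case True
  define a where "a = real n + 1/2"
  have a: "real (Suc n) = a + 1/2" "real (Suc n) <= 2 * a" by (auto simp: a_def)
  have "ph p * (real (Suc n) * gaussian (a + 1/2) p x) <= 1 * ((2 * a) * (E * gaussian (1/4) 0 x * gaussian a p x))"
   using ph(4)[of p] low[OF True, of a x] gaussian_pos a(2) by (intro mult_mono) (auto simp: less_imp_le)
  from divide_right_mono[OF this, of pi] show ?thesis unfolding F_def a_def[symmetric] a(1) by (simp add: mult_ac)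
 qed (use gaussian_pos in "auto simp: F_def phR E_def less_imp_le")
 have le1: "gaussian c p x <= 1" if "0 < c" for c p x using that by (simp add: gaussian_def)
 define phn where "phn n x = (LBINT p. F n x p)" for n x
 have ig: "?g c x" "(LBINT p. gaussian c p x) = pi / c" if "0 < c" for c x
 proof -
  have "(%p. gaussian c p x) = gaussian c x" by (auto simp: gaussian_def norm_minus_commute)
  thus "?g c x" "(LBINT p. gaussian c p x) = pi / c" using gaussian_integral[OF that, of x] by auto
 qed
 have bound: "norm (phn n x) <= 2 * E * gaussian (1/4) 0 x" for n x
 proof -
  note I = integrable_mult_right[of "2 * E / pi * gaussian (1/4) 0 x", OF integrable_mult_right[of "real n + 1/2", OF ig(1)[of "real n + 1/2" x]]]
  have "phn n x <= (LBINT p. 2 * E / pi * gaussian (1/4) 0 x * ?c n p x)" unfolding phn_def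
  proof (rule integral_mono[OF _ I Fle])
   show "integrable lborel (F n x)" by (rule integrable_dom[OF I], measurable, rule AE_I2,
     unfold real_norm_def abs_of_nonneg[OF F0], rule order.trans[OF Fle abs_ge_self])
  qed (simp add: add_nonneg_pos)
  also have "... = 2 * E * gaussian (1/4) 0 x" by (simp add: ig(2))
  finally show ?thesis using F0 by (simp add: phn_def)
 qed
 have lim: "(%n. phn n x) ----> ph x" for x
 proof -
  define G where "G v = gaussian 1 0 v / pi" for v
  have G: "integrable lborel G" "(LBINT v. G v) = 1" unfolding G_def using gaussian_integral[of 1 0] by auto
  define c where "c n = 1 / sqrt (real (Suc n))" for n
  let ?a = "%x n v. x + of_real (c n) * v"
  have c: "0 < c n" "(c n)^2 = 1 / real (Suc n)" for n by (auto simp: c_def power_divide)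
  have "phn n x = (LBINT v. G v * ph (?a x n v))" for n
  proof -
   have "phn n x = (LBINT p. F n x (x + p))" unfolding phn_def by (rule integral_lborel_translate(1)[symmetric]) measurable
   also have "... = (LBINT v. (c n)^2 *\<^sub>R F n x (?a x n v))" by (rule integral_lborel_complex_scale(1)[OF _ c(1)]) measurable
   also have "... = (LBINT v. G v * ph (?a x n v))"
   proof (intro integral_congr refl)
    fix v
    have "real (Suc n) * (cmod (x - ?a x n v))^2 = (cmod v)^2"
     by (simp add: norm_mult power_mult_distrib c(2))
    hence "gaussian (real (Suc n)) (?a x n v) x = gaussian 1 0 v"
     unfolding gaussian_def mult_minus_left by auto
    thus "(c n)^2 *\<^sub>R F n x (?a x n v) = G v * ph (?a x n v)" by (simp add: F_def G_def c(2))
   qed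
   finally show ?thesis .
  qed
  moreover have "(%n. LBINT v. G v * ph (?a x n v)) ----> (LBINT v. G v * ph x)"
  proof (rule integral_dominated_convergence[OF _ _ G(1)])
   show "AE v in lborel. (%n. G v * ph (?a x n v)) ----> G v * ph x"
   proof (intro AE_I2 tendsto_mult tendsto_const)
    fix v :: complex
    have "c ----> 0" unfolding c_def by real_asymp
    hence "(%n. x + of_real (c n) * v) ----> x + of_real 0 * v" by (intro tendsto_intros)
    from continuous_on_tendsto_compose[OF ph(1) this] show "(%n. ph (?a x n v)) ----> ph x" by simp
   qed
   show "AE v in lborel. norm (G v * ph (?a x n v)) <= G v" for n
    using ph(4) gaussian_pos by (intro AE_I2) (auto simp: G_def less_imp_le intro!: divide_right_mono)
  qed (unfold G_def, measurable)
  ultimately show ?thesis using G by simp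
 qed
 have main: "(%n. LBINT p. ph p * ?d n p M) ----> (\<integral>x. ph x \<partial>M)"
  if M: "locally_finite_measure M" and iM: "!!c p. 0 < c ==> integrable M (gaussian c p)" for M
 proof -
  have s [measurable_cong, simp]: "sets M = sets borel" using M by (simp add: locally_finite_measure_def)
  interpret M: sigma_finite_measure M using M by (rule locally_finite_sigma_finite)
  interpret pair_sigma_finite "lborel :: complex measure" M ..
  have "(%n. \<integral>x. phn n x \<partial>M) ----> (\<integral>x. ph x \<partial>M)"
   by (rule integral_dominated_convergence[OF _ _ integrable_mult_right[of "2 * E", OF iM[of "1/4" 0]]])
    (use lim bound in "auto simp: phn_def cong: measurable_cong_sets")
  moreover have "(\<integral>x. phn n x \<partial>M) = (LBINT p. ph p * ?d n p M)" for n
  proof -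
   let ?b = "2 * E / pi * (real n + 1/2)"
   let ?f = "%(p, x). F n x p"
   have "(\<integral>x. (LBINT p. ?f (p, x)) \<partial>M) = (LBINT p. \<integral>x. ?f (p, x) \<partial>M)"
   proof (rule Fubini_dominated(2))
    show "integrable lborel (%p::complex. ?b * indicator (cball 0 R) p :: real)"
     using emeasure_lborel_cball_finite[of "0::complex" R] by auto
    show "integrable M (gaussian (1/4) 0)" by (rule iM) simp
    show "norm (?f (p, x)) <= ?b * indicator (cball 0 R) p * gaussian (1/4) 0 x" for p x
    proof (cases "p \<in> cball 0 R")
     case True
     let ?h = "?b * 1 * gaussian (1/4) 0 x"
     have "2 * E / pi * gaussian (1/4) 0 x * ?c n p x <= 2 * E / pi * gaussian (1/4) 0 x * ((real n + 1/2) * 1)"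
      using gaussian_pos[of "1/4" 0 x] by (intro mult_left_mono le1) (auto simp: E_def)
     also have "... = ?h" by auto
     finally have "F n x p <= ?h" by (rule order.trans[OF Fle])
     moreover have "indicator (cball 0 R) p = (1::real)" using True by simp
     ultimately show ?thesis unfolding prod.case real_norm_def abs_of_nonneg[OF F0] by auto
    qed (auto simp: F_def phR)
   qed measurable
   thus ?thesis by (simp add: phn_def F_def)
  qed
  ultimately show ?thesis by simp
 qed
 have "(%n. LBINT p. ph p * (real (Suc n) / pi * (\<integral>x. gaussian (real (Suc n)) p x \<partial>\<nu>))) ----> ?e"
  using main[OF lf(1) i(1)] eq[OF of_nat_0_less_iff[THEN iffD2, OF zero_less_Suc]] by simp
 from LIMSEQ_unique[OF this main[OF lf(2) i(2)]] show "?e = (\<integral>x. ph x \<partial>\<nu>)" by simp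
qed

section \<open>From tent correlations to the vague limit\<close>

text \<open>The functional that integration against the autocorrelation measure will turn out to
  be.\<close>

definition pair_lim :: "(complex => real) => real" where
 "pair_lim ph = ph 0 + (LBINT u. (1 - g (cmod u)) * ph u)"

lemma integrable_pair_density:
 assumes [measurable]: "ph \<in> BM borel" and b: "!!u. abs (ph u) <= C * indicator (cball 0 r) u"
 shows "integrable lborel (%u. (1 - g (cmod u)) * ph u)"
proof -
 have "integrable lborel (%u::complex. C * indicator (cball 0 r) u)"
  using emeasure_lborel_cball_finite[of "0::complex" r] by simp
 moreover have "integrable lborel (%u. g (cmod u) *\<^sub>R (C * indicator (cball 0 r) u))"
  by (rule integrable_g_scaleR[of _ "abs C"]) (auto simp: indicator_def)
 ultimately have "integrable lborel (%u. (1 - g (cmod u)) * (C * indicator (cball 0 r) u))" unfolding left_diff_distrib by simp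
 thus ?thesis by (rule integrable_dom)
   (measurable, unfold norm_mult real_norm_def abs_mult[of "1 - _"], intro AE_I2 mult_left_mono order.trans[OF b abs_ge_self], simp)
qed

lemma tent_lipschitz:
 assumes R: "0 < R1" "R1 < R2" shows "abs (tent R1 R2 x - tent R1 R2 y) <= cmod (x - y) / R1"
proof -
 have *: "ln s - ln t <= d / R1" if "R1 <= t" "R1 <= s" "abs (s - t) <= d" for s t d :: real
 proof -
  have st: "0 < s" "0 < t" using that R by auto
  hence "1 + (s - t) / t = s / t" by (simp add: field_simps)
  hence "ln s - ln t = ln (1 + (s - t) / t)" using st by (simp add: ln_div)
  also have "... <= (s - t) / t" using that R by (intro ln_add_one_self_le_self2) (simp add: field_simps)
  also have "... <= d / t" using that R by (intro divide_right_mono) auto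
  also have "... <= d / R1" using that R by (intro divide_left_mono) auto
  finally show ?thesis .
 qed
 define c where "c z = min R2 (max R1 (cmod z))" for z
 have "abs (c x - c y) <= abs (cmod x - cmod y)" by (auto simp: c_def)
 also have "... <= cmod (x - y)" by (rule norm_triangle_ineq3)
 finally have d: "abs (c x - c y) <= cmod (x - y)" .
 have "R1 <= c z" for z using R by (auto simp: c_def)
 from *[OF this this, of x y] *[OF this this, of y x] d show ?thesis
  unfolding tent_def c_def[symmetric] by (simp add: abs_le_iff)
qed

section \<open>Tent correlations as smoothing kernels\<close>

context
 fixes q :: real
 assumes q: "0 < q"
begin

text \<open>The fixed ratio 2 of the radii gives a one-parameter family of bumps, supported in the
  disc of radius \<open>4 * q\<close>.\<close>

definition tq :: "complex => real" where "tq u = tent_corr q (2 * q) u"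

private lemma R: "0 < q" "q < 2 * q" using q by auto

definition mass :: real where "mass = pi * ((2 * q)^2 - q^2) / 2"

lemma mass_pos: "0 < mass" unfolding mass_def using q by auto

lemma tq_facts: "0 <= tq u" "tq u <= ln 2 * mass" "continuous_on UNIV tq" "tq \<in> BM borel"
 "integrable lborel tq" "(LBINT u. tq u) = mass^2"
proof -
 have l: "ln (2 * q) - ln q = ln 2" using q by (simp add: ln_mult)
 have e: "tq = tent_corr q (2 * q)" by (simp add: tq_def fun_eq_iff)
 show c: "continuous_on UNIV tq" unfolding e by (rule continuous_tent_corr[OF R])
 show "tq \<in> BM borel" by (rule cont_measurable[OF c])
 show "0 <= tq u" "tq u <= ln 2 * mass" "integrable lborel tq" "(LBINT u. tq u) = mass^2"
  using tent_corr_nonneg[OF R] tent_corr_le[OF R, of u] integral_tent_corr[OF R] unfolding e l mass_def by auto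
qed

lemma tq_eq_0: assumes "4 * q <= cmod u" shows "tq u = 0"
proof -
 have "tent q (2 * q) (u + v) * tent q (2 * q) v = 0" for v
 proof (cases "2 * q <= cmod v")
  case False
  hence "2 * q <= cmod (u + v)" using assms norm_triangle_ineq4[of "u + v" v] by simp
  thus ?thesis using q by (simp add: tent_eq_0)
 qed (use q in "simp add: tent_eq_0")
 thus ?thesis unfolding tq_def tent_corr_def by (simp only: integral_zero)
qed

private lemma integrable_tent_product: "integrable lborel (%v. tent q (2 * q) (u + v) * tent q (2 * q) v)"
proof (rule integrable_dom[OF integrable_mult_right[of "ln (2 * q) - ln q", OF integral_tent(1)[OF R]]])
 have *: "abs (tent q (2 * q) x) <= abs (ln (2 * q) - ln q)" for x using tent_nonneg[OF R, of x] tent_le[OF R, of x] by simp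
 show "AE v in lborel. norm (tent q (2 * q) (u + v) * tent q (2 * q) v) <= norm ((ln (2 * q) - ln q) * tent q (2 * q) v)"
  unfolding real_norm_def abs_mult by (intro AE_I2 mult_right_mono *) simp
qed measurable

lemma tq_lipschitz: "abs (tq u - tq u') <= mass / q * cmod (u - u')"
proof -
 let ?a = "%v. tent q (2 * q) (u + v) * tent q (2 * q) v - tent q (2 * q) (u' + v) * tent q (2 * q) v"
 note T = integral_tent(1)[OF R]
 note i = integrable_tent_product
 have "abs (tq u - tq u') = abs (LBINT v. tent q (2 * q) (u + v) * tent q (2 * q) v - tent q (2 * q) (u' + v) * tent q (2 * q) v)"
  unfolding tq_def tent_corr_def by (simp add: i)
 also have "... <= (LBINT v. abs (?a v))" by simp
 also have "... <= (LBINT v. cmod (u - u') / q * tent q (2 * q) v)"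
 proof (rule integral_mono)
  fix v
  let ?b = "cmod (u - u') / q * tent q (2 * q) v"
  have "abs (tent q (2 * q) (u + v) - tent q (2 * q) (u' + v)) * tent q (2 * q) v <= ?b"
   using tent_lipschitz[OF R, of "u + v" "u' + v"] tent_nonneg[OF R] by (intro mult_right_mono) auto
  thus "abs (?a v) <= ?b"
   using tent_nonneg[OF R, of v] by (simp add: abs_mult flip: left_diff_distrib)
 qed (use i T in auto)
 finally show ?thesis unfolding integral_mult_right_zero integral_tent(2)[OF R] mass_def[symmetric] by (simp add: mult.commute)
qed

text \<open>For \<open>v\<close> in the disc of radius \<open>q / 2\<close> around
  \<open>- u / 2\<close>, both tents take their maximal value \<open>ln 2\<close>.\<close>

lemma tq_lower: assumes "cmod u <= q" shows "(ln 2)^2 * (pi * (q / 2)^2) <= tq u"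
proof -
 let ?a = "ball (- u / 2) (q / 2)"
 have "(LBINT v. (ln 2)^2 * indicator ?a v) <= tq u" unfolding tq_def tent_corr_def
 proof (rule integral_mono)
  show "integrable lborel (%v. (ln 2)^2 * indicator ?a v :: real)"
   by (intro integrable_mult_right integrable_real_indicator) (auto simp: emeasure_ball_complex q less_imp_le)
  show "integrable lborel (%v. tent q (2 * q) (u + v) * tent q (2 * q) v)" by (rule integrable_tent_product)
  fix v
  let ?b = "cmod (v + u / 2) + cmod (u / 2)"
  have t: "tent q (2 * q) z = ln 2" if "cmod z <= q" for z using that q by (simp add: tent_def ln_mult)
  show "(ln 2)^2 * indicator ?a v <= tent q (2 * q) (u + v) * tent q (2 * q) v"
  proof (cases "v \<in> ball (- u / 2) (q / 2)")
   case True
   hence d: "cmod (v + u / 2) < q / 2" by (simp add: dist_norm norm_minus_commute)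
   have "cmod v <= ?b" "cmod (u + v) <= ?b"
    using norm_triangle_ineq4[of "v + u / 2" "u / 2"] norm_triangle_ineq[of "v + u / 2" "u / 2"] by auto
   hence "cmod v <= q" "cmod (u + v) <= q" using d assms by auto
   thus ?thesis using t by (simp add: power2)
  qed (use tent_nonneg[OF R] in simp)
 qed
 thus ?thesis using q by (simp add: measure_def emeasure_ball_complex)
qed

end

lemma pair_lim_diff_le:
 assumes m: "ph \<in> BM borel" "ph' \<in> BM borel" and i: "integrable lborel (%u. (1 - g (cmod u)) * ph' u)"
  and d: "!!u. abs (ph u - ph' u) <= e * indicator (cball 0 r) u" and r: "0 <= r"
 shows "abs (pair_lim ph - pair_lim ph') <= e * pair_lim (indicator (cball 0 r))"
proof -
 let ?a = "%u. 1 - g (cmod u)"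
 let ?b = "LBINT u. ?a u * (ph u - ph' u)"
 note [measurable] = m
 have id: "integrable lborel (%u. ?a u * (ph u - ph' u))" by (rule integrable_pair_density[OF _ d]) measurable
 have i1: "integrable lborel (%u::complex. ?a u * indicator (cball 0 r) u)"
  by (rule integrable_pair_density[of _ 1 r]) (auto intro!: borel_measurable_indicator)
 have "integrable lborel (%u. ?a u * ph u)" using integrable_plus[OF id i] by (simp flip: distrib_left)
 hence "pair_lim ph - pair_lim ph' = (ph 0 - ph' 0) + ?b"
  using i unfolding pair_lim_def right_diff_distrib by simp
 moreover have "abs ?b <= (LBINT u. e * (?a u * indicator (cball 0 r) u))"
 proof (rule order.trans[OF integral_abs_bound], rule integral_mono)
  show "abs (?a u * (ph u - ph' u)) <= e * (?a u * indicator (cball 0 r) u)" for u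
   using mult_left_mono[OF d[of u], of "1 - g (cmod u)"] g_le_1[of "cmod u"] by (simp add: abs_mult mult_ac)
 qed (use id i1 in auto)
 ultimately show ?thesis using d[of 0] unfolding pair_lim_def by (simp add: distrib_left)
qed

lemma rational_complex_near:
 assumes "0 < e" obtains a b :: rat where "cmod (c - Complex (of_rat a) (of_rat b)) < e"
proof -
 obtain a b where ab: "Re c - e / 2 < of_rat a" "of_rat a < Re c + e / 2" "Im c - e / 2 < of_rat b" "of_rat b < Im c + e / 2"
  using of_rat_dense[of "Re c - e / 2" "Re c + e / 2"] of_rat_dense[of "Im c - e / 2" "Im c + e / 2"] assms by auto
 have "cmod (c - Complex (of_rat a) (of_rat b)) <= abs (Re c - of_rat a) + abs (Im c - of_rat b)"
  using cmod_le[of "c - Complex (of_rat a) (of_rat b)"] by simp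
 also have "... < e" using ab by auto
 finally show ?thesis using that by auto
qed

section \<open>Averages over the differences of finite point sets\<close>

locale pair_average =
 fixes Z :: "nat => complex set"
 assumes fin: "finite (Z n)"
begin

definition X :: "nat => (complex => real) => real" where
 "X n ph = (\<Sum>x\<in>Z n. \<Sum>y\<in>Z n. ph (x - y)) / (pi * (real n)^2)"

lemma X_mono: "(!!u. ph u <= ph' u) ==> X n ph <= X n ph'"
 unfolding X_def by (intro divide_right_mono sum_mono) auto

lemma X_scale: "X n (%u. c * ph u) = c * X n ph"
 unfolding X_def by (simp add: sum_distrib_left)

lemma X_diff_le:
 assumes "!!u. abs (ph u - ph' u) <= e * k u" shows "abs (X n ph - X n ph') <= e * X n k"
proof -
 have "ph u - ph' u <= e * k u" "ph' u - ph u <= e * k u" for u using assms[of u] by auto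
 hence "X n (%u. ph u - ph' u) <= X n (%u. e * k u)" "X n (%u. ph' u - ph u) <= X n (%u. e * k u)" by (auto intro: X_mono)
 thus ?thesis unfolding X_scale by (simp add: X_def sum_subtractf diff_divide_distrib)
qed

context
 assumes tents: "!!q a b :: rat. 0 < q ==>
  (%n. X n (%u. tq (of_rat q) (u + Complex (of_rat a) (of_rat b)))) ----> pair_lim (%u. tq (of_rat q) (u + Complex (of_rat a) (of_rat b)))"
begin

text \<open>A multiple of a wide \<open>tq\<close> dominates the indicator of the disc, and its
  averages converge. With this bound, uniform approximation of test functions on a fixed disc
  suffices.\<close>

lemma X_ball_bounded: obtains B where "!!n. X n (indicator (cball 0 r)) <= B" "0 <= B"
proof -
 let ?a = "indicator (cball 0 r)"
 obtain m :: nat where m: "r < real m" using reals_Archimedean2 by auto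
 define q where "q = (of_nat (Suc m) :: rat)"
 have q: "0 < q" "r <= of_rat q" "(0::real) < of_rat q" using m by (auto simp: q_def simp del: of_nat_Suc)
 define de where "de = (ln 2)^2 * (pi * (of_rat q / 2)^2 :: real)"
 have de: "0 < de" using q by (simp add: de_def)
 have z: "Complex (of_rat 0) (of_rat 0) = 0" by (simp add: complex_eq_iff)
 have "convergent (%n. X n (tq (of_rat q)))" using tents[OF q(1), of 0 0] unfolding z by (auto simp: convergent_def)
 then obtain B where B: "!!n. abs (X n (tq (of_rat q))) <= B" using convergent_imp_Bseq BseqE by (metis real_norm_def)
 let ?b = "(1 / de) * B"
 have "X n ?a <= ?b" for n
 proof -
  have "X n ?a <= X n (%u. (1 / de) * tq (of_rat q) u)"
  proof (rule X_mono)
   show "indicator (cball 0 r) u <= (1 / de) * tq (of_rat q) u" for u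
    using tq_lower[OF q(3), of u] tq_facts(1)[OF q(3), of u] q(2) de unfolding de_def[symmetric]
    by (cases "u \<in> cball 0 r") (auto simp: divide_simps)
  qed
  also have "... <= ?b" unfolding X_scale using B[of n] de by (intro mult_left_mono) auto
  finally show ?thesis .
 qed
 moreover have "0 <= ?b" using B[of 0] de by auto
 ultimately show ?thesis using that by auto
qed

text \<open>Replacing \<open>ph\<close> by \<open>ph'\<close> costs \<open>e\<close> times a bounded
  quantity, in the averages as well as in the limit functional.\<close>

lemma X_approx:
 assumes m: "ph \<in> BM borel" and r: "0 <= r"
  and ap: "!!e. 0 < e ==> \<exists>ph'. ph' \<in> BM borel & (%n. X n ph') ----> pair_lim ph' &
   integrable lborel (%u. (1 - g (cmod u)) * ph' u) & (\<forall>u. abs (ph u - ph' u) <= e * indicator (cball 0 r) u)"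
 shows "(%n. X n ph) ----> pair_lim ph"
proof (rule LIMSEQ_I)
 fix e :: real assume e: "0 < e"
 obtain B where B: "!!n. X n (indicator (cball 0 r)) <= B" "0 <= B" by (rule X_ball_bounded[of r]) blast
 define P where "P = pair_lim (indicator (cball 0 r))"
 have P: "0 <= P" unfolding P_def pair_lim_def using g_le_1 by auto
 define T where "T = B + P + 1"
 have T: "0 < T" using B P by (simp add: T_def)
 define d where "d = e / (2 * T)"
 have d: "0 < d" using e T by (simp add: d_def)
 have dd: "d * B + d * P < e / 2"
 proof -
  have "d * (B + P) < d * T" using d by (intro mult_strict_left_mono) (auto simp: T_def)
  also have "... = e / 2" using T by (simp add: d_def)
  finally show ?thesis by (simp add: distrib_left)
 qed
 obtain ph' where ph': "ph' \<in> BM borel" "(%n. X n ph') ----> pair_lim ph'"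
   "integrable lborel (%u. (1 - g (cmod u)) * ph' u)" "!!u. abs (ph u - ph' u) <= d * indicator (cball 0 r) u" using ap[OF d] by auto
 obtain N where N: "!!n. N <= n ==> abs (X n ph' - pair_lim ph') < e / 2" using LIMSEQ_D[OF ph'(2), of "e / 2"] e by auto
 have "norm (X n ph - pair_lim ph) < e" if "N <= n" for n
 proof -
  have "abs (X n ph - X n ph') <= d * B"
   using X_diff_le[of ph ph' d "indicator (cball 0 r)" n, OF ph'(4)] mult_left_mono[OF B(1)[of n], of d] d by linarith
  moreover have "abs (pair_lim ph - pair_lim ph') <= d * P" unfolding P_def by (rule pair_lim_diff_le[OF m ph'(1,3,4) r])
  ultimately show ?thesis using N[OF that] dd unfolding real_norm_def by linarith
 qed
 thus "\<exists>N. \<forall>n\<ge>N. norm (X n ph - pair_lim ph) < e" by auto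
qed

text \<open>Lipschitz continuity of \<open>tq\<close> carries the convergence from rational shifts
  to all shifts.\<close>

lemma X_tent_shift:
 assumes q: "0 < q" shows "(%n. X n (%u. tq (of_rat q) (u + c))) ----> pair_lim (%u. tq (of_rat q) (u + c))"
proof -
 define Q :: real where "Q = of_rat q"
 have Q: "0 < Q" using q by (simp add: Q_def)
 note [measurable] = tq_facts(4)[OF Q]
 have sup: "abs (tq Q (u + c')) <= ln 2 * mass Q * indicator (cball 0 r) u" if "4 * Q + cmod c' <= r" for u c' r
 proof (cases "u \<in> cball 0 r")
  case False
  hence "4 * Q <= cmod (u + c')" using that norm_triangle_ineq4[of "u + c'" c'] by simp
  thus ?thesis using False tq_eq_0[OF Q] by simp
 qed (use tq_facts[OF Q] in simp)
 define r where "r = 4 * Q + cmod c + 1"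
 have "(%n. X n (%u. tq Q (u + c))) ----> pair_lim (%u. tq Q (u + c))"
 proof (rule X_approx[where r = r])
  fix e :: real assume e: "0 < e"
  define L where "L = mass Q / Q"
  have L: "0 < L" using Q mass_pos[OF Q] by (simp add: L_def)
  obtain a b where ab: "cmod (c - Complex (of_rat a) (of_rat b)) < min 1 (e / L)"
   by (rule rational_complex_near[of "min 1 (e / L)" c]) (use e L in auto)
  define c' where "c' = Complex (of_rat a) (of_rat b)"
  let ?a = "%u. abs (tq Q (u + c) - tq Q (u + c'))"
  have c': "cmod (c - c') < 1" "cmod (c - c') * L <= e" using ab L by (auto simp: c'_def pos_less_divide_eq)
  have r': "4 * Q + cmod c' <= r" "4 * Q + cmod c <= r" using c'(1) norm_triangle_ineq3[of c c'] unfolding r_def by auto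
  show "\<exists>ph'. ph' \<in> BM borel & (%n. X n ph') ----> pair_lim ph' &
   integrable lborel (%u. (1 - g (cmod u)) * ph' u) & (\<forall>u. abs (tq Q (u + c) - ph' u) <= e * indicator (cball 0 r) u)"
  proof (intro exI[of _ "%u. tq Q (u + c')"] conjI allI)
   show "(%n. X n (%u. tq Q (u + c'))) ----> pair_lim (%u. tq Q (u + c'))"
    unfolding c'_def Q_def by (rule tents[OF q])
    show "integrable lborel (%u. (1 - g (cmod u)) * tq Q (u + c'))"
    by (rule integrable_pair_density[OF _ sup[OF r'(1)]]) measurable
   show "?a u <= e * indicator (cball 0 r) u" for u
   proof (cases "u \<in> cball 0 r")
    case True
    have "?a u <= L * cmod (c - c')" using tq_lipschitz[OF Q, of "u + c" "u + c'"] by (simp add: L_def)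
    thus ?thesis using c'(2) True by (simp add: mult.commute)
   qed (use sup[OF r'(1), of u] sup[OF r'(2), of u] in simp)
  qed measurable
 qed (use Q in "auto simp: r_def")
 thus ?thesis by (simp add: Q_def)
qed

text \<open>The convolution \<open>ph'\<close> of \<open>ph\<close> with the normalized kernel is a
  mixture of shifted tent correlations, so dominated convergence over the shifts carries their
  limits to \<open>ph'\<close>. Uniform continuity brings \<open>ph'\<close> close to
  \<open>ph\<close>.\<close>

theorem X_limit:
 assumes ph: "continuous_on UNIV ph" and K: "compact K" "!!x. x \<notin> K ==> ph x = 0" shows "(%n. X n ph) ----> pair_lim ph"
proof -
 let ?a = "%u. 1 - g (cmod u)"
 have [measurable]: "ph \<in> BM borel" using ph by (rule cont_measurable)
 obtain R where R: "0 <= R" "!!x. x \<in> K ==> cmod x <= R"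
  using compact_imp_bounded[OF K(1)] by (metis bounded_iff norm_ge_zero order.trans linear)
 let ?c = "cball 0 (R + 1)"
 have phR: "ph x = 0" if "R < cmod x" for x using K(2)[of x] R(2)[of x] that by auto
 obtain C where C: "!!x. abs (ph x) <= C"
 proof -
  have "bounded (ph ` K)" using K(1) ph by (intro compact_imp_bounded compact_continuous_image) (auto intro: continuous_on_subset)
  then obtain C where "!!x. x \<in> K ==> abs (ph x) <= C" by (auto simp: bounded_iff)
  hence "abs (ph x) <= max C 0" for x using K(2)[of x] by (cases "x \<in> K") (auto intro: le_max_iff_disj[THEN iffD2])
  thus ?thesis using that by auto
 qed
 have ib: "integrable lborel ph"
 proof (rule integrable_dom)
  show "integrable lborel (%x::complex. C * indicator (cball 0 R) x)"
   using emeasure_lborel_cball_finite[of "0::complex" R] by auto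
  show "AE x in lborel. norm (ph x) <= norm (C * indicator (cball 0 R) x)"
   using order.trans[OF C abs_ge_self] phR by (auto simp: indicator_def)
 qed measurable
 show ?thesis
 proof (rule X_approx[where r = "R + 1"])
  fix e :: real assume e: "0 < e"
  have "uniformly_continuous_on (cball 0 (R + 2)) ph"
   using ph by (intro compact_uniformly_continuous compact_cball) (auto intro: continuous_on_subset)
  then obtain d where d: "0 < d" "!!x y. x \<in> cball 0 (R + 2) ==> y \<in> cball 0 (R + 2) ==> dist y x < d ==> dist (ph y) (ph x) < e"
   using e unfolding uniformly_continuous_on_def by auto
  \<comment> \<open>\<open>4 * q < d\<close> places the support of the kernel within the scale of
    uniform continuity, and \<open>4 * q < 1\<close> keeps \<open>ph'\<close> supported in the disc
    of radius \<open>R + 1\<close>.\<close>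
  obtain q where q: "0 < (of_rat q :: real)" "of_rat q < min 1 d / 4" using of_rat_dense[of 0 "min 1 d / 4"] d(1) by auto
  define Q :: real where "Q = of_rat q"
  let ?b = "%p. %u. tq Q (u - p)"
  let ?d = "%p. LBINT u. ?a u * tq Q (u - p)"
  have Q: "0 < Q" "4 * Q < 1" "4 * Q < d" using q by (auto simp: Q_def)
  note [measurable] = tq_facts(4)[OF Q(1)]
  note tq = tq_facts[OF Q(1)] tq_eq_0[OF Q(1)]
  define m where "m = (mass Q)^2"
  let ?g = "LBINT p. ph p / m * ?d p"
  have m: "0 < m" using mass_pos[OF Q(1)] by (simp add: m_def)
  define ph' where "ph' u = (LBINT p. ph p / m * tq Q (u - p))" for u
  let ?i = "LBINT u. ?a u * ph' u"
  have [measurable]: "ph' \<in> BM borel" unfolding ph'_def by auto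
  define c where "c = ln 2 * mass Q"
  let ?l = "%u. c * indicator ?c u"
  have tsup: "tq Q (u - p) <= c * indicator ?c u" if "cmod p <= R" for u p
  proof (cases "u \<in> cball 0 (R + 1)")
   case False
   hence "4 * Q <= cmod (u - p)" using that Q norm_triangle_ineq2[of u p] by simp
   thus ?thesis using False tq(7) by simp
  qed (use tq(2) in "simp add: c_def")
  have c0: "0 <= c" using mass_pos[OF Q(1)] by (simp add: c_def)
  have prod_le: "abs (ph p / m * tq Q (u - p)) <= abs (ph p) / m * ?l u" for u p
  proof (cases "cmod p <= R")
   case True
   thus ?thesis using tsup[OF True, of u] tq(1) m unfolding abs_mult by (intro mult_mono) auto
  qed (simp add: phR)
  have iphi: "integrable lborel (%p. abs (ph p) / m)" using ib by simp
  have ip: "integrable lborel (%p. ph p / m * tq Q (u - p))" for u by (rule integrable_dom[OF integrable_mult_left[of c, OF iphi]]) (measurable, rule AE_I2, unfold real_norm_def, rule order.trans[OF prod_le], use m c0 in "auto simp: indicator_def ")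
  have iD: "integrable lborel (%u. ?a u * ?l u)"
   by (rule integrable_pair_density[of _ c "R + 1"]) (use c0 in "auto intro!: borel_measurable_times borel_measurable_indicator")
  have g1: "0 <= 1 - g (cmod u)" for u using g_le_1[of "cmod u"] by simp
  let ?F = "%(p, u). (1 - g (cmod u)) * (ph p / m * tq Q (u - p))"
  let ?f = "%p u. ?F (p, u) = ph p / m * (?a u * tq Q (u - p))"
  have Fle: "norm (?F (p, u)) <= abs (ph p) / m * (?a u * ?l u)" for p u
   using mult_left_mono[OF prod_le[of p u] g1[of u]] g1[of u] by (simp add: abs_mult mult_ac)
  have mF: "?F \<in> BM (lborel >< lborel)" by simp
  note Fub = lborel_pair.Fubini_dominated[OF mF iphi iD Fle]
  have il: "integrable lborel (%u. ?a u * ph' u)" using lborel_pair.integrable_snd[OF Fub(1)] by (simp add: ph'_def)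
  have tlim: "(%n. X n (?b p)) ----> pair_lim (?b p)" for p using X_tent_shift[of q "- p"] q(1) by (simp add: Q_def)
  have XF: "X n ph' = (LBINT p. ph p / m * X n (?b p))" for n
  proof -
   have "X n ph' = (LBINT p. (\<Sum>x\<in>Z n. \<Sum>y\<in>Z n. ph p / m * tq Q (x - y - p))) / (pi * (real n)^2)"
    unfolding X_def ph'_def using ip by simp
   thus ?thesis unfolding X_def by (simp add: sum_distrib_left)
  qed
  have PF: "pair_lim ph' = (LBINT p. ph p / m * pair_lim (?b p))"
  proof -
   have "?i = (LBINT p. (LBINT u. ?F (p, u)))" using Fub(2) by (simp add: ph'_def)
   also have "... = ?g"
   proof (intro integral_congr refl)
    fix p
    have "?f p u" for u by simp
    thus "(LBINT u. ?F (p, u)) = ph p / m * ?d p" by (simp only: integral_mult_right_zero)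
   qed
   finally have 1: "?i = ?g" .
   have "?f p u" for p u by simp
   hence "integrable lborel (%p. ph p / m * ?d p)"
    using lborel_pair.integrable_fst'[OF Fub(1)] by (simp only: integral_mult_right_zero)
   thus ?thesis unfolding pair_lim_def 1 distrib_left using ip[of 0] by (simp add: ph'_def)
  qed
  obtain B where B: "!!n. X n (indicator (cball 0 (R + 1))) <= B" "0 <= B" by (rule X_ball_bounded[of "R + 1"]) blast
  have lim': "(%n. X n ph') ----> pair_lim ph'" unfolding XF PF
  proof (rule integral_dominated_convergence[OF _ _ integrable_mult_left[of "c * B", OF iphi]])
   show "AE p in lborel. (%n. ph p / m * X n (?b p)) ----> ph p / m * pair_lim (?b p)"
    by (intro AE_I2 tendsto_mult tendsto_const tlim)
   show "AE p in lborel. norm (ph p / m * X n (?b p)) <= abs (ph p) / m * (c * B)" for n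
   proof (rule AE_I2)
    fix p
    show "norm (ph p / m * X n (%u. tq Q (u - p))) <= abs (ph p) / m * (c * B)"
    proof (cases "cmod p <= R")
     case True
     have "X n (?b p) <= c * X n (indicator ?c)"
      unfolding X_scale[symmetric] by (rule X_mono) (rule tsup[OF True])
     also have "... <= c * B" using B c0 by (intro mult_left_mono) auto
     finally have 1: "X n (?b p) <= c * B" .
     have "0 <= X n (?b p)" unfolding X_def using tq(1) by (intro divide_nonneg_nonneg sum_nonneg) auto
     thus ?thesis using 1 m by (simp add: abs_mult mult_left_mono divide_right_mono)
    qed (simp add: phR)
   qed
  qed (unfold X_def pair_lim_def, measurable)
  have ap: "abs (ph u - ph' u) <= e * indicator ?c u" for u
  proof (cases "u \<in> cball 0 (R + 1)")
   case True
   let ?e = "integrable lborel (%p. tq Q (u - p))"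
   let ?h = "(LBINT p. tq Q (u - p)) = m"
   let ?j = "%p. ph u / m * tq Q (u - p) - ph p / m * tq Q (u - p)"
   let ?k = "%p. abs (ph u - ph p) / m * tq Q (u - p)"
   have t1: "?e" "?h"
   proof -
    show "?e"
    proof (rule integrable_dom)
     show "integrable lborel (%p::complex. c * indicator (cball u (4 * Q)) p)"
      using emeasure_lborel_cball_finite[of u "4 * Q"] by auto
     show "AE p in lborel. norm (tq Q (u - p)) <= norm (c * indicator (cball u (4 * Q)) p)"
      using tq(1,2,7) c0 by (intro AE_I2) (auto simp: indicator_def c_def dist_norm)
    qed measurable
    show "?h" unfolding m_def using integral_lborel_reflect[of "tq Q" u] tq(6) by simp
   qed
   have "ph u - ph' u = (LBINT p. ph u / m * tq Q (u - p) - ph p / m * tq Q (u - p))" unfolding ph'_def using t1 ip m by simp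
   also have "abs (...) <= (LBINT p. abs (?j p))" by simp
   also have "... <= (LBINT p. e / m * tq Q (u - p))"
   proof (rule integral_mono)
    fix p
    show "abs (?j p) <= e / m * tq Q (u - p)"
    proof (cases "4 * Q <= cmod (u - p)")
     case False
     hence "cmod p <= R + 2" using True Q norm_triangle_ineq2[of p u] by (simp add: norm_minus_commute)
     hence "abs (ph u - ph p) <= e" using d(2)[of p u] True False Q by (simp add: dist_norm)
     hence "?k p <= e / m * tq Q (u - p)" using m tq(1) by (intro mult_right_mono divide_right_mono) auto
     moreover have "abs (?j p) = ?k p"
      using m tq(1)[of "u - p"] unfolding left_diff_distrib[symmetric] diff_divide_distrib[symmetric] by (simp add: abs_mult)
     ultimately show ?thesis by simp
    qed (simp add: tq(7))
   qed (use t1 ip in auto)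
   also have "... = e" using t1 m by simp
   finally show ?thesis using True by simp
  next
   case False
   hence "ph p / m * tq Q (u - p) = 0" for p using prod_le[of p u] by simp
   hence "ph' u = 0" unfolding ph'_def by (simp only: integral_zero)
   thus ?thesis using False phR[of u] by simp
  qed
  show "\<exists>ph'. ph' \<in> BM borel & (%n. X n ph') ----> pair_lim ph' &
   integrable lborel (%u. ?a u * ph' u) & (\<forall>u. abs (ph u - ph' u) <= e * indicator ?c u)"
   using lim' il ap by (intro exI[of _ ph'] conjI) auto
 qed (use R in auto)
qed

end

end

section \<open>The autocorrelation and diffraction measures\<close>

text \<open>The sum of a point mass at \<open>0\<close> and a density \<open>F \<ge> 0\<close>, as the image of a two-sheeted measure:
 one sheet carries \<open>F\<close>, the other a probability density and is collapsed to \<open>0\<close>.\<close>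

definition two_sheets :: "(complex => real) => (bool \<times> complex) measure" where
 "two_sheets F = density (count_space UNIV >< lborel) (%(b, x). ennreal (if b then F x else gaussian pi 0 x))"

definition dirac_plus :: "(complex => real) => complex measure" where
 "dirac_plus F = distr (two_sheets F) borel (%(b, x). if b then x else 0)"

lemma sets_dirac_plus [simp, measurable_cong]: "sets (dirac_plus F) = sets borel" by (simp add: dirac_plus_def)
lemma space_dirac_plus [simp]: "space (dirac_plus F) = UNIV" by (simp add: dirac_plus_def)

context
 fixes F :: "complex => real"
 assumes F [measurable]: "F \<in> BM borel" and F0: "!!x. 0 <= F x"
begin

private lemma m [measurable]:
 "(%(b, x). if b then x else (0::complex)) \<in> BM (count_space UNIV >< lborel)"
 "(%(b, x). if b then F x else gaussian pi 0 x) \<in> BM (count_space UNIV >< lborel)" by auto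

lemma nn_integral_dirac_plus:
 assumes [measurable]: "f \<in> BM borel" shows "(\<integral>\<^sup>+x. f x \<partial>dirac_plus F) = f 0 + (NINT x. ennreal (F x) * f x)"
proof -
 let ?a = "NINT x. ennreal (gaussian pi 0 x)"
 have "?a = ennreal (LBINT x. gaussian pi 0 x)"
  using gaussian_pos by (intro nn_integral_eq_integral gaussian_integral) (auto simp: less_imp_le)
 hence g1: "?a = 1" using gaussian_integral(2)[of pi 0] by simp
 let ?h = "%(b, x). ennreal (if b then F x else gaussian pi 0 x) * f (if b then x else 0)"
 have "(\<integral>\<^sup>+x. f x \<partial>dirac_plus F) = (\<integral>\<^sup>+p. ?h p \<partial>(count_space UNIV >< lborel))"
  unfolding dirac_plus_def two_sheets_def by (subst nn_integral_distr, measurable, subst nn_integral_density, measurable) (simp add: case_prod_beta')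
 also have "... = (\<integral>\<^sup>+b. (NINT x. ?h (b, x)) \<partial>count_space UNIV)"
  by (rule lborel.nn_integral_fst[symmetric]) measurable
 also have "... = (\<Sum>b\<in>UNIV. NINT x. ?h (b, x))" by (rule nn_integral_count_space_finite) simp
 also have "... = f 0 + (NINT x. ennreal (F x) * f x)" by (simp add: UNIV_bool nn_integral_multc g1)
 finally show ?thesis .
qed

lemma emeasure_dirac_plus: "A \<in> sets borel ==> emeasure (dirac_plus F) A = indicator A 0 + (NINT x. ennreal (F x) * indicator A x)"
 using nn_integral_dirac_plus[of "indicator A"] by simp

lemma integral_dirac_plus:
 fixes f :: "complex => 'b::{banach, second_countable_topology}"
 assumes [measurable]: "f \<in> BM borel" and i: "integrable lborel (%x. F x *\<^sub>R f x)"
 shows "integrable (dirac_plus F) f" "(\<integral>x. f x \<partial>dirac_plus F) = f 0 + (LBINT x. F x *\<^sub>R f x)"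
proof -
 let ?h = "%(b, x). (if b then F x else gaussian pi 0 x) *\<^sub>R f (if b then x else 0)"
 let ?a = "%(b, x). if b then F x else gaussian pi 0 x"
 let ?b = "count_space UNIV >< lborel"
 let ?c = "%(b, x). if b then x else 0"
 let ?d = "\<integral>x. f x \<partial>dirac_plus F"
 let ?e = "f 0 + (LBINT x. F x *\<^sub>R f x)"
 let ?f = "integrable (dirac_plus F) f"
 have I: "?f"
 proof (rule integrableI_bounded)
  have "(NINT x. ennreal (norm (F x *\<^sub>R f x))) < \<infinity>" using i by (simp add: integrable_iff_bounded)
  thus "(\<integral>\<^sup>+x. ennreal (norm (f x)) \<partial>dirac_plus F) < \<infinity>"
   using F0 by (subst nn_integral_dirac_plus) (auto simp: ennreal_mult)
 qed measurable
 thus "?f" .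
 interpret B: sigma_finite_measure "count_space (UNIV :: bool set)" by (rule sigma_finite_measure_count_space_finite) simp
 interpret P: pair_sigma_finite "count_space (UNIV :: bool set)" "lborel :: complex measure" ..
 have nn: "AE p in count_space UNIV >< lborel. 0 <= ?a p"
  using F0 gaussian_pos by (auto simp: less_imp_le)
 have e: "?h = (%p. ?a p *\<^sub>R f (?c p))" by auto
 have d: "two_sheets F = density ?b (%p. ennreal (?a p))"
  by (simp add: two_sheets_def case_prod_beta')
 have m2: "?c \<in> measurable (two_sheets F) borel" unfolding two_sheets_def by simp
 have m3: "(%p. f (?c p)) \<in> BM ?b" by simp
 have "integrable ?b ?h"
  using I unfolding dirac_plus_def integrable_distr_eq[OF m2 assms(1)] unfolding d integrable_density[OF m3 m(2) nn] e .
 note F = P.integral_fst'[OF this]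
 have "?d = (\<integral>p. ?h p \<partial>?b)"
  unfolding dirac_plus_def integral_distr[OF m2 assms(1)] unfolding d integral_density[OF m3 m(2) nn] e ..
 also have "... = (\<Sum>b\<in>UNIV. LBINT x. ?h (b, x))" unfolding F[symmetric] by (rule lebesgue_integral_count_space_finite) simp
 also have "... = ?e" using gaussian_integral[of pi 0] by (simp add: UNIV_bool)
 finally show "?d = ?e" .
qed

lemma eq_dirac_plus_density_dirac_plus:
 assumes i: "!!r. integrable lborel (%x. F x * indicator (cball 0 r) x)"
 shows "locally_finite_measure (dirac_plus F)" "eq_dirac_plus_density (dirac_plus F) F"
proof -
 let ?a = "dirac_plus F"
 have iA: "integrable lborel (%x. F x *\<^sub>R (indicator A x :: real))" if [measurable]: "A \<in> sets borel" and b: "bounded A" for A :: "complex set"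
 proof -
  obtain r where "!!x. x \<in> A ==> cmod x <= r" using b by (auto simp: bounded_iff)
  thus ?thesis by (intro integrable_dom[OF i[of r]]) (auto simp: indicator_def)
 qed
 note I = integral_dirac_plus[OF _ iA]
 have fin: "emeasure ?a A < \<infinity>" if "A \<in> sets borel" "bounded A" for A
  using I(1)[OF _ that] that by (simp add: integrable_indicator_iff[of _ A])
  show "locally_finite_measure ?a"
  unfolding locally_finite_measure_def using fin by (auto simp: compact_imp_bounded borel_compact)
 show "eq_dirac_plus_density ?a F" unfolding eq_dirac_plus_density_def
 proof (intro conjI ballI impI)
  fix A :: "complex set" assume A: "A \<in> sets borel" "bounded A"
  show "set_integrable lborel A F" using iA[OF A] by (simp add: set_integrable_def mult.commute)
  show "emeasure ?a A < \<infinity>" by (rule fin[OF A])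
  have "measure ?a A = indicator A 0 + (LBINT x. F x *\<^sub>R indicator A x)" using I(2)[OF _ A] A(1) by simp
  thus "measure ?a A = measure (return borel 0) A + (LINT x:A|lborel. F x)"
   using A(1) by (simp add: measure_return set_lebesgue_integral_def mult.commute)
 qed simp
qed

lemma translation_bounded_dirac_plus:
 assumes C: "!!x. F x <= C" shows "translation_bounded (dirac_plus F)" unfolding translation_bounded_def
proof (intro conjI ballI impI)
 let ?a = "dirac_plus F"
 fix B :: "complex set" assume B: "B \<in> sets borel" "bounded B"
 let ?d = "SUP x. emeasure ?a ((+) x ` B)"
 obtain r where r: "0 < r" "!!x. x \<in> B ==> cmod x < r" using bounded_pos_less[of B] B by auto
 let ?c = "1 + ennreal C * ennreal (pi * r^2)"
 have "emeasure ?a ((+) x ` B) <= ?c" for x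
 proof -
  let ?b = "NINT y. ennreal C * indicator (ball x r) y"
  have "emeasure ?a ((+) x ` B) <= emeasure ?a (ball x r)" using r by (intro emeasure_mono) (auto simp: dist_norm)
  also have "... <= 1 + ?b" unfolding emeasure_dirac_plus[OF borel_ball_complex]
   by (intro add_mono nn_integral_mono mult_right_mono ennreal_leI C) (auto simp: indicator_def)
  also have "?b = ennreal C * ennreal (pi * r^2)"
   using r by (simp add: nn_integral_cmult_indicator emeasure_ball_complex)
  finally show ?thesis .
 qed
 hence "?d <= ?c" by (rule SUP_least)
 thus "?d < \<infinity>" by (rule order.strict_trans1) (simp add: ennreal_mult_less_top)
qed simp

end

section \<open>The two limit measures and their Fourier duality\<close>

definition \<gamma>0 :: "complex measure" where "\<gamma>0 = dirac_plus (%x. 1 - g (cmod x))"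
definition \<gamma>hat0 :: "complex measure" where "\<gamma>hat0 = dirac_plus (%x. 1 - h (cmod x))"

lemma autocorrelation_density: "(%x. 1 - g (cmod x)) \<in> BM borel" "0 <= 1 - g (cmod x)"
 using g_le_1 by auto

lemma diffraction_density: "(%x. 1 - h (cmod x)) \<in> BM borel" "0 <= 1 - h (cmod x)"
 using one_minus_h_bounds by auto

lemma autocorrelation_measure: "locally_finite_measure \<gamma>0" "eq_dirac_plus_density \<gamma>0 (%x. 1 - g (cmod x))"
 unfolding \<gamma>0_def
 by (intro eq_dirac_plus_density_dirac_plus autocorrelation_density integrable_pair_density[of _ 1]; auto intro!: borel_measurable_indicator)+

lemma diffraction_integrable: "integrable lborel (%x. (1 - h (cmod x)) * indicator (cball 0 r) x)"
proof (rule integrable_dom)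
 let ?a = "1 + (LBINT z. abs (g (cmod z)))"
 show "integrable lborel (%x::complex. ?a * indicator (cball 0 r) x)"
  using emeasure_lborel_cball_finite[of "0::complex" r] by simp
 show "AE x in lborel. norm ((1 - h (cmod x)) * indicator (cball 0 r) x) <= norm (?a * indicator (cball 0 r) x)"
  unfolding real_norm_def abs_mult abs_of_nonneg[OF one_minus_h_bounds(1)]
  by (intro AE_I2 mult_right_mono order.trans[OF one_minus_h_bounds(2) abs_ge_self]) simp
qed (intro borel_measurable_times borel_measurable_indicator; simp add: diffraction_density)

lemma diffraction_measure: "locally_finite_measure \<gamma>hat0" "eq_dirac_plus_density \<gamma>hat0 (%x. 1 - h (cmod x))" "translation_bounded \<gamma>hat0"
 unfolding \<gamma>hat0_def by (intro eq_dirac_plus_density_dirac_plus diffraction_density diffraction_integrable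
   translation_bounded_dirac_plus[OF _ _ one_minus_h_bounds(2)])+

text \<open>The transform exchanges the point mass with the constant density 1: \<open>f 0\<close>
  and \<open>fourier f 0\<close> occur on both sides with exchanged roles. The remaining terms match
  because \<open>h\<close> is the transform of \<open>g\<close>.\<close>

lemma fourier_identity: "satisfies_fourier_identity \<gamma>0 \<gamma>hat0"
 unfolding satisfies_fourier_identity_def
proof (intro allI impI)
 fix f :: "complex => complex" assume f: "schwartz f"
 let ?a = "LBINT y. of_real (g (cmod y)) * fourier f y"
 note [measurable] = schwartz_measurable[OF f] measurable_fourier[OF f]
 note 1 = integral_schwartz_one_minus_h[OF f]
 have ig: "integrable lborel (%y. of_real (g (cmod y)) * fourier f y)"
  using integrable_g_scaleR[OF measurable_fourier[OF f] fourier_le[OF f]] by (simp add: scaleR_conv_of_real)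
 have 2: "integrable lborel (%y. (1 - g (cmod y)) *\<^sub>R fourier f y)"
  "(LBINT y. (1 - g (cmod y)) *\<^sub>R fourier f y) = f 0 - ?a"
  using ig integrable_fourier[OF f] integral_fourier[OF f] by (simp_all add: scaleR_conv_of_real left_diff_distrib)
 have 3: "integrable lborel (%x. (1 - h (cmod x)) *\<^sub>R f x)"
  "(LBINT x. (1 - h (cmod x)) *\<^sub>R f x) = fourier f 0 - ?a"
  using 1 by (simp_all add: scaleR_conv_of_real)
 note G = integral_dirac_plus[OF autocorrelation_density measurable_fourier[OF f] 2(1), folded \<gamma>0_def]
 note H = integral_dirac_plus[OF diffraction_density schwartz_measurable[OF f] 3(1), folded \<gamma>hat0_def]
 show "integrable \<gamma>hat0 f & integrable \<gamma>0 (fourier f) & (\<integral>x. f x \<partial>\<gamma>hat0) = (\<integral>x. fourier f x \<partial>\<gamma>0)"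
  using G H unfolding 2(2) 3(2) by simp
qed

lemma translation_bounded_locally_finite: "translation_bounded \<mu> ==> locally_finite_measure \<mu>"
proof -
 assume t: "translation_bounded \<mu>"
 have "emeasure \<mu> K < \<infinity>" if K: "compact K" for K
 proof -
  have "emeasure \<mu> ((+) 0 ` K) <= (SUP x. emeasure \<mu> ((+) x ` K))" by (rule SUP_upper) simp
  also have "... < \<infinity>" using t K by (auto simp: translation_bounded_def compact_imp_bounded borel_compact)
  finally show ?thesis by simp
 qed
 thus ?thesis using t by (auto simp: locally_finite_measure_def translation_bounded_def)
qed

text \<open>Gaussians are Schwartz functions and already determine a translation-bounded
  measure.\<close>

lemma fourier_transform_unique: "is_fourier_transform_of \<gamma>hat0 \<gamma>0"
 unfolding is_fourier_transform_of_def
proof (intro conjI allI impI diffraction_measure fourier_identity)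
 let ?a = "%c p M. complex_of_real (\<integral>x. gaussian c p x \<partial>M) = (\<integral>x. fourier (%x. of_real (gaussian c p x)) x \<partial>\<gamma>0)"
 fix \<mu> :: "complex measure" assume \<mu>: "translation_bounded \<mu> & satisfies_fourier_identity \<gamma>0 \<mu>"
 have G: "integrable M (gaussian c p)"
  "?a c p M"
  if "satisfies_fourier_identity \<gamma>0 M" "0 < c" for M c p
 proof -
  note S = that(1)[unfolded satisfies_fourier_identity_def, rule_format, OF schwartz_gaussian[OF that(2), of p]]
  thus "integrable M (gaussian c p)" by (simp add: complex_of_real_integrable_eq)
  show "?a c p M"
   using S by auto
 qed
 show "\<mu> = \<gamma>hat0"
 proof (rule gaussians_determine_measure)
  fix c p assume c: "(0::real) < c"
  let ?b = "\<integral>x. gaussian c p x \<partial>\<gamma>hat0"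
  let ?c = "\<integral>x. gaussian c p x \<partial>\<mu>"
  have "complex_of_real ?c = of_real ?b"
   using G(2)[OF _ c] \<mu> fourier_identity by simp
  thus "?c = ?b" by simp
 qed (use \<mu> G(1) fourier_identity diffraction_measure translation_bounded_locally_finite in auto)
qed

section \<open>The zero set\<close>

context simple_entire
begin

lemma locally_finite_zero_measure: "locally_finite_measure (zero_measure f)"
 unfolding locally_finite_measure_def
proof (intro conjI allI impI)
 fix K :: "complex set" assume K: "compact K"
 let ?a = "emeasure (zero_measure f) K"
 let ?b = "K \<inter> {z. f z = 0}"
 obtain r where r: "!!x. x \<in> K ==> cmod x < r" using compact_imp_bounded[OF K] by (auto simp: bounded_pos_less)
 have "?a = emeasure (count_space {z. f z = 0}) ?b"
  unfolding zero_measure_def using K by (subst emeasure_distr) (auto simp: borel_compact)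
 moreover have "finite ?b" by (rule finite_subset[OF _ finite_zeros_in[of r]]) (use r in "auto simp: zeros_in_def")
 ultimately show "?a < \<infinity>" by (simp add: of_nat_less_top)
qed (simp add: zero_measure_def)

lemma restricted_zero_measure: "restricted_to (zero_measure f) (ball 0 r) = distr (count_space (zeros_in r)) borel (%z. z)"
proof (rule measure_eqI)
 let ?c = "count_space {z. f z = 0}"
 fix A assume "A \<in> sets (restricted_to (zero_measure f) (ball 0 r))"
 hence A: "A \<in> sets borel" by (simp add: restricted_to_def zero_measure_def)
 let ?a = "emeasure (distr (count_space (zeros_in r)) borel (%z. z)) A"
 let ?b = "emeasure (restricted_to (zero_measure f) (ball 0 r)) A"
 let ?d = "A \<inter> zeros_in r"
 let ?e = "ball 0 r \<inter> A"
 have "?b = (\<integral>\<^sup>+z. indicator (ball 0 r) z * indicator A z \<partial>zero_measure f)"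
  unfolding restricted_to_def using A by (subst emeasure_density) (auto simp: zero_measure_def)
 also have "... = (\<integral>\<^sup>+z. indicator ?e z \<partial>zero_measure f)" by (simp add: indicator_inter_arith)
 also have "... = emeasure (zero_measure f) ?e" using A by (intro nn_integral_indicator) (auto simp: zero_measure_def)
 also have "... = emeasure ?c (ball 0 r \<inter> A \<inter> {z. f z = 0})"
  unfolding zero_measure_def using A by (subst emeasure_distr) auto
 also have "ball 0 r \<inter> A \<inter> {z. f z = 0} = A \<inter> zeros_in r" by (auto simp: zeros_in_def)
 also have "emeasure ?c ?d = emeasure (count_space (zeros_in r)) ?d"
  by (subst (1 2) emeasure_count_space) (auto simp: zeros_in_def)
 also have "... = ?a" using A by (subst emeasure_distr) auto
 finally show "?b = ?a" .
qed (simp add: restricted_to_def zero_measure_def)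

text \<open>The restricted zero measure is the image of a counting measure on a finite set, so the
  convolution with its reflection is the image of the counting measure on pairs under
  subtraction.\<close>

lemma integral_pair_measure:
 fixes ph :: "complex => real"
 assumes [measurable]: "ph \<in> BM borel" and n: "0 < n"
 shows "(\<integral>x. ph x \<partial>(let \<omega>\<^sub>n = restricted_to (zero_measure f) (ball 0 (real n)) in
   scale_measure (1 / emeasure lborel (ball (0::complex) (real n))) (measure_conv \<omega>\<^sub>n (reflected \<omega>\<^sub>n))))
  = (\<Sum>x\<in>zeros_in (real n). \<Sum>y\<in>zeros_in (real n). ph (x - y)) / (pi * (real n)^2)"
proof -
 define S where "S = zeros_in (real n)"
 let ?a = "distr (count_space S) borel (%z. z)"
 let ?b = "distr (count_space S) borel (uminus :: complex => complex)"
 have S: "finite S" unfolding S_def by (rule finite_zeros_in)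
 define a where "a = 1 / (pi * (real n)^2)"
 have a: "0 <= a" by (simp add: a_def)
 have sc: "1 / emeasure lborel (ball (0::complex) (real n)) = ennreal a"
  using n by (simp add: emeasure_ball_complex a_def divide_ennreal[symmetric])
 define C where "C = measure_conv ?a (reflected ?a)"
 let ?c = "\<integral>x. ph x \<partial>C"
 have r: "reflected ?a = distr (count_space S) borel uminus"
  unfolding reflected_def by (subst distr_distr) (auto simp: comp_def)
 have "finite_measure ?b"
  using S by (intro finite_measure.finite_measure_distr finite_measure_count_space) auto
 hence "sigma_finite_measure ?b" by (rule finite_measure.axioms)
 hence C: "C = distr (count_space (S \<times> S)) borel (%(x, y). x - y)" unfolding C_def r measure_conv_def using S by (subst pair_measure_distr, simp, simp, simp, subst pair_measure_countable, simp add: countable_finite, subst distr_distr) (auto simp: comp_def case_prod_beta' space_pair_measure)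
 have sets: "sets C = sets borel" by (simp add: C)
 have "scale_measure (ennreal a) C = density C (%_. ennreal a)"
  by (rule measure_eqI) (auto simp: sets emeasure_density_const emeasure_density)
 hence "(\<integral>x. ph x \<partial>scale_measure (ennreal a) C) = a * ?c"
  using a by (simp add: integral_density sets cong: measurable_cong_sets)
 also have "?c = (\<Sum>p\<in>S \<times> S. ph (fst p - snd p))"
  unfolding C using S by (subst integral_distr) (auto simp: lebesgue_integral_count_space_finite case_prod_beta)
 also have "... = (\<Sum>x\<in>S. \<Sum>y\<in>S. ph (x - y))" by (simp add: sum.cartesian_product case_prod_beta)
 finally show ?thesis unfolding Let_def restricted_zero_measure sc S_def[symmetric] C_def[symmetric] by (simp add: a_def)
qed

text \<open>\<open>ring_corr_eq\<close> identifies the limits of the tent averages with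
  \<open>pair_lim\<close>; \<open>X_limit\<close> extends them to all continuous functions of
  compact support, and \<open>pair_lim\<close> is integration against
  \<open>\<gamma>0\<close>.\<close>

lemma autocorrelation_zero_measure:
 assumes conv: "!!q a b :: rat. 0 < q ==>
  (%n. (\<Sum>x\<in>zeros_in (real n). \<Sum>y\<in>zeros_in (real n). tent_corr (of_rat q) (2 * of_rat q) (x - y + Complex (of_rat a) (of_rat b))) / (pi * (real n)^2))
   ----> ring_corr (of_rat q) (2 * of_rat q) (Complex (of_rat a) (of_rat b))" shows "is_autocorrelation (zero_measure f) \<gamma>0"
 unfolding is_autocorrelation_def vague_limit_def
proof (intro conjI allI impI locally_finite_zero_measure autocorrelation_measure)
 let ?a = "%n. let \<omega>\<^sub>n = restricted_to (zero_measure f) (ball 0 (real n)) in scale_measure (1 / emeasure lborel (ball (0::complex) (real n))) (measure_conv \<omega>\<^sub>n (reflected \<omega>\<^sub>n))"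
 fix ph :: "complex => real"
 assume ph: "continuous_on UNIV ph" "\<exists>K. compact K & (\<forall>x. x \<notin> K --> ph x = 0)"
 then obtain K where K: "compact K" "!!x. x \<notin> K ==> ph x = 0" by auto
 let ?c = "\<integral>x. ph x \<partial>\<gamma>0"
 have m [measurable]: "ph \<in> BM borel" using ph(1) by (rule cont_measurable)
 interpret pair_average "%n. zeros_in (real n)" by unfold_locales (rule finite_zeros_in)
 have "(%n. X n ph) ----> pair_lim ph"
 proof (rule X_limit[OF _ ph(1) K])
  fix q a b :: rat assume q: "0 < q"
  let ?b = "%u. tq (of_rat q) (u + Complex (of_rat a) (of_rat b))"
  define Q c where "Q = (of_rat q :: real)" and "c = Complex (of_rat a) (of_rat b)"
  have Q: "0 < Q" "Q < 2 * Q" using q by (auto simp: Q_def)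
  have e: "pair_lim (%u. tq Q (u + c)) = ring_corr Q (2 * Q) c" unfolding ring_corr_eq(2)[OF Q] pair_lim_def tq_def[OF Q(1)] by simp
  show "(%n. X n ?b) ----> pair_lim ?b"
   unfolding Q_def[symmetric] c_def[symmetric] e unfolding X_def tq_def[OF Q(1)] using conv[OF q, of a b, folded Q_def c_def] by simp
 qed
 moreover have "pair_lim ph = ?c"
 proof -
  obtain r where r: "!!x. x \<in> K ==> cmod x <= r" using compact_imp_bounded[OF K(1)] by (auto simp: bounded_iff)
  have "bounded (ph ` K)" using K(1) ph(1) by (intro compact_imp_bounded compact_continuous_image) (auto intro: continuous_on_subset)
  then obtain C where C: "!!x. x \<in> K ==> abs (ph x) <= C" by (auto simp: bounded_iff)
  have "abs (ph x) <= max C 0 * indicator (cball 0 r) x" for x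
   using C[of x] K(2)[of x] r[of x] by (cases "x \<in> K") auto
  from integral_dirac_plus(2)[OF autocorrelation_density m, folded \<gamma>0_def] integrable_pair_density[OF m this]
  show ?thesis by (simp add: pair_lim_def)
 qed
 moreover have "\<forall>\<^sub>F n in sequentially. (\<integral>x. ph x \<partial>(?a n)) = X n ph"
  using eventually_gt_at_top[of "0::nat"] by eventually_elim (simp only: integral_pair_measure[OF m] X_def)
 ultimately show "(%n. \<integral>x. ph x \<partial>(?a n)) ----> ?c"
  by (simp only: filterlim_cong)
qed

end

lemma distr_standard_complex_gaussian:
 assumes "standard_complex_gaussian M X" shows "distr M borel X = cgauss"
 using assms unfolding standard_complex_gaussian_def distributed_def cgauss_def by (simp cong: distr_cong)

theorem theorem6p2:
 fixes M :: "'w measure" and a :: "nat \<Rightarrow> 'w \<Rightarrow> complex"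
 assumes "prob_space M"
  and "prob_space.indep_vars M (\<lambda>_. borel) a UNIV"
  and "\<And>n. standard_complex_gaussian M (a n)"
 shows "AE w in M. \<exists>\<gamma> \<gamma>hat.
      is_autocorrelation (zero_measure (gaf (\<lambda>n. a n w))) \<gamma> \<and>
      is_diffraction (zero_measure (gaf (\<lambda>n. a n w))) \<gamma>hat \<and>
      eq_dirac_plus_density \<gamma> (\<lambda>x. 1 - g (cmod x)) \<and>
      eq_dirac_plus_density \<gamma>hat (\<lambda>t. 1 - h (cmod t))"
proof -
 interpret prob_space M by fact
 interpret gaussian_sequence M a by unfold_locales (use assms distr_standard_complex_gaussian in auto)
 \<comment> \<open>Rational radii and shifts leave only a countable union of null sets.\<close>
 have "AE w in M. \<forall>q a b :: rat. 0 < q -->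
  (%n. (\<Sum>x\<in>simple_entire.zeros_in (gaf (coef w)) (real n). \<Sum>y\<in>simple_entire.zeros_in (gaf (coef w)) (real n).
   tent_corr (of_rat q) (2 * of_rat q) (x - y + Complex (of_rat a) (of_rat b))) / (pi * (real n)^2))
   ----> ring_corr (of_rat q) (2 * of_rat q) (Complex (of_rat a) (of_rat b))" unfolding AE_all_countable
 proof (intro allI)
  fix q a b :: rat
  show "AE w in M. 0 < q -->
  (%n. (\<Sum>x\<in>simple_entire.zeros_in (gaf (coef w)) (real n). \<Sum>y\<in>simple_entire.zeros_in (gaf (coef w)) (real n).
   tent_corr (of_rat q) (2 * of_rat q) (x - y + Complex (of_rat a) (of_rat b))) / (pi * (real n)^2))
   ----> ring_corr (of_rat q) (2 * of_rat q) (Complex (of_rat a) (of_rat b))"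
   using AE_pair_sums[of "of_rat q" "2 * of_rat q"] by auto
 qed
 thus ?thesis using AE_simple_entire
 proof eventually_elim
  case (elim w)
  let ?a = "zero_measure (gaf (coef w))"
  interpret simple_entire "gaf (coef w)" using elim by simp
  have "is_autocorrelation ?a \<gamma>0" by (rule autocorrelation_zero_measure) (use elim in blast)
  moreover from this have "is_diffraction ?a \<gamma>hat0"
   unfolding is_diffraction_def using fourier_transform_unique by auto
  ultimately show ?case using autocorrelation_measure(2) diffraction_measure(2) unfolding coef_def by auto
 qed
qed

end
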